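(* Let $n\ge 1$ and $b\ge 1$ be integers, let $\gamma\in\{0,1\}$, $\alpha\in\,]\tfrac12,1]$ and $0<T\le+\infty$. Let $p(\cdot)\in\mathcal{P}^{\log}(\mathbb{R}^n)$ be a variable exponent with $p^->1$ such that the exponents of all the spaces below are admissible, that is, $b+1<p^-\le p^+<+\infty$ and $\frac{nb}{(b+1)(2\alpha-\gamma)}>1$. Then there exists $\varepsilon>0$ such that the following holds. Let $u_0\in \mathcal{L}^{p(\cdot)}_{\frac{nb}{2\alpha-\gamma}}(\mathbb{R}^n)$ be an initial datum and let $f=\nabla^{\gamma}(\mathcal{F})$ be an external force, where $\mathcal{F}\in \mathcal{L}^{\frac{p(\cdot)}{b+1}}_{\frac{nb}{(b+1)(2\alpha-\gamma)}}\big(\mathbb{R}^n,L^\infty([0,T[)\big)$. If $$\|u_0\|_{\mathcal{L}^{p(\cdot)}_{\frac{nb}{2\alpha-\gamma}}(\mathbb{R}^n)}+\|\mathcal{F}\|_{\mathcal{L}^{\frac{p(\cdot)}{b+1}}_{\frac{nb}{(b+1)(2\alpha-\gamma)}}(\mathbb{R}^n,L^\infty([0,T[))}\le\varepsilon,$$ then the Cauchy problem $$\partial_t u+(-\Delta)^{\alpha}u=\nabla^{\gamma}(|u|^b u)+f,\qquad u(0,\cdot)=u_0,$$ admits a unique (global) mild solution in the space $\mathcal{L}^{p(\cdot)}_{\frac{nb}{2\alpha-\gamma}}\big(\mathbb{R}^n,L^\infty([0,T[)\big)$.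
   Context: All functions are real valued. A variable exponent on $\mathbb{R}^n$ is a measurable function $p(\cdot):\mathbb{R}^n\to[1,+\infty[$; $p^-$ and $p^+$ denote its essential infimum and essential supremum, and all variable exponents are assumed to satisfy $1<p^-\le p^+<+\infty$. The space $L^{p(\cdot)}(\mathbb{R}^n)$ consists of the measurable $f$ with finite Luxemburg norm $\|f\|_{L^{p(\cdot)}}=\inf\{\lambda>0:\int_{\mathbb{R}^n}|f(x)/\lambda|^{p(x)}dx\le 1\}$. $\mathcal{P}^{\log}(\mathbb{R}^n)$ is the set of variable exponents for which the limit $\frac1{p_\infty}=\lim_{|x|\to+\infty}\frac1{p(x)}$ exists and there is $C>0$ such that for all $x,y\in\mathbb{R}^n$: $\left|\frac1{p(x)}-\frac1{p(y)}\right|\le\frac{C}{\log(e+1/|x-y|)}$ and $\left|\frac1{p(x)}-\frac1{p_\infty}\right|\le\frac{C}{\log(e+|x|)}$. For $p(\cdot)\in\mathcal{P}^{\log}(\mathbb{R}^n)$ and a constant $q\in(1,+\infty)$, the mixed Lebesgue space is $\mathcal{L}^{p(\cdot)}_q(\mathbb{R}^n)=L^{p(\cdot)}(\mathbb{R}^n)\cap L^q(\mathbb{R}^n)$ with norm $\max\{\|\cdot\|_{L^{p(\cdot)}},\|\cdot\|_{L^q}\}$. The space $\mathcal{L}^{p(\cdot)}_q(\mathbb{R}^n,L^\infty([0,T[))$ consists of the measurable $u(t,x)$ on $[0,T[\times\mathbb{R}^n$ such that $x\mapsto\|u(\cdot,x)\|_{L^\infty([0,T[)}$ belongs to $\mathcal{L}^{p(\cdot)}_q(\mathbb{R}^n)$,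 normed by the $\mathcal{L}^{p(\cdot)}_q$-norm of that function. $\nabla^{0}$ is the identity operator and $\nabla^{1}(g)=\vec 1\cdot\vec\nabla g=\sum_{j=1}^n\partial_{x_j}g$. $(-\Delta)^\alpha$ is the Fourier multiplier with symbol $|\xi|^{2\alpha}$. The fractional heat kernel is $\mathfrak{g}^\alpha_t(x)=(2\pi)^{-n}\int_{\mathbb{R}^n}e^{ix\cdot\xi}e^{-t|\xi|^{2\alpha}}d\xi$. A mild solution is a function $u$ satisfying $$u(t,x)=\mathfrak{g}^\alpha_t*u_0(x)+\int_0^t\mathfrak{g}^\alpha_{t-s}*f(s,x)\,ds+\int_0^t\mathfrak{g}^\alpha_{t-s}*\nabla^\gamma(|u|^bu)(s,x)\,ds,$$ where $*$ is convolution in $x$ and, when $\gamma=1$, $\mathfrak{g}^\alpha_{t-s}*\nabla^1(h)$ means $(\vec 1\cdot\vec\nabla\mathfrak{g}^\alpha_{t-s})*h$. *)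

theory Defs
  imports "HOL-Analysis.Analysis" "HOL-Probability.Essential_Supremum"
begin

section \<open>Variable exponents\<close>

text \<open>``Measurable'' always means Lebesgue measurable.\<close>

definition exponent_minus :: "(real^'n \<Rightarrow> real) \<Rightarrow> ereal" where
  "exponent_minus p = Liminf (ae_filter lebesgue) (\<lambda>x. ereal (p x))"

definition exponent_plus :: "(real^'n \<Rightarrow> real) \<Rightarrow> ereal" where
  "exponent_plus p = esssup lebesgue (\<lambda>x. ereal (p x))"

definition variable_exponent :: "(real^'n \<Rightarrow> real) \<Rightarrow> bool" where
  "variable_exponent p \<longleftrightarrow>
     p \<in> borel_measurable lebesgue \<and> (\<forall>x. 1 \<le> p x) \<and>
     1 < exponent_minus p \<and> exponent_minus p \<le> exponent_plus p \<and> exponent_plus p < \<infinity>"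

text \<open>On the diagonal \<open>x = y\<close> the first bound reads \<open>0 \<le> C / ln (exp 1 + 1 / 0)\<close>, which is
  harmless: it holds trivially both with \<open>1 / 0 = 0\<close> and with \<open>1 / 0 = \<infinity>\<close>.\<close>

definition P_log :: "(real^'n \<Rightarrow> real) set" where
  "P_log = {p. variable_exponent p \<and>
     (\<exists>L. ((\<lambda>x. 1 / p x) \<longlongrightarrow> L) at_infinity \<and>
       (\<exists>C>0. \<forall>x y. \<bar>1 / p x - 1 / p y\<bar> \<le> C / ln (exp 1 + 1 / norm (x - y)) \<and>
                   \<bar>1 / p x - L\<bar> \<le> C / ln (exp 1 + norm x)))}"

section \<open>Lebesgue spaces\<close>

definition luxemburg_norm :: "(real^'n \<Rightarrow> real) \<Rightarrow> (real^'n \<Rightarrow> real) \<Rightarrow> ennreal" where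
  "luxemburg_norm p f =
     Inf {ennreal l | l. 0 < l \<and> (\<integral>\<^sup>+x. ennreal (\<bar>f x / l\<bar> powr p x) \<partial>lebesgue) \<le> 1}"

definition Lq_norm :: "real \<Rightarrow> (real^'n \<Rightarrow> real) \<Rightarrow> ennreal" where
  "Lq_norm q f =
     (let I = (\<integral>\<^sup>+x. ennreal (\<bar>f x\<bar> powr q) \<partial>lebesgue)
      in if I = \<infinity> then \<infinity> else ennreal (enn2real I powr (1 / q)))"

definition mixed_norm :: "(real^'n \<Rightarrow> real) \<Rightarrow> real \<Rightarrow> (real^'n \<Rightarrow> real) \<Rightarrow> ennreal" where
  "mixed_norm p q f = max (luxemburg_norm p f) (Lq_norm q f)"

definition mixed_space :: "(real^'n \<Rightarrow> real) \<Rightarrow> real \<Rightarrow> (real^'n \<Rightarrow> real) set" where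
  "mixed_space p q =
     {f \<in> borel_measurable lebesgue. luxemburg_norm p f < \<infinity> \<and> Lq_norm q f < \<infinity>}"

definition time_interval :: "ereal \<Rightarrow> real set" where
  "time_interval T = {t. 0 \<le> t \<and> ereal t < T}"

definition time_sup :: "ereal \<Rightarrow> (real \<Rightarrow> real^'n \<Rightarrow> real) \<Rightarrow> real^'n \<Rightarrow> ereal" where
  "time_sup T u x = esssup (lebesgue_on (time_interval T)) (\<lambda>t. ereal \<bar>u t x\<bar>)"

text \<open>The values of \<open>u t\<close> for \<open>t\<close> outside \<open>time_interval T\<close> play no role.
  Almost everywhere finiteness is required before passing to real values because
  \<open>real_of_ereal\<close> maps \<open>\<infinity>\<close> to \<open>0\<close>.\<close>

definition mixed_time_space ::
    "(real^'n \<Rightarrow> real) \<Rightarrow> real \<Rightarrow> ereal \<Rightarrow> (real \<Rightarrow> real^'n \<Rightarrow> real) set" where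
  "mixed_time_space p q T =
     {u. (\<lambda>(t, x). u t x) \<in> borel_measurable (lebesgue_on (time_interval T \<times> UNIV)) \<and>
         (AE x in lebesgue. time_sup T u x < \<infinity>) \<and>
         (\<lambda>x. real_of_ereal (time_sup T u x)) \<in> mixed_space p q}"

definition mixed_time_norm ::
    "(real^'n \<Rightarrow> real) \<Rightarrow> real \<Rightarrow> ereal \<Rightarrow> (real \<Rightarrow> real^'n \<Rightarrow> real) \<Rightarrow> ennreal" where
  "mixed_time_norm p q T u = mixed_norm p q (\<lambda>x. real_of_ereal (time_sup T u x))"

section \<open>Mild solutions\<close>

text \<open>The defining integral is real by symmetry, so that taking the real part only changes
  its type.\<close>

definition frac_heat_kernel :: "real \<Rightarrow> real \<Rightarrow> real^'n \<Rightarrow> real" where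
  "frac_heat_kernel \<alpha> t x =
     Re (complex_of_real ((2 * pi) powr (- real CARD('n))) *
         (LINT \<xi>|lborel. exp (\<i> * complex_of_real (x \<bullet> \<xi>)) *
                         complex_of_real (exp (- t * norm \<xi> powr (2 * \<alpha>)))))"

definition nabla_pow :: "nat \<Rightarrow> (real^'n \<Rightarrow> real) \<Rightarrow> real^'n \<Rightarrow> real" where
  "nabla_pow \<gamma> g x =
     (if \<gamma> = 0 then g x else (\<Sum>j\<in>UNIV. deriv (\<lambda>r. g (x + r *\<^sub>R axis j 1)) 0))"

definition convolution_at :: "(real^'n \<Rightarrow> real) \<Rightarrow> (real^'n \<Rightarrow> real) \<Rightarrow> real^'n \<Rightarrow> real" where
  "convolution_at k h x = (LINT y|lebesgue. k (x - y) * h y)"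

definition convolvable_at :: "(real^'n \<Rightarrow> real) \<Rightarrow> (real^'n \<Rightarrow> real) \<Rightarrow> real^'n \<Rightarrow> bool" where
  "convolvable_at k h x \<longleftrightarrow> integrable lebesgue (\<lambda>y. k (x - y) * h y)"

text \<open>At time \<open>0\<close> the heat kernel is the Dirac mass, which is not a function.\<close>

definition heat_flow :: "real \<Rightarrow> real \<Rightarrow> (real^'n \<Rightarrow> real) \<Rightarrow> real^'n \<Rightarrow> real" where
  "heat_flow \<alpha> t u0 x = (if t = 0 then u0 x else convolution_at (frac_heat_kernel \<alpha> t) u0 x)"

text \<open>\<open>duhamel \<gamma> \<alpha> h\<close> is the time integral of the heat semigroup applied to
  the \<open>\<gamma>\<close>-th power of nabla of \<open>h\<close>, the derivative being carried by the kernel.\<close>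

definition duhamel ::
    "nat \<Rightarrow> real \<Rightarrow> (real \<Rightarrow> real^'n \<Rightarrow> real) \<Rightarrow> real \<Rightarrow> real^'n \<Rightarrow> real" where
  "duhamel \<gamma> \<alpha> h t x =
     (LINT s:{0<..<t}|lebesgue.
        convolution_at (nabla_pow \<gamma> (frac_heat_kernel \<alpha> (t - s))) (h s) x)"

definition duhamel_exists ::
    "nat \<Rightarrow> real \<Rightarrow> (real \<Rightarrow> real^'n \<Rightarrow> real) \<Rightarrow> real \<Rightarrow> real^'n \<Rightarrow> bool" where
  "duhamel_exists \<gamma> \<alpha> h t x \<longleftrightarrow>
     (AE s in lebesgue_on {0<..<t}.
        convolvable_at (nabla_pow \<gamma> (frac_heat_kernel \<alpha> (t - s))) (h s) x) \<and>
     set_integrable lebesgue {0<..<t}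
        (\<lambda>s. convolution_at (nabla_pow \<gamma> (frac_heat_kernel \<alpha> (t - s))) (h s) x)"

text \<open>Mild solutions on \<open>time_interval T\<close> of the Cauchy problem with initial datum \<open>u0\<close> and
  with force the \<open>\<gamma>\<close>-th power of nabla of \<open>F\<close>. The existence of all integrals is part of
  the definition, since a divergent integral would otherwise count as \<open>0\<close>.\<close>

definition mild_solution ::
    "nat \<Rightarrow> real \<Rightarrow> nat \<Rightarrow> ereal \<Rightarrow> (real^'n \<Rightarrow> real) \<Rightarrow> (real \<Rightarrow> real^'n \<Rightarrow> real) \<Rightarrow>
     (real \<Rightarrow> real^'n \<Rightarrow> real) \<Rightarrow> bool" where
  "mild_solution \<gamma> \<alpha> b T u0 F u \<longleftrightarrow>
     (\<forall>t\<in>time_interval T. AE x in lebesgue.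
        (0 < t \<longrightarrow> convolvable_at (frac_heat_kernel \<alpha> t) u0 x) \<and>
        duhamel_exists \<gamma> \<alpha> F t x \<and>
        duhamel_exists \<gamma> \<alpha> (\<lambda>s y. \<bar>u s y\<bar> ^ b * u s y) t x \<and>
        u t x = heat_flow \<alpha> t u0 x + duhamel \<gamma> \<alpha> F t x
                + duhamel \<gamma> \<alpha> (\<lambda>s y. \<bar>u s y\<bar> ^ b * u s y) t x)"

end

theory Submission
  imports Defs "HOL-Probability.Probability"
begin

text \<open>The equation is read as a fixed point problem \<open>u = A + D (\<bar>u\<bar> ^ b * u)\<close>. Here \<open>A\<close> collects the
  contributions of the initial datum and of the force, and \<open>D\<close> is the Duhamel integral
  (\<open>duhamel_op\<close>) with the kernel \<open>K \<sigma>\<close>, the \<open>\<gamma>\<close>-th power of nabla applied to the fractional heat kernel at time \<open>\<sigma>\<close>. The norm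
  takes the supremum in time before it integrates in space. If \<open>\<bar>h s y\<bar> \<le> H y\<close>, then \<open>\<bar>D h t x\<bar>\<close>
  is at most the potential \<open>R H x\<close>, the integral of \<open>\<bar>K \<sigma> (x - y)\<bar> * H y\<close> over all \<open>\<sigma> > 0\<close> and all \<open>y\<close>.
  Time has disappeared from this bound; hence the smallness condition does not
  depend on \<open>T\<close>, and solutions are global.

  By subordination the fractional heat kernel is a mixture of Gaussians over a law
  on the positive half line whose Laplace transform is \<open>exp (- (l powr \<alpha>))\<close> (\<open>stable_subordinator\<close>,
  \<open>frac_heat_kernel_eq\<close>). All negative moments of this law are finite, so that estimates for Gaussians
  pass to \<open>K\<close>: the convolution of \<open>\<bar>K \<sigma>\<bar>\<close> with \<open>H\<close> is bounded by a power of \<open>\<sigma>\<close> times the maximal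
  function of \<open>H\<close>, and by another power of \<open>\<sigma>\<close> times the norm of \<open>H\<close> in \<open>L^q'\<close>
  (\<open>frac_kernel_maxfun_bound\<close>, \<open>frac_kernel_decay_bound\<close>). The first bound is integrable at \<open>\<sigma> = 0\<close> and the
  second one at infinity. Optimising the splitting point, as Hedberg did for Riesz potentials,
  gives \<open>R H x \<le> C * epow (maxfun H x) (1 / (b + 1))\<close> when the \<open>L^q'\<close> norm of \<open>H\<close> is at most 1
  (\<open>hedberg\<close>); the power is \<open>1 / (b + 1)\<close> exactly because the exponent \<open>q'\<close> is critical for the scaling
  of the equation. The maximal function is bounded for log-Hoelder exponents bounded away from 1
  (\<open>maxfun_modular_bounded\<close>), which applies to \<open>p / (b + 1)\<close> since the infimum of \<open>p\<close> exceeds \<open>b + 1\<close>.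
  So \<open>R\<close> maps the unit ball of the space of forces into a ball of the space of solutions.

  For existence, consider \<open>V_(k+1) = a + R (V_k ^ (b + 1))\<close>. These functions increase with \<open>k\<close>, and for
  small data they stay in a small ball (\<open>majorant_step\<close>); their limit \<open>V\<close> is therefore finite almost everywhere. The
  Picard iterates satisfy \<open>\<bar>u_(k+1) - u_k\<bar> \<le> V_(k+1) - V_k\<close> (\<open>picard_bounds\<close>), because the increments of
  the nonlinearity are controlled by those of the power function along the majorants. Hence they
  converge at every point where \<open>V\<close> is finite, and dominated convergence yields the equation
  (\<open>picard_limit\<close>).

  Uniqueness concerns all solutions in the space, not only small ones. Let \<open>V\<close> dominate two
  solutions. If their difference is at most \<open>exp (k * t) * W x\<close>, then it is also at most
  \<open>exp (k * t)\<close> times the potential of \<open>c * V ^ b * W\<close> with the kernel weighted by \<open>exp (- (k * \<sigma>))\<close>. Split \<open>V\<close>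
  into the part above a high level, which has small \<open>L^Q\<close> norm for \<open>Q = (b + 1) * q'\<close>, and a bounded part,
  on which a large \<open>k\<close> makes the weighted kernel small. Thus for large \<open>k\<close> each iteration halves the
  bound in \<open>L^Q\<close> (\<open>difference_bound_contraction\<close>), and the difference vanishes (\<open>difference_vanishes\<close>).

  All estimates are made for Borel functions with values in \<open>[0, \<infinity>]\<close> and for modulars rather than norms.
  Lebesgue measurable functions enter and leave through Borel representatives.\<close>

section \<open>Real powers of extended nonnegative reals\<close>

text \<open>The value at \<open>top\<close> needs its own clause because \<open>enn2real top = 0\<close>.\<close>

definition epow :: "ennreal \<Rightarrow> real \<Rightarrow> ennreal" where
  "epow x a = (if x = top then top else ennreal (enn2real x powr a))"

lemma epow_ennreal [simp]: "0 \<le> x \<Longrightarrow> epow (ennreal x) a = ennreal (x powr a)"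
  by (simp add: epow_def)

lemma epow_top [simp]: "epow top a = top"
  by (simp add: epow_def)

lemma epow_0 [simp]: "epow 0 a = 0"
  by (simp add: epow_def)

lemma epow_one_base [simp]: "epow 1 a = 1"
  by (simp add: epow_def)

lemma epow_1 [simp]: "epow x 1 = x"
  by (cases x) auto

lemma epow_eq_top_iff [simp]: "epow x a = top \<longleftrightarrow> x = top"
  by (simp add: epow_def)

lemma epow_eq_0_iff [simp]: "epow x a = 0 \<longleftrightarrow> x = 0"
  by (cases x) auto

lemma epow_mono: "x \<le> y \<Longrightarrow> 0 \<le> a \<Longrightarrow> epow x a \<le> epow y a"
  by (cases x; cases y) (auto intro!: ennreal_leI powr_mono2 simp: top_unique)

lemma epow_mult: "epow (x * y) a = epow x a * epow y a"
proof (cases x)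
  case (real r)
  note x = this
  show ?thesis
  proof (cases y)
    case (real s)
    then show ?thesis using x by (simp add: ennreal_mult[symmetric] powr_mult)
  next
    case top
    then show ?thesis using x by (cases "r = 0") (simp_all add: ennreal_mult_top)
  qed
next
  case top
  then show ?thesis
    by (cases "y = 0") (simp_all add: ennreal_top_mult)
qed

lemma epow_epow: "epow (epow x a) b = epow x (a * b)"
  by (cases x) (auto simp: powr_powr)

lemma epow_inverse: "a \<noteq> 0 \<Longrightarrow> epow (epow x a) (1 / a) = x"
  by (simp add: epow_epow)

lemma epow_inverse': "a \<noteq> 0 \<Longrightarrow> epow (epow x (1 / a)) a = x"
  by (simp add: epow_epow)

lemma epow_add_exponent: "epow x (a + b) = epow x a * epow x b"
  by (cases x) (auto simp: powr_add ennreal_mult ennreal_top_mult)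

lemma epow_of_nat: "0 < n \<Longrightarrow> epow x (real n) = x ^ n"
  by (cases x) (auto simp: powr_realpow' ennreal_power power_0_left power_eq_top_ennreal)

lemma epow_le_imp_le: "0 < a \<Longrightarrow> epow x a \<le> y \<Longrightarrow> x \<le> epow y (1 / a)"
  using epow_mono[of "epow x a" y "1/a"] by (simp add: epow_inverse)

lemma epow_exponent_mono: "1 \<le> x \<Longrightarrow> a \<le> b \<Longrightarrow> epow x a \<le> epow x b"
  by (cases x) (auto intro!: ennreal_leI powr_mono simp flip: ennreal_1)

lemma epow_exponent_antimono: "x \<le> 1 \<Longrightarrow> a \<le> b \<Longrightarrow> epow x b \<le> epow x a"
  by (cases x) (auto intro!: ennreal_leI powr_mono' simp flip: ennreal_1 simp: top_unique)

text \<open>One of two summands is at least half of the sum. This replaces the convexity inequality and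
  holds for every nonnegative exponent, hence pointwise for variable exponents.\<close>

lemma epow_add_le:
  assumes "0 \<le> a"
  shows "epow (x + y) a \<le> epow (2 * x) a + epow (2 * y) a"
proof (cases "x \<le> y")
  case True
  then have "x + y \<le> 2 * y" by (simp add: mult_2 add_right_mono)
  from epow_mono[OF this assms] show ?thesis
    by (rule order_trans) simp
next
  case False
  then have "x + y \<le> 2 * x" by (simp add: mult_2 add_left_mono)
  from epow_mono[OF this assms] show ?thesis
    by (rule order_trans) simp
qed

lemma epow_scale_le:
  assumes "c \<le> 1" "1 \<le> a"
  shows "epow (c * x) a \<le> c * epow x a"
  using mult_right_mono[OF epow_exponent_antimono[OF assms], of "epow x a"]
  by (simp add: epow_mult)

lemma epow_SUP:
  assumes "0 < a"
  shows "epow (SUP i\<in>I. f i) a = (SUP i\<in>I. epow (f i) a)"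
proof (rule antisym)
  have "(SUP i\<in>I. f i) \<le> epow (SUP i\<in>I. epow (f i) a) (1 / a)"
  proof (rule SUP_least)
    fix i assume "i \<in> I"
    then have "epow (f i) a \<le> (SUP i\<in>I. epow (f i) a)" by (rule SUP_upper)
    then show "f i \<le> epow (SUP i\<in>I. epow (f i) a) (1 / a)"
      by (rule epow_le_imp_le[OF assms])
  qed
  from epow_mono[OF this, of a] assms
  show "epow (SUP i\<in>I. f i) a \<le> (SUP i\<in>I. epow (f i) a)"
    by (simp add: epow_inverse')
  show "(SUP i\<in>I. epow (f i) a) \<le> epow (SUP i\<in>I. f i) a"
    using assms by (intro SUP_least epow_mono SUP_upper) auto
qed

lemma borel_measurable_epow [measurable]:
  assumes [measurable]: "f \<in> borel_measurable M" "p \<in> borel_measurable M"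
  shows "(\<lambda>x. epow (f x) (p x)) \<in> borel_measurable M"
  unfolding epow_def by measurable

section \<open>The modular of a variable exponent\<close>

text \<open>The integrals that define the Luxemburg norm and the norm of \<open>L^q\<close>. With values in \<open>ennreal\<close> they make
  sense for suprema and for infinite values, which the majorants below can take.\<close>

definition modular :: "('a::euclidean_space \<Rightarrow> real) \<Rightarrow> ('a \<Rightarrow> ennreal) \<Rightarrow> ennreal" where
  "modular p F = (\<integral>\<^sup>+x. epow (F x) (p x) \<partial>lborel)"

lemma modular_mono:
  assumes "\<And>x. 0 \<le> p x" "\<And>x. F x \<le> G x"
  shows "modular p F \<le> modular p G"
  unfolding modular_def by (intro nn_integral_mono epow_mono assms)

lemma modular_scale:
  assumes [measurable]: "p \<in> borel_measurable borel" "F \<in> borel_measurable borel"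
    and "\<And>x. 1 \<le> p x" "c \<le> 1"
  shows "modular p (\<lambda>x. c * F x) \<le> c * modular p F"
  unfolding modular_def
  by (subst nn_integral_cmult[symmetric]) (auto intro!: nn_integral_mono epow_scale_le assms)

text \<open>The factors 2 stand in for the triangle inequality of the Luxemburg norm.\<close>

lemma modular_add:
  assumes [measurable]: "p \<in> borel_measurable borel" "F \<in> borel_measurable borel"
    "G \<in> borel_measurable borel"
    and "\<And>x. 0 \<le> p x"
  shows "modular p (\<lambda>x. F x + G x) \<le> modular p (\<lambda>x. 2 * F x) + modular p (\<lambda>x. 2 * G x)"
  unfolding modular_def
  by (subst nn_integral_add[symmetric]) (auto intro!: nn_integral_mono epow_add_le assms)

lemma modular_SUP:
  assumes [measurable]: "p \<in> borel_measurable borel" "\<And>i. F i \<in> borel_measurable borel"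
    and "\<And>x. 0 < p x" and F: "incseq F"
  shows "modular p (\<lambda>x. SUP i. F i x) = (SUP i. modular p (F i))"
proof -
  have "incseq (\<lambda>i x. epow (F i x) (p x))"
    using F assms(3) by (intro incseq_SucI le_funI epow_mono) (auto simp: incseq_Suc_iff le_fun_def less_imp_le)
  then show ?thesis
    unfolding modular_def using assms(3)
    by (simp add: epow_SUP nn_integral_monotone_convergence_SUP)
qed

section \<open>The centred maximal function\<close>

definition avg :: "('a::euclidean_space \<Rightarrow> ennreal) \<Rightarrow> 'a \<Rightarrow> real \<Rightarrow> ennreal" where
  "avg f x r = (\<integral>\<^sup>+y\<in>ball x r. f y \<partial>lborel) / emeasure lborel (ball x r)"

definition maxfun :: "('a::euclidean_space \<Rightarrow> ennreal) \<Rightarrow> 'a \<Rightarrow> ennreal" where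
  "maxfun f x = (SUP r\<in>{0<..}. avg f x r)"

lemma emeasure_ball_pos: "0 < r \<Longrightarrow> 0 < emeasure lborel (ball (x::'a::euclidean_space) r)"
  using emeasure_lborel_ball_finite[of x r] content_ball_pos[of r x]
  by (subst emeasure_eq_ennreal_measure) auto

lemma emeasure_ball_eq:
  "0 \<le> r \<Longrightarrow> emeasure lborel (ball (x::'a::euclidean_space) r)
     = ennreal (r ^ DIM('a) * measure lborel (ball (0::'a) 1))"
  using emeasure_lborel_ball_finite[of x r]
  by (subst emeasure_eq_ennreal_measure) (auto simp: content_ball_conv_unit_ball[of r x])

lemma sets_borel_ball [measurable]: "ball (x::'a::euclidean_space) r \<in> sets borel"
  by simp

lemma ennreal_divide_mult_cancel:
  "0 < e \<Longrightarrow> e < top \<Longrightarrow> a / e * e = (a::ennreal)"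
  by (metis ennreal_times_divide mult.commute mult_divide_eq_ennreal less_top not_gr_zero)

lemma ennreal_divide_le_iff_mult:
  assumes "0 < e" "e < top"
  shows "a / e \<le> c \<longleftrightarrow> a \<le> c * (e::ennreal)"
  using mult_right_mono[of "a / e" c e] divide_right_mono_ennreal[of a "c * e" e] assms
  by (auto simp: ennreal_divide_mult_cancel mult_divide_eq_ennreal)

lemma avg_le_iff:
  assumes "0 < r"
  shows "avg f x r \<le> c \<longleftrightarrow> (\<integral>\<^sup>+y\<in>ball x r. f y \<partial>lborel) \<le> c * emeasure lborel (ball x r)"
  unfolding avg_def using emeasure_ball_pos[OF assms, of x] emeasure_lborel_ball_finite[of x r]
  by (intro ennreal_divide_le_iff_mult) auto

lemma ball_integral_eq_avg:
  assumes "0 < r"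
  shows "(\<integral>\<^sup>+y\<in>ball x r. f y \<partial>lborel) = avg f x r * emeasure lborel (ball x r)"
  unfolding avg_def using emeasure_ball_pos[OF assms, of x] emeasure_lborel_ball_finite[of x r]
  by (intro ennreal_divide_mult_cancel[symmetric]) auto

lemma avg_le_maxfun: "0 < r \<Longrightarrow> avg f x r \<le> maxfun f x"
  unfolding maxfun_def by (rule SUP_upper) simp

lemma ball_integral_le_maxfun:
  "0 < r \<Longrightarrow> (\<integral>\<^sup>+y\<in>ball x r. f y \<partial>lborel) \<le> maxfun f x * emeasure lborel (ball x r)"
  by (simp add: ball_integral_eq_avg avg_le_maxfun mult_right_mono)

lemma avg_mono: "(\<And>y. y \<in> ball x r \<Longrightarrow> f y \<le> g y) \<Longrightarrow> avg f x r \<le> avg g x r"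
  unfolding avg_def
  by (intro divide_right_mono_ennreal nn_integral_mono) (auto simp: indicator_def)

lemma maxfun_mono: "(\<And>y. f y \<le> g y) \<Longrightarrow> maxfun f x \<le> maxfun g x"
  unfolding maxfun_def by (intro SUP_mono) (auto intro!: avg_mono)

lemma avg_add:
  assumes [measurable]: "f \<in> borel_measurable borel" "g \<in> borel_measurable borel"
  shows "avg (\<lambda>y. f y + g y) x r = avg f x r + avg g x r"
  unfolding avg_def by (simp add: distrib_right nn_integral_add add_divide_distrib_ennreal)

lemma avg_cmult:
  assumes [measurable]: "f \<in> borel_measurable borel"
  shows "avg (\<lambda>y. c * f y) x r = c * avg f x r"
  unfolding avg_def by (simp add: mult.assoc nn_integral_cmult ennreal_times_divide)

lemma avg_const: "0 < r \<Longrightarrow> avg (\<lambda>y. c) x r = c"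
  unfolding avg_def using emeasure_ball_pos[of r x] emeasure_lborel_ball_finite[of x r]
  by (simp add: nn_integral_cmult_indicator mult_divide_eq_ennreal)

lemma maxfun_add_le:
  assumes [measurable]: "f \<in> borel_measurable borel" "g \<in> borel_measurable borel"
  shows "maxfun (\<lambda>y. f y + g y) x \<le> maxfun f x + maxfun g x"
  unfolding maxfun_def[of "\<lambda>y. f y + g y"]
  by (intro SUP_least) (auto simp: avg_add intro!: add_mono avg_le_maxfun)

lemma maxfun_cmult:
  assumes [measurable]: "f \<in> borel_measurable borel"
  shows "maxfun (\<lambda>y. c * f y) x = c * maxfun f x"
  unfolding maxfun_def by (simp add: avg_cmult SUP_mult_left_ennreal)

lemma maxfun_const: "maxfun (\<lambda>y. c) x = c"
  unfolding maxfun_def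
  by (rule antisym) (auto simp: avg_const intro!: SUP_least SUP_upper2[of 1])

text \<open>A ball whose average exceeds \<open>c\<close> can be enlarged and moved a little: the larger ball contains the
  original one, and its measure is only slightly bigger, so that its average still exceeds \<open>c\<close>.\<close>

lemma open_maxfun_superlevel: "open {x::'a::euclidean_space. c < maxfun f x}"
proof (rule openI)
  fix x assume "x \<in> {x. c < maxfun f x}"
  then obtain r where r: "0 < r" and *: "c < avg f x r"
    by (auto simp: maxfun_def less_SUP_iff)
  define v where "v = measure lborel (ball (0::'a) 1)"
  have v: "0 < v" unfolding v_def by simp
  have lt: "c * ennreal (r ^ DIM('a) * v) < (\<integral>\<^sup>+y\<in>ball x r. f y \<partial>lborel)"
    using * r avg_le_iff[of r f x c] by (auto simp: not_le[symmetric] emeasure_ball_eq v_def)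
  have ctop: "c \<noteq> top" using * by auto
  have "((\<lambda>s. c * ennreal (s ^ DIM('a) * v)) \<longlongrightarrow> c * ennreal (r ^ DIM('a) * v)) (at_right r)"
    by (intro ennreal_tendsto_cmult tendsto_ennrealI tendsto_intros) (use ctop in \<open>auto simp: less_top\<close>)
  then have "eventually (\<lambda>s. c * ennreal (s ^ DIM('a) * v) < (\<integral>\<^sup>+y\<in>ball x r. f y \<partial>lborel)) (at_right r)"
    using lt by (rule order_tendstoD(2))
  then obtain s where s: "r < s" "c * ennreal (s ^ DIM('a) * v) < (\<integral>\<^sup>+y\<in>ball x r. f y \<partial>lborel)"
    unfolding eventually_at_right_field
    by (metis dense less_add_one)
  show "\<exists>e>0. ball x e \<subseteq> {x. c < maxfun f x}"
  proof (intro exI conjI subsetI)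
    show "0 < s - r" using s by simp
    fix z assume z: "z \<in> ball x (s - r)"
    have "ball x r \<subseteq> ball z s"
    proof
      fix y assume "y \<in> ball x r"
      then show "y \<in> ball z s" using z dist_triangle[of z y x] by (auto simp: dist_commute)
    qed
    then have "(\<integral>\<^sup>+y\<in>ball x r. f y \<partial>lborel) \<le> (\<integral>\<^sup>+y\<in>ball z s. f y \<partial>lborel)"
      by (intro nn_integral_mono mult_left_mono) (auto simp: indicator_def)
    with s(2) r s(1) have "c * emeasure lborel (ball z s) < (\<integral>\<^sup>+y\<in>ball z s. f y \<partial>lborel)"
      by (auto simp: emeasure_ball_eq v_def)
    then have "c < avg f z s" using avg_le_iff[of s f z c] r s(1) by (auto simp: not_le[symmetric])
    also have "\<dots> \<le> maxfun f z" using r s(1) by (intro avg_le_maxfun) simp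
    finally show "z \<in> {x. c < maxfun f x}" by simp
  qed
qed

lemma borel_measurable_maxfun [measurable]: "maxfun f \<in> borel_measurable borel"
proof (rule borel_measurableI_greater)
  fix c
  have "open {x. c < maxfun f x}" by (rule open_maxfun_superlevel)
  then show "{w \<in> space borel. c < maxfun f w} \<in> sets borel" by simp
qed

text \<open>Subadditivity for families indexed by a countable set, in the form that fits the set of centres
  which the covering lemma provides.\<close>

lemma emeasure_UN_countable_le:
  assumes C: "countable C" and [measurable]: "\<And>i. i \<in> C \<Longrightarrow> X i \<in> sets M"
  shows "emeasure M (\<Union>i\<in>C. X i) \<le> (\<integral>\<^sup>+i. emeasure M (X i) \<partial>count_space C)"
proof -
  have m: "(\<Union>i\<in>C. X i) \<in> sets M" using C by (intro sets.countable_UN') auto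
  have "emeasure M (\<Union>i\<in>C. X i) = (\<integral>\<^sup>+y. indicator (\<Union>i\<in>C. X i) y \<partial>M)" using m by simp
  also have "\<dots> \<le> (\<integral>\<^sup>+y. (\<integral>\<^sup>+i. indicator (X i) y \<partial>count_space C) \<partial>M)"
  proof (intro nn_integral_mono)
    fix y
    show "indicator (\<Union>i\<in>C. X i) y \<le> (\<integral>\<^sup>+i. indicator (X i) y \<partial>count_space C :: ennreal)"
    proof (cases "y \<in> (\<Union>i\<in>C. X i)")
      case True
      then obtain i where i: "i \<in> C" "y \<in> X i" by auto
      have "(1::ennreal) = (\<integral>\<^sup>+j. indicator {i} j \<partial>count_space C)"
        using i by (simp add: emeasure_count_space)
      also have "\<dots> \<le> (\<integral>\<^sup>+i. indicator (X i) y \<partial>count_space C)"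
        using i by (intro nn_integral_mono) (auto simp: indicator_def)
      finally show ?thesis using True by simp
    qed simp
  qed
  also have "\<dots> = (\<integral>\<^sup>+i. (\<integral>\<^sup>+y. indicator (X i) y \<partial>M) \<partial>count_space C)"
    by (rule nn_integral_count_space_nn_integral[OF C]) auto
  also have "\<dots> = (\<integral>\<^sup>+i. emeasure M (X i) \<partial>count_space C)"
    by (intro nn_integral_cong) auto
  finally show ?thesis .
qed

text \<open>Every point of the superlevel set is the centre of a ball whose average exceeds \<open>l\<close>. The Vitali
  covering lemma selects countably many disjoint ones whose fivefold enlargements cover the set.\<close>

lemma maxfun_weak_type:
  fixes f :: "'a::euclidean_space \<Rightarrow> ennreal"
  assumes [measurable]: "f \<in> borel_measurable borel" and l: "0 < l"
  shows "ennreal l * emeasure lborel {x. ennreal l < maxfun f x}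
      \<le> 5 ^ DIM('a) * (\<integral>\<^sup>+x. f x \<partial>lborel)"
proof (cases "(\<integral>\<^sup>+x. f x \<partial>lborel) = top")
  case True
  then show ?thesis by (simp add: ennreal_mult_top)
next
  case False
  then obtain I where I: "0 \<le> I" "(\<integral>\<^sup>+x. f x \<partial>lborel) = ennreal I"
    by (cases "(\<integral>\<^sup>+x. f x \<partial>lborel)") auto
  define v where "v = measure lborel (ball (0::'a) 1)"
  have v: "0 < v" unfolding v_def by simp
  define S where "S = {x. ennreal l < maxfun f x}"
  have "\<exists>r>0. ennreal l < avg f x r" if "x \<in> S" for x
    using that by (auto simp: S_def maxfun_def less_SUP_iff)
  then obtain r where r: "\<And>x. x \<in> S \<Longrightarrow> 0 < r x" "\<And>x. x \<in> S \<Longrightarrow> ennreal l < avg f x (r x)"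
    by metis
  have big: "ennreal l * emeasure lborel (ball x (r x)) \<le> (\<integral>\<^sup>+y\<in>ball x (r x). f y \<partial>lborel)"
    if "x \<in> S" for x
    using r(2)[OF that] ball_integral_eq_avg[OF r(1)[OF that], of f x]
    by (simp add: mult_right_mono less_imp_le)
  \<comment> \<open>The covering lemma needs bounded radii. They are bounded because a large ball with average
    above \<open>l\<close> has measure at most \<open>I / l\<close>.\<close>
  have bound: "r x \<le> max 1 (I / (l * v))" if "x \<in> S" for x
  proof (cases "r x \<le> 1")
    case False
    have "ennreal (l * (r x ^ DIM('a) * v)) \<le> (\<integral>\<^sup>+y\<in>ball x (r x). f y \<partial>lborel)"
      using big[OF that] r(1)[OF that] l v by (simp add: emeasure_ball_eq ennreal_mult v_def)
    also have "\<dots> \<le> (\<integral>\<^sup>+x. f x \<partial>lborel)"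
      by (intro nn_integral_mono) (auto simp: indicator_def)
    finally have "l * (r x ^ DIM('a) * v) \<le> I" using I by (simp add: ennreal_le_iff)
    moreover have "r x \<le> r x ^ DIM('a)" using False self_le_power[of "r x" "DIM('a)"] by simp
    ultimately have "l * (r x * v) \<le> I" using l v
      by (meson mult_left_mono mult_right_mono order_trans less_imp_le)
    then have "r x \<le> I / (l * v)" using l v by (simp add: field_simps)
    then show ?thesis by simp
  qed simp
  have cov: "S \<subseteq> (\<Union>i\<in>S. ball i (r i))" using r(1) by auto
  have rad: "\<And>i. i \<in> S \<Longrightarrow> 0 < r i \<and> r i \<le> max 1 (I / (l * v))"
    using r(1) bound by auto
  obtain C where C: "countable C" "C \<subseteq> S"
    "pairwise (\<lambda>i j. disjnt (ball i (r i)) (ball j (r j))) C"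
    "S \<subseteq> (\<Union>i\<in>C. ball i (5 * r i))"
    by (rule Vitali_covering_lemma_balls[OF cov rad])
  have disj: "disjoint_family_on (\<lambda>i. ball i (r i)) C"
    using C(3) by (auto simp: disjoint_family_on_def pairwise_def disjnt_def)
  have five: "emeasure lborel (ball i (5 * r i)) = 5 ^ DIM('a) * emeasure lborel (ball i (r i))"
    if "i \<in> C" for i :: 'a
    using r(1)[of i] that C(2) v
    by (auto simp: emeasure_ball_eq power_mult_distrib ennreal_mult mult.assoc
        ennreal_power[symmetric])
  have "emeasure lborel S \<le> emeasure lborel (\<Union>i\<in>C. ball i (5 * r i))"
    using C(1,4) by (intro emeasure_mono) (auto intro!: sets.countable_UN')
  also have "\<dots> \<le> (\<integral>\<^sup>+i. emeasure lborel (ball i (5 * r i)) \<partial>count_space C)"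
    using C(1) by (intro emeasure_UN_countable_le) auto
  also have "\<dots> = (\<integral>\<^sup>+i. 5 ^ DIM('a) * emeasure lborel (ball i (r i)) \<partial>count_space C)"
    by (intro nn_integral_cong) (simp add: five)
  finally have "ennreal l * emeasure lborel S
    \<le> ennreal l * (\<integral>\<^sup>+i. 5 ^ DIM('a) * emeasure lborel (ball i (r i)) \<partial>count_space C)"
    by (rule mult_left_mono) simp
  also have "\<dots> = 5 ^ DIM('a) * (\<integral>\<^sup>+i. ennreal l * emeasure lborel (ball i (r i)) \<partial>count_space C)"
    by (simp add: nn_integral_cmult mult.left_commute)
  also have "\<dots> \<le> 5 ^ DIM('a) * (\<integral>\<^sup>+i. (\<integral>\<^sup>+y\<in>ball i (r i). f y \<partial>lborel) \<partial>count_space C)"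
    using big C(2) by (intro mult_left_mono nn_integral_mono) auto
  also have "(\<integral>\<^sup>+i. (\<integral>\<^sup>+y\<in>ball i (r i). f y \<partial>lborel) \<partial>count_space C)
      = (\<integral>\<^sup>+i. emeasure (density lborel f) (ball i (r i)) \<partial>count_space C)"
    by (simp add: emeasure_density)
  also have "\<dots> = emeasure (density lborel f) (\<Union>i\<in>C. ball i (r i))"
    using C(1) disj by (subst emeasure_UN_countable) auto
  also have "\<dots> \<le> emeasure (density lborel f) UNIV"
    by (intro emeasure_mono) auto
  also have "\<dots> = (\<integral>\<^sup>+x. f x \<partial>lborel)" by (simp add: emeasure_density)
  finally show ?thesis by (simp add: S_def mult_left_mono)
qed

section \<open>Jensen's inequality and the maximal theorem for constant exponents\<close>

lemma nn_integral_lborel_swap: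
  fixes f :: "'a::euclidean_space \<Rightarrow> 'b::euclidean_space \<Rightarrow> ennreal"
  assumes "case_prod f \<in> borel_measurable (borel \<Otimes>\<^sub>M borel)"
  shows "(\<integral>\<^sup>+x. (\<integral>\<^sup>+y. f x y \<partial>lborel) \<partial>lborel) = (\<integral>\<^sup>+y. (\<integral>\<^sup>+x. f x y \<partial>lborel) \<partial>lborel)"
proof -
  have "case_prod f \<in> borel_measurable (lborel \<Otimes>\<^sub>M lborel)"
    using assms by (simp add: lborel_prod borel_prod)
  then show ?thesis by (rule lborel_pair.Fubini'[symmetric])
qed

text \<open>Convexity of \<open>x powr s\<close>, written without subtraction for use in \<open>ennreal\<close>.\<close>

lemma powr_tangent_le:
  assumes "0 \<le> (x::real)" "0 < i" "1 \<le> s"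
  shows "s * i powr (s - 1) * x \<le> x powr s + (s - 1) * i powr s"
proof (cases "s = 1")
  case False
  then have s: "1 < s" using assms by simp
  have "x * i powr (s - 1) \<le> x powr s / s + (i powr (s - 1)) powr (s / (s - 1)) / (s / (s - 1))"
    by (rule Youngs_inequality) (use s assms in \<open>auto simp: field_simps\<close>)
  also have "(i powr (s - 1)) powr (s / (s - 1)) = i powr s" using s by (simp add: powr_powr)
  finally show ?thesis using s by (simp add: field_simps)
qed (use assms in auto)

text \<open>Integrate the tangent inequality at the mean of \<open>f\<close>.\<close>

lemma (in prob_space) jensen_epow:
  assumes [measurable]: "f \<in> borel_measurable M" and s: "1 \<le> s"
  shows "epow (\<integral>\<^sup>+x. f x \<partial>M) s \<le> (\<integral>\<^sup>+x. epow (f x) s \<partial>M)"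
proof (cases "\<integral>\<^sup>+x. f x \<partial>M")
  case top
  have "f x \<le> 1 + epow (f x) s" for x
    using epow_exponent_mono[of "f x" 1 s] s by (cases "f x \<le> 1") (auto intro: add_increasing2 add_increasing)
  then have "(\<integral>\<^sup>+x. f x \<partial>M) \<le> (\<integral>\<^sup>+x. 1 + epow (f x) s \<partial>M)" by (rule nn_integral_mono)
  also have "\<dots> = 1 + (\<integral>\<^sup>+x. epow (f x) s \<partial>M)"
    by (subst nn_integral_add) (auto simp: emeasure_space_1)
  finally show ?thesis using top by (auto simp: top_unique)
next
  case (real i)
  show ?thesis
  proof (cases "i = 0")
    case False
    with real have i: "0 < i" by simp
    have tangent: "ennreal (s * i powr (s - 1)) * f x \<le> epow (f x) s + ennreal ((s - 1) * i powr s)" for x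
    proof (cases "f x")
      case (real r)
      then show ?thesis using powr_tangent_le[of r i s] i s
        by (auto simp flip: ennreal_mult ennreal_plus intro!: ennreal_leI)
    qed simp
    have "i powr s = i * i powr (s - 1)" using i powr_mult_base[of i "s - 1"] by simp
    then have "ennreal (s * i powr s) = ennreal (s * i powr (s - 1)) * (\<integral>\<^sup>+x. f x \<partial>M)"
      using real i s by (simp flip: ennreal_mult add: ac_simps)
    also have "\<dots> = (\<integral>\<^sup>+x. ennreal (s * i powr (s - 1)) * f x \<partial>M)"
      by (simp add: nn_integral_cmult)
    also have "\<dots> \<le> (\<integral>\<^sup>+x. epow (f x) s + ennreal ((s - 1) * i powr s) \<partial>M)"
      by (rule nn_integral_mono) (rule tangent)
    also have "\<dots> = (\<integral>\<^sup>+x. epow (f x) s \<partial>M) + ennreal ((s - 1) * i powr s)"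
      by (subst nn_integral_add) (auto simp: emeasure_space_1)
    finally have *: "ennreal (s * i powr s) \<le> (\<integral>\<^sup>+x. epow (f x) s \<partial>M) + ennreal ((s - 1) * i powr s)" .
    have "ennreal (i powr s) \<le> (\<integral>\<^sup>+x. epow (f x) s \<partial>M)"
    proof (cases "\<integral>\<^sup>+x. epow (f x) s \<partial>M")
      case (real J)
      with * s have "s * i powr s \<le> J + (s - 1) * i powr s"
        by (simp flip: ennreal_plus)
      then show ?thesis using real by (auto simp: algebra_simps intro!: ennreal_leI)
    qed simp
    then show ?thesis using real by simp
  qed (use real in simp)
qed

lemma jensen_avg:
  fixes f :: "'a::euclidean_space \<Rightarrow> ennreal"
  assumes [measurable]: "f \<in> borel_measurable borel" and s: "1 \<le> s" and r: "0 < r"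
  shows "epow (avg f x r) s \<le> avg (\<lambda>y. epow (f y) s) x r"
proof -
  interpret prob_space "uniform_measure lborel (ball x r)"
    using emeasure_ball_pos[OF r, of x] emeasure_lborel_ball_finite[of x r]
    by (intro prob_space_uniform_measure) auto
  have "f \<in> borel_measurable (uniform_measure lborel (ball x r))" by simp
  from jensen_epow[OF this s] show ?thesis
    by (simp add: avg_def nn_integral_uniform_measure)
qed

text \<open>The layer cake formula: \<open>epow c (a + 1)\<close> as an integral over the levels below \<open>c\<close>.\<close>

lemma nn_integral_powr_below:
  assumes a: "-1 < a"
  shows "(\<integral>\<^sup>+l. (if 0 < l \<and> ennreal l < c then ennreal (l powr a) else 0) \<partial>lborel)
     = ennreal (1 / (a + 1)) * epow c (a + 1)" (is "?I c = _")
proof -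
  have fin: "?I (ennreal r) = ennreal (1 / (a + 1)) * epow (ennreal r) (a + 1)" if r: "0 \<le> r" for r
  proof -
    have "?I (ennreal r) = (\<integral>\<^sup>+l. ennreal (l powr a) * indicator {0..r} l \<partial>lborel)"
    proof (rule nn_integral_cong_AE)
      have "AE l in lborel. l \<noteq> r" by (rule AE_lborel_singleton)
      then show "AE l in lborel. (if 0 < l \<and> ennreal l < ennreal r then ennreal (l powr a) else 0)
        = ennreal (l powr a) * indicator {0..r} l"
        by eventually_elim (use r in \<open>auto simp: indicator_def ennreal_less_iff\<close>)
    qed
    also have "\<dots> = ennreal (r powr (a + 1) / (a + 1))"
      by (rule nn_integral_has_integral_lebesgue'[OF _ has_integral_powr_from_0[OF a r]]) simp
    finally show ?thesis using r a by (simp flip: ennreal_mult)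
  qed
  show ?thesis
  proof (cases c)
    case (real r)
    then show ?thesis using fin[of r] by simp
  next
    case top
    have "?I top = top"
    proof (rule ccontr)
      assume "?I top \<noteq> top"
      then obtain J where J: "0 \<le> J" "?I top = ennreal J" by (cases "?I top") auto
      define r where "r = ((J + 1) * (a + 1)) powr (1 / (a + 1))"
      have "?I (ennreal r) \<le> ?I top" by (intro nn_integral_mono) auto
      moreover have "?I (ennreal r) = ennreal (J + 1)"
        using fin[of r] a J(1) by (simp add: r_def powr_powr flip: ennreal_mult)
      ultimately show False using J by (simp add: ennreal_le_iff)
    qed
    then show ?thesis using top a by (simp add: ennreal_mult_top)
  qed
qed

text \<open>The part of \<open>f\<close> below \<open>l / 2\<close> contributes at most \<open>l / 2\<close> to the maximal function, so the weak type
  inequality is needed for the rest of \<open>f\<close> only.\<close>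

lemma maxfun_superlevel_le:
  fixes f :: "'a::euclidean_space \<Rightarrow> ennreal"
  assumes [measurable]: "f \<in> borel_measurable borel" and l: "0 < l"
  shows "ennreal l * emeasure lborel {x. ennreal l < maxfun f x}
    \<le> 2 * 5 ^ DIM('a) * (\<integral>\<^sup>+x. (if ennreal l < 2 * f x then f x else 0) \<partial>lborel)"
proof -
  define g where "g = (\<lambda>x. if ennreal l < 2 * f x then f x else 0)"
  have [measurable]: "g \<in> borel_measurable borel" unfolding g_def by measurable
  have half: "f y \<le> g y + ennreal (l / 2)" for y
  proof (cases "f y")
    case (real r)
    have "2 * ennreal r = ennreal (2 * r)" using real by (simp add: ennreal_mult)
    then show ?thesis using real l
      by (auto simp: g_def ennreal_less_iff not_less ennreal_le_iff)
  qed (auto simp: g_def ennreal_mult_top)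
  have "maxfun f x \<le> maxfun g x + ennreal (l / 2)" for x
    using order_trans[OF maxfun_mono[OF half] maxfun_add_le[of g "\<lambda>_. ennreal (l/2)" x]]
    by (simp add: maxfun_const)
  then have le: "maxfun f x \<le> ennreal l" if "maxfun g x \<le> ennreal (l / 2)" for x
    using order_trans[OF _ add_right_mono[OF that], of "maxfun f x" "ennreal (l / 2)"] l
    by (simp flip: ennreal_plus)
  then have "{x. ennreal l < maxfun f x} \<subseteq> {x. ennreal (l / 2) < maxfun g x}"
    by (auto simp: not_le[symmetric])
  then have "ennreal l * emeasure lborel {x. ennreal l < maxfun f x}
    \<le> ennreal l * emeasure lborel {x. ennreal (l / 2) < maxfun g x}"
    by (intro mult_left_mono emeasure_mono) auto
  also have "\<dots> = 2 * (ennreal (l / 2) * emeasure lborel {x. ennreal (l / 2) < maxfun g x})"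
    using l by (simp add: mult.assoc[symmetric] flip: ennreal_numeral ennreal_mult)
  also have "\<dots> \<le> 2 * (5 ^ DIM('a) * (\<integral>\<^sup>+x. g x \<partial>lborel))"
    using maxfun_weak_type[of g "l / 2"] l by (simp add: mult_left_mono)
  finally show ?thesis by (simp add: g_def mult.assoc)
qed

text \<open>The Hardy-Littlewood maximal theorem by Marcinkiewicz interpolation between the weak type
  inequality and the trivial bound in \<open>L^\<infinity>\<close>: integrate the truncated weak type inequality over the levels.\<close>

theorem maxfun_strong_type:
  assumes s: "1 < s"
  obtains K where "0 < K" "\<And>f::'a::euclidean_space \<Rightarrow> ennreal. f \<in> borel_measurable borel \<Longrightarrow>
    (\<integral>\<^sup>+x. epow (maxfun f x) s \<partial>lborel) \<le> ennreal K * (\<integral>\<^sup>+x. epow (f x) s \<partial>lborel)"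
proof
  define K where "K = s * (2 * 5 ^ DIM('a)) * (1 / (s - 1)) * 2 powr (s - 1)"
  show "0 < K" using s by (simp add: K_def)
  fix f :: "'a \<Rightarrow> ennreal" assume [measurable]: "f \<in> borel_measurable borel"
  have "(\<integral>\<^sup>+x. epow (maxfun f x) s \<partial>lborel)
    = (\<integral>\<^sup>+x. ennreal s * (\<integral>\<^sup>+l. (if 0 < l \<and> ennreal l < maxfun f x then ennreal (l powr (s - 1)) else 0) \<partial>lborel) \<partial>lborel)"
    using s by (subst nn_integral_powr_below)
      (auto simp: mult.assoc[symmetric] simp flip: ennreal_mult)
  also have "\<dots> = ennreal s * (\<integral>\<^sup>+l. (\<integral>\<^sup>+x. (if 0 < l \<and> ennreal l < maxfun f x then ennreal (l powr (s - 1)) else 0) \<partial>lborel) \<partial>lborel)"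
    by (subst nn_integral_cmult, simp, subst nn_integral_lborel_swap) auto
  also have "\<dots> \<le> ennreal s * (\<integral>\<^sup>+l. (\<integral>\<^sup>+x. 2 * 5 ^ DIM('a) * (f x * (if 0 < l \<and> ennreal l < 2 * f x then ennreal (l powr (s - 2)) else 0)) \<partial>lborel) \<partial>lborel)"
  proof (rule mult_left_mono[OF nn_integral_mono])
    fix l :: real
    show "(\<integral>\<^sup>+x. (if 0 < l \<and> ennreal l < maxfun f x then ennreal (l powr (s - 1)) else 0) \<partial>lborel)
      \<le> (\<integral>\<^sup>+x. 2 * 5 ^ DIM('a) * (f x * (if 0 < l \<and> ennreal l < 2 * f x then ennreal (l powr (s - 2)) else 0)) \<partial>lborel)"
    proof (cases "0 < l")
      case True
      have "(\<integral>\<^sup>+x. (if 0 < l \<and> ennreal l < maxfun f x then ennreal (l powr (s - 1)) else 0) \<partial>lborel)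
        = (\<integral>\<^sup>+x. ennreal (l powr (s - 1)) * indicator {x. ennreal l < maxfun f x} x \<partial>lborel)"
        using True by (intro nn_integral_cong) auto
      also have "\<dots> = ennreal (l powr (s - 1)) * emeasure lborel {x. ennreal l < maxfun f x}"
        by (rule nn_integral_cmult_indicator) simp
      also have "\<dots> = ennreal (l powr (s - 2) * l) * emeasure lborel {x. ennreal l < maxfun f x}"
        using True powr_mult_base[of l "s - 2"] by (simp add: mult.commute)
      also have "ennreal (l powr (s - 2) * l) * emeasure lborel {x. ennreal l < maxfun f x}
        \<le> ennreal (l powr (s - 2)) * (2 * 5 ^ DIM('a) * (\<integral>\<^sup>+x. (if ennreal l < 2 * f x then f x else 0) \<partial>lborel))"
        using maxfun_superlevel_le[of f l] True
        by (simp add: ennreal_mult mult.assoc mult_left_mono)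
      also have "\<dots> = (\<integral>\<^sup>+x. (2 * 5 ^ DIM('a) * ennreal (l powr (s - 2))) * (if ennreal l < 2 * f x then f x else 0) \<partial>lborel)"
        by (simp add: nn_integral_cmult ac_simps)
      also have "\<dots> \<le> (\<integral>\<^sup>+x. 2 * 5 ^ DIM('a) * (f x * (if 0 < l \<and> ennreal l < 2 * f x then ennreal (l powr (s - 2)) else 0)) \<partial>lborel)"
        using True by (intro nn_integral_mono) (auto simp: ac_simps)
      finally show ?thesis .
    qed simp
  qed simp
  also have "\<dots> = ennreal s * (2 * 5 ^ DIM('a) * (\<integral>\<^sup>+x. (\<integral>\<^sup>+l. f x * (if 0 < l \<and> ennreal l < 2 * f x then ennreal (l powr (s - 2)) else 0) \<partial>lborel) \<partial>lborel))"
    by (subst nn_integral_lborel_swap, simp)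
       (simp add: nn_integral_cmult mult.assoc)
  also have "\<dots> = ennreal s * (2 * 5 ^ DIM('a) * (\<integral>\<^sup>+x. ennreal (1 / (s - 1) * 2 powr (s - 1)) * epow (f x) s \<partial>lborel))"
  proof -
    have "(\<integral>\<^sup>+l. f x * (if 0 < l \<and> ennreal l < 2 * f x then ennreal (l powr (s - 2)) else 0) \<partial>lborel)
      = ennreal (1 / (s - 1) * 2 powr (s - 1)) * epow (f x) s" for x
    proof -
      have "(\<integral>\<^sup>+l. f x * (if 0 < l \<and> ennreal l < 2 * f x then ennreal (l powr (s - 2)) else 0) \<partial>lborel)
        = f x * (ennreal (1 / (s - 1)) * epow (2 * f x) (s - 1))"
        using s nn_integral_powr_below[of "s - 2" "2 * f x"] by (subst nn_integral_cmult) auto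
      also have "\<dots> = ennreal (1 / (s - 1)) * ennreal (2 powr (s - 1)) * (epow (f x) (s - 1) * epow (f x) 1)"
        using epow_ennreal[of 2 "s - 1"] by (simp add: epow_mult ac_simps)
      also have "epow (f x) (s - 1) * epow (f x) 1 = epow (f x) s"
        using epow_add_exponent[of "f x" "s - 1" 1] by (simp only: diff_add_cancel)
      finally show ?thesis using s by (simp flip: ennreal_mult)
    qed
    then show ?thesis by simp
  qed
  also have "\<dots> = ennreal K * (\<integral>\<^sup>+x. epow (f x) s \<partial>lborel)"
  proof -
    have "ennreal K = ennreal s * (ennreal 2 * ennreal (5 ^ DIM('a))) * ennreal (1 / (s - 1) * 2 powr (s - 1))"
      using s unfolding K_def by (subst ennreal_mult[symmetric]; simp add: mult.assoc)+
    also have "\<dots> = ennreal s * (2 * 5 ^ DIM('a)) * ennreal (1 / (s - 1) * 2 powr (s - 1))"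
      by (simp flip: ennreal_power)
    finally show ?thesis by (simp add: nn_integral_cmult mult.assoc)
  qed
  finally show "(\<integral>\<^sup>+x. epow (maxfun f x) s \<partial>lborel) \<le> ennreal K * (\<integral>\<^sup>+x. epow (f x) s \<partial>lborel)" .
qed

section \<open>The maximal theorem for log-Hoelder exponents\<close>

text \<open>The two regularity conditions in \<open>P_log\<close>, separated from the bounds on the range of the exponent.\<close>

definition log_holder :: "('a::euclidean_space \<Rightarrow> real) \<Rightarrow> bool" where
  "log_holder p \<longleftrightarrow> (\<exists>L C. 0 < C \<and>
     (\<forall>x y. \<bar>1 / p x - 1 / p y\<bar> \<le> C / ln (exp 1 + 1 / norm (x - y))) \<and>
     (\<forall>x. \<bar>1 / p x - L\<bar> \<le> C / ln (exp 1 + norm x)))"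

lemma ln_exp_1_add_ge_1: "0 \<le> t \<Longrightarrow> 1 \<le> ln (exp 1 + t::real)"
  by (subst ln_ge_iff) (auto intro: add_pos_nonneg)

lemma log_holder_const: "log_holder (\<lambda>x. c)"
  unfolding log_holder_def
  by (intro exI[of _ "1 / c"] exI[of _ 1])
     (auto intro!: divide_nonneg_nonneg order_trans[OF _ ln_exp_1_add_ge_1])

lemma log_holder_cmult:
  assumes "log_holder p" "0 < c"
  shows "log_holder (\<lambda>x. p x / c)"
proof -
  obtain L C where C: "0 < C"
    "\<And>x y. \<bar>1 / p x - 1 / p y\<bar> \<le> C / ln (exp 1 + 1 / norm (x - y))"
    "\<And>x. \<bar>1 / p x - L\<bar> \<le> C / ln (exp 1 + norm x)"
    using assms(1) unfolding log_holder_def by blast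
  have eq: "\<bar>c / u - c * v\<bar> = c * \<bar>1 / u - v\<bar>" for u v :: real
  proof -
    have "c / u - c * v = c * (1 / u - v)" by (simp add: right_diff_distrib)
    then show ?thesis using assms(2) by (simp add: abs_mult)
  qed
  have "\<bar>c / p x - c / p y\<bar> \<le> c * C / ln (exp 1 + 1 / norm (x - y))" for x y
    using mult_left_mono[OF C(2)[of x y], of c] assms(2) eq[of "p x" "1 / p y"] by simp
  moreover have "\<bar>c / p x - c * L\<bar> \<le> c * C / ln (exp 1 + norm x)" for x
    using mult_left_mono[OF C(3)[of x], of c] assms(2) eq[of "p x" L] by simp
  ultimately show ?thesis
    unfolding log_holder_def using assms(2) C(1)
    by (intro exI[of _ "c * L"] exI[of _ "c * C"]) auto
qed

lemma log_holder_reciprocal_limit: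
  fixes p :: "'a::euclidean_space \<Rightarrow> real"
  assumes C: "\<And>x. \<bar>1 / p x - L\<bar> \<le> C / ln (exp 1 + norm x)"
    and lo: "\<And>x. l \<le> 1 / p x" and hi: "\<And>x. 1 / p x \<le> h"
  shows "l \<le> L" "L \<le> h"
proof -
  have lim: "((\<lambda>t. C / ln (exp 1 + t)) \<longlongrightarrow> 0) at_top" by real_asymp
  have "l - C / ln (exp 1 + t) \<le> L \<and> L \<le> h + C / ln (exp 1 + t)" if t: "0 \<le> t" for t
  proof -
    obtain x :: 'a where "norm x = t" using vector_choose_size[OF t] by blast
    then show ?thesis using C[of x] lo[of x] hi[of x] by (auto simp: abs_le_iff)
  qed
  then have ev: "\<forall>\<^sub>F t in at_top. l - C / ln (exp 1 + t) \<le> L" "\<forall>\<^sub>F t in at_top. L \<le> h + C / ln (exp 1 + t)"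
    by (auto intro: eventually_mono[OF eventually_ge_at_top[of 0]])
  have "((\<lambda>t. l - C / ln (exp 1 + t)) \<longlongrightarrow> l - 0) at_top" by (intro tendsto_diff lim tendsto_const)
  from tendsto_upperbound[OF this ev(1)] show "l \<le> L" by simp
  have "((\<lambda>t. h + C / ln (exp 1 + t)) \<longlongrightarrow> h + 0) at_top" by (intro tendsto_add lim tendsto_const)
  from tendsto_lowerbound[OF this ev(2)] show "L \<le> h" by simp
qed

lemma abs_diff_le_of_reciprocals:
  fixes u v :: real
  assumes "0 < u" "0 < v" "u \<le> B" "v \<le> B" "\<bar>1 / u - 1 / v\<bar> \<le> d"
  shows "\<bar>u - v\<bar> \<le> B * B * d"
proof -
  have "u - v = (u * v) * (1 / v - 1 / u)" using assms by (simp add: field_simps)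
  then have "\<bar>u - v\<bar> = (u * v) * \<bar>1 / u - 1 / v\<bar>"
    using assms by (simp add: abs_mult abs_minus_commute)
  also have "\<dots> \<le> (B * B) * d"
    using assms by (intro mult_mono) auto
  finally show ?thesis .
qed

text \<open>Exponents bounded above inherit the log-Hoelder bounds of their reciprocals. The division by the
  lower bound \<open>a\<close> prepares the maximal theorem: there the exponent \<open>p = r * a\<close> is reached by applying the
  classical theorem with exponent \<open>a\<close> to a function raised to the power \<open>r\<close>.\<close>

lemma log_holder_rescaled:
  fixes p :: "'a::euclidean_space \<Rightarrow> real"
  assumes p: "log_holder p" and a: "1 \<le> a" "\<And>x. a \<le> p x" and B: "\<And>x. p x \<le> B"
  obtains C rinf where "0 \<le> C" "1 \<le> rinf"
    "\<And>x y. \<bar>p x / a - p y / a\<bar> \<le> C / ln (exp 1 + 1 / norm (x - y))"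
    "\<And>x. \<bar>p x / a - rinf\<bar> \<le> C / ln (exp 1 + norm x)"
proof -
  obtain L C where C: "0 < C"
    "\<And>x y. \<bar>1 / p x - 1 / p y\<bar> \<le> C / ln (exp 1 + 1 / norm (x - y))"
    "\<And>x. \<bar>1 / p x - L\<bar> \<le> C / ln (exp 1 + norm x)"
    using p unfolding log_holder_def by blast
  have B1: "1 \<le> B" using a(1) a(2)[of 0] B[of 0] by simp
  have pos: "0 < p x" for x using a(1) a(2)[of x] by simp
  have L: "1 / B \<le> L" "L \<le> 1 / a"
    using log_holder_reciprocal_limit[OF C(3), of "1 / B" "1 / a"] a B pos
    by (auto simp: frac_le B1 less_le_trans[OF zero_less_one])
  have Lpos: "0 < L" using L(1) B1 by (meson less_le_trans zero_less_divide_1_iff zero_less_one)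
  have LB: "1 / L \<le> B" using L(1) Lpos B1 by (simp add: field_simps)
  have La: "a \<le> 1 / L" using L(2) Lpos a(1) by (simp add: field_simps)
  have div: "\<bar>u / a - v / a\<bar> \<le> \<bar>u - v\<bar>" for u v :: real
    using a(1) by (simp add: divide_le_eq_1 mult_left_le abs_divide flip: diff_divide_distrib)
       (metis abs_ge_zero divide_le_eq mult_le_cancel_left1 less_le_trans zero_less_one not_less)
  show ?thesis
  proof
    show "0 \<le> B * B * C" using B1 C(1) by simp
    show "1 \<le> (1 / L) / a" using La a(1) by (subst le_divide_eq_1_pos) auto
    fix x y :: 'a
    show "\<bar>p x / a - p y / a\<bar> \<le> B * B * C / ln (exp 1 + 1 / norm (x - y))"
      using order_trans[OF div abs_diff_le_of_reciprocals[OF pos pos B B C(2)]] by simp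
    show "\<bar>p x / a - (1 / L) / a\<bar> \<le> B * B * C / ln (exp 1 + norm x)"
      using order_trans[OF div abs_diff_le_of_reciprocals[of "p x" "1 / L" B "C / ln (exp 1 + norm x)", OF pos _ B LB]]
        C(3)[of x] Lpos by simp
  qed
qed

text \<open>Jensen's inequality for the variable exponent \<open>r\<close>, for functions without values strictly between 0 and 1.
  It holds with the smallest exponent on the ball, since for values above 1 lowering the exponent is
  free. To return to \<open>r x\<close> one raises the average, at most \<open>1 / \<bar>B\<bar>\<close>, to a power of order \<open>1 / ln (1 / \<bar>B\<bar>)\<close>,
  which costs a bounded factor: this is the point of the log-Hoelder condition.\<close>

lemma avg_large_part:
  fixes r :: "'a::euclidean_space \<Rightarrow> real"
  assumes [measurable]: "g \<in> borel_measurable borel" "r \<in> borel_measurable borel"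
    and r1: "\<And>x. 1 \<le> r x" and C: "0 \<le> C"
    and LH: "\<And>x y. \<bar>r x - r y\<bar> \<le> C / ln (exp 1 + 1 / norm (x - y))"
    and g: "\<And>y. g y = 0 \<or> 1 \<le> g y" and R: "0 < R"
    and small: "avg g x R * emeasure lborel (ball x R) \<le> 1"
  shows "epow (avg g x R) (r x)
    \<le> ennreal (exp (C * (\<bar>ln (measure lborel (ball (0::'a) 1))\<bar> + DIM('a))))
       * avg (\<lambda>y. epow (g y) (r y)) x R"
proof -
  define v where "v = measure lborel (ball (0::'a) 1)"
  have v: "0 < v" unfolding v_def by simp
  define K where "K = exp (C * (\<bar>ln v\<bar> + DIM('a)))"
  have "avg g x R \<noteq> top"
    using small emeasure_ball_pos[OF R, of x]
    by (auto simp: ennreal_top_mult top_unique split: if_splits)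
  then obtain A where A: "0 \<le> A" "avg g x R = ennreal A" by (cases "avg g x R") auto
  have K1: "1 \<le> K" using C by (simp add: K_def)
  define w where "w = exp 1 + 1 / R"
  define d where "d = C / ln w"
  have w: "1 \<le> ln w" using R unfolding w_def by (intro ln_exp_1_add_ge_1) simp
  have d: "0 \<le> d" using C w by (simp add: d_def)
  \<comment> \<open>\<open>s\<close> is a lower bound of \<open>r\<close> on the ball, is at least 1, and differs from \<open>r x\<close> by at most \<open>d\<close>.\<close>
  define s where "s = max 1 (r x - d)"
  have s: "1 \<le> s" "s \<le> r x" "r x - s \<le> d" using r1[of x] d by (auto simp: s_def)
  have sr: "s \<le> r y" if "y \<in> ball x R" for y
  proof (cases "y = x")
    case False
    have "\<bar>r x - r y\<bar> \<le> C / ln (exp 1 + 1 / norm (x - y))" by (rule LH)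
    also have "\<dots> \<le> d" unfolding d_def w_def
      using that False R C ln_exp_1_add_ge_1[of "1/R"]
      by (intro divide_left_mono ln_mono mult_pos_pos add_pos_pos add_left_mono)
         (auto simp: dist_norm frac_le intro!: less_le_trans[OF _ ln_exp_1_add_ge_1] add_pos_pos)
    finally show ?thesis using r1[of y] by (auto simp: s_def)
  qed (use s in auto)
  have J: "epow (avg g x R) s \<le> avg (\<lambda>y. epow (g y) (r y)) x R"
  proof -
    have "epow (avg g x R) s \<le> avg (\<lambda>y. epow (g y) s) x R" by (rule jensen_avg) (use s R in auto)
    also have "\<dots> \<le> avg (\<lambda>y. epow (g y) (r y)) x R"
    proof (rule avg_mono)
      fix y assume y: "y \<in> ball x R"
      show "epow (g y) s \<le> epow (g y) (r y)" using g[of y] sr[OF y] by (auto intro: epow_exponent_mono)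
    qed
    finally show ?thesis .
  qed
  have "epow (avg g x R) (r x) \<le> ennreal K * epow (avg g x R) s"
  proof (cases "A \<le> 1")
    case True
    have "epow (avg g x R) (r x) \<le> epow (avg g x R) s"
      using True A s(2) by (intro epow_exponent_antimono) (auto simp: ennreal_le_1)
    also have "\<dots> \<le> ennreal K * epow (avg g x R) s"
      using mult_right_mono[of 1 "ennreal K" "epow (avg g x R) s"] K1 by simp
    finally show ?thesis .
  next
    case False
    \<comment> \<open>Only \<open>A > 1\<close> matters: then \<open>ln A\<close> is at most a multiple of \<open>ln w\<close>, and \<open>d * ln w = C\<close>.\<close>
    have "ennreal (A * (R ^ DIM('a) * v)) \<le> 1"
      using small A R v by (simp add: emeasure_ball_eq v_def ennreal_mult)
    then have "A * (R ^ DIM('a) * v) \<le> 1" by (simp add: ennreal_le_1)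
    then have "A \<le> 1 / (R ^ DIM('a) * v)" using R v by (simp add: field_simps)
    then have "ln A \<le> ln (1 / (R ^ DIM('a) * v))" using False R v by (subst ln_le_cancel_iff) auto
    also have "\<dots> = DIM('a) * ln (1 / R) - ln v" using R v by (simp add: ln_div ln_mult ln_realpow)
    also have "\<dots> \<le> DIM('a) * ln w + \<bar>ln v\<bar> * ln w"
    proof -
      have "ln (1 / R) \<le> ln w" unfolding w_def using R by (subst ln_le_cancel_iff) (auto intro: add_pos_pos)
      then have "DIM('a) * ln (1 / R) \<le> DIM('a) * ln w" by (intro mult_left_mono) auto
      moreover have "\<bar>ln v\<bar> * 1 \<le> \<bar>ln v\<bar> * ln w" using w by (intro mult_left_mono) auto
      ultimately show ?thesis by linarith
    qed
    finally have lnA: "ln A \<le> (\<bar>ln v\<bar> + DIM('a)) * ln w" by (simp add: algebra_simps)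
    have "A powr (r x - s) \<le> A powr d" using False s(3) by (intro powr_mono) auto
    also have "\<dots> = exp (d * ln A)" using False by (simp add: powr_def)
    also have "\<dots> \<le> K" unfolding K_def
    proof (subst exp_le_cancel_iff)
      have "d * ln A \<le> d * ((\<bar>ln v\<bar> + DIM('a)) * ln w)" using lnA d by (rule mult_left_mono)
      also have "\<dots> = C * (\<bar>ln v\<bar> + DIM('a))" using w by (simp add: d_def)
      finally show "d * ln A \<le> C * (\<bar>ln v\<bar> + DIM('a))" .
    qed
    finally have "A powr (r x - s) \<le> K" .
    moreover have "epow (avg g x R) (r x) = ennreal (A powr (r x - s)) * epow (avg g x R) s"
      using A epow_add_exponent[of "avg g x R" "r x - s" s] by simp
    ultimately show ?thesis by (simp add: mult_right_mono ennreal_leI)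
  qed
  also have "\<dots> \<le> ennreal K * avg (\<lambda>y. epow (g y) (r y)) x R" using J by (simp add: mult_left_mono)
  finally show ?thesis by (simp add: K_def v_def)
qed

text \<open>Where the exponents are close only at infinity, they can be exchanged up to an additive error that
  decays as fast as desired. If \<open>z \<ge> w powr (- m)\<close> with \<open>w = exp 1 + t\<close>, then \<open>z powr (a - b)\<close> is bounded because
  \<open>\<bar>ln z\<bar> \<le> m * ln w\<close>; otherwise \<open>z\<close> itself is smaller than the error.\<close>

lemma epow_exponent_swap:
  assumes z: "z \<le> 1" and ab: "1 \<le> a" "\<bar>a - b\<bar> \<le> C / ln (exp 1 + t)" and t: "0 \<le> t" and m: "0 \<le> m"
  shows "epow z a \<le> ennreal (exp (m * C)) * (epow z b + ennreal ((exp 1 + t) powr (- m)))"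
proof -
  obtain u where u: "0 \<le> u" "u \<le> 1" "z = ennreal u" using z by (cases z) (auto simp: ennreal_le_1 top_unique)
  define w where "w = exp 1 + t"
  have w: "1 \<le> ln w" "0 < w" using t ln_exp_1_add_ge_1[of t] by (auto simp: w_def add_pos_nonneg)
  have "0 \<le> C / ln w" using order_trans[OF abs_ge_zero ab(2)] by (simp only: w_def)
  then have C: "0 \<le> C" using divide_neg_pos[of C "ln w"] w by linarith
  have K: "1 \<le> exp (m * C)" using m C by simp
  have "u powr a \<le> exp (m * C) * (u powr b + w powr (- m))"
  proof (cases "b \<le> a \<or> u = 0")
    case True
    then have "u powr a \<le> 1 * (u powr b + w powr (- m))"
      using u by (cases "u = 0") (auto intro: powr_mono' add_increasing2)
    also have "\<dots> \<le> exp (m * C) * (u powr b + w powr (- m))" using K by (intro mult_right_mono) auto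
    finally show ?thesis .
  next
    case False
    then have ba: "a < b" "0 < u" using u by auto
    show ?thesis
    proof (cases "w powr (- m) \<le> u")
      case True
      have "(b - a) * (- ln u) \<le> C / ln w * (m * ln w)"
      proof (rule mult_mono)
        show "b - a \<le> C / ln w" using ab(2) by (simp add: w_def[symmetric])
        have "ln (w powr (- m)) \<le> ln u" using True ba w by (subst ln_le_cancel_iff) auto
        then show "- ln u \<le> m * ln w" using w by (simp add: ln_powr)
        show "0 \<le> C / ln w" using C w(1) by (intro divide_nonneg_pos) auto
        show "0 \<le> - ln u" using ba u by simp
      qed
      moreover have "w \<noteq> 1" using w(1) by auto
      ultimately have "(a - b) * ln u \<le> m * C" using w by (simp add: algebra_simps)
      then have "u powr (a - b) \<le> exp (m * C)" using ba by (simp add: powr_def)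
      then have "u powr (a - b) * u powr b \<le> exp (m * C) * u powr b" by (rule mult_right_mono) simp
      then have "u powr a \<le> exp (m * C) * u powr b" by (simp flip: powr_add)
      also have "\<dots> \<le> exp (m * C) * (u powr b + w powr (- m))" by (intro mult_left_mono) auto
      finally show ?thesis .
    next
      case False
      have "u powr a \<le> u powr 1" using u ab by (intro powr_mono') auto
      also have "\<dots> \<le> 1 * (u powr b + w powr (- m))" using False ba by (simp add: add_increasing)
      also have "\<dots> \<le> exp (m * C) * (u powr b + w powr (- m))" using K by (intro mult_right_mono) auto
      finally show ?thesis .
    qed
  qed
  then have "ennreal (u powr a) \<le> ennreal (exp (m * C) * (u powr b + w powr (- m)))"
    by (rule ennreal_leI)
  also have "\<dots> = ennreal (exp (m * C)) * (ennreal (u powr b) + ennreal (w powr (- m)))"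
    by (simp add: ennreal_mult ennreal_plus)
  finally show ?thesis using u by (simp add: w_def)
qed

text \<open>Compare with a sum over balls of integer radii; two powers beyond the dimension make it converge.\<close>

lemma nn_integral_decay_finite:
  "(\<integral>\<^sup>+x. ennreal ((exp 1 + norm (x::'a::euclidean_space)) powr (- real (DIM('a) + 2))) \<partial>lborel) < top"
proof -
  define v where "v = measure lborel (ball (0::'a) 1)"
  have v: "0 < v" unfolding v_def by simp
  have pw: "ennreal ((exp 1 + norm x) powr (- real (DIM('a) + 2)))
     \<le> (\<Sum>k. ennreal (real (Suc k) powr (- real (DIM('a) + 2))) * indicator (ball 0 (real (Suc k))) x)"
    for x :: 'a
  proof -
    define k where "k = nat \<lfloor>norm x\<rfloor>"
    define G where "G = (\<lambda>i. ennreal (real (Suc i) powr (- real (DIM('a) + 2))) * indicator (ball 0 (real (Suc i))) x)"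
    have k: "real k \<le> norm x" "norm x < real (Suc k)" unfolding k_def by (auto simp: of_nat_nat) linarith+
    have "(exp 1 + norm x) powr (- real (DIM('a) + 2)) \<le> real (Suc k) powr (- real (DIM('a) + 2))"
    proof (rule powr_mono2')
      show "real (Suc k) \<le> exp 1 + norm x" using k(1) exp_ge_add_one_self[of 1] by simp
    qed auto
    then have "ennreal ((exp 1 + norm x) powr (- real (DIM('a) + 2)))
      \<le> ennreal (real (Suc k) powr (- real (DIM('a) + 2))) * indicator (ball 0 (real (Suc k))) x"
      using k by (simp add: ennreal_leI)
    also have "\<dots> = G k" by (simp only: G_def)
    also have "\<dots> \<le> (\<Sum>i. G i)" using sum_le_suminf[of G "{k}"] by simp
    finally show ?thesis by (simp only: G_def)
  qed
  have "(\<integral>\<^sup>+x. ennreal ((exp 1 + norm (x::'a)) powr (- real (DIM('a) + 2))) \<partial>lborel)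
    \<le> (\<integral>\<^sup>+x. (\<Sum>k. ennreal (real (Suc k) powr (- real (DIM('a) + 2))) * indicator (ball 0 (real (Suc k))) (x::'a)) \<partial>lborel)"
    by (intro nn_integral_mono pw)
  also have "\<dots> = (\<Sum>k. \<integral>\<^sup>+x. ennreal (real (Suc k) powr (- real (DIM('a) + 2))) * indicator (ball 0 (real (Suc k))) (x::'a) \<partial>lborel)"
    by (rule nn_integral_suminf) simp
  also have "\<dots> = (\<Sum>k. ennreal (v * inverse ((real (Suc k))\<^sup>2)))"
  proof (intro suminf_cong)
    fix k
    have "x powr (- real (DIM('a) + 2)) * (x ^ DIM('a)) = inverse (x\<^sup>2)" if "0 < x" for x :: real
      using that by (subst powr_minus, subst powr_realpow) (auto simp: power_add power2_eq_square)
    from this[OF of_nat_0_less_iff[THEN iffD2, OF zero_less_Suc]]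
    have "real (Suc k) powr (- real (DIM('a) + 2)) * (real (Suc k) ^ DIM('a)) = inverse ((real (Suc k))\<^sup>2)" .
    then have eq: "real (Suc k) powr (- real (DIM('a) + 2)) * (real (Suc k) ^ DIM('a) * v) = v * inverse ((real (Suc k))\<^sup>2)"
      by (metis mult.assoc mult.commute)
    have "(\<integral>\<^sup>+x. ennreal (real (Suc k) powr (- real (DIM('a) + 2))) * indicator (ball 0 (real (Suc k))) (x::'a) \<partial>lborel)
       = ennreal (real (Suc k) powr (- real (DIM('a) + 2))) * ennreal (real (Suc k) ^ DIM('a) * v)"
      by (subst nn_integral_cmult_indicator) (auto simp: emeasure_ball_eq v_def)
    also have "\<dots> = ennreal (v * inverse ((real (Suc k))\<^sup>2))"
      using v by (subst ennreal_mult[symmetric]) (simp_all only: eq, auto)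
    finally show "(\<integral>\<^sup>+x. ennreal (real (Suc k) powr (- real (DIM('a) + 2))) * indicator (ball 0 (real (Suc k))) (x::'a) \<partial>lborel)
       = ennreal (v * inverse ((real (Suc k))\<^sup>2))" .
  qed
  also have "\<dots> < top"
  proof -
    have "summable (\<lambda>k. inverse ((real (Suc k))\<^sup>2))"
      using inverse_power_summable[of 2, where 'a=real] by (subst summable_Suc_iff) (simp add: power_inverse)
    then have "summable (\<lambda>k. v * inverse ((real (Suc k))\<^sup>2))" by (rule summable_mult)
    then have "(\<Sum>k. ennreal (v * inverse ((real (Suc k))\<^sup>2))) \<noteq> top"
      using v by (intro ennreal_suminf_neq_top) auto
    then show ?thesis by (simp add: less_top)
  qed
  finally show ?thesis .
qed

text \<open>Write \<open>p = r * a\<close>. It suffices to bound \<open>epow (maxfun f x) (r x)\<close> by the maximal function of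
  \<open>g = epow f r\<close> plus a fixed function in \<open>L^a\<close>, because \<open>g\<close> belongs to \<open>L^a\<close> and \<open>a > 1\<close>. For the part of \<open>f\<close> above 1
  this is the Jensen inequality above. For the part below 1 the exponent \<open>r\<close> is exchanged for its limit
  at infinity, the constant Jensen inequality is applied, and the exponent is exchanged back inside
  the average.\<close>

theorem maxfun_modular_bounded:
  fixes p :: "'a::euclidean_space \<Rightarrow> real"
  assumes lh: "log_holder p" and pm [measurable]: "p \<in> borel_measurable borel"
    and a: "1 < a" "\<And>x. a \<le> p x" and B: "\<And>x. p x \<le> B"
  obtains K where "1 \<le> K"
    "\<And>f. f \<in> borel_measurable borel \<Longrightarrow> modular p f \<le> 1 \<Longrightarrow> modular p (maxfun f) \<le> ennreal K"
proof -
  obtain C rinf where C: "0 \<le> C" "1 \<le> rinf"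
    and LH0: "\<And>x y. \<bar>p x / a - p y / a\<bar> \<le> C / ln (exp 1 + 1 / norm (x - y))"
    and LHi: "\<And>x. \<bar>p x / a - rinf\<bar> \<le> C / ln (exp 1 + norm x)"
    using log_holder_rescaled[OF lh _ a(2) B] a(1) by (metis less_imp_le)
  obtain K0 where K0: "0 < K0" "\<And>f::'a \<Rightarrow> ennreal. f \<in> borel_measurable borel \<Longrightarrow>
    (\<integral>\<^sup>+x. epow (maxfun f x) a \<partial>lborel) \<le> ennreal K0 * (\<integral>\<^sup>+x. epow (f x) a \<partial>lborel)"
    using maxfun_strong_type[OF a(1), where 'a='a] by blast
  define r where "r = (\<lambda>x. p x / a)"
  have [measurable]: "r \<in> borel_measurable borel" unfolding r_def by measurable
  have r1: "1 \<le> r x" for x using a(1) a(2)[of x] by (simp add: r_def)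
  have rB: "r x \<le> B / a" for x using a(1) B[of x] by (simp add: r_def divide_right_mono)
  define m where "m = real (DIM('a) + 2)"
  define h where "h = (\<lambda>x::'a. ennreal ((exp 1 + norm x) powr (- m)))"
  have hm [measurable]: "h \<in> borel_measurable borel" unfolding h_def by measurable
  define I where "I = (\<integral>\<^sup>+x. h x \<partial>lborel)"
  have I: "I < top" unfolding I_def h_def m_def by (rule nn_integral_decay_finite)
  define E where "E = ennreal (exp (C * (\<bar>ln (measure lborel (ball (0::'a) 1))\<bar> + DIM('a))))"
  define F where "F = ennreal (exp (m * C))"
  have F1: "1 \<le> F" using C(1) by (simp add: F_def m_def)
  define W where "W = epow 2 (B / a) * (E + F * F)"
  define T where "T = epow W a * (epow 2 a * (ennreal K0 + epow 2 a * (ennreal K0 * I + I)))"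
  have W: "W < top" by (simp add: W_def E_def F_def less_top[symmetric] ennreal_mult_eq_top_iff)
  have T: "T < top" using W I by (simp add: T_def less_top[symmetric] ennreal_mult_eq_top_iff)
  have main: "modular p (maxfun f) \<le> T"
    if [measurable]: "f \<in> borel_measurable borel" and f: "modular p f \<le> 1" for f
  proof -
    define g where "g = (\<lambda>y. epow (f y) (r y))"
    define f1 where "f1 = (\<lambda>y. if 1 \<le> f y then f y else 0)"
    define f2 where "f2 = (\<lambda>y. if 1 \<le> f y then 0 else f y)"
    have [measurable]: "g \<in> borel_measurable borel" "f1 \<in> borel_measurable borel" "f2 \<in> borel_measurable borel"
      unfolding g_def f1_def f2_def by measurable
    have ga: "epow (g y) a = epow (f y) (p y)" for y
      using a(1) by (simp add: g_def epow_epow r_def)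
    have large: "epow (maxfun f1 x) (r x) \<le> E * maxfun g x" for x
    proof -
      have "epow (avg f1 x R) (r x) \<le> E * maxfun g x" if R: "0 < R" for R
      proof -
        have "avg f1 x R * emeasure lborel (ball x R) = (\<integral>\<^sup>+y\<in>ball x R. f1 y \<partial>lborel)"
          using ball_integral_eq_avg[OF R, of f1 x] by simp
        also have "\<dots> \<le> modular p f" unfolding modular_def
        proof (rule nn_integral_mono)
          fix y
          have "1 \<le> p y" using a(1) a(2)[of y] by simp
          then show "f1 y * indicator (ball x R) y \<le> epow (f y) (p y)"
            using epow_exponent_mono[of "f y" 1 "p y"] by (auto simp: f1_def indicator_def)
        qed
        finally have small: "avg f1 x R * emeasure lborel (ball x R) \<le> 1" using f by (rule order_trans)
        have "epow (avg f1 x R) (r x) \<le> E * avg (\<lambda>y. epow (f1 y) (r y)) x R"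
          unfolding E_def using LH0 by (intro avg_large_part r1 C(1) R small) (auto simp: f1_def r_def)
        also have "avg (\<lambda>y. epow (f1 y) (r y)) x R \<le> avg g x R"
          by (rule avg_mono) (auto simp: f1_def g_def)
        also have "avg g x R \<le> maxfun g x" by (rule avg_le_maxfun[OF R])
        finally show ?thesis by (simp add: mult_left_mono)
      qed
      then show ?thesis using r1[of x] by (simp add: maxfun_def[of f1] epow_SUP SUP_le_iff)
    qed
    have small: "epow (maxfun f2 x) (r x) \<le> F * F * (maxfun g x + (maxfun h x + h x))" for x
    proof -
      have "epow (avg f2 x R) (r x) \<le> F * F * (maxfun g x + (maxfun h x + h x))" if R: "0 < R" for R
      proof -
        have "avg f2 x R \<le> avg (\<lambda>_. 1) x R" by (rule avg_mono) (auto simp: f2_def)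
        then have le1: "avg f2 x R \<le> 1" by (simp add: avg_const[OF R])
        have m0: "0 \<le> m" by (simp add: m_def)
        have "epow (avg f2 x R) (r x) \<le> F * (epow (avg f2 x R) rinf + h x)"
          unfolding F_def h_def using LHi[of x] le1 r1[of x] m0
          by (intro epow_exponent_swap) (auto simp: r_def)
        also have "epow (avg f2 x R) rinf \<le> avg (\<lambda>y. epow (f2 y) rinf) x R"
          by (rule jensen_avg) (use C R in auto)
        also have "avg (\<lambda>y. epow (f2 y) rinf) x R \<le> avg (\<lambda>y. F * (g y + h y)) x R"
        proof (rule avg_mono)
          fix y
          have "epow (f2 y) rinf \<le> F * (epow (f2 y) (r y) + h y)"
            unfolding F_def h_def using LHi[of y] C m0
            by (intro epow_exponent_swap) (auto simp: f2_def r_def abs_minus_commute)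
          also have "\<dots> \<le> F * (g y + h y)"
            by (intro mult_left_mono add_right_mono) (auto simp: f2_def g_def)
          finally show "epow (f2 y) rinf \<le> F * (g y + h y)" .
        qed
        also have "avg (\<lambda>y. F * (g y + h y)) x R = F * (avg g x R + avg h x R)"
          by (simp add: avg_cmult avg_add)
        also have "\<dots> \<le> F * (maxfun g x + maxfun h x)"
          by (intro mult_left_mono add_mono avg_le_maxfun R) auto
        finally have "epow (avg f2 x R) (r x) \<le> F * (F * (maxfun g x + maxfun h x) + h x)"
          by (simp add: mult_left_mono)
        also have "\<dots> \<le> F * (F * (maxfun g x + maxfun h x) + F * h x)"
          using mult_right_mono[OF F1, of "h x"] by (intro mult_left_mono add_left_mono) auto
        also have "\<dots> = F * F * (maxfun g x + (maxfun h x + h x))"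
          by (simp add: distrib_left mult.assoc add.assoc)
        finally show ?thesis .
      qed
      then show ?thesis using r1[of x] by (simp add: maxfun_def[of f2] epow_SUP SUP_le_iff)
    qed
    have pointwise: "epow (maxfun f x) (p x) \<le> epow W a * (epow 2 a *
        (epow (maxfun g x) a + epow 2 a * (epow (maxfun h x) a + epow (h x) a)))" for x
    proof -
      define G where "G = maxfun g x"
      define H where "H = maxfun h x + h x"
      have r0: "0 \<le> r x" "0 \<le> a" using r1[of x] a(1) by auto
      have "f = (\<lambda>y. f1 y + f2 y)" by (auto simp: f1_def f2_def)
      then have "maxfun f x \<le> maxfun f1 x + maxfun f2 x"
        using maxfun_add_le[of f1 f2 x] by simp
      then have "epow (maxfun f x) (r x) \<le> epow (maxfun f1 x + maxfun f2 x) (r x)"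
        using r0(1) by (rule epow_mono)
      also have "\<dots> \<le> epow (2 * maxfun f1 x) (r x) + epow (2 * maxfun f2 x) (r x)"
        using r0 by (intro epow_add_le) auto
      also have "\<dots> = epow 2 (r x) * (epow (maxfun f1 x) (r x) + epow (maxfun f2 x) (r x))"
        by (simp add: epow_mult distrib_left)
      also have "\<dots> \<le> epow 2 (B / a) * (E * (G + H) + F * F * (G + H))"
      proof (intro mult_mono add_mono epow_exponent_mono rB)
        have "epow (maxfun f1 x) (r x) \<le> E * G" unfolding G_def by (rule large)
        also have "\<dots> \<le> E * (G + H)" by (intro mult_left_mono) auto
        finally show "epow (maxfun f1 x) (r x) \<le> E * (G + H)" .
        show "epow (maxfun f2 x) (r x) \<le> F * F * (G + H)" unfolding G_def H_def by (rule small)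
      qed auto
      also have "\<dots> = W * (G + H)" by (simp add: W_def distrib_right distrib_left mult.assoc)
      finally have "epow (epow (maxfun f x) (r x)) a \<le> epow (W * (G + H)) a" using r0(2) by (rule epow_mono)
      also have "\<dots> \<le> epow W a * (epow 2 a * (epow G a + epow H a))"
        unfolding epow_mult[of W]
        using epow_add_le[OF r0(2), of G H] by (intro mult_left_mono) (auto simp: epow_mult distrib_left)
      also have "epow H a \<le> epow 2 a * (epow (maxfun h x) a + epow (h x) a)"
        using epow_add_le[OF r0(2), of "maxfun h x" "h x"] by (simp add: H_def epow_mult distrib_left)
      finally show ?thesis
        using a(1) by (simp add: epow_epow r_def G_def add_left_mono mult_left_mono)
    qed
    have Ih: "(\<integral>\<^sup>+x. epow (h x) a \<partial>lborel) \<le> I"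
      unfolding I_def
    proof (rule nn_integral_mono)
      fix x :: 'a
      have "(exp 1 + norm x) powr (- m) \<le> (exp 1 + norm x) powr 0"
      proof (rule powr_mono)
        show "1 \<le> exp 1 + norm x" using exp_ge_add_one_self[of 1] norm_ge_zero[of x] by linarith
      qed (simp add: m_def)
      then have "h x \<le> 1" unfolding h_def by (intro ennreal_le_1[THEN iffD2]) (auto split: if_splits)
      then show "epow (h x) a \<le> h x" using epow_exponent_antimono[of "h x" 1 a] a(1) by simp
    qed
    have "modular p (maxfun f) \<le> (\<integral>\<^sup>+x. epow W a * (epow 2 a *
        (epow (maxfun g x) a + epow 2 a * (epow (maxfun h x) a + epow (h x) a))) \<partial>lborel)"
      unfolding modular_def by (rule nn_integral_mono) (rule pointwise)
    also have "\<dots> = epow W a * (epow 2 a * ((\<integral>\<^sup>+x. epow (maxfun g x) a \<partial>lborel)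
        + epow 2 a * ((\<integral>\<^sup>+x. epow (maxfun h x) a \<partial>lborel) + (\<integral>\<^sup>+x. epow (h x) a \<partial>lborel))))"
      by (simp add: nn_integral_cmult nn_integral_add)
    also have "\<dots> \<le> T" unfolding T_def
    proof (intro mult_left_mono add_mono)
      have "(\<integral>\<^sup>+x. epow (maxfun g x) a \<partial>lborel) \<le> ennreal K0 * (\<integral>\<^sup>+x. epow (g x) a \<partial>lborel)"
        by (rule K0(2)) simp
      also have "\<dots> \<le> ennreal K0 * 1"
        using f by (intro mult_left_mono) (auto simp: ga modular_def)
      finally show "(\<integral>\<^sup>+x. epow (maxfun g x) a \<partial>lborel) \<le> ennreal K0" by simp
      have "(\<integral>\<^sup>+x. epow (maxfun h x) a \<partial>lborel) \<le> ennreal K0 * (\<integral>\<^sup>+x. epow (h x) a \<partial>lborel)"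
        by (rule K0(2)) simp
      also have "\<dots> \<le> ennreal K0 * I" using Ih by (rule mult_left_mono) simp
      finally show "(\<integral>\<^sup>+x. epow (maxfun h x) a \<partial>lborel) \<le> ennreal K0 * I" .
    qed (use Ih in auto)
    finally show ?thesis .
  qed
  show ?thesis
  proof
    show "1 \<le> max 1 (enn2real T)" by simp
    have "T \<le> ennreal (max 1 (enn2real T))"
      using T by (cases T) (auto intro!: ennreal_leI)
    then show "modular p (maxfun f) \<le> ennreal (max 1 (enn2real T))"
      if "f \<in> borel_measurable borel" "modular p f \<le> 1" for f
      using main[OF that] by (rule order_trans[rotated])
  qed
qed

section \<open>One-sided stable laws\<close>

text \<open>Nonnegativity of \<open>\<phi>\<close> is recorded because \<open>ennreal\<close> sends negative reals to 0.\<close>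

definition has_laplace :: "real measure \<Rightarrow> (real \<Rightarrow> real) \<Rightarrow> bool" where
  "has_laplace M \<phi> \<longleftrightarrow> real_distribution M \<and> (AE s in M. 0 \<le> s) \<and>
     (\<forall>l\<ge>0. 0 \<le> \<phi> l \<and> (\<integral>\<^sup>+s. ennreal (exp (- (l * s))) \<partial>M) = ennreal (\<phi> l))"

lemma real_distribution_return [simp]: "real_distribution (return borel c)"
  by (simp add: real_distribution_def real_distribution_axioms_def prob_space_return)

lemma real_distribution_distr':
  "real_distribution M \<Longrightarrow> f \<in> borel_measurable borel \<Longrightarrow> real_distribution (distr M borel f)"
proof -
  assume "real_distribution M" and [measurable]: "f \<in> borel_measurable borel"
  then interpret real_distribution M by simp
  show ?thesis
    by (simp add: real_distribution_def real_distribution_axioms_def prob_space_distr)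
qed

lemma has_laplace_return: "0 \<le> c \<Longrightarrow> has_laplace (return borel c) (\<lambda>l. exp (- (l * c)))"
  unfolding has_laplace_def by (auto simp: nn_integral_return AE_return)

lemma has_laplace_scale:
  assumes M: "has_laplace M \<phi>" and c: "0 \<le> c"
  shows "has_laplace (distr M borel (\<lambda>s. c * s)) (\<lambda>l. \<phi> (c * l))"
proof -
  interpret real_distribution M using M by (simp add: has_laplace_def)
  have "AE s in M. 0 \<le> s" using M by (simp add: has_laplace_def)
  then have "AE s in M. 0 \<le> c * s" by eventually_elim (use c in simp)
  then have ae: "AE s in distr M borel (\<lambda>s. c * s). 0 \<le> s" by (subst AE_distr_iff) auto
  have "(\<integral>\<^sup>+s. ennreal (exp (- (l * s))) \<partial>distr M borel (\<lambda>s. c * s)) = ennreal (\<phi> (c * l))"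
    if "0 \<le> l" for l
  proof -
    have "(\<integral>\<^sup>+s. ennreal (exp (- (l * s))) \<partial>distr M borel (\<lambda>s. c * s))
      = (\<integral>\<^sup>+s. ennreal (exp (- (c * l * s))) \<partial>M)"
      by (subst nn_integral_distr) (auto simp: mult.commute[of l] mult.assoc)
    then show ?thesis using M c that by (simp add: has_laplace_def)
  qed
  then show ?thesis
    using M c ae by (auto simp: has_laplace_def real_distribution_distr')
qed

lemma has_laplace_convolution:
  assumes M: "has_laplace M \<phi>" and N: "has_laplace N \<psi>"
  shows "has_laplace (M \<star> N) (\<lambda>l. \<phi> l * \<psi> l)"
proof -
  interpret M: real_distribution M using M by (simp add: has_laplace_def)
  interpret N: real_distribution N using N by (simp add: has_laplace_def)
  interpret P: pair_prob_space M N ..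
  have rd: "real_distribution (M \<star> N)"
    unfolding real_distribution_def real_distribution_axioms_def convolution_def
    by (auto intro!: P.prob_space_distr)
  have aeM: "AE s in M. 0 \<le> s" and aeN: "AE s in N. 0 \<le> s"
    using M N by (auto simp: has_laplace_def)
  have "(\<integral>\<^sup>+s. indicator {..<0} s \<partial>(M \<star> N)) = (\<integral>\<^sup>+x. (\<integral>\<^sup>+y. indicator {..<0} (x + y) \<partial>N) \<partial>M)"
    by (rule nn_integral_convolution) (auto intro: M.finite_measure_axioms N.finite_measure_axioms)
  also have "\<dots> = (\<integral>\<^sup>+x. 0 \<partial>M)"
  proof (rule nn_integral_cong_AE)
    show "AE x in M. (\<integral>\<^sup>+y. indicator {..<0} (x + y) \<partial>N) = 0"
      using aeM
    proof eventually_elim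
      case (elim x)
      have "AE y in N. indicator {..<0} (x + y) = (0::ennreal)"
        using aeN by eventually_elim (use elim in auto)
      then show ?case by (subst nn_integral_0_iff_AE) auto
    qed
  qed
  finally have "(\<integral>\<^sup>+s. indicator {..<0} s \<partial>(M \<star> N)) = 0" by simp
  then have "AE s in M \<star> N. indicator {..<0} s = (0::ennreal)"
    by (subst (asm) nn_integral_0_iff_AE) auto
  then have ae: "AE s in M \<star> N. 0 \<le> s" by eventually_elim (auto simp: indicator_def split: if_splits)
  have "(\<integral>\<^sup>+s. ennreal (exp (- (l * s))) \<partial>(M \<star> N)) = ennreal (\<phi> l * \<psi> l)" if l: "0 \<le> l" for l
  proof -
    have "(\<integral>\<^sup>+s. ennreal (exp (- (l * s))) \<partial>(M \<star> N))
      = (\<integral>\<^sup>+x. (\<integral>\<^sup>+y. ennreal (exp (- (l * (x + y)))) \<partial>N) \<partial>M)"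
      by (rule nn_integral_convolution) (auto intro: M.finite_measure_axioms N.finite_measure_axioms)
    also have "\<dots> = (\<integral>\<^sup>+x. (\<integral>\<^sup>+y. ennreal (exp (- (l * x))) * ennreal (exp (- (l * y))) \<partial>N) \<partial>M)"
      by (simp add: distrib_left exp_diff exp_minus divide_inverse flip: ennreal_mult)
    also have "\<dots> = ennreal (\<phi> l) * ennreal (\<psi> l)"
      using M N l by (simp add: nn_integral_cmult nn_integral_multc has_laplace_def)
    finally show ?thesis using M N l by (simp add: ennreal_mult has_laplace_def)
  qed
  then show ?thesis using rd ae M N by (auto simp: has_laplace_def)
qed

lemma has_laplace_power:
  assumes "has_laplace M \<phi>"
  shows "\<exists>N. has_laplace N (\<lambda>l. \<phi> l ^ k)"
proof (induction k)
  case 0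
  show ?case using has_laplace_return[of 0] by auto
next
  case (Suc k)
  then show ?case using has_laplace_convolution[OF assms] by auto
qed

lemma has_laplace_integral:
  assumes M: "has_laplace M \<phi>" and l: "0 \<le> l"
  shows "integrable M (\<lambda>s. exp (- (l * max s 0)))" "(LINT s|M. exp (- (l * max s 0))) = \<phi> l"
proof -
  interpret real_distribution M using M by (simp add: has_laplace_def)
  show "integrable M (\<lambda>s. exp (- (l * max s 0)))"
    by (rule integrable_const_bound[where B=1]) (use l in auto)
  have ae: "AE s in M. 0 \<le> s" using M by (simp add: has_laplace_def)
  have "(LINT s|M. exp (- (l * max s 0))) = enn2real (\<integral>\<^sup>+s. ennreal (exp (- (l * max s 0))) \<partial>M)"
    by (rule integral_eq_nn_integral) auto
  also have "(\<integral>\<^sup>+s. ennreal (exp (- (l * max s 0))) \<partial>M) = (\<integral>\<^sup>+s. ennreal (exp (- (l * s))) \<partial>M)"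
    by (rule nn_integral_cong_AE) (use ae in eventually_elim, auto simp: max_def)
  also have "\<dots> = ennreal (\<phi> l)" using M l by (simp add: has_laplace_def)
  finally show "(LINT s|M. exp (- (l * max s 0))) = \<phi> l" using M l by (simp add: has_laplace_def)
qed

text \<open>The continuity theorem for Laplace transforms: a transform close to 1 at one point \<open>l\<close>, uniformly in
  \<open>k\<close>, confines the mass to a compact set, so that Helly's selection theorem applies.\<close>

lemma has_laplace_limit:
  assumes \<mu>: "\<And>k. has_laplace (\<mu> k) (\<phi> k)"
    and lim: "\<And>l. 0 \<le> l \<Longrightarrow> (\<lambda>k. \<phi> k l) \<longlonglongrightarrow> \<psi> l"
    and uniform: "\<And>e. 0 < e \<Longrightarrow> \<exists>l>0. \<forall>k. 1 - e \<le> \<phi> k l"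
  shows "\<exists>M. has_laplace M \<psi>"
proof -
  have rd: "real_distribution (\<mu> k)" for k using \<mu>[of k] by (simp add: has_laplace_def)
  have "tight \<mu>"
    unfolding tight_def
  proof (intro conjI allI impI rd)
    fix e :: real assume e: "0 < e"
    obtain l where l: "0 < l" "\<And>k. 1 - e / 3 \<le> \<phi> k l" using uniform[of "e / 3"] e by auto
    \<comment> \<open>Beyond \<open>b\<close> the integrand \<open>exp (- (l * s))\<close> is at most one half.\<close>
    define b where "b = ln 2 / l"
    have b: "0 < b" using l by (simp add: b_def)
    have "1 - e < measure (\<mu> k) {- 1<..b}" for k
    proof -
      interpret real_distribution "\<mu> k" by (rule rd)
      have ae: "AE s in \<mu> k. 0 \<le> s" using \<mu>[of k] by (simp add: has_laplace_def)
      have "\<phi> k l = (LINT s|\<mu> k. exp (- (l * max s 0)))"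
        using has_laplace_integral(2)[OF \<mu>, of l k] l by simp
      also have "\<dots> \<le> (LINT s|\<mu> k. 1 / 2 + 1 / 2 * indicator {- 1<..b} s)"
      proof (rule integral_mono_AE)
        show "integrable (\<mu> k) (\<lambda>s. exp (- (l * max s 0)))"
          using has_laplace_integral(1)[OF \<mu>] l by simp
        show "integrable (\<mu> k) (\<lambda>s. 1 / 2 + 1 / 2 * indicator {- 1<..b} s :: real)"
          by (auto intro!: integrable_const_bound[where B=1] simp: indicator_def)
        show "AE s in \<mu> k. exp (- (l * max s 0)) \<le> 1 / 2 + 1 / 2 * indicator {- 1<..b} s"
          using ae
        proof eventually_elim
          case (elim s)
          show ?case
          proof (cases "s \<le> b")
            case True
            then show ?thesis using elim l by (simp add: mult_nonneg_nonneg)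
          next
            case False
            then have "ln 2 < l * s" using l by (simp add: b_def field_simps)
            then have "exp (- (l * s)) \<le> exp (- ln 2)" by simp
            also have "exp (- ln 2) = (1 / 2 :: real)" by (simp add: exp_minus)
            finally show ?thesis using elim False by (simp add: max_def)
          qed
        qed
      qed
      also have "\<dots> = 1 / 2 + 1 / 2 * measure (\<mu> k) {- 1<..b}"
      proof -
        have "integrable (\<mu> k) (indicator {- 1<..b} :: real \<Rightarrow> real)"
          by (rule integrable_real_indicator) (auto simp: emeasure_eq_measure)
        then show ?thesis using prob_space by (subst Bochner_Integration.integral_add) auto
      qed
      finally show ?thesis using l(2)[of k] e by simp
    qed
    then show "\<exists>a b. a < b \<and> (\<forall>n. 1 - e < measure (\<mu> n) {a<..b})"
      using b by (intro exI[of _ "-1"] exI[of _ b]) auto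
  qed
  from tight_imp_convergent_subsubsequence[OF this, of id]
  obtain r M where r: "strict_mono r" and M: "real_distribution M" and conv: "weak_conv_m (\<mu> \<circ> id \<circ> r) M"
    by (auto simp: strict_mono_id)
  interpret real_distribution M by (rule M)
  have int: "(LINT s|M. exp (- (l * max s 0))) = \<psi> l" if l: "0 \<le> l" for l
  proof (rule LIMSEQ_unique)
    have "(\<lambda>n. LINT s|(\<mu> \<circ> id \<circ> r) n. exp (- (l * max s 0))) \<longlonglongrightarrow> (LINT s|M. exp (- (l * max s 0)))"
      by (rule weak_conv_imp_integral_bdd_continuous_conv[where B=1])
         (use rd M conv l in \<open>auto intro!: continuous_intros simp: o_def\<close>)
    then show "(\<lambda>n. \<phi> (r n) l) \<longlonglongrightarrow> (LINT s|M. exp (- (l * max s 0)))"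
      using has_laplace_integral(2)[OF \<mu> l] by simp
    show "(\<lambda>n. \<phi> (r n) l) \<longlonglongrightarrow> \<psi> l"
      using LIMSEQ_subseq_LIMSEQ[OF lim[OF l] r] by (simp add: o_def)
  qed
  \<comment> \<open>Replacing the limit law by its image under \<open>max s 0\<close> enforces support in the half line.\<close>
  have "has_laplace (distr M borel (\<lambda>s. max s 0)) \<psi>"
    unfolding has_laplace_def
  proof (intro conjI allI impI)
    show "real_distribution (distr M borel (\<lambda>s. max s 0))" by (rule real_distribution_distr'[OF M]) simp
    show "AE s in distr M borel (\<lambda>s. max s 0). 0 \<le> s" by (subst AE_distr_iff) auto
    fix l :: real assume l: "0 \<le> l"
    have "integrable M (\<lambda>s. exp (- (l * max s 0)))"
      by (rule integrable_const_bound[where B=1]) (use l in auto)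
    then have "(\<integral>\<^sup>+s. ennreal (exp (- (l * max s 0))) \<partial>M) = ennreal (\<psi> l)"
      by (subst nn_integral_eq_integral) (auto simp: int[OF l])
    then show "(\<integral>\<^sup>+s. ennreal (exp (- (l * s))) \<partial>distr M borel (\<lambda>s. max s 0)) = ennreal (\<psi> l)"
      by (simp add: nn_integral_distr)
    have "0 \<le> (LINT s|M. exp (- (l * max s 0)))" by (rule Bochner_Integration.integral_nonneg) simp
    then show "0 \<le> \<psi> l" by (simp only: int[OF l])
  qed
  then show ?thesis by blast
qed

lemma one_minus_over_power_limit:
  fixes x :: "nat \<Rightarrow> real"
  assumes "x \<longlonglongrightarrow> c"
  shows "(\<lambda>k. (1 - x k / real (Suc k)) ^ Suc k) \<longlonglongrightarrow> exp (- c)"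
proof -
  define y where "y = (\<lambda>k. - x k / real (Suc k))"
  have y: "y \<longlonglongrightarrow> 0"
    unfolding y_def using assms
    by (intro real_tendsto_divide_at_top[of _ "- c"] tendsto_minus
        filterlim_compose[OF filterlim_real_sequentially filterlim_Suc])
  have ev: "\<forall>\<^sub>F k in sequentially. \<bar>y k\<bar> < 1 / 2"
    using tendstoD[OF y, of "1 / 2"] by (simp add: dist_real_def)
  have "(\<lambda>k. real (Suc k) * (ln (1 + y k) - y k)) \<longlonglongrightarrow> 0"
  proof (rule Lim_null_comparison)
    show "\<forall>\<^sub>F k in sequentially. norm (real (Suc k) * (ln (1 + y k) - y k)) \<le> 2 * \<bar>x k\<bar> * \<bar>y k\<bar>"
      using ev
    proof eventually_elim
      case (elim k)
      have "\<bar>ln (1 + y k) - y k\<bar> \<le> 2 * (y k)\<^sup>2" using elim by (intro abs_ln_one_plus_x_minus_x_bound) auto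
      then have "real (Suc k) * \<bar>ln (1 + y k) - y k\<bar> \<le> real (Suc k) * (2 * (y k)\<^sup>2)"
        by (rule mult_left_mono) simp
      also have "\<dots> = 2 * (real (Suc k) * \<bar>y k\<bar>) * \<bar>y k\<bar>" by (simp add: power2_eq_square flip: abs_mult)
      also have "real (Suc k) * \<bar>y k\<bar> = \<bar>x k\<bar>" by (simp add: y_def abs_divide)
      finally show ?case by (simp add: abs_mult)
    qed
    have "(\<lambda>k. 2 * \<bar>x k\<bar> * \<bar>y k\<bar>) \<longlonglongrightarrow> 2 * \<bar>c\<bar> * \<bar>0\<bar>" by (intro tendsto_intros assms y)
    then show "(\<lambda>k. 2 * \<bar>x k\<bar> * \<bar>y k\<bar>) \<longlonglongrightarrow> 0" by simp
  qed
  then have "(\<lambda>k. real (Suc k) * (ln (1 + y k) - y k) - x k) \<longlonglongrightarrow> 0 - c" by (intro tendsto_diff assms)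
  then have "(\<lambda>k. exp (real (Suc k) * (ln (1 + y k) - y k) - x k)) \<longlonglongrightarrow> exp (0 - c)" by (rule tendsto_exp)
  moreover have "\<forall>\<^sub>F k in sequentially. exp (real (Suc k) * (ln (1 + y k) - y k) - x k) = (1 - x k / real (Suc k)) ^ Suc k"
    using ev
  proof eventually_elim
    case (elim k)
    have "real (Suc k) * (ln (1 + y k) - y k) - x k = real (Suc k) * ln (1 + y k)"
    proof -
      have "real (Suc k) * y k = - x k" unfolding y_def by (simp del: of_nat_Suc)
      then show ?thesis by (simp only: right_diff_distrib)
    qed
    then have "exp (real (Suc k) * (ln (1 + y k) - y k) - x k) = exp (ln (1 + y k)) ^ Suc k"
      by (simp only: exp_of_nat_mult)
    also have "exp (ln (1 + y k)) = 1 + y k" using elim by (intro exp_ln) (auto simp: abs_less_iff)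
    finally show ?case by (simp add: y_def)
  qed
  ultimately show ?thesis by (simp add: tendsto_cong)
qed

section \<open>Existence of the stable subordinator\<close>

lemma nn_integral_powr_above:
  assumes "e < -1" "0 < c"
  shows "(\<integral>\<^sup>+x. ennreal (x powr e) * indicator {c..} x \<partial>lborel) = ennreal (c powr (e + 1) / (- (e + 1)))"
proof -
  have "(\<integral>\<^sup>+x. ennreal (x powr e) * indicator {c..} x \<partial>lborel) = ennreal (- (c powr (e + 1)) / (e + 1))"
    by (rule nn_integral_has_integral_lebesgue'[OF _ has_integral_powr_to_inf[OF assms]]) simp
  then show ?thesis by (simp add: minus_divide_right)
qed

text \<open>The law is the weak limit of normalised sums of independent Pareto variables with tail \<open>u powr (- a)\<close>.
  The Laplace transform of one variable is \<open>1 - l powr a * j l\<close>, where \<open>j\<close> increases to a constant \<open>c\<close> as \<open>l\<close>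
  tends to 0; the normalisation \<open>n k\<close> is chosen such that the transform of the sum of \<open>Suc k\<close> variables
  is \<open>(1 - l powr a / c * j (n k * l) / Suc k) ^ Suc k\<close>.\<close>

lemma stable_law_exists:
  assumes a: "0 < a" "a < 1"
  obtains M where "has_laplace M (\<lambda>l. exp (- (l powr a)))"
proof -
  define w where "w = (\<lambda>u::real. a * u powr (- 1 - a))"
  have w0: "0 \<le> w u" for u using a by (simp add: w_def)
  have [measurable]: "w \<in> borel_measurable borel" unfolding w_def by measurable
  define P where "P = density lborel (\<lambda>u. ennreal (w u) * indicator {1..} u)"
  have wint: "(\<integral>\<^sup>+u. ennreal (w u) * indicator {1..} u \<partial>lborel) = 1"
  proof -
    have "(\<integral>\<^sup>+u. ennreal (w u) * indicator {1..} u \<partial>lborel)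
      = (\<integral>\<^sup>+u. ennreal a * (ennreal (u powr (- 1 - a)) * indicator {1..} u) \<partial>lborel)"
      using a by (simp add: w_def ennreal_mult mult.assoc)
    also have "\<dots> = 1" using a nn_integral_powr_above[of "- 1 - a" 1]
      by (simp add: nn_integral_cmult flip: ennreal_mult)
    finally show ?thesis .
  qed
  have sP: "sets P = sets borel" "space P = UNIV" by (simp_all add: P_def)
  interpret P: prob_space P
    by (rule prob_spaceI) (simp add: P_def emeasure_density wint)
  have rdP: "real_distribution P"
    using P.prob_space_axioms sP by (simp add: real_distribution_def real_distribution_axioms_def)
  have aeP: "AE s in P. 0 \<le> s"
    unfolding P_def by (subst AE_density) (auto simp: indicator_def)
  \<comment> \<open>By rescaling, one minus the Laplace transform of \<open>P\<close> at \<open>l\<close> equals \<open>l powr a * J l\<close>.\<close>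
  define J where "J = (\<lambda>l. (\<integral>\<^sup>+u. ennreal (w u * (1 - exp (- u))) * indicator {l..} u \<partial>lborel))"
  define J0 where "J0 = (\<integral>\<^sup>+u. ennreal (w u * (1 - exp (- u))) * indicator {0<..} u \<partial>lborel)"
  have J_le: "J l \<le> J0" if "0 < l" for l
    unfolding J_def J0_def using that by (intro nn_integral_mono) (auto simp: indicator_def)
  have J0_fin: "J0 < top"
  proof -
    have "J0 \<le> (\<integral>\<^sup>+u. ennreal a * (if 0 < u \<and> ennreal u < ennreal 1 then ennreal (u powr (- a)) else 0)
        + ennreal (w u) * indicator {1..} u \<partial>lborel)"
      unfolding J0_def
    proof (rule nn_integral_mono)
      fix u :: real
      show "ennreal (w u * (1 - exp (- u))) * indicator {0<..} u
        \<le> ennreal a * (if 0 < u \<and> ennreal u < ennreal 1 then ennreal (u powr (- a)) else 0)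
        + ennreal (w u) * indicator {1..} u"
      proof (cases "0 < u \<and> u < 1")
        case True
        have "w u * (1 - exp (- u)) \<le> w u * u"
          using exp_ge_add_one_self[of "- u"] w0 by (intro mult_left_mono) auto
        also have "\<dots> = a * u powr (- a)"
          using True powr_mult_base[of u "- 1 - a"] by (simp add: w_def mult.commute)
        finally show ?thesis using True a
          by (auto simp: ennreal_less_iff simp flip: ennreal_mult intro!: ennreal_leI)
      next
        case False
        have "w u * (1 - exp (- u)) \<le> w u * 1" by (intro mult_left_mono w0) auto
        with False show ?thesis by (auto simp: indicator_def not_less intro!: ennreal_leI add_increasing)
      qed
    qed
    also have "\<dots> = ennreal a * (ennreal (1 / (- a + 1)) * epow (ennreal 1) (- a + 1)) + 1"
      using a by (subst nn_integral_add, simp, simp, subst nn_integral_cmult, simp, subst nn_integral_powr_below)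
        (auto simp: wint)
    also have "\<dots> < top" by (simp add: ennreal_mult_less_top)
    finally show ?thesis .
  qed
  have J0_pos: "0 < J0"
  proof -
    have "0 < ennreal (1 - exp (- 1)) * 1" by simp
    also have "ennreal (1 - exp (- 1)) * 1 = (\<integral>\<^sup>+u. ennreal (1 - exp (- 1)) * (ennreal (w u) * indicator {1..} u) \<partial>lborel)"
      by (simp add: nn_integral_cmult wint)
    also have "\<dots> \<le> J0" unfolding J0_def
    proof (rule nn_integral_mono)
      fix u :: real
      show "ennreal (1 - exp (- 1)) * (ennreal (w u) * indicator {1..} u)
        \<le> ennreal (w u * (1 - exp (- u))) * indicator {0<..} u"
      proof (cases "1 \<le> u")
        case True
        then have "(1 - exp (- 1)) * w u \<le> w u * (1 - exp (- u))"
          using w0[of u] by (subst mult.commute) (intro mult_left_mono, auto)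
        then show ?thesis using True w0[of u]
          by (simp add: ennreal_mult[symmetric] del: ennreal_le_iff2)
      qed simp
    qed
    finally show ?thesis .
  qed
  define c where "c = enn2real J0"
  have c: "0 < c" "J0 = ennreal c"
    using J0_fin J0_pos by (auto simp: c_def enn2real_positive_iff)
  define j where "j = (\<lambda>l. enn2real (J l))"
  have Jj: "J l = ennreal (j l)" "0 \<le> j l" "j l \<le> c" if "0 < l" for l
    using J_le[OF that] J0_fin c by (auto simp: j_def ennreal_enn2real_if top_unique enn2real_leI)
  have defect: "(\<integral>\<^sup>+s. ennreal (1 - exp (- (l * s))) \<partial>P) = ennreal (l powr a * j l)" if l: "0 < l" for l
  proof -
    have "J l = ennreal \<bar>l\<bar> * (\<integral>\<^sup>+s. ennreal (w (0 + l * s) * (1 - exp (- (0 + l * s)))) * indicator {l..} (0 + l * s) \<partial>lborel)"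
      unfolding J_def by (rule nn_integral_real_affine) (use l in auto)
    also have "\<dots> = ennreal l * (\<integral>\<^sup>+s. ennreal (l powr (- 1 - a)) * (ennreal (w s) * indicator {1..} s * ennreal (1 - exp (- (l * s)))) \<partial>lborel)"
    proof -
      have "ennreal (w (0 + l * s) * (1 - exp (- (0 + l * s)))) * indicator {l..} (0 + l * s)
        = ennreal (l powr (- 1 - a)) * (ennreal (w s) * indicator {1..} s * ennreal (1 - exp (- (l * s))))" for s
      proof (cases "1 \<le> s")
        case True
        have "w (l * s) = l powr (- 1 - a) * w s" using l True by (simp add: w_def powr_mult)
        then show ?thesis using True l w0[of s] by (simp add: ennreal_mult[symmetric] mult.assoc)
      next
        case False
        then have "l * s < l" using l by simp
        then show ?thesis using False by simp
      qed
      then show ?thesis using l by simp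
    qed
    also have "\<dots> = ennreal (l * l powr (- 1 - a)) * (\<integral>\<^sup>+s. ennreal (1 - exp (- (l * s))) \<partial>P)"
      using l unfolding P_def
      by (subst nn_integral_density) (auto simp: nn_integral_cmult ennreal_mult mult.assoc)
    also have "l * l powr (- 1 - a) = l powr (- a)" using l powr_mult_base[of l "- 1 - a"] by simp
    finally have "ennreal (l powr a) * J l = ennreal (l powr a) * ennreal (l powr (- a)) * (\<integral>\<^sup>+s. ennreal (1 - exp (- (l * s))) \<partial>P)"
      by (simp add: mult.assoc)
    also have "ennreal (l powr a) * ennreal (l powr (- a)) = 1"
      using l by (simp flip: ennreal_mult powr_add)
    finally show ?thesis using Jj[OF l] by (simp add: ennreal_mult)
  qed
  define \<phi> where "\<phi> = (\<lambda>l. if l = 0 then 1 else 1 - l powr a * j l)"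
  have lapP: "has_laplace P \<phi>"
    unfolding has_laplace_def
  proof (intro conjI allI impI rdP aeP)
    fix l :: real assume l: "0 \<le> l"
    have "0 \<le> \<phi> l \<and> (\<integral>\<^sup>+s. ennreal (exp (- (l * s))) \<partial>P) = ennreal (\<phi> l)"
    proof (cases "l = 0")
      case True
      then show ?thesis using P.emeasure_space_1 by (simp add: \<phi>_def)
    next
      case False
      with l have l: "0 < l" by simp
      have "(\<integral>\<^sup>+s. ennreal (exp (- (l * s))) \<partial>P) + (\<integral>\<^sup>+s. ennreal (1 - exp (- (l * s))) \<partial>P)
        = (\<integral>\<^sup>+s. ennreal (exp (- (l * s))) + ennreal (1 - exp (- (l * s))) \<partial>P)"
        by (subst nn_integral_add) (auto simp: measurable_cong_sets[OF sP(1) refl])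
      also have "\<dots> = (\<integral>\<^sup>+s. 1 \<partial>P)"
        by (rule nn_integral_cong_AE) (use aeP in eventually_elim, use l in \<open>auto simp flip: ennreal_plus\<close>)
      finally have sum: "(\<integral>\<^sup>+s. ennreal (exp (- (l * s))) \<partial>P) + ennreal (l powr a * j l) = 1"
        using P.emeasure_space_1 by (simp add: defect[OF l])
      then obtain y where y: "0 \<le> y" "(\<integral>\<^sup>+s. ennreal (exp (- (l * s))) \<partial>P) = ennreal y"
        by (cases "\<integral>\<^sup>+s. ennreal (exp (- (l * s))) \<partial>P") auto
      have "ennreal (y + l powr a * j l) = ennreal 1"
        using sum y Jj[OF l] by (simp add: ennreal_plus)
      then have "y + l powr a * j l = 1" using y(1) Jj[OF l] by (subst (asm) ennreal_inj) auto
      then show ?thesis using y l by (simp add: \<phi>_def)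
    qed
    then show "0 \<le> \<phi> l" "(\<integral>\<^sup>+s. ennreal (exp (- (l * s))) \<partial>P) = ennreal (\<phi> l)" by auto
  qed
  define n where "n = (\<lambda>k. (c * real (Suc k)) powr (- (1 / a)))"
  have n: "0 < n k" for k using c by (simp add: n_def)
  have na: "(n k * l) powr a = l powr a / (c * real (Suc k))" if "0 \<le> l" for k l
  proof -
    have "n k powr a = inverse (c * real (Suc k))"
      unfolding n_def by (subst powr_powr) (use a c in \<open>simp add: powr_minus\<close>)
    then show ?thesis using that n[of k] by (simp add: powr_mult divide_inverse)
  qed
  have n0: "n \<longlonglongrightarrow> 0"
    unfolding n_def using a c by real_asymp
  have "\<exists>N. has_laplace N (\<lambda>l. \<phi> (n k * l) ^ Suc k)" for k
    using has_laplace_power[OF has_laplace_scale[OF lapP less_imp_le[OF n[of k]]], of "Suc k"] by simp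
  then obtain \<mu> where \<mu>: "\<And>k. has_laplace (\<mu> k) (\<lambda>l. \<phi> (n k * l) ^ Suc k)" by metis
  have jlim: "(\<lambda>k. j (n k * l)) \<longlonglongrightarrow> c" if l: "0 < l" for l
  proof -
    have "(\<lambda>k. \<integral>\<^sup>+u. ennreal (w u * (1 - exp (- u))) * indicator {n k * l..} u \<partial>lborel) \<longlonglongrightarrow> J0"
      unfolding J0_def
    proof (rule nn_integral_LIMSEQ)
      have "n (Suc k) \<le> n k" for k
        unfolding n_def using a c by (intro powr_mono2') (auto intro: mult_left_mono)
      then have "n (Suc k) * l \<le> n k * l" for k using l by simp
      then show "incseq (\<lambda>k u. ennreal (w u * (1 - exp (- u))) * indicator {n k * l..} u)"
        by (intro incseq_SucI le_funI mult_left_mono) (auto simp: indicator_def intro: order_trans)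
      fix u :: real
      show "(\<lambda>k. ennreal (w u * (1 - exp (- u))) * indicator {n k * l..} u)
         \<longlonglongrightarrow> ennreal (w u * (1 - exp (- u))) * indicator {0<..} u"
      proof (cases "0 < u")
        case True
        have "(\<lambda>k. n k * l) \<longlonglongrightarrow> 0 * l" by (intro tendsto_intros n0)
        then have "\<forall>\<^sub>F k in sequentially. n k * l < u" using True by (intro order_tendstoD(2)) auto
        then have "\<forall>\<^sub>F k in sequentially. ennreal (w u * (1 - exp (- u))) * indicator {n k * l..} u
          = ennreal (w u * (1 - exp (- u))) * indicator {0<..} u"
          by eventually_elim (use True in auto)
        then show ?thesis by (rule tendsto_eventually)
      next
        case False
        then have "u < n k * l" for k using n[of k] l by (meson mult_pos_pos not_less order.strict_trans1)
        then show ?thesis using False by (simp add: not_le)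
      qed
    qed simp
    then have "(\<lambda>k. ennreal (j (n k * l))) \<longlonglongrightarrow> ennreal c"
      using Jj(1)[OF mult_pos_pos[OF n l]] c by (simp add: J_def)
    then show ?thesis using c Jj(2)[OF mult_pos_pos[OF n l]] by (subst (asm) tendsto_ennreal_iff) auto
  qed
  have "\<exists>M. has_laplace M (\<lambda>l. exp (- (l powr a)))"
  proof (rule has_laplace_limit[OF \<mu>])
    fix l :: real assume "0 \<le> l"
    show "(\<lambda>k. \<phi> (n k * l) ^ Suc k) \<longlonglongrightarrow> exp (- (l powr a))"
    proof (cases "l = 0")
      case True
      then show ?thesis by (simp add: \<phi>_def)
    next
      case False
      with \<open>0 \<le> l\<close> have l: "0 < l" by simp
      have eq: "\<phi> (n k * l) = 1 - (l powr a / c * j (n k * l)) / real (Suc k)" for k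
        using n[of k] l c na[of l k] by (simp add: \<phi>_def)
      have "(\<lambda>k. l powr a / c * j (n k * l)) \<longlonglongrightarrow> l powr a / c * c"
        by (intro tendsto_intros jlim l)
      then have "(\<lambda>k. l powr a / c * j (n k * l)) \<longlonglongrightarrow> l powr a" using c by simp
      from one_minus_over_power_limit[OF this] show ?thesis by (simp only: eq)
    qed
  next
    fix e :: real assume e: "0 < e"
    define e' where "e' = min e 1"
    have e': "0 < e'" "e' \<le> 1" "e' \<le> e" using e by (auto simp: e'_def)
    \<comment> \<open>Bernoulli's inequality gives the uniform lower bound for the powers.\<close>
    define l where "l = e' powr (1 / a)"
    have l: "0 < l" "l powr a = e'" using e' a by (simp_all add: l_def powr_powr)
    have "1 - e \<le> \<phi> (n k * l) ^ Suc k" for k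
    proof -
      have pos: "0 < n k * l" using n[of k] l by simp
      have "e' / (c * real (Suc k)) * j (n k * l) \<le> e' / (c * real (Suc k)) * c"
        using Jj(3)[OF pos] e' c by (intro mult_left_mono) auto
      then have le: "e' / (c * real (Suc k)) * j (n k * l) \<le> e' / real (Suc k)" using c by simp
      have "e' / real (Suc k) \<le> 1" using e' by (simp add: divide_le_eq_1)
      define X where "X = e' / (c * real (Suc k)) * j (n k * l)"
      have "real (Suc k) * X \<le> real (Suc k) * (e' / real (Suc k))"
        unfolding X_def by (intro mult_left_mono le) simp
      also have "\<dots> = e'" by simp
      finally have kX: "real (Suc k) * X \<le> e'" .
      have "1 + real (Suc k) * (- X) \<le> (1 + (- X)) ^ Suc k"
        using le \<open>e' / real (Suc k) \<le> 1\<close> unfolding X_def by (intro Bernoulli_inequality) linarith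
      moreover have "\<phi> (n k * l) = 1 + (- X)"
        using pos na[of l k] l n[of k] by (simp add: \<phi>_def X_def)
      moreover have "1 - e \<le> 1 + real (Suc k) * (- X)"
        using kX e' by (simp only: mult_minus_right)
      ultimately show ?thesis by (simp only:)
    qed
    then show "\<exists>l>0. \<forall>k. 1 - e \<le> \<phi> (n k * l) ^ Suc k" using l(1) by blast
  qed
  then show ?thesis using that by blast
qed

lemma nn_integral_stretched_exp_finite:
  assumes k: "0 < k" and a: "0 < a"
  shows "(\<integral>\<^sup>+l. ennreal (l powr (k - 1) * exp (- (l powr a))) * indicator {0<..} l \<partial>lborel) < top"
proof -
  have "eventually (\<lambda>l. l powr (k - 1) * exp (- (l powr a)) \<le> l powr (- 2)) at_top"
    using k a by real_asymp
  then obtain L0 where L0: "\<And>l. L0 \<le> l \<Longrightarrow> l powr (k - 1) * exp (- (l powr a)) \<le> l powr (- 2)"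
    by (auto simp: eventually_at_top_linorder)
  define L where "L = max 1 L0"
  have L: "0 < L" "L0 \<le> L" by (auto simp: L_def)
  have "(\<integral>\<^sup>+l. ennreal (l powr (k - 1) * exp (- (l powr a))) * indicator {0<..} l \<partial>lborel)
    \<le> (\<integral>\<^sup>+l. (if 0 < l \<and> ennreal l < ennreal L then ennreal (l powr (k - 1)) else 0)
        + ennreal (l powr (- 2)) * indicator {L..} l \<partial>lborel)"
  proof (rule nn_integral_mono)
    fix l :: real
    show "ennreal (l powr (k - 1) * exp (- (l powr a))) * indicator {0<..} l
      \<le> (if 0 < l \<and> ennreal l < ennreal L then ennreal (l powr (k - 1)) else 0)
        + ennreal (l powr (- 2)) * indicator {L..} l"
    proof (cases "0 < l \<and> l < L")
      case True
      have "l powr (k - 1) * exp (- (l powr a)) \<le> l powr (k - 1) * 1" by (intro mult_left_mono) auto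
      then show ?thesis using True by (auto simp: ennreal_less_iff intro!: ennreal_leI)
    next
      case False
      then show ?thesis using L0[of l] L
        by (auto simp: indicator_def not_less ennreal_less_iff intro!: ennreal_leI)
    qed
  qed
  also have "\<dots> = ennreal (1 / k) * epow (ennreal L) k + ennreal (L powr (- 1))"
    using nn_integral_powr_below[of "k - 1" "ennreal L"] nn_integral_powr_above[of "-2" L] k L(1)
    by (subst nn_integral_add) auto
  also have "\<dots> < top" by (simp add: less_top[symmetric] ennreal_mult_eq_top_iff)
  finally show ?thesis .
qed

lemma Gamma_scaled:
  assumes k: "0 < (k::real)" and s: "0 < s"
  shows "(\<integral>\<^sup>+l. ennreal (l powr (k - 1)) * indicator {0<..} l * ennreal (exp (- (l * s))) \<partial>lborel)
    = ennreal (Gamma k) * ennreal (s powr (- k))"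
proof -
  have "ennreal (Gamma k) = (\<integral>\<^sup>+t. ennreal (indicator {0..} t * t powr (k - 1) / exp t) \<partial>lborel)"
    by (rule Gamma_conv_nn_integral_real[OF k])
  also have "\<dots> = ennreal \<bar>s\<bar> * (\<integral>\<^sup>+l. ennreal (indicator {0..} (0 + s * l) * (0 + s * l) powr (k - 1) / exp (0 + s * l)) \<partial>lborel)"
    by (rule nn_integral_real_affine) (use s in auto)
  also have "\<dots> = ennreal s * (\<integral>\<^sup>+l. ennreal (s powr (k - 1)) * (ennreal (l powr (k - 1)) * indicator {0<..} l * ennreal (exp (- (l * s)))) \<partial>lborel)"
  proof -
    have "ennreal (indicator {0..} (0 + s * l) * (0 + s * l) powr (k - 1) / exp (0 + s * l))
      = ennreal (s powr (k - 1)) * (ennreal (l powr (k - 1)) * indicator {0<..} l * ennreal (exp (- (l * s))))" for l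
    proof (cases "0 < l")
      case True
      then show ?thesis using s
        by (simp add: powr_mult exp_minus divide_inverse mult.commute[of l] mult.assoc flip: ennreal_mult)
    next
      case False
      then show ?thesis using s by (cases "l = 0") (auto simp: indicator_def zero_le_mult_iff)
    qed
    then show ?thesis using s by simp
  qed
  also have "\<dots> = ennreal (s powr k) * (\<integral>\<^sup>+l. ennreal (l powr (k - 1)) * indicator {0<..} l * ennreal (exp (- (l * s))) \<partial>lborel)"
    using s powr_mult_base[of s "k - 1"]
    by (subst nn_integral_cmult) (auto simp: mult.assoc[symmetric] simp flip: ennreal_mult)
  finally have "ennreal (s powr (- k)) * ennreal (Gamma k) = ennreal (s powr (- k)) * ennreal (s powr k) *
      (\<integral>\<^sup>+l. ennreal (l powr (k - 1)) * indicator {0<..} l * ennreal (exp (- (l * s))) \<partial>lborel)"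
    by (simp add: mult.assoc)
  also have "ennreal (s powr (- k)) * ennreal (s powr k) = 1"
    using s by (simp flip: ennreal_mult powr_add)
  finally show ?thesis by (simp add: mult.commute)
qed

text \<open>Write \<open>s powr (- k)\<close> as an integral of \<open>exp (- (l * s))\<close> over \<open>l\<close> and exchange the integrals: the
  Laplace transform of the law decays fast at infinity.\<close>

lemma laplace_negative_moment_finite:
  assumes M: "has_laplace M (\<lambda>l. exp (- (l powr a)))" and a: "0 < a" and pos: "AE s in M. 0 < s" and k: "0 \<le> k"
  shows "(\<integral>\<^sup>+s. ennreal (s powr (- k)) \<partial>M) < top"
proof (cases "k = 0")
  case True
  interpret real_distribution M using M by (simp add: has_laplace_def)
  have "(\<integral>\<^sup>+s. ennreal (s powr (- k)) \<partial>M) \<le> (\<integral>\<^sup>+s. 1 \<partial>M)"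
    by (rule nn_integral_mono) (simp add: True)
  also have "\<dots> < top" by (simp add: less_top[symmetric])
  finally show ?thesis .
next
  case False
  with k have k: "0 < k" by simp
  interpret real_distribution M using M by (simp add: has_laplace_def)
  interpret pair_sigma_finite M "lborel :: real measure" ..
  have "ennreal (Gamma k) * (\<integral>\<^sup>+s. ennreal (s powr (- k)) \<partial>M) = (\<integral>\<^sup>+s. ennreal (Gamma k) * ennreal (s powr (- k)) \<partial>M)"
    by (simp add: nn_integral_cmult)
  also have "\<dots> = (\<integral>\<^sup>+s. (\<integral>\<^sup>+l. ennreal (l powr (k - 1)) * indicator {0<..} l * ennreal (exp (- (l * s))) \<partial>lborel) \<partial>M)"
    by (rule nn_integral_cong_AE) (use pos in eventually_elim, simp add: Gamma_scaled[OF k])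
  also have "\<dots> = (\<integral>\<^sup>+l. (\<integral>\<^sup>+s. ennreal (l powr (k - 1)) * indicator {0<..} l * ennreal (exp (- (l * s))) \<partial>M) \<partial>lborel)"
    by (rule Fubini'[symmetric]) measurable
  also have "\<dots> = (\<integral>\<^sup>+l. ennreal (l powr (k - 1) * exp (- (l powr a))) * indicator {0<..} l \<partial>lborel)"
  proof (rule nn_integral_cong)
    fix l :: real
    show "(\<integral>\<^sup>+s. ennreal (l powr (k - 1)) * indicator {0<..} l * ennreal (exp (- (l * s))) \<partial>M)
      = ennreal (l powr (k - 1) * exp (- (l powr a))) * indicator {0<..} l"
    proof (cases "0 < l")
      case True
      then show ?thesis using M by (simp add: nn_integral_cmult has_laplace_def ennreal_mult)
    qed simp
  qed
  also have "\<dots> < top" by (rule nn_integral_stretched_exp_finite[OF k a])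
  finally show ?thesis using Gamma_real_pos[OF k] by (auto simp: ennreal_mult_less_top less_top)
qed

text \<open>For \<open>a = 1\<close> the law is the Dirac mass at 1. There is no mass at 0 because the Laplace transform tends
  to 0 at infinity.\<close>

theorem stable_subordinator:
  assumes a: "0 < a" "a \<le> 1"
  obtains M where "real_distribution M" "AE s in M. 0 < s"
    "\<And>l. 0 \<le> l \<Longrightarrow> (\<integral>\<^sup>+s. ennreal (exp (- (l * s))) \<partial>M) = ennreal (exp (- (l powr a)))"
    "\<And>k. 0 \<le> k \<Longrightarrow> (\<integral>\<^sup>+s. ennreal (s powr (- k)) \<partial>M) < top"
proof -
  obtain M where M: "has_laplace M (\<lambda>l. exp (- (l powr a)))"
  proof (cases "a = 1")
    case True
    have "has_laplace (return borel 1) (\<lambda>l. exp (- (l powr a)))"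
      using has_laplace_return[of 1] True by (auto simp: has_laplace_def)
    then show ?thesis using that by blast
  next
    case False
    then show ?thesis using stable_law_exists[of a] a that by auto
  qed
  interpret real_distribution M using M by (simp add: has_laplace_def)
  have "measure M {0} \<le> exp (- (l powr a))" if l: "0 \<le> l" for l
  proof -
    have "emeasure M {0} = (\<integral>\<^sup>+s. indicator {0} s \<partial>M)" by simp
    also have "\<dots> \<le> (\<integral>\<^sup>+s. ennreal (exp (- (l * s))) \<partial>M)"
      by (rule nn_integral_mono) (auto simp: indicator_def)
    also have "\<dots> = ennreal (exp (- (l powr a)))" using M l by (simp add: has_laplace_def)
    finally show ?thesis by (simp add: emeasure_eq_measure)
  qed
  then have "eventually (\<lambda>l. measure M {0} \<le> exp (- (l powr a))) at_top"
    by (auto intro: eventually_mono[OF eventually_ge_at_top[of 0]])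
  moreover have "((\<lambda>l. exp (- (l powr a))) \<longlongrightarrow> 0) at_top" using a by real_asymp
  ultimately have "measure M {0} \<le> 0" by (intro tendsto_lowerbound[of _ 0 at_top]) auto
  then have "emeasure M {0} = 0" by (simp add: emeasure_eq_measure measure_le_0_iff)
  then have "AE s in M. s \<noteq> 0" by (intro AE_I[of _ _ "{0}"]) auto
  moreover have "AE s in M. 0 \<le> s" using M by (simp add: has_laplace_def)
  ultimately have pos: "AE s in M. 0 < s" by eventually_elim auto
  show ?thesis
    using that[of M] M pos laplace_negative_moment_finite[OF M a(1) pos]
    by (auto simp: has_laplace_def)
qed

section \<open>Gaussian kernels\<close>

text \<open>The heat kernel at time \<open>\<tau>\<close>.\<close>

definition gauss :: "real \<Rightarrow> 'a::euclidean_space \<Rightarrow> real" where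
  "gauss \<tau> x = (4 * pi * \<tau>) powr (- (DIM('a) / 2)) * exp (- ((norm x)\<^sup>2 / (4 * \<tau>)))"

lemma gauss_nonneg [simp]: "0 \<le> gauss \<tau> x"
  by (simp add: gauss_def)

lemma borel_measurable_gauss [measurable]:
  assumes [measurable]: "f \<in> borel_measurable M" "g \<in> borel_measurable M"
  shows "(\<lambda>x. gauss (f x) (g x :: 'a::euclidean_space)) \<in> borel_measurable M"
  unfolding gauss_def by measurable

text \<open>A rescaling of the characteristic function of the standard normal distribution.\<close>

lemma fourier_gaussian_real:
  assumes t: "0 < t"
  shows "integrable lborel (\<lambda>\<xi>. exp (\<i> * complex_of_real (x * \<xi>)) * complex_of_real (exp (- (t * \<xi>\<^sup>2))))"
    and "(LINT \<xi>|lborel. exp (\<i> * complex_of_real (x * \<xi>)) * complex_of_real (exp (- (t * \<xi>\<^sup>2))))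
      = complex_of_real (sqrt (pi / t) * exp (- (x\<^sup>2 / (4 * t))))"
proof -
  define c where "c = sqrt (2 * t)"
  have c: "0 < c" "c\<^sup>2 = 2 * t" using t by (auto simp: c_def)
  define f where "f = (\<lambda>u::real. complex_of_real (std_normal_density u) * iexp (x / c * u))"
  have int: "integrable lborel f" unfolding f_def
  proof (rule integrableI_bounded)
    have "(\<integral>\<^sup>+u. ennreal (norm (complex_of_real (std_normal_density u) * iexp (x / c * u))) \<partial>lborel)
      = (\<integral>\<^sup>+u. ennreal (std_normal_density u) \<partial>lborel)"
      by (simp add: norm_mult)
    also have "\<dots> < \<infinity>"
      using integrable_std_normal_moment[of 0]
      by (simp add: integrable_iff_bounded)
    finally show "(\<integral>\<^sup>+u. ennreal (norm (complex_of_real (std_normal_density u) * iexp (x / c * u))) \<partial>lborel) < \<infinity>" .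
  qed simp
  have eq: "exp (\<i> * complex_of_real (x * \<xi>)) * complex_of_real (exp (- (t * \<xi>\<^sup>2)))
     = complex_of_real (sqrt (2 * pi)) * f (0 + c * \<xi>)" for \<xi>
    using c by (simp add: f_def std_normal_density_def power_mult_distrib mult.assoc mult.left_commute)
  show "integrable lborel (\<lambda>\<xi>. exp (\<i> * complex_of_real (x * \<xi>)) * complex_of_real (exp (- (t * \<xi>\<^sup>2))))"
    unfolding eq using c by (intro integrable_mult_right lborel_integrable_real_affine[OF int]) auto
  have "exp (- ((x / c)\<^sup>2) / 2) = char std_normal_distribution (x / c)"
    by (simp add: char_std_normal_distribution)
  also have "\<dots> = (LINT u|lborel. f u)"
    unfolding char_def f_def
    by (subst integral_density) (auto simp: scaleR_conv_of_real)
  also have "\<dots> = \<bar>c\<bar> *\<^sub>R (LINT \<xi>|lborel. f (0 + c * \<xi>))"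
    by (rule lborel_integral_real_affine) (use c in auto)
  finally have "complex_of_real c * (LINT \<xi>|lborel. f (0 + c * \<xi>)) = exp (- ((x / c)\<^sup>2) / 2)"
    using c by (simp add: scaleR_conv_of_real)
  then have "(LINT \<xi>|lborel. f (0 + c * \<xi>)) = exp (- ((x / c)\<^sup>2) / 2) / complex_of_real c"
    using c by (simp add: field_simps)
  then have "(LINT \<xi>|lborel. complex_of_real (sqrt (2 * pi)) * f (0 + c * \<xi>))
    = complex_of_real (sqrt (2 * pi)) * (exp (- ((x / c)\<^sup>2) / 2) / complex_of_real c)"
    by (simp only: integral_mult_right_zero)
  also have "\<dots> = complex_of_real (sqrt (2 * pi) / c * exp (- ((x / c)\<^sup>2) / 2))"
    by simp
  also have "sqrt (2 * pi) / c = sqrt (pi / t)"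
    using t by (simp add: c_def real_sqrt_divide[symmetric])
  also have "- ((x / c)\<^sup>2) / 2 = - (x\<^sup>2 / (4 * t))"
    using c by (simp add: power_divide)
  finally show "(LINT \<xi>|lborel. exp (\<i> * complex_of_real (x * \<xi>)) * complex_of_real (exp (- (t * \<xi>\<^sup>2))))
      = complex_of_real (sqrt (pi / t) * exp (- (x\<^sup>2 / (4 * t))))"
    by (simp only: eq)
qed

lemma lborel_product_integral:
  fixes f :: "'a::euclidean_space \<Rightarrow> real \<Rightarrow> complex"
  assumes f: "\<And>b. b \<in> Basis \<Longrightarrow> integrable lborel (f b)"
  shows "integrable lborel (\<lambda>x. \<Prod>b\<in>Basis. f b (x \<bullet> b))"
    and "(LINT x|lborel. (\<Prod>b\<in>Basis. f b (x \<bullet> b))) = (\<Prod>b\<in>Basis. (LINT x|lborel. f b x))"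
proof -
  interpret product_sigma_finite "\<lambda>_::'a. lborel :: real measure" ..
  have [measurable]: "f b \<in> borel_measurable borel" if "b \<in> Basis" for b
    using f[OF that] by simp
  have inner: "(\<Sum>b\<in>Basis. x b *\<^sub>R b) \<bullet> c = x c" if "c \<in> Basis" for x and c :: 'a
    using that by (simp add: inner_sum_left inner_Basis if_distrib cong: if_cong)
  have eq: "(\<Prod>b\<in>Basis. f b ((\<Sum>c\<in>Basis. x c *\<^sub>R c) \<bullet> b)) = (\<Prod>b\<in>Basis. f b (x b))" for x
    by (intro prod.cong refl) (simp add: inner)
  have meas: "(\<lambda>x. \<Prod>b\<in>Basis. f b (x \<bullet> b)) \<in> borel_measurable borel" by measurable
  show "integrable lborel (\<lambda>x. \<Prod>b\<in>Basis. f b (x \<bullet> b))"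
    by (subst lborel_eq, subst integrable_distr_eq)
       (use product_integrable_prod[of Basis f] f meas in \<open>auto simp: eq\<close>)
  show "(LINT x|lborel. (\<Prod>b\<in>Basis. f b (x \<bullet> b))) = (\<Prod>b\<in>Basis. (LINT x|lborel. f b x))"
    by (subst lborel_eq, subst integral_distr)
       (use product_integral_prod[of Basis f] f meas in \<open>auto simp: eq\<close>)
qed

lemma fourier_gaussian:
  fixes x :: "'a::euclidean_space"
  assumes t: "0 < t"
  shows "integrable lborel (\<lambda>\<xi>. exp (\<i> * complex_of_real (x \<bullet> \<xi>)) * complex_of_real (exp (- (t * (norm \<xi>)\<^sup>2))))"
    and "(LINT \<xi>|lborel. exp (\<i> * complex_of_real (x \<bullet> \<xi>)) * complex_of_real (exp (- (t * (norm \<xi>)\<^sup>2))))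
      = complex_of_real ((pi / t) powr (DIM('a) / 2) * exp (- ((norm x)\<^sup>2 / (4 * t))))"
proof -
  define f where "f = (\<lambda>b \<xi>. exp (\<i> * complex_of_real ((x \<bullet> b) * \<xi>)) * complex_of_real (exp (- (t * \<xi>\<^sup>2))))"
  have int: "integrable lborel (f b)" for b unfolding f_def by (rule fourier_gaussian_real(1)[OF t])
  have sq: "(norm y)\<^sup>2 = (\<Sum>b\<in>Basis. (y \<bullet> b)\<^sup>2)" for y :: 'a
    unfolding power2_norm_eq_inner by (subst euclidean_inner) (simp add: power2_eq_square)
  have eq: "exp (\<i> * complex_of_real (x \<bullet> \<xi>)) * complex_of_real (exp (- (t * (norm \<xi>)\<^sup>2)))
    = (\<Prod>b\<in>Basis. f b (\<xi> \<bullet> b))" for \<xi>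
  proof -
    have "\<i> * complex_of_real (x \<bullet> \<xi>) = (\<Sum>b\<in>Basis. \<i> * complex_of_real ((x \<bullet> b) * (\<xi> \<bullet> b)))"
      by (simp add: euclidean_inner[of x \<xi>] sum_distrib_left)
    moreover have "- (t * (norm \<xi>)\<^sup>2) = (\<Sum>b\<in>Basis. - (t * (\<xi> \<bullet> b)\<^sup>2))"
      by (simp add: sq sum_distrib_left sum_negf)
    ultimately show ?thesis by (simp only: exp_sum finite_Basis f_def prod.distrib of_real_prod)
  qed
  show "integrable lborel (\<lambda>\<xi>. exp (\<i> * complex_of_real (x \<bullet> \<xi>)) * complex_of_real (exp (- (t * (norm \<xi>)\<^sup>2))))"
    unfolding eq by (rule lborel_product_integral(1)[OF int])
  have "(LINT \<xi>|lborel. exp (\<i> * complex_of_real (x \<bullet> \<xi>)) * complex_of_real (exp (- (t * (norm \<xi>)\<^sup>2))))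
    = (\<Prod>b\<in>Basis. complex_of_real (sqrt (pi / t) * exp (- ((x \<bullet> b)\<^sup>2 / (4 * t)))))"
    unfolding eq lborel_product_integral(2)[OF int] unfolding f_def
    by (simp only: fourier_gaussian_real(2)[OF t])
  also have "\<dots> = complex_of_real (sqrt (pi / t) ^ DIM('a) * exp (- ((norm x)\<^sup>2 / (4 * t))))"
    by (simp only: of_real_prod[symmetric] prod.distrib prod_constant sq sum_divide_distrib
        sum_negf[symmetric] exp_sum finite_Basis)
  also have "sqrt (pi / t) ^ DIM('a) = (pi / t) powr (DIM('a) / 2)"
    using t by (simp add: powr_half_sqrt[symmetric] powr_realpow[symmetric] powr_powr)
  finally show "(LINT \<xi>|lborel. exp (\<i> * complex_of_real (x \<bullet> \<xi>)) * complex_of_real (exp (- (t * (norm \<xi>)\<^sup>2))))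
      = complex_of_real ((pi / t) powr (DIM('a) / 2) * exp (- ((norm x)\<^sup>2 / (4 * t))))" .
qed

lemma nn_integral_gaussian:
  assumes t: "0 < t"
  shows "(\<integral>\<^sup>+\<xi>. ennreal (exp (- (t * (norm (\<xi>::'a::euclidean_space))\<^sup>2))) \<partial>lborel) = ennreal ((pi / t) powr (DIM('a) / 2))"
proof -
  have int: "integrable lborel (\<lambda>\<xi>::'a. complex_of_real (exp (- (t * (norm \<xi>)\<^sup>2))))"
    using fourier_gaussian(1)[OF t, of 0] by simp
  then have int': "integrable lborel (\<lambda>\<xi>::'a. exp (- (t * (norm \<xi>)\<^sup>2)))"
    by (simp only: complex_of_real_integrable_eq)
  have "complex_of_real (LINT \<xi>::'a|lborel. exp (- (t * (norm \<xi>)\<^sup>2))) = (LINT \<xi>::'a|lborel. complex_of_real (exp (- (t * (norm \<xi>)\<^sup>2))))"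
    by (rule integral_complex_of_real[symmetric])
  also have "\<dots> = complex_of_real ((pi / t) powr (DIM('a) / 2))"
    using fourier_gaussian(2)[OF t, of "0::'a"] by simp
  finally have eq: "(LINT \<xi>::'a|lborel. exp (- (t * (norm \<xi>)\<^sup>2))) = (pi / t) powr (DIM('a) / 2)"
    by (rule of_real_eq_iff[THEN iffD1])
  have "(\<integral>\<^sup>+\<xi>. ennreal (exp (- (t * (norm (\<xi>::'a))\<^sup>2))) \<partial>lborel) = ennreal (LINT \<xi>::'a|lborel. exp (- (t * (norm \<xi>)\<^sup>2)))"
    by (rule nn_integral_eq_integral[OF int']) simp
  then show ?thesis by (simp only: eq)
qed

lemma nn_integral_reflect_translate:
  fixes f :: "'a::euclidean_space \<Rightarrow> ennreal"
  assumes [measurable]: "f \<in> borel_measurable borel"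
  shows "(\<integral>\<^sup>+y. f (x - y) \<partial>lborel) = (\<integral>\<^sup>+y. f y \<partial>lborel)"
proof -
  have "lborel = density (distr lborel borel (\<lambda>y. x + (-1) *\<^sub>R y)) (\<lambda>_. ennreal (\<bar>-1\<bar> ^ DIM('a)))"
    using lborel_affine[of "-1" x] by simp
  from arg_cong[OF this, of "\<lambda>M. nn_integral M f"]
  have "(\<integral>\<^sup>+y. f y \<partial>lborel) = (\<integral>\<^sup>+y. f y \<partial>density (distr lborel borel (\<lambda>y. x + (-1) *\<^sub>R y)) (\<lambda>_. ennreal (\<bar>-1\<bar> ^ DIM('a))))" .
  also have "\<dots> = (\<integral>\<^sup>+y. f (x - y) \<partial>lborel)"
    by (simp add: nn_integral_density nn_integral_distr)
  finally show ?thesis by simp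
qed

lemma nn_integral_gauss:
  assumes t: "0 < t"
  shows "(\<integral>\<^sup>+y. ennreal (gauss t (x - y :: 'a::euclidean_space)) \<partial>lborel) = 1"
proof -
  have "(\<integral>\<^sup>+y. ennreal (gauss t (x - y)) \<partial>lborel) = (\<integral>\<^sup>+y. ennreal (gauss t (y::'a)) \<partial>lborel)"
    by (rule nn_integral_reflect_translate) simp
  also have "\<dots> = (\<integral>\<^sup>+y. ennreal ((4 * pi * t) powr (- (DIM('a) / 2))) * ennreal (exp (- (1 / (4 * t) * (norm (y::'a))\<^sup>2))) \<partial>lborel)"
    by (simp add: gauss_def ennreal_mult)
  also have "\<dots> = ennreal ((4 * pi * t) powr (- (DIM('a) / 2))) * ennreal ((pi / (1 / (4 * t))) powr (DIM('a) / 2))"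
    using nn_integral_gaussian[of "1 / (4 * t)", where 'a='a] t by (subst nn_integral_cmult) auto
  also have "\<dots> = 1"
    using t by (simp add: mult.commute[of pi] mult.assoc flip: ennreal_mult powr_add)
  finally show ?thesis .
qed

text \<open>A Gaussian is a superposition of indicator functions of centred balls, hence a convolution with it
  is an average of ball averages.\<close>

lemma gauss_layer_cake:
  fixes z :: "'a::euclidean_space"
  assumes t: "0 < t"
  shows "ennreal (gauss t z) = (\<integral>\<^sup>+\<rho>. (if 0 < \<rho> then ennreal ((4 * pi * t) powr (- (DIM('a) / 2)) *
      (\<rho> / (2 * t) * exp (- (\<rho>\<^sup>2 / (4 * t))))) else 0) * indicator (ball 0 \<rho>) z \<partial>lborel)"
proof -
  define c where "c = (4 * pi * t) powr (- (DIM('a) / 2))"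
  have "(\<integral>\<^sup>+\<rho>. (if 0 < \<rho> then ennreal (c * (\<rho> / (2 * t) * exp (- (\<rho>\<^sup>2 / (4 * t))))) else 0) * indicator (ball 0 \<rho>) z \<partial>lborel)
     = (\<integral>\<^sup>+\<rho>. ennreal c * (ennreal (\<rho> / (2 * t) * exp (- (\<rho>\<^sup>2 / (4 * t)))) * indicator {norm z..} \<rho>) \<partial>lborel)"
  proof (rule nn_integral_cong_AE)
    have "AE \<rho> in lborel. \<rho> \<noteq> norm z" by (rule AE_lborel_singleton)
    then show "AE \<rho> in lborel. (if 0 < \<rho> then ennreal (c * (\<rho> / (2 * t) * exp (- (\<rho>\<^sup>2 / (4 * t))))) else 0) * indicator (ball 0 \<rho>) z
      = ennreal c * (ennreal (\<rho> / (2 * t) * exp (- (\<rho>\<^sup>2 / (4 * t)))) * indicator {norm z..} \<rho>)"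
    proof eventually_elim
      case (elim \<rho>)
      have c0: "0 \<le> c" by (simp add: c_def)
      show ?case
      proof (cases "norm z < \<rho>")
        case True
        then have \<rho>: "0 < \<rho>" using norm_ge_zero[of z] by linarith
        then have "0 \<le> \<rho> / (2 * t) * exp (- (\<rho>\<^sup>2 / (4 * t)))" using t by simp
        from ennreal_mult[OF c0 this] show ?thesis using True \<rho> by (simp add: indicator_def)
      qed (use elim in \<open>simp add: indicator_def\<close>)
    qed
  qed
  also have "\<dots> = ennreal c * ennreal (0 - - exp (- ((norm z)\<^sup>2 / (4 * t))))"
  proof (subst nn_integral_cmult, simp, subst nn_integral_FTC_atLeast[where F="\<lambda>\<rho>. - exp (- (\<rho>\<^sup>2 / (4 * t)))" and T=0])
    show "DERIV (\<lambda>\<rho>. - exp (- (\<rho>\<^sup>2 / (4 * t)))) \<rho> :> \<rho> / (2 * t) * exp (- (\<rho>\<^sup>2 / (4 * t)))" for \<rho>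
      using t by (auto intro!: derivative_eq_intros simp: field_simps)
    show "((\<lambda>\<rho>. - exp (- (\<rho>\<^sup>2 / (4 * t)))) \<longlongrightarrow> 0) at_top"
      using t by real_asymp
    show "0 \<le> \<rho> / (2 * t) * exp (- (\<rho>\<^sup>2 / (4 * t)))" if "norm z \<le> \<rho>" for \<rho>
    proof -
      have "0 \<le> \<rho>" using that norm_ge_zero[of z] by linarith
      then show ?thesis using t by simp
    qed
  qed auto
  finally show ?thesis unfolding c_def by (subst eq_commute) (simp add: gauss_def ennreal_mult)
qed

lemma gauss_conv_le_maxfun:
  fixes H :: "'a::euclidean_space \<Rightarrow> ennreal"
  assumes t: "0 < t" and [measurable]: "H \<in> borel_measurable borel"
  shows "(\<integral>\<^sup>+y. ennreal (gauss t (x - y)) * H y \<partial>lborel) \<le> maxfun H x"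
proof -
  define w where "w = (\<lambda>\<rho>. if 0 < \<rho> then ennreal ((4 * pi * t) powr (- (DIM('a) / 2)) *
      (\<rho> / (2 * t) * exp (- (\<rho>\<^sup>2 / (4 * t))))) else 0)"
  have [measurable]: "w \<in> borel_measurable borel" unfolding w_def by measurable
  have *: "(\<integral>\<^sup>+y. ennreal (gauss t (x - y)) * G y \<partial>lborel)
      = (\<integral>\<^sup>+\<rho>. w \<rho> * (\<integral>\<^sup>+y\<in>ball x \<rho>. G y \<partial>lborel) \<partial>lborel)"
    if [measurable]: "G \<in> borel_measurable borel" for G :: "'a \<Rightarrow> ennreal"
  proof -
    have ind: "indicator (ball 0 \<rho>) (x - y) = (indicator (ball x \<rho>) y :: ennreal)" for y \<rho>
      by (auto simp: indicator_def dist_norm norm_minus_commute)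
    have "ennreal (gauss t (x - y)) = (\<integral>\<^sup>+\<rho>. w \<rho> * (if dist x y < \<rho> then 1 else 0) \<partial>lborel)" for y
      unfolding gauss_layer_cake[OF t] ind w_def by (simp add: indicator_def of_bool_def)
    then have "(\<integral>\<^sup>+y. ennreal (gauss t (x - y)) * G y \<partial>lborel)
      = (\<integral>\<^sup>+y. (\<integral>\<^sup>+\<rho>. w \<rho> * (if dist x y < \<rho> then 1 else 0) * G y \<partial>lborel) \<partial>lborel)"
      by (simp add: nn_integral_multc)
    also have "\<dots> = (\<integral>\<^sup>+\<rho>. (\<integral>\<^sup>+y. w \<rho> * (if dist x y < \<rho> then 1 else 0) * G y \<partial>lborel) \<partial>lborel)"
      by (rule nn_integral_lborel_swap) measurable
    also have "\<dots> = (\<integral>\<^sup>+\<rho>. w \<rho> * (\<integral>\<^sup>+y\<in>ball x \<rho>. G y \<partial>lborel) \<partial>lborel)"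
      by (simp add: mult.assoc nn_integral_cmult indicator_def of_bool_def mult.commute[of "G _"])
    finally show ?thesis .
  qed
  have "(\<integral>\<^sup>+y. ennreal (gauss t (x - y)) * H y \<partial>lborel)
      = (\<integral>\<^sup>+\<rho>. w \<rho> * (\<integral>\<^sup>+y\<in>ball x \<rho>. H y \<partial>lborel) \<partial>lborel)"
    by (rule *) simp
  also have "\<dots> \<le> (\<integral>\<^sup>+\<rho>. maxfun H x * (w \<rho> * (\<integral>\<^sup>+y\<in>ball x \<rho>. 1 \<partial>lborel)) \<partial>lborel)"
  proof (rule nn_integral_mono)
    fix \<rho> :: real
    show "w \<rho> * (\<integral>\<^sup>+y\<in>ball x \<rho>. H y \<partial>lborel) \<le> maxfun H x * (w \<rho> * (\<integral>\<^sup>+y\<in>ball x \<rho>. 1 \<partial>lborel))"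
    proof (cases "0 < \<rho>")
      case True
      have "w \<rho> * (\<integral>\<^sup>+y\<in>ball x \<rho>. H y \<partial>lborel) \<le> w \<rho> * (maxfun H x * emeasure lborel (ball x \<rho>))"
        by (intro mult_left_mono ball_integral_le_maxfun True) simp
      then show ?thesis by (simp add: mult.left_commute)
    qed (simp add: w_def)
  qed
  also have "\<dots> = maxfun H x * (\<integral>\<^sup>+\<rho>. w \<rho> * (\<integral>\<^sup>+y\<in>ball x \<rho>. 1 \<partial>lborel) \<partial>lborel)"
  proof (rule nn_integral_cmult)
    have "(\<lambda>\<rho>. w \<rho> * (\<integral>\<^sup>+y. (if dist x y < \<rho> then 1 else 0) \<partial>lborel)) \<in> borel_measurable lborel"
      by measurable
    then show "(\<lambda>\<rho>. w \<rho> * (\<integral>\<^sup>+y\<in>ball x \<rho>. 1 \<partial>lborel)) \<in> borel_measurable lborel"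
      by (simp add: indicator_def)
  qed
  also have "(\<integral>\<^sup>+\<rho>. w \<rho> * (\<integral>\<^sup>+y\<in>ball x \<rho>. 1 \<partial>lborel) \<partial>lborel) = 1"
    using *[of "\<lambda>_. 1"] nn_integral_gauss[OF t, of x] by simp
  finally show ?thesis by simp
qed

text \<open>Jensen's inequality for the probability density \<open>gauss t (x - y)\<close>, followed by its supremum bound.\<close>

lemma gauss_conv_decay:
  fixes H :: "'a::euclidean_space \<Rightarrow> ennreal"
  assumes t: "0 < t" and [measurable]: "H \<in> borel_measurable borel" and r: "1 \<le> r"
    and H: "(\<integral>\<^sup>+y. epow (H y) r \<partial>lborel) \<le> 1"
  shows "(\<integral>\<^sup>+y. ennreal (gauss t (x - y)) * H y \<partial>lborel) \<le> ennreal ((4 * pi * t) powr (- (DIM('a) / (2 * r))))"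
proof -
  define Q where "Q = density lborel (\<lambda>y. ennreal (gauss t (x - y)))"
  interpret Q: prob_space Q
    by (rule prob_spaceI) (simp add: Q_def emeasure_density nn_integral_gauss[OF t])
  have "H \<in> borel_measurable Q" by (simp add: Q_def)
  from Q.jensen_epow[OF this r]
  have "epow (\<integral>\<^sup>+y. ennreal (gauss t (x - y)) * H y \<partial>lborel) r \<le> (\<integral>\<^sup>+y. ennreal (gauss t (x - y)) * epow (H y) r \<partial>lborel)"
    by (simp add: Q_def nn_integral_density)
  also have "\<dots> \<le> (\<integral>\<^sup>+y. ennreal ((4 * pi * t) powr (- (DIM('a) / 2))) * epow (H y) r \<partial>lborel)"
    using t by (intro nn_integral_mono mult_right_mono ennreal_leI) (auto simp: gauss_def intro!: mult_left_le)
  also have "\<dots> = ennreal ((4 * pi * t) powr (- (DIM('a) / 2))) * (\<integral>\<^sup>+y. epow (H y) r \<partial>lborel)"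
    by (rule nn_integral_cmult) simp
  also have "\<dots> \<le> ennreal ((4 * pi * t) powr (- (DIM('a) / 2))) * 1"
    by (intro mult_left_mono H) simp
  finally have "(\<integral>\<^sup>+y. ennreal (gauss t (x - y)) * H y \<partial>lborel) \<le> epow (ennreal ((4 * pi * t) powr (- (DIM('a) / 2)))) (1 / r)"
    using r by (intro epow_le_imp_le) auto
  then show ?thesis using r by (simp add: powr_powr)
qed

lemma gauss_bound: "0 < \<tau> \<Longrightarrow> gauss \<tau> (x::'a::euclidean_space) \<le> (4 * pi * \<tau>) powr (- (DIM('a) / 2))"
  by (simp add: gauss_def mult_left_le)

lemma gauss_directional_derivative:
  fixes x e :: "'a::euclidean_space"
  assumes \<tau>: "0 < \<tau>"
  shows "((\<lambda>r. gauss \<tau> (x + r *\<^sub>R e)) has_real_derivative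
     (- ((x + r *\<^sub>R e) \<bullet> e) / (2 * \<tau>) * gauss \<tau> (x + r *\<^sub>R e))) (at r)"
proof -
  have sq: "(norm (x + r *\<^sub>R e))\<^sup>2 = x \<bullet> x + 2 * r * (x \<bullet> e) + r * r * (e \<bullet> e)" for r
    by (simp add: power2_norm_eq_inner inner_add_left inner_add_right inner_commute algebra_simps)
  show ?thesis
    unfolding gauss_def sq using \<tau>
    by (auto intro!: derivative_eq_intros simp: inner_add_left field_simps)
qed

lemma self_le_exp_square: "u / 2 \<le> exp (u\<^sup>2 / 8)" for u :: real
proof -
  have "0 \<le> (u - 2)\<^sup>2 / 8" by simp
  then have "u / 2 \<le> 1 + u\<^sup>2 / 8" by (simp add: power2_eq_square field_simps)
  also have "\<dots> \<le> exp (u\<^sup>2 / 8)" by (rule exp_ge_add_one_self)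
  finally show ?thesis .
qed

text \<open>The linear factor of the gradient is absorbed by passing to twice the time.\<close>

lemma gauss_gradient_le:
  fixes x e :: "'a::euclidean_space"
  assumes \<tau>: "0 < \<tau>" and e: "norm e = 1"
  shows "\<bar>- (x \<bullet> e) / (2 * \<tau>) * gauss \<tau> x\<bar> \<le> 2 powr (DIM('a) / 2) * \<tau> powr (- (1 / 2)) * gauss (2 * \<tau>) x"
proof -
  define u where "u = norm x / sqrt \<tau>"
  have u2: "u\<^sup>2 = (norm x)\<^sup>2 / \<tau>" using \<tau> by (simp add: u_def power_divide)
  have s: "\<tau> powr (- (1 / 2)) = 1 / sqrt \<tau>" using \<tau> by (simp add: powr_minus_divide powr_half_sqrt)
  have "\<bar>x \<bullet> e\<bar> \<le> norm x" using Cauchy_Schwarz_ineq2[of x e] e by simp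
  then have "\<bar>- (x \<bullet> e) / (2 * \<tau>) * gauss \<tau> x\<bar> \<le> norm x / (2 * \<tau>) * gauss \<tau> x"
    using \<tau> by (simp add: abs_mult divide_right_mono mult_right_mono)
  also have "norm x / (2 * \<tau>) = (1 / sqrt \<tau>) * (u / 2)"
    using \<tau> by (simp add: u_def)
  also have "(1 / sqrt \<tau>) * (u / 2) * gauss \<tau> x \<le> (1 / sqrt \<tau>) * (exp (u\<^sup>2 / 8) * gauss \<tau> x)"
    using \<tau> self_le_exp_square[of u] unfolding mult.assoc
    by (intro mult_left_mono mult_right_mono) auto
  also have "exp (u\<^sup>2 / 8) * gauss \<tau> x = 2 powr (DIM('a) / 2) * gauss (2 * \<tau>) x"
  proof -
    have "exp (u\<^sup>2 / 8) * exp (- ((norm x)\<^sup>2 / (4 * \<tau>))) = exp (- ((norm x)\<^sup>2 / (4 * (2 * \<tau>))))"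
      using \<tau> by (simp add: u2 exp_add[symmetric] field_simps)
    moreover have "(4 * pi * \<tau>) powr (- (DIM('a) / 2)) = 2 powr (DIM('a) / 2) * (4 * pi * (2 * \<tau>)) powr (- (DIM('a) / 2))"
      using \<tau> powr_mult[of 2 "4 * pi * \<tau>" "- (DIM('a) / 2)"]
      by (simp add: mult.left_commute mult.assoc[symmetric] powr_add[symmetric])
    ultimately show ?thesis by (simp add: gauss_def mult_ac)
  qed
  finally show ?thesis by (simp add: s mult_ac)
qed

lemma gauss_le_double:
  assumes \<tau>: "0 < \<tau>"
  shows "gauss \<tau> (x::'a::euclidean_space) \<le> 2 powr (DIM('a) / 2) * gauss (2 * \<tau>) x"
proof -
  have "exp (- ((norm x)\<^sup>2 / (4 * \<tau>))) \<le> exp (- ((norm x)\<^sup>2 / (4 * (2 * \<tau>))))"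
    using \<tau> by (simp add: frac_le)
  moreover have "(4 * pi * \<tau>) powr (- (DIM('a) / 2)) = 2 powr (DIM('a) / 2) * (4 * pi * (2 * \<tau>)) powr (- (DIM('a) / 2))"
    using \<tau> powr_mult[of 2 "4 * pi * \<tau>" "- (DIM('a) / 2)"]
    by (simp add: mult.left_commute mult.assoc[symmetric] powr_add[symmetric])
  ultimately show ?thesis by (simp add: gauss_def mult.assoc mult_left_mono)
qed

section \<open>The fractional heat kernel as a mixture of Gaussians\<close>

lemma ennreal_abs_integral_le:
  fixes f :: "'a \<Rightarrow> real"
  shows "ennreal \<bar>LINT x|M. f x\<bar> \<le> (\<integral>\<^sup>+x. ennreal \<bar>f x\<bar> \<partial>M)"
proof (cases "integrable M f")
  case True
  then show ?thesis using integral_norm_bound_ennreal[OF True] by simp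
qed (simp add: not_integrable_integral_eq)

locale stable_subordinator_law = real_distribution M for M :: "real measure" +
  fixes \<alpha> :: real
  assumes \<alpha>: "0 < \<alpha>" "\<alpha> \<le> 1"
    and positive: "AE s in M. 0 < s"
    and laplace: "\<And>l. 0 \<le> l \<Longrightarrow> (\<integral>\<^sup>+s. ennreal (exp (- (l * s))) \<partial>M) = ennreal (exp (- (l powr \<alpha>)))"
    and moments: "\<And>k. 0 \<le> k \<Longrightarrow> (\<integral>\<^sup>+s. ennreal (s powr (- k)) \<partial>M) < top"
begin

lemma laplace_integral:
  assumes l: "0 \<le> l"
  shows "(LINT s|M. exp (- (l * s))) = exp (- (l powr \<alpha>))"
  by (subst integral_eq_nn_integral) (auto simp: laplace[OF l])

lemma moment_integrable: "0 \<le> k \<Longrightarrow> integrable M (\<lambda>s. s powr (- k))"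
  by (rule integrableI_bounded) (use moments in \<open>auto simp: less_top\<close>)

lemma scaled_moment_integrable:
  assumes "0 \<le> k" "0 < c"
  shows "integrable M (\<lambda>s. (c * s) powr (- k))"
proof -
  have "integrable M (\<lambda>s. c powr (- k) * s powr (- k))"
    using moment_integrable[OF assms(1)] by simp
  moreover have "AE s in M. c powr (- k) * s powr (- k) = (c * s) powr (- k)"
    using positive by eventually_elim (use assms in \<open>simp add: powr_mult\<close>)
  ultimately show ?thesis by (subst (asm) integrable_cong_AE) auto
qed

text \<open>With \<open>S\<close> distributed according to \<open>M\<close>, the symbol \<open>exp (- t * norm \<xi> powr (2 * \<alpha>))\<close> is the expectation of
  \<open>exp (- (S * t powr (1 / \<alpha>) * (norm \<xi>)\<^sup>2))\<close>. Exchange the expectation with the Fourier integral; Fubini's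
  theorem applies because \<open>S\<close> has a finite moment of order \<open>- n / 2\<close>.\<close>

lemma frac_heat_kernel_eq:
  fixes x :: "real^'n"
  assumes t: "0 < t"
  shows "frac_heat_kernel \<alpha> t x = (LINT s|M. gauss (s * t powr (1 / \<alpha>)) x)"
proof -
  define t' where "t' = t powr (1 / \<alpha>)"
  have t': "0 < t'" "t' powr \<alpha> = t" using t \<alpha> by (simp_all add: t'_def powr_powr)
  define f where "f = (\<lambda>s (\<xi>::real^'n). exp (\<i> * complex_of_real (x \<bullet> \<xi>)) * complex_of_real (exp (- ((s * t') * (norm \<xi>)\<^sup>2))))"
  have fm [measurable]: "case_prod f \<in> borel_measurable (M \<Otimes>\<^sub>M lborel)"
    unfolding f_def by measurable
  interpret P: pair_sigma_finite M "lborel :: (real^'n) measure" ..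
  have nrm: "norm (f s \<xi>) = exp (- ((s * t') * (norm \<xi>)\<^sup>2))" for s \<xi>
    by (simp add: f_def norm_mult)
  have pos: "AE s in M. 0 < s * t'" using positive by eventually_elim (use t' in simp)
  have int: "integrable (M \<Otimes>\<^sub>M lborel) (case_prod f)"
  proof (rule P.Fubini_integrable[OF fm])
    have eq: "AE s in M. (LINT \<xi>|lborel. norm (case_prod f (s, \<xi>))) = pi powr (CARD('n) / 2) * (t' * s) powr (- (CARD('n) / 2))"
      using pos
    proof eventually_elim
      case (elim s)
      have "(LINT \<xi>|lborel. norm (case_prod f (s, \<xi>))) = enn2real (\<integral>\<^sup>+\<xi>. ennreal (exp (- ((s * t') * (norm (\<xi>::real^'n))\<^sup>2))) \<partial>lborel)"
        by (simp add: nrm integral_eq_nn_integral)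
      also have "\<dots> = (pi / (s * t')) powr (CARD('n) / 2)"
        using nn_integral_gaussian[OF elim, where 'a="real^'n"] by simp
      also have "\<dots> = pi powr (CARD('n) / 2) / (s * t') powr (CARD('n) / 2)"
        by (rule powr_divide)
      also have "\<dots> = pi powr (CARD('n) / 2) * (t' * s) powr (- (CARD('n) / 2))"
        by (simp only: powr_minus_divide mult.commute[of s t'] times_divide_eq_right mult_1_right)
      finally show ?case .
    qed
    have "integrable M (\<lambda>s. pi powr (CARD('n) / 2) * (t' * s) powr (- (CARD('n) / 2)))"
      using scaled_moment_integrable[of "CARD('n) / 2" t'] t' by simp
    then show "integrable M (\<lambda>s. LINT \<xi>|lborel. norm (case_prod f (s, \<xi>)))"
    proof (rule integrable_cong_AE[THEN iffD1, rotated -1])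
      show "(\<lambda>s. LINT \<xi>|lborel. norm (case_prod f (s, \<xi>))) \<in> borel_measurable M" by measurable
      show "AE s in M. pi powr (CARD('n) / 2) * (t' * s) powr (- (CARD('n) / 2)) = (LINT \<xi>|lborel. norm (case_prod f (s, \<xi>)))"
        using eq by eventually_elim simp
    qed simp
    show "AE s in M. integrable lborel (\<lambda>\<xi>. case_prod f (s, \<xi>))"
      using pos by eventually_elim (simp add: f_def fourier_gaussian(1))
  qed
  have inner: "(LINT s|M. f s \<xi>) = exp (\<i> * complex_of_real (x \<bullet> \<xi>)) * complex_of_real (exp (- t * norm \<xi> powr (2 * \<alpha>)))" for \<xi>
  proof -
    have "(LINT s|M. f s \<xi>) = exp (\<i> * complex_of_real (x \<bullet> \<xi>)) * (LINT s|M. complex_of_real (exp (- ((t' * (norm \<xi>)\<^sup>2) * s))))"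
    proof -
      have "s * t' * (norm \<xi>)\<^sup>2 = t' * (norm \<xi>)\<^sup>2 * s" for s by simp
      then show ?thesis by (simp only: f_def integral_mult_right_zero)
    qed
    also have "(LINT s|M. complex_of_real (exp (- ((t' * (norm \<xi>)\<^sup>2) * s)))) = complex_of_real (exp (- ((t' * (norm \<xi>)\<^sup>2) powr \<alpha>)))"
      by (subst integral_complex_of_real, subst laplace_integral) (use t' in auto)
    also have "(t' * (norm \<xi>)\<^sup>2) powr \<alpha> = t * norm \<xi> powr (2 * \<alpha>)"
      using t' \<alpha> by (cases "\<xi> = 0") (auto simp: powr_mult powr_powr simp flip: powr_numeral)
    finally show ?thesis by simp
  qed
  have "(LINT \<xi>|lborel. exp (\<i> * complex_of_real (x \<bullet> \<xi>)) * complex_of_real (exp (- t * norm \<xi> powr (2 * \<alpha>))))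
    = (LINT s|M. (LINT \<xi>|lborel. f s \<xi>))"
    unfolding inner[symmetric] by (rule P.Fubini_integral[OF int])
  also have "\<dots> = (LINT s|M. complex_of_real ((pi / (s * t')) powr (CARD('n) / 2) * exp (- ((norm x)\<^sup>2 / (4 * (s * t'))))))"
  proof (rule integral_cong_AE)
    show "AE s in M. (LINT \<xi>|lborel. f s \<xi>) = complex_of_real ((pi / (s * t')) powr (CARD('n) / 2) * exp (- ((norm x)\<^sup>2 / (4 * (s * t')))))"
      using pos by eventually_elim (use fourier_gaussian(2)[where x=x] in \<open>simp add: f_def\<close>)
  qed measurable
  also have "\<dots> = complex_of_real (LINT s|M. (pi / (s * t')) powr (CARD('n) / 2) * exp (- ((norm x)\<^sup>2 / (4 * (s * t')))))"
    by (rule integral_complex_of_real)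
  finally have "frac_heat_kernel \<alpha> t x = (2 * pi) powr (- real CARD('n)) *
      (LINT s|M. (pi / (s * t')) powr (CARD('n) / 2) * exp (- ((norm x)\<^sup>2 / (4 * (s * t')))))"
    unfolding frac_heat_kernel_def by simp
  also have "\<dots> = (LINT s|M. (2 * pi) powr (- real CARD('n)) * ((pi / (s * t')) powr (CARD('n) / 2) * exp (- ((norm x)\<^sup>2 / (4 * (s * t'))))))"
    by simp
  also have "\<dots> = (LINT s|M. gauss (s * t') x)"
  proof (rule integral_cong_AE)
    show "AE s in M. (2 * pi) powr (- real CARD('n)) * ((pi / (s * t')) powr (CARD('n) / 2) * exp (- ((norm x)\<^sup>2 / (4 * (s * t'))))) = gauss (s * t') x"
      using pos
    proof eventually_elim
      case (elim s)
      define \<tau> where "\<tau> = s * t'"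
      have \<tau>: "0 < \<tau>" using elim by (simp add: \<tau>_def)
      have e1: "(2 * pi) powr (- real CARD('n)) = ((2 * pi) powr 2) powr (- (CARD('n) / 2))"
        by (subst powr_powr) simp
      have e2: "(pi / \<tau>) powr (CARD('n) / 2) = (\<tau> / pi) powr (- (CARD('n) / 2))"
        by (subst powr_minus_divide) (simp add: powr_divide)
      have "(2 * pi) powr (- real CARD('n)) * (pi / \<tau>) powr (CARD('n) / 2)
        = ((2 * pi) powr 2) powr (- (CARD('n) / 2)) * (\<tau> / pi) powr (- (CARD('n) / 2))"
        by (simp only: e1 e2)
      also have "\<dots> = ((2 * pi) powr 2 * (\<tau> / pi)) powr (- (CARD('n) / 2))"
        using \<tau> by (subst powr_mult) auto
      also have "(2 * pi) powr 2 * (\<tau> / pi) = 4 * pi * \<tau>" by (simp add: power2_eq_square)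
      finally show ?case by (simp add: gauss_def \<tau>_def flip: mult.assoc)
    qed
  qed measurable
  finally show ?thesis by (simp add: t'_def)
qed

end

text \<open>The \<open>\<gamma>\<close>-th power of nabla of the Gaussian.\<close>

definition mixture_kernel :: "nat \<Rightarrow> real \<Rightarrow> real^'n \<Rightarrow> real" where
  "mixture_kernel \<gamma> \<tau> z =
     (if \<gamma> = 0 then gauss \<tau> z else (\<Sum>j\<in>UNIV. - (z \<bullet> axis j 1) / (2 * \<tau>) * gauss \<tau> z))"

definition mixture_bound :: "real \<Rightarrow> real" where
  "mixture_bound n = n * 2 powr (n / 2)"

lemma borel_measurable_mixture_kernel [measurable]:
  assumes [measurable]: "f \<in> borel_measurable M" "g \<in> borel_measurable M"
  shows "(\<lambda>x. mixture_kernel \<gamma> (f x) (g x :: real^'n)) \<in> borel_measurable M"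
  unfolding mixture_kernel_def by measurable

lemma mixture_kernel_le:
  fixes z :: "real^'n"
  assumes \<tau>: "0 < \<tau>" and \<gamma>: "\<gamma> \<in> {0, 1}"
  shows "\<bar>mixture_kernel \<gamma> \<tau> z\<bar>
    \<le> mixture_bound CARD('n) * \<tau> powr (- (\<gamma> / 2)) * gauss (2 * \<tau>) z"
proof (cases "\<gamma> = 0")
  case True
  have "gauss \<tau> z \<le> 1 * (2 powr (CARD('n) / 2) * gauss (2 * \<tau>) z)"
    using gauss_le_double[OF \<tau>, of z] by simp
  also have "\<dots> \<le> real CARD('n) * (2 powr (CARD('n) / 2) * gauss (2 * \<tau>) z)"
    by (intro mult_right_mono) (auto simp: Suc_leI)
  finally show ?thesis using True \<tau> by (simp add: mixture_kernel_def mixture_bound_def mult.assoc)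
next
  case False
  with \<gamma> have \<gamma>: "\<gamma> = 1" by auto
  have "\<bar>mixture_kernel \<gamma> \<tau> z\<bar> \<le> (\<Sum>j\<in>UNIV. \<bar>- (z \<bullet> (axis j 1 :: real^'n)) / (2 * \<tau>) * gauss \<tau> z\<bar>)"
  proof -
    have "mixture_kernel \<gamma> \<tau> z = (\<Sum>j\<in>UNIV. - (z \<bullet> (axis j 1 :: real^'n)) / (2 * \<tau>) * gauss \<tau> z)"
      using \<gamma> by (simp add: mixture_kernel_def)
    then show ?thesis by (simp only: sum_abs)
  qed
  also have "\<dots> \<le> (\<Sum>j\<in>(UNIV::'n set). 2 powr (CARD('n) / 2) * \<tau> powr (- (1 / 2)) * gauss (2 * \<tau>) z)"
    using gauss_gradient_le[OF \<tau>, of _ z] by (intro sum_mono) simp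
  also have "\<dots> = mixture_bound CARD('n) * \<tau> powr (- (\<gamma> / 2)) * gauss (2 * \<tau>) z"
    using \<gamma> by (simp add: mixture_bound_def mult.assoc)
  finally show ?thesis .
qed

context stable_subordinator_law
begin

lemma gauss_integrable:
  fixes x :: "'a::euclidean_space"
  assumes c: "0 < c" and k: "0 \<le> k"
  shows "integrable M (\<lambda>s. (c * s) powr (- k) * gauss (2 * (c * s)) x)"
proof (rule Bochner_Integration.integrable_bound)
  show "integrable M (\<lambda>s. (8 * pi) powr (- (DIM('a) / 2)) * (c * s) powr (- (k + DIM('a) / 2)))"
    using scaled_moment_integrable[of "k + DIM('a) / 2" c] c k by simp
  show "AE s in M. norm ((c * s) powr (- k) * gauss (2 * (c * s)) x)
      \<le> norm ((8 * pi) powr (- (DIM('a) / 2)) * (c * s) powr (- (k + DIM('a) / 2)))"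
    using positive
  proof eventually_elim
    case (elim s)
    define \<tau> where "\<tau> = c * s"
    have \<tau>: "0 < \<tau>" using elim c by (simp add: \<tau>_def)
    have "\<tau> powr (- k) * gauss (2 * \<tau>) x \<le> \<tau> powr (- k) * (4 * pi * (2 * \<tau>)) powr (- (DIM('a) / 2))"
      using \<tau> by (intro mult_left_mono gauss_bound) auto
    also have "4 * pi * (2 * \<tau>) = 8 * pi * \<tau>" by simp
    also have "\<tau> powr (- k) * (8 * pi * \<tau>) powr (- (DIM('a) / 2))
      = (8 * pi) powr (- (DIM('a) / 2)) * (\<tau> powr (- k) * \<tau> powr (- (DIM('a) / 2)))"
      using \<tau> by (subst powr_mult) auto
    also have "\<tau> powr (- k) * \<tau> powr (- (DIM('a) / 2)) = \<tau> powr (- (k + DIM('a) / 2))"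
      by (simp flip: powr_add)
    finally show ?case by (simp add: \<tau>_def abs_mult)
  qed
qed measurable

text \<open>Differentiation under the integral sign: by the mean value inequality the difference quotients are
  dominated by \<open>B\<close>, which is a negative moment of \<open>M\<close>.\<close>

lemma mixture_directional_derivative:
  fixes x e :: "'a::euclidean_space"
  assumes c: "0 < c" and e: "norm e = 1"
  shows "((\<lambda>r. LINT s|M. gauss (c * s) (x + r *\<^sub>R e)) has_real_derivative
      (LINT s|M. - (x \<bullet> e) / (2 * (c * s)) * gauss (c * s) x)) (at 0)"
proof -
  have pos: "AE s in M. 0 < c * s" using positive by eventually_elim (use c in simp)
  define B where "B = (\<lambda>s. 2 powr (DIM('a) / 2) * (8 * pi) powr (- (DIM('a) / 2)) * (c * s) powr (- (1 / 2 + DIM('a) / 2)))"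
  have B: "integrable M B"
    unfolding B_def using scaled_moment_integrable[of "1 / 2 + DIM('a) / 2" c] c by simp
  have grad: "\<bar>- (y \<bullet> e) / (2 * (c * s)) * gauss (c * s) y\<bar> \<le> B s" if s: "0 < c * s" for y s
  proof -
    define \<tau> where "\<tau> = c * s"
    have \<tau>: "0 < \<tau>" using s by (simp add: \<tau>_def)
    have "\<bar>- (y \<bullet> e) / (2 * \<tau>) * gauss \<tau> y\<bar> \<le> 2 powr (DIM('a) / 2) * \<tau> powr (- (1 / 2)) * gauss (2 * \<tau>) y"
      by (rule gauss_gradient_le[OF \<tau> e])
    also have "\<dots> \<le> 2 powr (DIM('a) / 2) * \<tau> powr (- (1 / 2)) * (4 * pi * (2 * \<tau>)) powr (- (DIM('a) / 2))"
      using \<tau> by (intro mult_left_mono gauss_bound) auto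
    also have "4 * pi * (2 * \<tau>) = 8 * pi * \<tau>" by simp
    also have "(8 * pi * \<tau>) powr (- (DIM('a) / 2)) = (8 * pi) powr (- (DIM('a) / 2)) * \<tau> powr (- (DIM('a) / 2))"
      using \<tau> by (subst powr_mult) auto
    also have "2 powr (DIM('a) / 2) * \<tau> powr (- (1 / 2)) * ((8 * pi) powr (- (DIM('a) / 2)) * \<tau> powr (- (DIM('a) / 2)))
      = 2 powr (DIM('a) / 2) * (8 * pi) powr (- (DIM('a) / 2)) * (\<tau> powr (- (1 / 2)) * \<tau> powr (- (DIM('a) / 2)))"
      by (simp only: mult_ac)
    also have "\<tau> powr (- (1 / 2)) * \<tau> powr (- (DIM('a) / 2)) = \<tau> powr (- (1 / 2 + DIM('a) / 2))"
      unfolding powr_add[symmetric] by simp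
    finally show ?thesis by (simp only: B_def \<tau>_def)
  qed
  have gi: "integrable M (\<lambda>s. gauss (c * s) y)" for y :: 'a
  proof (rule Bochner_Integration.integrable_bound)
    show "integrable M (\<lambda>s. (4 * pi) powr (- (DIM('a) / 2)) * (c * s) powr (- (DIM('a) / 2)))"
      using scaled_moment_integrable[of "DIM('a) / 2" c] c by simp
    show "AE s in M. norm (gauss (c * s) y) \<le> norm ((4 * pi) powr (- (DIM('a) / 2)) * (c * s) powr (- (DIM('a) / 2)))"
      using pos
    proof eventually_elim
      case (elim s)
      have "(4 * pi * (c * s)) powr (- (DIM('a) / 2)) = (4 * pi) powr (- (DIM('a) / 2)) * (c * s) powr (- (DIM('a) / 2))"
        using elim by (subst powr_mult) auto
      then show ?case using gauss_bound[OF elim, of y] by (simp add: abs_mult)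
    qed
  qed measurable
  have "(\<lambda>i. ((LINT s|M. gauss (c * s) (x + X i *\<^sub>R e)) - (LINT s|M. gauss (c * s) x)) / X i)
      \<longlonglongrightarrow> (LINT s|M. - (x \<bullet> e) / (2 * (c * s)) * gauss (c * s) x)"
    if X: "\<And>i. X i \<noteq> 0" "X \<longlonglongrightarrow> 0" for X :: "nat \<Rightarrow> real"
  proof -
    have "(\<lambda>i. LINT s|M. (gauss (c * s) (x + X i *\<^sub>R e) - gauss (c * s) x) / X i)
      \<longlonglongrightarrow> (LINT s|M. - (x \<bullet> e) / (2 * (c * s)) * gauss (c * s) x)"
    proof (rule integral_dominated_convergence[OF _ _ B])
      show "AE s in M. (\<lambda>i. (gauss (c * s) (x + X i *\<^sub>R e) - gauss (c * s) x) / X i)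
          \<longlonglongrightarrow> - (x \<bullet> e) / (2 * (c * s)) * gauss (c * s) x"
        using pos
      proof eventually_elim
        case (elim s)
        have "((\<lambda>h. (gauss (c * s) (x + (0 + h) *\<^sub>R e) - gauss (c * s) (x + 0 *\<^sub>R e)) / h)
            \<longlongrightarrow> - ((x + 0 *\<^sub>R e) \<bullet> e) / (2 * (c * s)) * gauss (c * s) (x + 0 *\<^sub>R e)) (at 0)"
          using gauss_directional_derivative[OF elim, of x e 0] by (simp only: DERIV_def)
        then have "((\<lambda>h. (gauss (c * s) (x + h *\<^sub>R e) - gauss (c * s) x) / h)
            \<longlongrightarrow> - (x \<bullet> e) / (2 * (c * s)) * gauss (c * s) x) (at 0)"
          by simp
        from this[unfolded tendsto_at_iff_sequentially, rule_format, of X] X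
        show ?case by (simp add: o_def)
      qed
      show "AE s in M. norm ((gauss (c * s) (x + X i *\<^sub>R e) - gauss (c * s) x) / X i) \<le> B s" for i
        using pos
      proof eventually_elim
        case (elim s)
        have "norm (gauss (c * s) (x + X i *\<^sub>R e) - gauss (c * s) (x + 0 *\<^sub>R e)) \<le> B s * norm (X i - 0)"
        proof (rule field_differentiable_bound[where S=UNIV])
          show "((\<lambda>r. gauss (c * s) (x + r *\<^sub>R e)) has_field_derivative
              (- ((x + r *\<^sub>R e) \<bullet> e) / (2 * (c * s)) * gauss (c * s) (x + r *\<^sub>R e))) (at r within UNIV)" for r
            using gauss_directional_derivative[OF elim, of x e r] by simp
          show "norm (- ((x + r *\<^sub>R e) \<bullet> e) / (2 * (c * s)) * gauss (c * s) (x + r *\<^sub>R e)) \<le> B s" for r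
            using grad[OF elim, of "x + r *\<^sub>R e"] by simp
        qed auto
        then show ?case using X(1)[of i] by (simp add: abs_divide divide_le_eq)
      qed
    qed measurable
    then show ?thesis using gi by simp
  qed
  then show ?thesis
    unfolding DERIV_def tendsto_at_iff_sequentially by (auto simp: o_def)
qed

text \<open>The kernel in the Duhamel integral. As a mixture it is jointly measurable in time and space, also
  for \<open>\<gamma> = 1\<close>, where the definition by derivatives would not show it.\<close>

definition frac_kernel :: "nat \<Rightarrow> real \<Rightarrow> real^'n \<Rightarrow> real" where
  "frac_kernel \<gamma> \<sigma> z = (LINT s|M. mixture_kernel \<gamma> (\<sigma> powr (1 / \<alpha>) * s) z)"

lemma borel_measurable_frac_kernel [measurable]:
  "(\<lambda>(\<sigma>, z). frac_kernel \<gamma> \<sigma> (z :: real^'n)) \<in> borel_measurable (borel \<Otimes>\<^sub>M borel)"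
  unfolding frac_kernel_def by measurable

lemma nabla_pow_frac_heat_kernel:
  fixes z :: "real^'n"
  assumes \<sigma>: "0 < \<sigma>" and \<gamma>: "\<gamma> \<in> {0, 1}"
  shows "nabla_pow \<gamma> (frac_heat_kernel \<alpha> \<sigma>) z = frac_kernel \<gamma> \<sigma> z"
proof (cases "\<gamma> = 0")
  case True
  then show ?thesis using frac_heat_kernel_eq[OF \<sigma>, of z]
    by (simp add: nabla_pow_def frac_kernel_def mixture_kernel_def mult.commute)
next
  case False
  define c where "c = \<sigma> powr (1 / \<alpha>)"
  have c: "0 < c" using \<sigma> by (simp add: c_def)
  have ax: "norm (axis j 1 :: real^'n) = 1" for j by simp
  have int: "integrable M (\<lambda>s. - (z \<bullet> axis j 1) / (2 * (c * s)) * gauss (c * s) z)" for j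
  proof (rule Bochner_Integration.integrable_bound)
    show "integrable M (\<lambda>s. 2 powr (CARD('n) / 2) * ((c * s) powr (- (1 / 2)) * gauss (2 * (c * s)) z))"
      using gauss_integrable[OF c, of "1 / 2" z] by simp
    show "AE s in M. norm (- (z \<bullet> axis j 1) / (2 * (c * s)) * gauss (c * s) z)
      \<le> norm (2 powr (CARD('n) / 2) * ((c * s) powr (- (1 / 2)) * gauss (2 * (c * s)) z))"
      using positive
    proof eventually_elim
      case (elim s)
      then show ?case using gauss_gradient_le[OF _ ax, of "c * s" z j] c
        by (simp add: abs_mult mult.assoc)
    qed
  qed measurable
  have "deriv (\<lambda>r. frac_heat_kernel \<alpha> \<sigma> (z + r *\<^sub>R axis j 1)) 0
      = (LINT s|M. - (z \<bullet> axis j 1) / (2 * (c * s)) * gauss (c * s) z)" for j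
    using mixture_directional_derivative[OF c ax, of z j]
    by (intro DERIV_imp_deriv) (simp add: frac_heat_kernel_eq[OF \<sigma>] c_def mult.commute)
  then have "nabla_pow \<gamma> (frac_heat_kernel \<alpha> \<sigma>) z
    = (\<Sum>j\<in>UNIV. LINT s|M. - (z \<bullet> axis j 1) / (2 * (c * s)) * gauss (c * s) z)"
    using False by (simp add: nabla_pow_def)
  also have "\<dots> = (LINT s|M. (\<Sum>j\<in>UNIV. - (z \<bullet> axis j 1) / (2 * (c * s)) * gauss (c * s) z))"
    by (rule Bochner_Integration.integral_sum[symmetric]) (rule int)
  finally show ?thesis using False by (simp add: frac_kernel_def mixture_kernel_def c_def)
qed

lemma frac_kernel_conv_le:
  fixes H :: "real^'n \<Rightarrow> ennreal"
  assumes \<sigma>: "0 < \<sigma>" and \<gamma>: "\<gamma> \<in> {0, 1}" and [measurable]: "H \<in> borel_measurable borel"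
  shows "(\<integral>\<^sup>+y. ennreal \<bar>frac_kernel \<gamma> \<sigma> (x - y)\<bar> * H y \<partial>lborel)
    \<le> (\<integral>\<^sup>+s. ennreal (mixture_bound CARD('n) * (\<sigma> powr (1 / \<alpha>) * s) powr (- (\<gamma> / 2))) *
         (\<integral>\<^sup>+y. ennreal (gauss (2 * (\<sigma> powr (1 / \<alpha>) * s)) (x - y)) * H y \<partial>lborel) \<partial>M)"
proof -
  define c where "c = \<sigma> powr (1 / \<alpha>)"
  have c: "0 < c" using \<sigma> by (simp add: c_def)
  define C where "C = mixture_bound CARD('n)"
  have C: "0 \<le> C" by (simp add: C_def mixture_bound_def)
  interpret P: pair_sigma_finite M "lborel :: (real^'n) measure" ..
  have "ennreal \<bar>frac_kernel \<gamma> \<sigma> z\<bar> \<le> (\<integral>\<^sup>+s. ennreal (C * (c * s) powr (- (\<gamma> / 2))) * ennreal (gauss (2 * (c * s)) z) \<partial>M)" for z :: "real^'n"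
  proof -
    have "ennreal \<bar>frac_kernel \<gamma> \<sigma> z\<bar> \<le> (\<integral>\<^sup>+s. ennreal \<bar>mixture_kernel \<gamma> (c * s) z\<bar> \<partial>M)"
      unfolding frac_kernel_def c_def by (rule ennreal_abs_integral_le)
    also have "\<dots> \<le> (\<integral>\<^sup>+s. ennreal (C * (c * s) powr (- (\<gamma> / 2))) * ennreal (gauss (2 * (c * s)) z) \<partial>M)"
    proof (rule nn_integral_mono_AE)
      show "AE s in M. ennreal \<bar>mixture_kernel \<gamma> (c * s) z\<bar> \<le> ennreal (C * (c * s) powr (- (\<gamma> / 2))) * ennreal (gauss (2 * (c * s)) z)"
        using positive
      proof eventually_elim
        case (elim s)
        then show ?case using mixture_kernel_le[OF _ \<gamma>, of "c * s" z] c C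
          by (subst ennreal_mult[symmetric]) (auto intro!: ennreal_leI simp: C_def)
      qed
    qed
    finally show ?thesis .
  qed
  then have "(\<integral>\<^sup>+y. ennreal \<bar>frac_kernel \<gamma> \<sigma> (x - y)\<bar> * H y \<partial>lborel)
    \<le> (\<integral>\<^sup>+y. (\<integral>\<^sup>+s. ennreal (C * (c * s) powr (- (\<gamma> / 2))) * ennreal (gauss (2 * (c * s)) (x - y)) \<partial>M) * H y \<partial>lborel)"
    by (intro nn_integral_mono mult_right_mono) auto
  also have "\<dots> = (\<integral>\<^sup>+y. (\<integral>\<^sup>+s. ennreal (C * (c * s) powr (- (\<gamma> / 2))) * ennreal (gauss (2 * (c * s)) (x - y)) * H y \<partial>M) \<partial>lborel)"
    by (simp add: nn_integral_multc)
  also have "\<dots> = (\<integral>\<^sup>+s. (\<integral>\<^sup>+y. ennreal (C * (c * s) powr (- (\<gamma> / 2))) * ennreal (gauss (2 * (c * s)) (x - y)) * H y \<partial>lborel) \<partial>M)"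
    by (rule P.Fubini') measurable
  finally show ?thesis by (simp add: nn_integral_cmult mult.assoc C_def c_def)
qed

text \<open>Both convolution bounds integrate a bound for Gaussians against a negative moment.\<close>

lemma mixture_moment:
  assumes k: "0 \<le> k" "0 \<le> m" and C: "0 \<le> C" "0 \<le> C'"
  shows "\<exists>D>0. \<forall>\<sigma>>0. (\<integral>\<^sup>+s. ennreal (C * (\<sigma> powr (1 / \<alpha>) * s) powr (- k)) * ennreal (C' * (\<sigma> powr (1 / \<alpha>) * s) powr (- m)) \<partial>M)
     \<le> ennreal (D * \<sigma> powr (- ((k + m) / \<alpha>)))"
proof -
  define J where "J = (\<integral>\<^sup>+s. ennreal (s powr (- (k + m))) \<partial>M)"
  have J: "J < top" unfolding J_def using k by (intro moments) simp
  define D where "D = C * C' * enn2real J + 1"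
  have D: "0 < D" using C by (simp add: D_def add_nonneg_pos)
  have "(\<integral>\<^sup>+s. ennreal (C * (\<sigma> powr (1 / \<alpha>) * s) powr (- k)) * ennreal (C' * (\<sigma> powr (1 / \<alpha>) * s) powr (- m)) \<partial>M)
     \<le> ennreal (D * \<sigma> powr (- ((k + m) / \<alpha>)))" if \<sigma>: "0 < \<sigma>" for \<sigma>
  proof -
    have "(\<integral>\<^sup>+s. ennreal (C * (\<sigma> powr (1 / \<alpha>) * s) powr (- k)) * ennreal (C' * (\<sigma> powr (1 / \<alpha>) * s) powr (- m)) \<partial>M)
      = (\<integral>\<^sup>+s. ennreal (C * C' * \<sigma> powr (- ((k + m) / \<alpha>))) * ennreal (s powr (- (k + m))) \<partial>M)"
    proof (rule nn_integral_cong_AE)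
      show "AE s in M. ennreal (C * (\<sigma> powr (1 / \<alpha>) * s) powr (- k)) * ennreal (C' * (\<sigma> powr (1 / \<alpha>) * s) powr (- m))
        = ennreal (C * C' * \<sigma> powr (- ((k + m) / \<alpha>))) * ennreal (s powr (- (k + m)))"
        using positive
      proof eventually_elim
        case (elim s)
        have "C * (\<sigma> powr (1 / \<alpha>) * s) powr (- k) * (C' * (\<sigma> powr (1 / \<alpha>) * s) powr (- m))
          = C * C' * ((\<sigma> powr (1 / \<alpha>) * s) powr (- k) * (\<sigma> powr (1 / \<alpha>) * s) powr (- m))"
          by (simp only: mult_ac)
        also have "(\<sigma> powr (1 / \<alpha>) * s) powr (- k) * (\<sigma> powr (1 / \<alpha>) * s) powr (- m) = (\<sigma> powr (1 / \<alpha>) * s) powr (- (k + m))"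
          unfolding powr_add[symmetric] by simp
        also have "\<dots> = \<sigma> powr (- ((k + m) / \<alpha>)) * s powr (- (k + m))"
        proof -
          have "(\<sigma> powr (1 / \<alpha>)) powr (- (k + m)) = \<sigma> powr (- ((k + m) / \<alpha>))"
            by (subst powr_powr, rule arg_cong[where f="(powr) \<sigma>"]) (simp add: algebra_simps add_divide_distrib)
          then show ?thesis using elim by (subst powr_mult) auto
        qed
        finally show ?case using C by (simp only: ennreal_mult[symmetric] mult_nonneg_nonneg powr_ge_zero mult.assoc)
      qed
    qed
    also have "\<dots> = ennreal (C * C' * \<sigma> powr (- ((k + m) / \<alpha>))) * ennreal (enn2real J)"
      unfolding J_def using J[unfolded J_def] by (subst nn_integral_cmult) auto
    also have "\<dots> = ennreal (C * C' * \<sigma> powr (- ((k + m) / \<alpha>)) * enn2real J)"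
      using C by (simp add: ennreal_mult)
    also have "\<dots> \<le> ennreal (D * \<sigma> powr (- ((k + m) / \<alpha>)))"
      by (intro ennreal_leI) (simp add: D_def algebra_simps)
    finally show ?thesis .
  qed
  then show ?thesis using D by blast
qed

theorem frac_kernel_maxfun_bound:
  assumes \<gamma>: "\<gamma> \<in> {0, 1}"
  shows "\<exists>D>0. \<forall>H\<in>borel_measurable borel. \<forall>\<sigma>>0. \<forall>x::real^'n.
    (\<integral>\<^sup>+y. ennreal \<bar>frac_kernel \<gamma> \<sigma> (x - y)\<bar> * H y \<partial>lborel)
      \<le> ennreal (D * \<sigma> powr (- (\<gamma> / (2 * \<alpha>)))) * maxfun H x"
proof -
  define C where "C = mixture_bound CARD('n)"
  have C: "0 \<le> C" by (simp add: C_def mixture_bound_def)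
  obtain D where D: "0 < D" "\<And>\<sigma>. 0 < \<sigma> \<Longrightarrow>
     (\<integral>\<^sup>+s. ennreal (C * (\<sigma> powr (1 / \<alpha>) * s) powr (- (\<gamma> / 2))) * ennreal (1 * (\<sigma> powr (1 / \<alpha>) * s) powr (- 0)) \<partial>M)
     \<le> ennreal (D * \<sigma> powr (- ((\<gamma> / 2 + 0) / \<alpha>)))"
    using mixture_moment[of "\<gamma> / 2" 0 C 1] C by auto
  have "(\<integral>\<^sup>+y. ennreal \<bar>frac_kernel \<gamma> \<sigma> (x - y)\<bar> * H y \<partial>lborel)
      \<le> ennreal (D * \<sigma> powr (- (\<gamma> / (2 * \<alpha>)))) * maxfun H x"
    if [measurable]: "H \<in> borel_measurable borel" and \<sigma>: "0 < \<sigma>" for H \<sigma> and x :: "real^'n"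
  proof -
    define c where "c = \<sigma> powr (1 / \<alpha>)"
    have c: "0 < c" using \<sigma> by (simp add: c_def)
    have "(\<integral>\<^sup>+y. ennreal \<bar>frac_kernel \<gamma> \<sigma> (x - y)\<bar> * H y \<partial>lborel)
      \<le> (\<integral>\<^sup>+s. ennreal (C * (c * s) powr (- (\<gamma> / 2))) *
         (\<integral>\<^sup>+y. ennreal (gauss (2 * (c * s)) (x - y)) * H y \<partial>lborel) \<partial>M)"
      unfolding C_def c_def by (rule frac_kernel_conv_le[OF \<sigma> \<gamma>]) simp
    also have "\<dots> \<le> (\<integral>\<^sup>+s. ennreal (C * (c * s) powr (- (\<gamma> / 2))) * ennreal (1 * (c * s) powr (- 0)) * maxfun H x \<partial>M)"
    proof (rule nn_integral_mono_AE)
      show "AE s in M. ennreal (C * (c * s) powr (- (\<gamma> / 2))) * (\<integral>\<^sup>+y. ennreal (gauss (2 * (c * s)) (x - y)) * H y \<partial>lborel)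
        \<le> ennreal (C * (c * s) powr (- (\<gamma> / 2))) * ennreal (1 * (c * s) powr (- 0)) * maxfun H x"
        using positive
      proof eventually_elim
        case (elim s)
        then have "(\<integral>\<^sup>+y. ennreal (gauss (2 * (c * s)) (x - y)) * H y \<partial>lborel) \<le> maxfun H x"
          using c by (intro gauss_conv_le_maxfun) auto
        then show ?case using elim c by (simp add: mult_left_mono)
      qed
    qed
    also have "\<dots> = (\<integral>\<^sup>+s. ennreal (C * (c * s) powr (- (\<gamma> / 2))) * ennreal (1 * (c * s) powr (- 0)) \<partial>M) * maxfun H x"
      by (rule nn_integral_multc) measurable
    also have "\<dots> \<le> ennreal (D * \<sigma> powr (- ((\<gamma> / 2 + 0) / \<alpha>))) * maxfun H x"
      using D(2)[OF \<sigma>] unfolding c_def by (rule mult_right_mono) simp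
    also have "(\<gamma> / 2 + 0) / \<alpha> = \<gamma> / (2 * \<alpha>)" by simp
    finally show ?thesis .
  qed
  then show ?thesis using D(1) by blast
qed

theorem frac_kernel_decay_bound:
  assumes \<gamma>: "\<gamma> \<in> {0, 1}" and r: "1 \<le> r"
  shows "\<exists>D>0. \<forall>H\<in>borel_measurable borel. (\<integral>\<^sup>+y. epow (H y) r \<partial>lborel) \<le> 1 \<longrightarrow> (\<forall>\<sigma>>0. \<forall>x::real^'n.
    (\<integral>\<^sup>+y. ennreal \<bar>frac_kernel \<gamma> \<sigma> (x - y)\<bar> * H y \<partial>lborel)
      \<le> ennreal (D * \<sigma> powr (- ((\<gamma> + CARD('n) / r) / (2 * \<alpha>)))))"
proof -
  define C where "C = mixture_bound CARD('n)"
  have C: "0 \<le> C" by (simp add: C_def mixture_bound_def)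
  define m where "m = CARD('n) / (2 * r)"
  have m: "0 \<le> m" using r by (simp add: m_def)
  define C' where "C' = (8 * pi) powr (- m)"
  obtain D where D: "0 < D" "\<And>\<sigma>. 0 < \<sigma> \<Longrightarrow>
     (\<integral>\<^sup>+s. ennreal (C * (\<sigma> powr (1 / \<alpha>) * s) powr (- (\<gamma> / 2))) * ennreal (C' * (\<sigma> powr (1 / \<alpha>) * s) powr (- m)) \<partial>M)
     \<le> ennreal (D * \<sigma> powr (- ((\<gamma> / 2 + m) / \<alpha>)))"
    using mixture_moment[of "\<gamma> / 2" m C C'] C m by (auto simp: C'_def)
  have "(\<integral>\<^sup>+y. ennreal \<bar>frac_kernel \<gamma> \<sigma> (x - y)\<bar> * H y \<partial>lborel)
      \<le> ennreal (D * \<sigma> powr (- ((\<gamma> + CARD('n) / r) / (2 * \<alpha>))))"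
    if [measurable]: "H \<in> borel_measurable borel" and H: "(\<integral>\<^sup>+y. epow (H y) r \<partial>lborel) \<le> 1"
      and \<sigma>: "0 < \<sigma>" for H \<sigma> and x :: "real^'n"
  proof -
    define c where "c = \<sigma> powr (1 / \<alpha>)"
    have c: "0 < c" using \<sigma> by (simp add: c_def)
    have "(\<integral>\<^sup>+y. ennreal \<bar>frac_kernel \<gamma> \<sigma> (x - y)\<bar> * H y \<partial>lborel)
      \<le> (\<integral>\<^sup>+s. ennreal (C * (c * s) powr (- (\<gamma> / 2))) *
         (\<integral>\<^sup>+y. ennreal (gauss (2 * (c * s)) (x - y)) * H y \<partial>lborel) \<partial>M)"
      unfolding C_def c_def by (rule frac_kernel_conv_le[OF \<sigma> \<gamma>]) simp
    also have "\<dots> \<le> (\<integral>\<^sup>+s. ennreal (C * (c * s) powr (- (\<gamma> / 2))) * ennreal (C' * (c * s) powr (- m)) \<partial>M)"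
    proof (rule nn_integral_mono_AE)
      show "AE s in M. ennreal (C * (c * s) powr (- (\<gamma> / 2))) * (\<integral>\<^sup>+y. ennreal (gauss (2 * (c * s)) (x - y)) * H y \<partial>lborel)
        \<le> ennreal (C * (c * s) powr (- (\<gamma> / 2))) * ennreal (C' * (c * s) powr (- m))"
        using positive
      proof eventually_elim
        case (elim s)
        have "(\<integral>\<^sup>+y. ennreal (gauss (2 * (c * s)) (x - y)) * H y \<partial>lborel)
          \<le> ennreal ((4 * pi * (2 * (c * s))) powr (- (DIM(real^'n) / (2 * r))))"
          using c elim r H by (intro gauss_conv_decay) auto
        also have "4 * pi * (2 * (c * s)) = 8 * pi * (c * s)" by simp
        also have "(8 * pi * (c * s)) powr (- (DIM(real^'n) / (2 * r))) = C' * (c * s) powr (- m)"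
          unfolding C'_def m_def using elim c by (subst powr_mult) auto
        finally show ?case by (rule mult_left_mono) simp
      qed
    qed
    also have "\<dots> \<le> ennreal (D * \<sigma> powr (- ((\<gamma> / 2 + m) / \<alpha>)))"
      using D(2)[OF \<sigma>] unfolding c_def .
    also have "(\<gamma> / 2 + m) / \<alpha> = (\<gamma> + CARD('n) / r) / (2 * \<alpha>)"
      using \<alpha>(1) r by (simp add: m_def field_simps)
    finally show ?thesis .
  qed
  then show ?thesis using D(1) by blast
qed

end

section \<open>Space-time potentials with critical scaling\<close>

lemma nn_integral_powr_above':
  assumes "e < -1" "0 < c"
  shows "(\<integral>\<^sup>+x. (if c \<le> x then ennreal (x powr e) else 0) \<partial>lborel) = ennreal (c powr (e + 1) / (- (e + 1)))"
  unfolding nn_integral_powr_above[OF assms, symmetric]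
  by (intro nn_integral_cong) (auto simp: indicator_def)

text \<open>Use the first bound below the time \<open>s\<close> and the second one above it; \<open>s\<close> is chosen to make both
  contributions the same power of \<open>m\<close>.\<close>

lemma hedberg_split:
  fixes D1 D2 \<theta> \<kappa> m :: real and A :: "real \<Rightarrow> ennreal"
  assumes D: "0 \<le> D1" "0 \<le> D2" and \<theta>: "\<theta> < 1" and \<kappa>: "1 < \<kappa>" and m: "0 < m"
    and A1: "\<And>\<sigma>. 0 < \<sigma> \<Longrightarrow> A \<sigma> \<le> ennreal (D1 * \<sigma> powr (- \<theta>)) * ennreal m"
    and A2: "\<And>\<sigma>. 0 < \<sigma> \<Longrightarrow> A \<sigma> \<le> ennreal (D2 * \<sigma> powr (- \<kappa>))"
  shows "(\<integral>\<^sup>+\<sigma>. (if 0 < \<sigma> then A \<sigma> else 0) \<partial>lborel)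
    \<le> ennreal ((D1 / (1 - \<theta>) + D2 / (\<kappa> - 1)) * m powr (1 - (1 - \<theta>) / (\<kappa> - \<theta>)))"
proof -
  define s where "s = m powr (- (1 / (\<kappa> - \<theta>)))"
  have s: "0 < s" using m by (simp add: s_def)
  have k: "0 < \<kappa> - \<theta>" using \<theta> \<kappa> by simp
  have pos: "0 \<le> D1 * m" using D m by simp
  have "(\<integral>\<^sup>+\<sigma>. (if 0 < \<sigma> then A \<sigma> else 0) \<partial>lborel)
    \<le> (\<integral>\<^sup>+\<sigma>. ennreal (D1 * m) * (if 0 < \<sigma> \<and> ennreal \<sigma> < ennreal s then ennreal (\<sigma> powr (- \<theta>)) else 0)
        + ennreal D2 * (if s \<le> \<sigma> then ennreal (\<sigma> powr (- \<kappa>)) else 0) \<partial>lborel)"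
  proof (rule nn_integral_mono)
    fix \<sigma> :: real
    show "(if 0 < \<sigma> then A \<sigma> else 0) \<le> ennreal (D1 * m) * (if 0 < \<sigma> \<and> ennreal \<sigma> < ennreal s then ennreal (\<sigma> powr (- \<theta>)) else 0)
        + ennreal D2 * (if s \<le> \<sigma> then ennreal (\<sigma> powr (- \<kappa>)) else 0)"
    proof (cases "0 < \<sigma>")
      case True
      show ?thesis
      proof (cases "\<sigma> < s")
        case lt: True
        have "A \<sigma> \<le> ennreal (D1 * m) * ennreal (\<sigma> powr (- \<theta>))"
          using A1[OF True] D m by (simp add: mult_ac flip: ennreal_mult)
        then show ?thesis using True lt by (simp add: ennreal_less_iff)
      next
        case False
        have "A \<sigma> \<le> ennreal D2 * ennreal (\<sigma> powr (- \<kappa>))"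
          using A2[OF True] D by (simp flip: ennreal_mult)
        then show ?thesis using True False by (auto simp: not_less intro: add_increasing)
      qed
    qed simp
  qed
  also have "\<dots> = ennreal (D1 * m) * (ennreal (1 / (- \<theta> + 1)) * epow (ennreal s) (- \<theta> + 1))
      + ennreal D2 * ennreal (s powr (- \<kappa> + 1) / (- (- \<kappa> + 1)))"
    using nn_integral_powr_below[of "- \<theta>" "ennreal s"] nn_integral_powr_above'[of "- \<kappa>" s] \<theta> \<kappa> s
    by (subst nn_integral_add) (auto simp: nn_integral_cmult)
  also have "\<dots> = ennreal (D1 / (1 - \<theta>) * (m * s powr (1 - \<theta>)) + D2 / (\<kappa> - 1) * s powr (1 - \<kappa>))"
    using D m \<theta> \<kappa> s by (simp add: mult_ac add.commute flip: ennreal_mult ennreal_plus)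
  also have "m * s powr (1 - \<theta>) = m powr (1 - (1 - \<theta>) / (\<kappa> - \<theta>))"
    using m powr_add[of m 1 "- ((1 - \<theta>) / (\<kappa> - \<theta>))"] by (simp add: s_def powr_powr)
  also have "s powr (1 - \<kappa>) = m powr (1 - (1 - \<theta>) / (\<kappa> - \<theta>))"
  proof -
    have "- (1 / (\<kappa> - \<theta>)) * (1 - \<kappa>) = 1 - (1 - \<theta>) / (\<kappa> - \<theta>)" using k by (simp add: field_simps)
    then show ?thesis by (simp only: s_def powr_powr)
  qed
  finally show ?thesis by (simp add: distrib_right)
qed

text \<open>The kernel estimates on which existence and uniqueness rest. In \<open>decay_bound\<close> the exponent is the one for
  which Hedberg's argument gives the power \<open>1 / (b + 1)\<close>; it expresses that \<open>q\<close> is critical for the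
  scaling of the equation.\<close>

locale critical_kernel =
  fixes K :: "real \<Rightarrow> 'a::euclidean_space \<Rightarrow> real" and b :: nat and \<theta> q D1 D2 :: real
  assumes measurable_K: "case_prod K \<in> borel_measurable (borel \<Otimes>\<^sub>M borel)"
    and b: "1 \<le> b" and \<theta>: "\<theta> < 1" and q: "1 < q" and D: "0 < D1" "0 < D2"
    and maxfun_bound: "\<And>H \<sigma> x. H \<in> borel_measurable borel \<Longrightarrow> 0 < \<sigma> \<Longrightarrow>
      (\<integral>\<^sup>+y. ennreal \<bar>K \<sigma> (x - y)\<bar> * H y \<partial>lborel) \<le> ennreal (D1 * \<sigma> powr (- \<theta>)) * maxfun H x"
    and decay_bound: "\<And>H \<sigma> x. H \<in> borel_measurable borel \<Longrightarrow> (\<integral>\<^sup>+y. epow (H y) q \<partial>lborel) \<le> 1 \<Longrightarrow> 0 < \<sigma> \<Longrightarrow>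
      (\<integral>\<^sup>+y. ennreal \<bar>K \<sigma> (x - y)\<bar> * H y \<partial>lborel)
        \<le> ennreal (D2 * \<sigma> powr (- (\<theta> + (1 - \<theta>) * (real b + 1) / real b)))"
begin

lemma borel_measurable_K [measurable (raw)]:
  "f \<in> borel_measurable M \<Longrightarrow> g \<in> borel_measurable M \<Longrightarrow> (\<lambda>x. K (f x) (g x)) \<in> borel_measurable M"
  using measurable_compose[OF measurable_Pair measurable_K] by simp

text \<open>The weight \<open>w\<close> in time is constant in the existence proof and exponentially decaying in the
  uniqueness proof.\<close>

definition potential :: "(real \<Rightarrow> ennreal) \<Rightarrow> ('a \<Rightarrow> ennreal) \<Rightarrow> 'a \<Rightarrow> ennreal" where
  "potential w H x = (\<integral>\<^sup>+\<sigma>. (if 0 < \<sigma> then w \<sigma> * (\<integral>\<^sup>+y. ennreal \<bar>K \<sigma> (x - y)\<bar> * H y \<partial>lborel) else 0) \<partial>lborel)"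

lemma borel_measurable_potential [measurable]:
  assumes [measurable]: "w \<in> borel_measurable borel" "H \<in> borel_measurable borel"
  shows "potential w H \<in> borel_measurable borel"
  unfolding potential_def by measurable

lemma potential_mono:
  assumes "\<And>x. H x \<le> G x"
  shows "potential w H x \<le> potential w G x"
  unfolding potential_def
  using assms by (auto intro!: nn_integral_mono mult_left_mono)

lemma potential_add:
  assumes [measurable]: "w \<in> borel_measurable borel" "H \<in> borel_measurable borel" "G \<in> borel_measurable borel"
  shows "potential w (\<lambda>y. H y + G y) x = potential w H x + potential w G x"
proof -
  have "potential w (\<lambda>y. H y + G y) x = (\<integral>\<^sup>+\<sigma>.
      (if 0 < \<sigma> then w \<sigma> * (\<integral>\<^sup>+y. ennreal \<bar>K \<sigma> (x - y)\<bar> * H y \<partial>lborel) else 0)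
    + (if 0 < \<sigma> then w \<sigma> * (\<integral>\<^sup>+y. ennreal \<bar>K \<sigma> (x - y)\<bar> * G y \<partial>lborel) else 0) \<partial>lborel)"
    unfolding potential_def by (intro nn_integral_cong) (simp add: distrib_left nn_integral_add)
  also have "\<dots> = potential w H x + potential w G x"
    unfolding potential_def by (rule nn_integral_add) measurable
  finally show ?thesis .
qed

lemma potential_cmult:
  assumes [measurable]: "w \<in> borel_measurable borel" "H \<in> borel_measurable borel"
  shows "potential w (\<lambda>y. c * H y) x = c * potential w H x"
proof -
  have "potential w (\<lambda>y. c * H y) x = (\<integral>\<^sup>+\<sigma>.
      c * (if 0 < \<sigma> then w \<sigma> * (\<integral>\<^sup>+y. ennreal \<bar>K \<sigma> (x - y)\<bar> * H y \<partial>lborel) else 0) \<partial>lborel)"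
    unfolding potential_def
    by (intro nn_integral_cong) (simp add: mult.left_commute[of _ c] nn_integral_cmult)
  also have "\<dots> = c * potential w H x"
    unfolding potential_def by (rule nn_integral_cmult) measurable
  finally show ?thesis .
qed

lemma potential_SUP:
  assumes [measurable]: "w \<in> borel_measurable borel" "\<And>i. H i \<in> borel_measurable borel" and H: "incseq H"
  shows "potential w (\<lambda>y. SUP i. H i y) x = (SUP i. potential w (H i) x)"
proof -
  have le: "H i y \<le> H j y" if "i \<le> j" for i j y using H that by (auto simp: incseq_def le_fun_def)
  have inner: "(\<integral>\<^sup>+y. ennreal \<bar>K \<sigma> (x - y)\<bar> * (SUP i. H i y) \<partial>lborel)
    = (SUP i. \<integral>\<^sup>+y. ennreal \<bar>K \<sigma> (x - y)\<bar> * H i y \<partial>lborel)" for \<sigma>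
  proof -
    have "incseq (\<lambda>i y. ennreal \<bar>K \<sigma> (x - y)\<bar> * H i y)"
      by (auto simp: incseq_def le_fun_def intro!: mult_left_mono le)
    then show ?thesis
      by (subst nn_integral_monotone_convergence_SUP[symmetric]) (auto simp: SUP_mult_left_ennreal)
  qed
  have "potential w (\<lambda>y. SUP i. H i y) x = (\<integral>\<^sup>+\<sigma>. (SUP i. (if 0 < \<sigma> then w \<sigma> *
      (\<integral>\<^sup>+y. ennreal \<bar>K \<sigma> (x - y)\<bar> * H i y \<partial>lborel) else 0)) \<partial>lborel)"
    unfolding potential_def
  proof (intro nn_integral_cong)
    fix \<sigma> :: real
    show "(if 0 < \<sigma> then w \<sigma> * (\<integral>\<^sup>+y. ennreal \<bar>K \<sigma> (x - y)\<bar> * (SUP i. H i y) \<partial>lborel) else 0)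
      = (SUP i. if 0 < \<sigma> then w \<sigma> * (\<integral>\<^sup>+y. ennreal \<bar>K \<sigma> (x - y)\<bar> * H i y \<partial>lborel) else 0)"
    proof (cases "0 < \<sigma>")
      case True
      then show ?thesis by (simp only: if_True inner) (rule SUP_mult_left_ennreal)
    qed simp
  qed
  also have "\<dots> = (SUP i. potential w (H i) x)"
    unfolding potential_def
  proof (rule nn_integral_monotone_convergence_SUP)
    show "incseq (\<lambda>i \<sigma>. if 0 < \<sigma> then w \<sigma> * (\<integral>\<^sup>+y. ennreal \<bar>K \<sigma> (x - y)\<bar> * H i y \<partial>lborel) else 0)"
      by (auto simp: incseq_def le_fun_def intro!: mult_left_mono nn_integral_mono le)
  qed measurable
  finally show ?thesis .
qed

abbreviation R where "R \<equiv> potential (\<lambda>_. 1)"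

text \<open>The bound that turns the loss of \<open>b + 1\<close> powers in the nonlinearity into a gain of integrability.\<close>

lemma hedberg:
  obtains C where "0 < C" "\<And>(H :: 'a \<Rightarrow> ennreal) x. H \<in> borel_measurable borel \<Longrightarrow> (\<integral>\<^sup>+y. epow (H y) q \<partial>lborel) \<le> 1 \<Longrightarrow>
    R H x \<le> ennreal C * epow (maxfun H x) (1 / (real b + 1))"
proof
  define \<kappa> where "\<kappa> = \<theta> + (1 - \<theta>) * (real b + 1) / real b"
  have b0: "0 < real b" using b by simp
  have \<kappa>: "\<kappa> = 1 + (1 - \<theta>) / real b" using b0 by (simp add: \<kappa>_def field_simps)
  have \<kappa>1: "1 < \<kappa>" using \<theta> b0 by (simp add: \<kappa>)
  have ex: "1 - (1 - \<theta>) / (\<kappa> - \<theta>) = 1 / (real b + 1)"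
  proof -
    have "\<kappa> - \<theta> = (1 - \<theta>) * ((real b + 1) / real b)" by (simp add: \<kappa>_def)
    then have "(1 - \<theta>) / (\<kappa> - \<theta>) = real b / (real b + 1)" using \<theta> by simp
    then show ?thesis using b0 by (simp add: field_simps)
  qed
  define C where "C = D1 / (1 - \<theta>) + D2 / (\<kappa> - 1)"
  show C: "0 < C" using D \<theta> \<kappa>1 by (simp add: C_def add_pos_pos)
  fix H :: "'a \<Rightarrow> ennreal" and x assume H [measurable]: "H \<in> borel_measurable borel" and H1: "(\<integral>\<^sup>+y. epow (H y) q \<partial>lborel) \<le> 1"
  show "R H x \<le> ennreal C * epow (maxfun H x) (1 / (real b + 1))"
  proof (cases "maxfun H x")
    case (real m)
    show ?thesis
    proof (cases "m = 0")
      case True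
      have "(\<integral>\<^sup>+y. ennreal \<bar>K \<sigma> (x - y)\<bar> * H y \<partial>lborel) = 0" if "0 < \<sigma>" for \<sigma>
        using maxfun_bound[OF H that, of x] real True by simp
      then have "(if 0 < \<sigma> then 1 * (\<integral>\<^sup>+y. ennreal \<bar>K \<sigma> (x - y)\<bar> * H y \<partial>lborel) else 0) = 0" for \<sigma>
        by simp
      then have "R H x = 0" unfolding potential_def by (simp only: nn_integral_const) simp
      then show ?thesis by simp
    next
      case False
      then have m: "0 < m" using real by simp
      have "R H x \<le> ennreal (C * m powr (1 - (1 - \<theta>) / (\<kappa> - \<theta>)))"
        unfolding C_def potential_def mult_1
        using D \<theta> \<kappa>1 m maxfun_bound[OF H, of _ x] decay_bound[OF H H1, of _ x] real
        by (intro hedberg_split) (auto simp: \<kappa>_def)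
      then show ?thesis using real C unfolding ex by (simp add: ennreal_mult)
    qed
  next
    case top
    then show ?thesis using C b by (simp add: ennreal_mult_top)
  qed
qed

text \<open>An exponential weight in time makes the total mass of the kernel small: it is a Gamma integral that
  scales like a negative power of \<open>k\<close>.\<close>

lemma weighted_potential_small:
  assumes e: "0 < e"
  obtains k where "0 < k" "\<And>(H :: 'a \<Rightarrow> ennreal) x. H \<in> borel_measurable borel \<Longrightarrow>
    potential (\<lambda>\<sigma>. ennreal (exp (- (k * \<sigma>)))) H x \<le> ennreal e * maxfun H x"
proof -
  have "((\<lambda>k. D1 * Gamma (1 - \<theta>) * k powr (- (1 - \<theta>))) \<longlongrightarrow> 0) at_top" using \<theta> by real_asymp
  then have "eventually (\<lambda>k. D1 * Gamma (1 - \<theta>) * k powr (- (1 - \<theta>)) < e) at_top"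
    using e by (rule order_tendstoD(2))
  then obtain k where k: "0 < k" "D1 * Gamma (1 - \<theta>) * k powr (- (1 - \<theta>)) < e"
    unfolding eventually_at_top_linorder by (metis max.cobounded1 max.cobounded2 less_le_trans zero_less_one)
  have g: "0 < Gamma (1 - \<theta>)" using \<theta> by (intro Gamma_real_pos) simp
  show ?thesis
  proof
    fix H :: "'a \<Rightarrow> ennreal" and x assume [measurable]: "H \<in> borel_measurable borel"
    have "potential (\<lambda>\<sigma>. ennreal (exp (- (k * \<sigma>)))) H x
      \<le> (\<integral>\<^sup>+\<sigma>. ennreal (\<sigma> powr ((1 - \<theta>) - 1)) * indicator {0<..} \<sigma> * ennreal (exp (- (\<sigma> * k))) * (ennreal D1 * maxfun H x) \<partial>lborel)"
      unfolding potential_def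
    proof (rule nn_integral_mono)
      fix \<sigma> :: real
      show "(if 0 < \<sigma> then ennreal (exp (- (k * \<sigma>))) * (\<integral>\<^sup>+y. ennreal \<bar>K \<sigma> (x - y)\<bar> * H y \<partial>lborel) else 0)
        \<le> ennreal (\<sigma> powr ((1 - \<theta>) - 1)) * indicator {0<..} \<sigma> * ennreal (exp (- (\<sigma> * k))) * (ennreal D1 * maxfun H x)"
      proof (cases "0 < \<sigma>")
        case True
        have "ennreal (exp (- (k * \<sigma>))) * (\<integral>\<^sup>+y. ennreal \<bar>K \<sigma> (x - y)\<bar> * H y \<partial>lborel)
          \<le> ennreal (exp (- (k * \<sigma>))) * (ennreal (D1 * \<sigma> powr (- \<theta>)) * maxfun H x)"
          using True by (intro mult_left_mono maxfun_bound) auto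
        then show ?thesis using True D by (simp add: ennreal_mult mult_ac)
      qed simp
    qed
    also have "\<dots> = ennreal (Gamma (1 - \<theta>)) * ennreal (k powr (- (1 - \<theta>))) * (ennreal D1 * maxfun H x)"
      using Gamma_scaled[of "1 - \<theta>" k] \<theta> k by (subst nn_integral_multc) auto
    also have "\<dots> = ennreal (D1 * Gamma (1 - \<theta>) * k powr (- (1 - \<theta>))) * maxfun H x"
      using D g by (simp add: ennreal_mult mult_ac)
    also have "\<dots> \<le> ennreal e * maxfun H x"
      using k by (intro mult_right_mono ennreal_leI) auto
    finally show "potential (\<lambda>\<sigma>. ennreal (exp (- (k * \<sigma>)))) H x \<le> ennreal e * maxfun H x" .
  qed (rule k(1))
qed

text \<open>The exponents for which both \<open>e\<close> and \<open>e / (b + 1)\<close> satisfy the maximal theorem.\<close>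

definition admissible :: "('a \<Rightarrow> real) \<Rightarrow> bool" where
  "admissible e \<longleftrightarrow> log_holder e \<and> e \<in> borel_measurable borel \<and>
     (\<exists>a B. real b + 1 < a \<and> (\<forall>x. a \<le> e x \<and> e x \<le> B))"

lemma admissible_const: "real b + 1 < c \<Longrightarrow> admissible (\<lambda>_. c)"
  by (auto simp: admissible_def log_holder_const)

lemma admissible_measurable: "admissible e \<Longrightarrow> e \<in> borel_measurable borel"
  by (simp add: admissible_def)

lemma admissible_gt: "admissible e \<Longrightarrow> real b + 1 < e x"
  by (auto simp: admissible_def intro: less_le_trans)

lemma admissible_ge_1: "admissible e \<Longrightarrow> 1 \<le> e x"
  using admissible_gt[of e x] by simp

lemma maxfun_normalized:
  assumes e: "admissible e" and c: "1 \<le> c" "c \<le> real b + 1"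
  obtains C where "1 \<le> C"
    "\<And>f. f \<in> borel_measurable borel \<Longrightarrow> modular (\<lambda>x. e x / c) f \<le> 1 \<Longrightarrow>
       modular (\<lambda>x. e x / c) (maxfun f) \<le> ennreal C"
proof -
  obtain a B where a: "real b + 1 < a" "\<And>x. a \<le> e x" "\<And>x. e x \<le> B" using e by (auto simp: admissible_def)
  have [measurable]: "e \<in> borel_measurable borel" by (rule admissible_measurable[OF e])
  show ?thesis
  proof (rule maxfun_modular_bounded[of "\<lambda>x. e x / c" "a / c" "B / c"])
    show "log_holder (\<lambda>x. e x / c)" using e c by (intro log_holder_cmult) (auto simp: admissible_def)
    show "1 < a / c" using a c by simp
    show "a / c \<le> e x / c" "e x / c \<le> B / c" for x using a c by (auto intro: divide_right_mono)
  qed (use that in auto)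
qed

text \<open>Raised to the power \<open>e\<close>, Hedberg's bound is the modular of the maximal function for the exponent
  \<open>e / (b + 1)\<close>.\<close>

lemma R_modular_bound:
  assumes e: "admissible e"
  obtains C where "1 \<le> C"
    "\<And>h. h \<in> borel_measurable borel \<Longrightarrow> (\<integral>\<^sup>+y. epow (h y) q \<partial>lborel) \<le> 1 \<Longrightarrow>
      modular (\<lambda>x. e x / (real b + 1)) h \<le> 1 \<Longrightarrow> modular e (\<lambda>x. ennreal (1 / C) * R h x) \<le> 1"
proof -
  obtain K0 where K0: "1 \<le> K0" "\<And>f. f \<in> borel_measurable borel \<Longrightarrow> modular (\<lambda>x. e x / (real b + 1)) f \<le> 1 \<Longrightarrow>
       modular (\<lambda>x. e x / (real b + 1)) (maxfun f) \<le> ennreal K0"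
    using maxfun_normalized[OF e, of "real b + 1"] by auto
  obtain C0 where C0: "0 < C0" "\<And>H x. H \<in> borel_measurable borel \<Longrightarrow> (\<integral>\<^sup>+y. epow (H y) q \<partial>lborel) \<le> 1 \<Longrightarrow>
    R H x \<le> ennreal C0 * epow (maxfun H x) (1 / (real b + 1))"
    using hedberg by blast
  have [measurable]: "e \<in> borel_measurable borel" by (rule admissible_measurable[OF e])
  note e1 = admissible_ge_1[OF e]
  define C where "C = max 1 C0 * K0"
  have C: "1 \<le> C" using K0(1) mult_mono[of 1 "max 1 C0" 1 K0] by (simp add: C_def)
  show ?thesis
  proof
    fix h assume [measurable]: "h \<in> borel_measurable borel" and h: "(\<integral>\<^sup>+y. epow (h y) q \<partial>lborel) \<le> 1"
      and hm: "modular (\<lambda>x. e x / (real b + 1)) h \<le> 1"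
    define g where "g = (\<lambda>x. epow (maxfun h x) (1 / (real b + 1)))"
    have [measurable]: "g \<in> borel_measurable borel" unfolding g_def by measurable
    have "modular e (\<lambda>x. ennreal (1 / C) * R h x) \<le> modular e (\<lambda>x. ennreal (1 / K0) * g x)"
    proof (rule modular_mono)
      show "0 \<le> e x" for x using e1[of x] by simp
      fix x
      have "ennreal (1 / C) * R h x \<le> ennreal (1 / C) * (ennreal C0 * g x)"
        unfolding g_def by (intro mult_left_mono C0(2) h) auto
      also have "\<dots> = ennreal (C0 / C) * g x" using C0(1) C by (simp add: mult.assoc[symmetric] flip: ennreal_mult)
      also have "\<dots> \<le> ennreal (1 / K0) * g x"
      proof (intro mult_right_mono ennreal_leI)
        have "C0 / C \<le> max 1 C0 / C" using C by (intro divide_right_mono) auto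
        also have "\<dots> = 1 / K0" by (simp add: C_def max_def)
        finally show "C0 / C \<le> 1 / K0" .
      qed simp
      finally show "ennreal (1 / C) * R h x \<le> ennreal (1 / K0) * g x" .
    qed
    also have "\<dots> \<le> ennreal (1 / K0) * modular e g"
      by (rule modular_scale) (use e1 K0 in \<open>auto simp: ennreal_le_1\<close>)
    also have "modular e g = modular (\<lambda>x. e x / (real b + 1)) (maxfun h)"
      by (simp add: modular_def g_def epow_epow)
    also have "\<dots> \<le> ennreal K0" by (rule K0(2)) (use hm in auto)
    finally have "modular e (\<lambda>x. ennreal (1 / C) * R h x) \<le> ennreal (1 / K0) * ennreal K0"
      by (simp add: mult_left_mono)
    then show "modular e (\<lambda>x. ennreal (1 / C) * R h x) \<le> 1"
      using K0(1) by (simp flip: ennreal_mult)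
  qed (rule C)
qed

lemma modular_power_scaled:
  assumes "0 < l"
  shows "modular (\<lambda>x. e x / (real b + 1)) (\<lambda>x. (ennreal (1 / l) * V x) ^ (b + 1)) = modular e (\<lambda>x. ennreal (1 / l) * V x)"
proof -
  have b1: "real b + 1 = real (b + 1)" by simp
  have "(ennreal (1 / l) * V x) ^ (b + 1) = epow (ennreal (1 / l) * V x) (real b + 1)" for x
    unfolding b1 by (rule epow_of_nat[symmetric]) simp
  then show ?thesis by (simp add: modular_def epow_epow)
qed

text \<open>The map \<open>V \<mapsto> a + R (V ^ (b + 1))\<close> preserves the ball of radius \<open>l\<close> if \<open>l ^ b\<close> is small: by homogeneity the
  potential of \<open>V ^ (b + 1)\<close> is \<open>l ^ (b + 1)\<close> times one in the unit ball. The factors 4 make each of the two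
  summands contribute at most one half after \<open>modular_add\<close> has doubled them.\<close>

lemma majorant_step:
  assumes e: "admissible e" and l: "0 < l" and C: "1 \<le> C"
    and RC: "\<And>h. h \<in> borel_measurable borel \<Longrightarrow> (\<integral>\<^sup>+y. epow (h y) q \<partial>lborel) \<le> 1 \<Longrightarrow>
      modular (\<lambda>x. e x / (real b + 1)) h \<le> 1 \<Longrightarrow> modular e (\<lambda>x. ennreal (1 / C) * R h x) \<le> 1"
    and small: "4 * C * l ^ b \<le> 1"
    and [measurable]: "a \<in> borel_measurable borel" "V \<in> borel_measurable borel"
    and a: "modular e (\<lambda>x. ennreal (4 / l) * a x) \<le> 1"
    and V: "modular e (\<lambda>x. ennreal (1 / l) * V x) \<le> 1"
      "modular (\<lambda>_. (real b + 1) * q) (\<lambda>x. ennreal (1 / l) * V x) \<le> 1"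
  shows "modular e (\<lambda>x. ennreal (1 / l) * (a x + R (\<lambda>y. V y ^ (b + 1)) x)) \<le> 1"
proof -
  have [measurable]: "e \<in> borel_measurable borel" by (rule admissible_measurable[OF e])
  note e1 = admissible_ge_1[OF e]
  have e0: "0 \<le> e x" for x using e1[of x] by simp
  define h where "h = (\<lambda>x. (ennreal (1 / l) * V x) ^ (b + 1))"
  have [measurable]: "h \<in> borel_measurable borel" unfolding h_def by measurable
  have hq: "(\<integral>\<^sup>+y. epow (h y) q \<partial>lborel) \<le> 1"
    using V(2) modular_power_scaled[OF l, of "\<lambda>_. (real b + 1) * q" V] by (simp add: h_def modular_def)
  have hm: "modular (\<lambda>x. e x / (real b + 1)) h \<le> 1"
    using V(1) modular_power_scaled[OF l, of e V] by (simp add: h_def)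
  have Vh: "V y ^ (b + 1) = ennreal (l ^ (b + 1)) * h y" for y
  proof -
    have "ennreal (l ^ (b + 1)) * h y = (ennreal l * (ennreal (1 / l) * V y)) ^ (b + 1)"
      using l by (simp only: h_def power_mult_distrib ennreal_power less_imp_le)
    also have "ennreal l * (ennreal (1 / l) * V y) = V y"
      using l by (simp add: mult.assoc[symmetric] flip: ennreal_mult)
    finally show ?thesis by simp
  qed
  have eq: "ennreal (1 / l) * (a x + R (\<lambda>y. V y ^ (b + 1)) x) = ennreal (1 / l) * a x + ennreal (l ^ b) * R h x" for x
  proof -
    have "R (\<lambda>y. V y ^ (b + 1)) x = ennreal (l ^ (b + 1)) * R h x"
      unfolding Vh by (rule potential_cmult) auto
    moreover have "ennreal (1 / l) * ennreal (l ^ (b + 1)) = ennreal (l ^ b)"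
      using l by (simp flip: ennreal_mult)
    ultimately show ?thesis by (simp add: distrib_left mult.assoc[symmetric])
  qed
  have half: "2 * ennreal (1 / l) = ennreal (1 / 2) * ennreal (4 / l)"
  proof -
    have "ennreal 2 * ennreal (1 / l) = ennreal (2 * (1 / l))"
      by (rule ennreal_mult[symmetric]) (use l in auto)
    also have "2 * (1 / l) = 1 / 2 * (4 / l)" by simp
    also have "ennreal (1 / 2 * (4 / l)) = ennreal (1 / 2) * ennreal (4 / l)"
      by (rule ennreal_mult) (use l in auto)
    finally show ?thesis by (simp only: ennreal_numeral)
  qed
  have "modular e (\<lambda>x. ennreal (1 / l) * (a x + R (\<lambda>y. V y ^ (b + 1)) x))
    \<le> modular e (\<lambda>x. 2 * (ennreal (1 / l) * a x)) + modular e (\<lambda>x. 2 * (ennreal (l ^ b) * R h x))"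
    unfolding eq by (rule modular_add) (use e0 in auto)
  also have "(\<lambda>x. 2 * (ennreal (1 / l) * a x)) = (\<lambda>x. ennreal (1 / 2) * (ennreal (4 / l) * a x))"
    by (simp only: mult.assoc[symmetric] half)
  also have "modular e \<dots> \<le> ennreal (1 / 2) * modular e (\<lambda>x. ennreal (4 / l) * a x)"
    by (rule modular_scale[OF _ _ e1 ennreal_le_1[THEN iffD2]]) auto
  also have "\<dots> \<le> ennreal (1 / 2) * 1" by (intro mult_left_mono a) simp
  also have "(\<lambda>x. 2 * (ennreal (l ^ b) * R h x)) = (\<lambda>x. ennreal (2 * C * l ^ b) * (ennreal (1 / C) * R h x))"
    using l C by (simp add: mult.assoc[symmetric] flip: ennreal_mult ennreal_numeral)
  also have "modular e \<dots> \<le> ennreal (2 * C * l ^ b) * modular e (\<lambda>x. ennreal (1 / C) * R h x)"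
    by (rule modular_scale) (use e1 small in \<open>auto simp: ennreal_le_1\<close>)
  also have "\<dots> \<le> ennreal (1 / 2) * 1"
    using small by (intro mult_mono RC hq hm ennreal_leI) auto
  finally have "modular e (\<lambda>x. ennreal (1 / l) * (a x + R (\<lambda>y. V y ^ (b + 1)) x)) \<le> ennreal (1 / 2) * 1 + ennreal (1 / 2) * 1"
    by (simp add: add_mono)
  also have "\<dots> = 1" unfolding mult_1_right by (subst ennreal_plus[symmetric]) auto
  finally show ?thesis .
qed

end

section \<open>The nonlinearity\<close>

lemma power_increment_mono:
  fixes s x d :: real
  assumes "0 \<le> s" "s \<le> x" "0 \<le> d"
  shows "(s + d) ^ m - s ^ m \<le> (x + d) ^ m - x ^ m"
proof (induction m)
  case (Suc m)
  have "(s + d) ^ Suc m - s ^ Suc m = (s + d) * ((s + d) ^ m - s ^ m) + d * s ^ m"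
    by (simp add: algebra_simps)
  also have "\<dots> \<le> (x + d) * ((x + d) ^ m - x ^ m) + d * x ^ m"
    using assms Suc by (intro add_mono mult_mono power_mono) (auto intro: power_mono)
  also have "\<dots> = (x + d) ^ Suc m - x ^ Suc m" by (simp add: algebra_simps)
  finally show ?case .
qed simp

lemma power_increment_le:
  fixes x d :: real
  assumes "0 \<le> x" "0 \<le> d"
  shows "(x + d) ^ Suc b - x ^ Suc b \<le> real (Suc b) * (x + d) ^ b * d"
proof (induction b)
  case (Suc b)
  have "(x + d) ^ Suc (Suc b) - x ^ Suc (Suc b) = (x + d) * ((x + d) ^ Suc b - x ^ Suc b) + d * x ^ Suc b"
    by (simp add: algebra_simps)
  also have "\<dots> \<le> (x + d) * (real (Suc b) * (x + d) ^ b * d) + d * (x + d) ^ Suc b"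
    using assms Suc by (intro add_mono mult_left_mono power_mono) auto
  also have "\<dots> = real (Suc (Suc b)) * (x + d) ^ Suc b * d" by (simp add: algebra_simps)
  finally show ?case .
qed simp

definition signed_power :: "nat \<Rightarrow> real \<Rightarrow> real" where
  "signed_power b u = \<bar>u\<bar> ^ b * u"

lemma signed_power_0 [simp]: "signed_power b 0 = 0"
  by (simp add: signed_power_def)

lemma abs_signed_power: "\<bar>signed_power b u\<bar> = \<bar>u\<bar> ^ Suc b"
  by (simp add: signed_power_def abs_mult)

lemma signed_power_nonneg: "0 \<le> u \<Longrightarrow> signed_power b u = u ^ Suc b"
  by (simp add: signed_power_def)

lemma signed_power_minus: "signed_power b (- u) = - signed_power b u"
  by (simp add: signed_power_def)

lemma signed_power_bound:
  assumes "ennreal \<bar>r\<bar> \<le> (U :: ennreal)"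
  shows "ennreal \<bar>signed_power b r\<bar> \<le> U ^ Suc b"
proof -
  have "ennreal \<bar>signed_power b r\<bar> = ennreal \<bar>r\<bar> ^ Suc b" by (simp only: abs_signed_power ennreal_power abs_ge_zero)
  also have "\<dots> \<le> U ^ Suc b" using assms by (rule power_mono) simp
  finally show ?thesis .
qed

lemma borel_measurable_signed_power [measurable]:
  "f \<in> borel_measurable M \<Longrightarrow> (\<lambda>x. signed_power b (f x)) \<in> borel_measurable M"
  unfolding signed_power_def by measurable

text \<open>The increments of the nonlinearity are dominated by those of the power function along majorants.
  For values of equal sign this is convexity of the power, for opposite signs its superadditivity.\<close>

lemma signed_power_increment:
  fixes u v x y :: real
  assumes u: "\<bar>u\<bar> \<le> x" and v: "\<bar>v - u\<bar> + x \<le> y"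
  shows "\<bar>signed_power b v - signed_power b u\<bar> \<le> y ^ Suc b - x ^ Suc b"
proof -
  have x0: "0 \<le> x" "x \<le> y" using u v by linarith+
  have inc: "(s + d) ^ Suc b - s ^ Suc b \<le> y ^ Suc b - x ^ Suc b" if "0 \<le> s" "s \<le> x" "0 \<le> d" "x + d \<le> y" for s d
  proof -
    have "(s + d) ^ Suc b - s ^ Suc b \<le> (x + d) ^ Suc b - x ^ Suc b" by (rule power_increment_mono) (use that in auto)
    also have "\<dots> \<le> y ^ Suc b - x ^ Suc b" using that x0 by (intro diff_right_mono power_mono) auto
    finally show ?thesis .
  qed
  have nonneg: "\<bar>signed_power b v - signed_power b u\<bar> \<le> y ^ Suc b - x ^ Suc b"
    if uv: "0 \<le> u" "\<bar>u\<bar> \<le> x" "\<bar>v - u\<bar> + x \<le> y" for u v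
  proof (cases "0 \<le> v")
    case True
    show ?thesis
    proof (cases "u \<le> v")
      case le: True
      then have "u ^ Suc b \<le> v ^ Suc b" using uv by (intro power_mono) auto
      then show ?thesis using inc[of u "v - u"] uv True le by (simp add: signed_power_nonneg)
    next
      case False
      then have "v ^ Suc b \<le> u ^ Suc b" using True by (intro power_mono) auto
      then show ?thesis using inc[of v "u - v"] uv True False by (simp add: signed_power_nonneg)
    qed
  next
    case False
    have "\<bar>signed_power b v - signed_power b u\<bar> \<le> (- v) ^ Suc b + u ^ Suc b"
      using uv abs_triangle_ineq4[of "signed_power b v" "signed_power b u"] False
      by (simp add: abs_signed_power del: power_Suc)
    also have "\<dots> \<le> (u + (- v)) ^ Suc b"
      using power_increment_mono[of 0 u "- v" "Suc b"] uv False by simp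
    also have "\<dots> = (0 + (u - v)) ^ Suc b - 0 ^ Suc b" by simp
    also have "\<dots> \<le> y ^ Suc b - x ^ Suc b" by (rule inc) (use uv False x0 in auto)
    finally show ?thesis .
  qed
  show ?thesis
  proof (cases "0 \<le> u")
    case True
    then show ?thesis using nonneg u v by blast
  next
    case False
    then show ?thesis
      using nonneg[of "- u" "- v"] u v by (simp add: signed_power_minus abs_minus_commute)
  qed
qed

lemma signed_power_increment_ennreal:
  assumes u: "ennreal \<bar>u\<bar> \<le> X" and v: "ennreal \<bar>v - u\<bar> + X \<le> Y"
  shows "ennreal \<bar>signed_power b v - signed_power b u\<bar> + X ^ Suc b \<le> Y ^ Suc b"
proof (cases Y)
  case (real y)
  then have "X \<noteq> top" using v by (auto simp: top_unique)
  then obtain x where x: "0 \<le> x" "X = ennreal x" by (cases X) auto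
  have "\<bar>u\<bar> \<le> x" using u x by simp
  moreover have "\<bar>v - u\<bar> + x \<le> y" using v x real by (simp flip: ennreal_plus)
  ultimately have "\<bar>signed_power b v - signed_power b u\<bar> \<le> y ^ Suc b - x ^ Suc b" by (rule signed_power_increment)
  then have "ennreal (\<bar>signed_power b v - signed_power b u\<bar> + x ^ Suc b) \<le> ennreal (y ^ Suc b)"
    by (intro ennreal_leI) simp
  then show ?thesis using x real by (simp add: ennreal_power del: power_Suc)
next
  case top
  then show ?thesis by (simp add: ennreal_top_mult ennreal_mult_top)
qed

lemma signed_power_lipschitz:
  fixes u v V :: real
  assumes "\<bar>u\<bar> \<le> V" "\<bar>v\<bar> \<le> V"
  shows "\<bar>signed_power b v - signed_power b u\<bar> \<le> real (Suc b) * 3 ^ b * V ^ b * \<bar>v - u\<bar>"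
proof -
  have "\<bar>signed_power b v - signed_power b u\<bar> \<le> (V + \<bar>v - u\<bar>) ^ Suc b - V ^ Suc b"
    by (rule signed_power_increment) (use assms in auto)
  also have "\<dots> \<le> real (Suc b) * (V + \<bar>v - u\<bar>) ^ b * \<bar>v - u\<bar>"
    by (rule power_increment_le) (use assms in auto)
  also have "\<dots> \<le> real (Suc b) * (3 * V) ^ b * \<bar>v - u\<bar>"
    using assms by (intro mult_right_mono mult_left_mono power_mono) auto
  finally show ?thesis by (simp add: power_mult_distrib mult.assoc)
qed

section \<open>Existence by majorants\<close>

context critical_kernel
begin

lemma modular_scaled_le:
  assumes e: "admissible e" and [measurable]: "G \<in> borel_measurable borel"
    and G: "modular e G \<le> ennreal C" and c: "0 \<le> c" "c \<le> 1" and d: "c * C \<le> d"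
  shows "modular e (\<lambda>x. ennreal c * G x) \<le> ennreal d"
proof -
  have [measurable]: "e \<in> borel_measurable borel" by (rule admissible_measurable[OF e])
  have "modular e (\<lambda>x. ennreal c * G x) \<le> ennreal c * modular e G"
    by (rule modular_scale) (use admissible_ge_1[OF e] c in \<open>auto simp: ennreal_le_1\<close>)
  also have "\<dots> \<le> ennreal c * ennreal C" by (intro mult_left_mono G) simp
  also have "\<dots> = ennreal (c * C)" using c by (simp add: ennreal_mult')
  also have "\<dots> \<le> ennreal d" by (intro ennreal_leI d)
  finally show ?thesis .
qed

text \<open>The majorant of the data: the initial datum itself, at time 0, a multiple of its maximal function,
  which bounds the heat flow at positive times, and the potential of the force.\<close>

lemma data_majorant_small:
  assumes e: "admissible e" and l: "0 < l" and C1: "0 \<le> C1"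
  obtains \<epsilon> where "0 < \<epsilon>" "\<And>f0 F \<delta>. f0 \<in> borel_measurable borel \<Longrightarrow> F \<in> borel_measurable borel \<Longrightarrow>
     0 < \<delta> \<Longrightarrow> \<delta> \<le> \<epsilon> \<Longrightarrow>
     modular e (\<lambda>x. ennreal (1 / \<delta>) * f0 x) \<le> 1 \<Longrightarrow>
     (\<integral>\<^sup>+y. epow (ennreal (1 / \<delta>) * F y) q \<partial>lborel) \<le> 1 \<Longrightarrow>
     modular (\<lambda>x. e x / (real b + 1)) (\<lambda>x. ennreal (1 / \<delta>) * F x) \<le> 1 \<Longrightarrow>
     modular e (\<lambda>x. ennreal (4 / l) * (f0 x + (ennreal C1 * maxfun f0 x + R F x))) \<le> 1"
proof -
  obtain K0 where K0: "1 \<le> K0" "\<And>f. f \<in> borel_measurable borel \<Longrightarrow> modular e f \<le> 1 \<Longrightarrow>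
       modular e (maxfun f) \<le> ennreal K0"
    using maxfun_normalized[OF e, of 1] by auto
  obtain C where C: "1 \<le> C" "\<And>h. h \<in> borel_measurable borel \<Longrightarrow> (\<integral>\<^sup>+y. epow (h y) q \<partial>lborel) \<le> 1 \<Longrightarrow>
      modular (\<lambda>x. e x / (real b + 1)) h \<le> 1 \<Longrightarrow> modular e (\<lambda>x. ennreal (1 / C) * R h x) \<le> 1"
    using R_modular_bound[OF e] by blast
  have [measurable]: "e \<in> borel_measurable borel" by (rule admissible_measurable[OF e])
  have e0: "0 \<le> e x" for x using admissible_ge_1[OF e, of x] by simp
  define Q where "Q = 1 + C1 * K0 + C"
  have Q: "1 \<le> Q" "C1 * K0 \<le> Q" "C \<le> Q" "C1 \<le> Q"
    using C1 K0(1) C(1) mult_left_mono[of 1 K0 C1] by (auto simp: Q_def add_nonneg_nonneg)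
  define \<epsilon> where "\<epsilon> = l / (48 * Q)"
  have \<epsilon>: "0 < \<epsilon>" using l Q by (simp add: \<epsilon>_def)
  show ?thesis
  proof (rule that[OF \<epsilon>])
    fix f0 F :: "'a \<Rightarrow> ennreal" and \<delta> :: real
    assume f0 [measurable]: "f0 \<in> borel_measurable borel" and F [measurable]: "F \<in> borel_measurable borel"
      and \<delta>: "0 < \<delta>" "\<delta> \<le> \<epsilon>"
      and mf: "modular e (\<lambda>x. ennreal (1 / \<delta>) * f0 x) \<le> 1"
      and Fq: "(\<integral>\<^sup>+y. epow (ennreal (1 / \<delta>) * F y) q \<partial>lborel) \<le> 1"
      and mF: "modular (\<lambda>x. e x / (real b + 1)) (\<lambda>x. ennreal (1 / \<delta>) * F x) \<le> 1"
    \<comment> \<open>Two applications of \<open>modular_add\<close> multiply \<open>4 / l\<close> by at most 4, and three modulars share the bound 1.\<close>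
    have small: "16 * z * \<delta> / l \<le> 1 / 3" if "0 \<le> z" "z \<le> Q" for z
    proof -
      have "16 * z * \<delta> \<le> 16 * Q * \<epsilon>" using that \<delta> Q \<epsilon> by (intro mult_mono) auto
      also have "\<dots> = l / 3" using Q by (simp add: \<epsilon>_def)
      finally show ?thesis using l by (simp add: divide_le_eq)
    qed
    have t1: "modular e (\<lambda>x. 2 * (ennreal (4 / l) * f0 x)) \<le> ennreal (1 / 3)"
    proof -
      have c: "2 * ennreal (4 / l) = ennreal (8 * \<delta> / l) * ennreal (1 / \<delta>)"
      proof -
        have "ennreal 2 * ennreal (4 / l) = ennreal (2 * (4 / l))" by (rule ennreal_mult[symmetric]) (use l in auto)
        also have "2 * (4 / l) = 8 * \<delta> / l * (1 / \<delta>)" using \<delta> by simp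
        also have "ennreal \<dots> = ennreal (8 * \<delta> / l) * ennreal (1 / \<delta>)" by (rule ennreal_mult) (use l \<delta> in auto)
        finally show ?thesis by (simp only: ennreal_numeral)
      qed
      have "8 * \<delta> / l \<le> 16 * 1 * \<delta> / l" using l \<delta> by (simp add: divide_right_mono)
      then have "8 * \<delta> / l \<le> 1 / 3" using small[of 1] Q by linarith
      then have "modular e (\<lambda>x. ennreal (8 * \<delta> / l) * (ennreal (1 / \<delta>) * f0 x)) \<le> ennreal (1 / 3)"
        using mf l \<delta> by (intro modular_scaled_le[OF e, where C=1 and G="\<lambda>x. ennreal (1 / \<delta>) * f0 x"]) auto
      then show ?thesis by (simp only: mult.assoc[symmetric] c)
    qed
    have t2: "modular e (\<lambda>x. 2 * (2 * (ennreal (4 / l) * (ennreal C1 * maxfun f0 x)))) \<le> ennreal (1 / 3)"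
    proof -
      have "modular e (maxfun (\<lambda>x. ennreal (1 / \<delta>) * f0 x)) \<le> ennreal K0"
        by (rule K0(2)) (use mf in auto)
      moreover have "maxfun (\<lambda>x. ennreal (1 / \<delta>) * f0 x) = (\<lambda>x. ennreal (1 / \<delta>) * maxfun f0 x)"
        by (rule ext) (rule maxfun_cmult, simp)
      ultimately have M: "modular e (\<lambda>x. ennreal (1 / \<delta>) * maxfun f0 x) \<le> ennreal K0"
        by simp
      have c: "2 * (2 * (ennreal (4 / l) * ennreal C1)) = ennreal (16 * C1 * \<delta> / l) * ennreal (1 / \<delta>)"
      proof -
        have "ennreal 2 * (ennreal 2 * (ennreal (4 / l) * ennreal C1)) = ennreal (2 * (2 * (4 / l * C1)))"
          using l C1 by (simp only: ennreal_mult[symmetric] mult_nonneg_nonneg divide_nonneg_pos zero_le_numeral)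
        also have "2 * (2 * (4 / l * C1)) = 16 * C1 * \<delta> / l * (1 / \<delta>)" using \<delta> by simp
        also have "ennreal \<dots> = ennreal (16 * C1 * \<delta> / l) * ennreal (1 / \<delta>)" by (rule ennreal_mult) (use l \<delta> C1 in auto)
        finally show ?thesis by (simp only: ennreal_numeral)
      qed
      have "16 * C1 * \<delta> / l * K0 \<le> 1 / 3" using small[of "C1 * K0"] Q C1 K0(1) by (simp add: mult_ac)
      moreover have "16 * C1 * \<delta> / l \<le> 1" using small[of C1] Q C1 by linarith
      ultimately have "modular e (\<lambda>x. ennreal (16 * C1 * \<delta> / l) * (ennreal (1 / \<delta>) * maxfun f0 x)) \<le> ennreal (1 / 3)"
        using l \<delta> C1 by (intro modular_scaled_le[OF e _ M]) auto
      then show ?thesis by (simp only: mult.assoc[symmetric] c[symmetric])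
    qed
    have t3: "modular e (\<lambda>x. 2 * (2 * (ennreal (4 / l) * R F x))) \<le> ennreal (1 / 3)"
    proof -
      have "modular e (\<lambda>x. ennreal (1 / C) * R (\<lambda>x. ennreal (1 / \<delta>) * F x) x) \<le> 1"
        by (rule C(2)) (use Fq mF in auto)
      then have M: "modular e (\<lambda>x. ennreal (1 / C) * (ennreal (1 / \<delta>) * R F x)) \<le> ennreal 1"
        by (simp add: potential_cmult)
      have c: "2 * (2 * ennreal (4 / l)) = ennreal (16 * C * \<delta> / l) * (ennreal (1 / C) * ennreal (1 / \<delta>))"
      proof -
        have "ennreal 2 * (ennreal 2 * ennreal (4 / l)) = ennreal (2 * (2 * (4 / l)))"
          using l by (simp only: ennreal_mult[symmetric] mult_nonneg_nonneg divide_nonneg_pos zero_le_numeral)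
        also have "2 * (2 * (4 / l)) = 16 * C * \<delta> / l * (1 / C * (1 / \<delta>))" using \<delta> C(1) by simp
        also have "ennreal \<dots> = ennreal (16 * C * \<delta> / l) * ennreal (1 / C * (1 / \<delta>))"
          by (rule ennreal_mult) (use l \<delta> C(1) in auto)
        also have "ennreal (1 / C * (1 / \<delta>)) = ennreal (1 / C) * ennreal (1 / \<delta>)"
          by (rule ennreal_mult) (use \<delta> C(1) in auto)
        finally show ?thesis by (simp only: ennreal_numeral)
      qed
      have "16 * C * \<delta> / l \<le> 1 / 3" using small[of C] Q C(1) by simp
      then have "modular e (\<lambda>x. ennreal (16 * C * \<delta> / l) * (ennreal (1 / C) * (ennreal (1 / \<delta>) * R F x))) \<le> ennreal (1 / 3)"
        using l \<delta> C(1) by (intro modular_scaled_le[OF e _ M]) auto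
      then show ?thesis by (simp only: mult.assoc[symmetric] c[unfolded mult.assoc[symmetric]])
    qed
    have "modular e (\<lambda>x. ennreal (4 / l) * (f0 x + (ennreal C1 * maxfun f0 x + R F x)))
      \<le> modular e (\<lambda>x. 2 * (ennreal (4 / l) * f0 x))
        + modular e (\<lambda>x. 2 * (ennreal (4 / l) * (ennreal C1 * maxfun f0 x) + ennreal (4 / l) * R F x))"
      unfolding distrib_left[of "ennreal (4 / l)"] by (rule modular_add) (use e0 in auto)
    also have "modular e (\<lambda>x. 2 * (ennreal (4 / l) * (ennreal C1 * maxfun f0 x) + ennreal (4 / l) * R F x))
      \<le> modular e (\<lambda>x. 2 * (2 * (ennreal (4 / l) * (ennreal C1 * maxfun f0 x))))
        + modular e (\<lambda>x. 2 * (2 * (ennreal (4 / l) * R F x)))"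
      unfolding distrib_left[of 2] by (rule modular_add) (use e0 in auto)
    finally have "modular e (\<lambda>x. ennreal (4 / l) * (f0 x + (ennreal C1 * maxfun f0 x + R F x)))
      \<le> ennreal (1 / 3) + (ennreal (1 / 3) + ennreal (1 / 3))"
      using t1 t2 t3 by (meson add_mono order_trans order_refl)
    then show "modular e (\<lambda>x. ennreal (4 / l) * (f0 x + (ennreal C1 * maxfun f0 x + R F x))) \<le> 1"
      by (simp flip: ennreal_plus)
  qed
qed

text \<open>Picard iterates of the majorant equation. They increase, so that monotone convergence gives the
  equation in the limit.\<close>

primrec majorant :: "('a \<Rightarrow> ennreal) \<Rightarrow> nat \<Rightarrow> 'a \<Rightarrow> ennreal" where
  "majorant a 0 = (\<lambda>x. 0)"
| "majorant a (Suc k) = (\<lambda>x. a x + R (\<lambda>y. majorant a k y ^ Suc b) x)"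

definition majorant_limit :: "('a \<Rightarrow> ennreal) \<Rightarrow> 'a \<Rightarrow> ennreal" where
  "majorant_limit a x = (SUP k. majorant a k x)"

lemma borel_measurable_majorant [measurable]:
  assumes [measurable]: "a \<in> borel_measurable borel"
  shows "majorant a k \<in> borel_measurable borel"
  by (induction k) auto

lemma borel_measurable_majorant_limit [measurable]:
  "a \<in> borel_measurable borel \<Longrightarrow> majorant_limit a \<in> borel_measurable borel"
  unfolding majorant_limit_def by measurable

lemma majorant_Suc_le: "majorant a k x \<le> majorant a (Suc k) x"
proof (induction k arbitrary: x)
  case (Suc k)
  then show ?case
    by (simp del: power_Suc add: add_left_mono potential_mono power_mono)
qed simp

lemma incseq_majorant: "incseq (majorant a)"
  by (rule incseq_SucI) (auto simp: le_fun_def simp del: majorant.simps intro: majorant_Suc_le)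

lemma majorant_le_limit: "majorant a k x \<le> majorant_limit a x"
  unfolding majorant_limit_def by (rule SUP_upper) simp

lemma majorant_limit_fixed:
  assumes [measurable]: "a \<in> borel_measurable borel"
  shows "a x + R (\<lambda>y. majorant_limit a y ^ Suc b) x \<le> majorant_limit a x"
proof -
  have pw: "majorant_limit a y ^ Suc b = (SUP k. majorant a k y ^ Suc b)" for y
    unfolding majorant_limit_def epow_of_nat[OF zero_less_Suc, symmetric] by (rule epow_SUP) simp
  have "R (\<lambda>y. majorant_limit a y ^ Suc b) x = (SUP k. R (\<lambda>y. majorant a k y ^ Suc b) x)"
    unfolding pw
  proof (rule potential_SUP)
    show "incseq (\<lambda>k y. majorant a k y ^ Suc b)"
      using incseq_majorant[of a] by (intro incseq_SucI le_funI power_mono majorant_Suc_le) auto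
  qed measurable
  then have "a x + R (\<lambda>y. majorant_limit a y ^ Suc b) x = (SUP k. majorant a (Suc k) x)"
    by (simp add: ennreal_SUP_add_right del: power_Suc)
  also have "\<dots> \<le> majorant_limit a x"
    by (intro SUP_least majorant_le_limit)
  finally show ?thesis .
qed

text \<open>The step for the exponent \<open>e\<close> needs the bound in \<open>L^Q\<close> with \<open>Q = (b + 1) * q\<close>, hence both exponents run
  through the induction together; monotone convergence passes to the limit.\<close>

lemma modular_majorant:
  assumes l: "0 < l" and C: "1 \<le> C"
    and RC: "\<And>e h. e = e0 \<or> e = (\<lambda>_. (real b + 1) * q) \<Longrightarrow> h \<in> borel_measurable borel \<Longrightarrow>
      (\<integral>\<^sup>+y. epow (h y) q \<partial>lborel) \<le> 1 \<Longrightarrow>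
      modular (\<lambda>x. e x / (real b + 1)) h \<le> 1 \<Longrightarrow> modular e (\<lambda>x. ennreal (1 / C) * R h x) \<le> 1"
    and small: "4 * C * l ^ b \<le> 1"
    and [measurable]: "a \<in> borel_measurable borel"
    and e0: "admissible e0"
    and a: "\<And>e. e = e0 \<or> e = (\<lambda>_. (real b + 1) * q) \<Longrightarrow> modular e (\<lambda>x. ennreal (4 / l) * a x) \<le> 1"
    and e: "e = e0 \<or> e = (\<lambda>_. (real b + 1) * q)"
  shows "modular e (\<lambda>x. ennreal (1 / l) * majorant_limit a x) \<le> 1"
proof -
  have q1: "real b + 1 < (real b + 1) * q" using q by simp
  have adm: "admissible e" if "e = e0 \<or> e = (\<lambda>_. (real b + 1) * q)" for e
    using that e0 admissible_const[OF q1] by auto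
  have step: "\<forall>e. e = e0 \<or> e = (\<lambda>_. (real b + 1) * q) \<longrightarrow> modular e (\<lambda>x. ennreal (1 / l) * majorant a k x) \<le> 1" for k
  proof (induction k)
    case 0
    then show ?case by (simp add: modular_def)
  next
    case (Suc k)
    show ?case
    proof (intro allI impI)
      fix e assume ee: "e = e0 \<or> e = (\<lambda>_. (real b + 1) * q)"
      have "modular e (\<lambda>x. ennreal (1 / l) * (a x + R (\<lambda>y. majorant a k y ^ (b + 1)) x)) \<le> 1"
        by (rule majorant_step[OF adm[OF ee] l C RC[OF ee] small])
           (use Suc a[OF ee] ee in auto)
      then show "modular e (\<lambda>x. ennreal (1 / l) * majorant a (Suc k) x) \<le> 1" by simp
    qed
  qed
  have [measurable]: "e \<in> borel_measurable borel" by (rule admissible_measurable[OF adm[OF e]])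
  have "modular e (\<lambda>x. ennreal (1 / l) * majorant_limit a x) = modular e (\<lambda>x. SUP k. ennreal (1 / l) * majorant a k x)"
    by (simp add: majorant_limit_def SUP_mult_left_ennreal)
  also have "\<dots> = (SUP k. modular e (\<lambda>x. ennreal (1 / l) * majorant a k x))"
  proof (rule modular_SUP)
    show "0 < e x" for x using admissible_ge_1[OF adm[OF e], of x] by simp
    show "incseq (\<lambda>k x. ennreal (1 / l) * majorant a k x)"
      by (intro incseq_SucI le_funI mult_left_mono majorant_Suc_le) simp
  qed measurable
  also have "\<dots> \<le> 1" using step e by (intro SUP_least) auto
  finally show ?thesis .
qed

section \<open>The Duhamel operator\<close>

definition duhamel_kernel :: "real \<Rightarrow> 'a \<Rightarrow> real \<Rightarrow> 'a \<Rightarrow> real" where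
  "duhamel_kernel t x s y = (if 0 < s \<and> s < t then K (t - s) (x - y) else 0)"

text \<open>A single integral over space-time, for which Fubini's theorem and dominated convergence apply
  directly; the iterated integral in \<open>duhamel\<close> is recovered later.\<close>

definition duhamel_op :: "(real \<Rightarrow> 'a \<Rightarrow> real) \<Rightarrow> real \<Rightarrow> 'a \<Rightarrow> real" where
  "duhamel_op h t x =
     (LINT z|(lborel \<Otimes>\<^sub>M lborel). duhamel_kernel t x (fst z) (snd z) * h (fst z) (snd z))"

lemma borel_measurable_duhamel_kernel [measurable (raw)]:
  assumes [measurable]: "f \<in> borel_measurable M" "g \<in> borel_measurable M" "h \<in> borel_measurable M" "k \<in> borel_measurable M"
  shows "(\<lambda>w. duhamel_kernel (f w) (g w) (h w) (k w)) \<in> borel_measurable M"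
  unfolding duhamel_kernel_def by measurable

text \<open>Substitute \<open>\<sigma> = t - s\<close> and extend the integral to all \<open>\<sigma> > 0\<close>.\<close>

lemma duhamel_kernel_potential:
  assumes [measurable]: "w \<in> borel_measurable borel" "H \<in> borel_measurable borel"
  shows "(\<integral>\<^sup>+z. ennreal \<bar>duhamel_kernel t x (fst z) (snd z)\<bar> * (w (t - fst z) * H (snd z)) \<partial>(lborel \<Otimes>\<^sub>M lborel)) \<le> potential w H x"
proof -
  define f where "f = (\<lambda>\<sigma>. if 0 < \<sigma> then w \<sigma> * (\<integral>\<^sup>+y. ennreal \<bar>K \<sigma> (x - y)\<bar> * H y \<partial>lborel) else 0)"
  have [measurable]: "f \<in> borel_measurable borel" unfolding f_def by measurable
  have "(\<integral>\<^sup>+z. ennreal \<bar>duhamel_kernel t x (fst z) (snd z)\<bar> * (w (t - fst z) * H (snd z)) \<partial>(lborel \<Otimes>\<^sub>M lborel))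
    = (\<integral>\<^sup>+s. (\<integral>\<^sup>+y. ennreal \<bar>duhamel_kernel t x s y\<bar> * (w (t - s) * H y) \<partial>lborel) \<partial>lborel)"
    by (subst lborel.nn_integral_fst[symmetric]) auto
  also have "\<dots> \<le> (\<integral>\<^sup>+s. f (t - s) \<partial>lborel)"
  proof (rule nn_integral_mono)
    fix s
    show "(\<integral>\<^sup>+y. ennreal \<bar>duhamel_kernel t x s y\<bar> * (w (t - s) * H y) \<partial>lborel) \<le> f (t - s)"
    proof (cases "0 < s \<and> s < t")
      case True
      then show ?thesis
        by (simp add: f_def duhamel_kernel_def mult.left_commute[of _ "w _"] nn_integral_cmult)
    next
      case False
      then have "duhamel_kernel t x s y = 0" for y by (auto simp: duhamel_kernel_def)
      then show ?thesis by simp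
    qed
  qed
  also have "\<dots> = (\<integral>\<^sup>+s. f s \<partial>lborel)" by (rule nn_integral_reflect_translate) simp
  finally show ?thesis by (simp add: f_def potential_def)
qed

lemma duhamel_kernel_R:
  assumes [measurable]: "H \<in> borel_measurable borel"
  shows "(\<integral>\<^sup>+z. ennreal \<bar>duhamel_kernel t x (fst z) (snd z)\<bar> * H (snd z) \<partial>(lborel \<Otimes>\<^sub>M lborel)) \<le> R H x"
  using duhamel_kernel_potential[of "\<lambda>_. 1" H t x] by simp

lemma duhamel_op_abs_le:
  assumes [measurable]: "H \<in> borel_measurable borel"
    and h: "\<And>s y. ennreal \<bar>h s y\<bar> \<le> H y"
  shows "ennreal \<bar>duhamel_op h t x\<bar> \<le> R H x"
proof -
  have "ennreal \<bar>duhamel_op h t x\<bar> \<le> (\<integral>\<^sup>+z. ennreal \<bar>duhamel_kernel t x (fst z) (snd z) * h (fst z) (snd z)\<bar> \<partial>(lborel \<Otimes>\<^sub>M lborel))"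
    unfolding duhamel_op_def by (rule ennreal_abs_integral_le)
  also have "\<dots> \<le> (\<integral>\<^sup>+z. ennreal \<bar>duhamel_kernel t x (fst z) (snd z)\<bar> * H (snd z) \<partial>(lborel \<Otimes>\<^sub>M lborel))"
    using h by (intro nn_integral_mono) (simp add: abs_mult ennreal_mult mult_left_mono)
  also have "\<dots> \<le> R H x" by (rule duhamel_kernel_R) simp
  finally show ?thesis .
qed

lemma duhamel_op_integrable:
  assumes [measurable]: "H \<in> borel_measurable borel" "case_prod h \<in> borel_measurable (borel \<Otimes>\<^sub>M borel)"
    and h: "\<And>s y. ennreal \<bar>h s y\<bar> \<le> H y" and fin: "R H x < top"
  shows "integrable (lborel \<Otimes>\<^sub>M lborel) (\<lambda>z. duhamel_kernel t x (fst z) (snd z) * h (fst z) (snd z))"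
proof (rule integrableI_bounded)
  have [measurable]: "(\<lambda>z. h (fst z) (snd z)) \<in> borel_measurable (borel \<Otimes>\<^sub>M borel)"
    using assms(2) by (simp add: case_prod_beta' del: borel_prod)
  show "(\<lambda>z. duhamel_kernel t x (fst z) (snd z) * h (fst z) (snd z)) \<in> borel_measurable (lborel \<Otimes>\<^sub>M lborel)" by measurable
  have "(\<integral>\<^sup>+z. ennreal (norm (duhamel_kernel t x (fst z) (snd z) * h (fst z) (snd z))) \<partial>(lborel \<Otimes>\<^sub>M lborel))
    \<le> (\<integral>\<^sup>+z. ennreal \<bar>duhamel_kernel t x (fst z) (snd z)\<bar> * H (snd z) \<partial>(lborel \<Otimes>\<^sub>M lborel))"
    using h by (intro nn_integral_mono) (simp add: abs_mult ennreal_mult mult_left_mono)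
  also have "\<dots> \<le> R H x" by (rule duhamel_kernel_R) simp
  finally show "(\<integral>\<^sup>+z. ennreal (norm (duhamel_kernel t x (fst z) (snd z) * h (fst z) (snd z))) \<partial>(lborel \<Otimes>\<^sub>M lborel)) < \<infinity>"
    using fin by (simp add: less_top[symmetric] top_unique) (auto simp: top_unique)
qed

lemma borel_measurable_duhamel_op:
  assumes h: "case_prod h \<in> borel_measurable (borel \<Otimes>\<^sub>M borel)"
  shows "case_prod (duhamel_op h) \<in> borel_measurable (borel \<Otimes>\<^sub>M borel)"
proof -
  have [measurable]: "(\<lambda>z. h (fst z) (snd z)) \<in> borel_measurable (borel \<Otimes>\<^sub>M borel)"
    using h by (simp add: case_prod_beta' del: borel_prod)
  have "(\<lambda>p. LINT z|(lborel \<Otimes>\<^sub>M lborel). duhamel_kernel (fst p) (snd p) (fst z) (snd z) * h (fst z) (snd z)) \<in> borel_measurable (borel \<Otimes>\<^sub>M borel)"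
  proof (rule sigma_finite_measure.borel_measurable_lebesgue_integral)
    show "sigma_finite_measure (lborel \<Otimes>\<^sub>M lborel :: (real \<times> 'a) measure)"
      by (simp add: lborel_prod lborel.sigma_finite_measure_axioms)
  qed measurable
  then show ?thesis by (simp add: duhamel_op_def case_prod_beta' del: borel_prod)
qed

primrec picard :: "(real \<Rightarrow> 'a \<Rightarrow> real) \<Rightarrow> nat \<Rightarrow> real \<Rightarrow> 'a \<Rightarrow> real" where
  "picard A 0 = (\<lambda>t x. 0)"
| "picard A (Suc k) = (\<lambda>t x. A t x + duhamel_op (\<lambda>s y. signed_power b (picard A k s y)) t x)"

lemma borel_measurable_signed_power_prod:
  assumes "case_prod h \<in> borel_measurable (borel \<Otimes>\<^sub>M borel)"
  shows "case_prod (\<lambda>s y. signed_power b (h s y)) \<in> borel_measurable (borel \<Otimes>\<^sub>M borel)"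
  using borel_measurable_signed_power[OF assms, of b] by (simp add: case_prod_beta' del: borel_prod)

lemma borel_measurable_picard:
  assumes A: "case_prod A \<in> borel_measurable (borel \<Otimes>\<^sub>M borel)"
  shows "case_prod (picard A k) \<in> borel_measurable (borel \<Otimes>\<^sub>M borel)"
proof (induction k)
  case (Suc k)
  have "case_prod (duhamel_op (\<lambda>s y. signed_power b (picard A k s y))) \<in> borel_measurable (borel \<Otimes>\<^sub>M borel)"
    by (intro borel_measurable_duhamel_op borel_measurable_signed_power_prod Suc)
  then show ?case using A by (simp add: case_prod_beta' del: borel_prod)
qed (simp add: case_prod_beta')

text \<open>The second bound is stated with a sum because the majorants may be infinite.
  It telescopes: the increments of the iterates are summable wherever the limit of the majorants is
  finite.\<close>

lemma picard_bounds:
  assumes [measurable]: "a \<in> borel_measurable borel" and A: "case_prod A \<in> borel_measurable (borel \<Otimes>\<^sub>M borel)"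
    and Aa: "\<And>t x. ennreal \<bar>A t x\<bar> \<le> a x"
  shows "ennreal \<bar>picard A k t x\<bar> \<le> majorant a k x"
    and "ennreal \<bar>picard A (Suc k) t x - picard A k t x\<bar> + majorant a k x \<le> majorant a (Suc k) x"
proof -
  have abs: "ennreal \<bar>picard A k t x\<bar> \<le> majorant a k x" for k t x
  proof (induction k arbitrary: t x)
    case (Suc k)
    have "ennreal \<bar>picard A (Suc k) t x\<bar> \<le> ennreal \<bar>A t x\<bar> + ennreal \<bar>duhamel_op (\<lambda>s y. signed_power b (picard A k s y)) t x\<bar>"
      by (simp flip: ennreal_plus add: ennreal_leI)
    also have "\<dots> \<le> a x + R (\<lambda>y. majorant a k y ^ Suc b) x"
    proof (intro add_mono Aa duhamel_op_abs_le)
      fix s y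
      show "ennreal \<bar>signed_power b (picard A k s y)\<bar> \<le> majorant a k y ^ Suc b"
        using power_mono[OF Suc[of s y], of "Suc b"] by (simp add: abs_signed_power ennreal_power del: power_Suc)
    qed measurable
    finally show ?case by (simp del: power_Suc)
  qed simp
  show "ennreal \<bar>picard A k t x\<bar> \<le> majorant a k x" by (rule abs)
  show "ennreal \<bar>picard A (Suc k) t x - picard A k t x\<bar> + majorant a k x \<le> majorant a (Suc k) x"
  proof (induction k arbitrary: t x)
    case 0
    have "duhamel_op (\<lambda>s y. 0) t x = 0" by (simp add: duhamel_op_def)
    then show ?case using Aa[of t x] by (simp add: add_increasing2)
  next
    case (Suc k)
    define N where "N = (\<lambda>k s y. signed_power b (picard A k s y))"
    define P where "P = (\<lambda>k y. majorant a k y ^ Suc b)"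
    have [measurable]: "P k \<in> borel_measurable borel" for k unfolding P_def by measurable
    have Nm: "case_prod (N k) \<in> borel_measurable (borel \<Otimes>\<^sub>M borel)" for k
      unfolding N_def by (intro borel_measurable_signed_power_prod borel_measurable_picard A)
    have NP: "ennreal \<bar>N k s y\<bar> \<le> P k y" for k s y
      using power_mono[OF abs[of k s y], of "Suc b"]
      by (simp add: N_def P_def abs_signed_power ennreal_power del: power_Suc)
    have Pmono: "P k y \<le> P (Suc k) y" for y
      unfolding P_def by (intro power_mono majorant_Suc_le) simp
    show ?case
    proof (cases "R (P (Suc k)) x = top")
      case True
      have "majorant a (Suc (Suc k)) x = a x + R (P (Suc k)) x" by (simp add: P_def del: power_Suc)
      then show ?thesis using True by (simp del: majorant.simps picard.simps)
    next
      case False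
      then have fin: "R (P (Suc k)) x < top" by (simp add: less_top)
      have fin': "R (P k) x < top" using potential_mono[OF Pmono] fin by (rule le_less_trans)
      define E where "E = (\<lambda>y. P (Suc k) y - P k y)"
      have [measurable]: "E \<in> borel_measurable borel" unfolding E_def by measurable
      have EP: "E y + P k y = P (Suc k) y" for y
        unfolding E_def by (rule diff_add_cancel_ennreal[OF Pmono])
      have NE: "ennreal \<bar>N (Suc k) s y - N k s y\<bar> \<le> E y" for s y
      proof (cases "P k y = top")
        case True
        then have "P (Suc k) y = top" using Pmono[of y] by (simp add: top_unique)
        then show ?thesis by (simp add: E_def)
      next
        case False
        have "ennreal \<bar>N (Suc k) s y - N k s y\<bar> + P k y \<le> E y + P k y"
          unfolding EP unfolding N_def P_def by (rule signed_power_increment_ennreal[OF abs Suc])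
        then show ?thesis using False by (simp add: ennreal_add_left_cancel_le add.commute[of _ "P k y"])
      qed
      have "picard A (Suc (Suc k)) t x - picard A (Suc k) t x = duhamel_op (N (Suc k)) t x - duhamel_op (N k) t x"
        by (simp add: N_def)
      also have "\<dots> = duhamel_op (\<lambda>s y. N (Suc k) s y - N k s y) t x"
        unfolding duhamel_op_def right_diff_distrib
        by (rule Bochner_Integration.integral_diff[symmetric])
           (auto intro: duhamel_op_integrable[OF _ Nm NP] fin fin')
      finally have "ennreal \<bar>picard A (Suc (Suc k)) t x - picard A (Suc k) t x\<bar> \<le> R E x"
        using duhamel_op_abs_le[OF _ NE, where t=t and x=x] by simp
      moreover have "R E x + R (P k) x = R (P (Suc k)) x"
        using potential_add[of "\<lambda>_. 1" E "P k" x] by (simp add: EP)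
      ultimately have "ennreal \<bar>picard A (Suc (Suc k)) t x - picard A (Suc k) t x\<bar> + (a x + R (P k) x)
        \<le> a x + R (P (Suc k)) x"
        by (metis add.assoc add.commute add_left_mono)
      then show ?thesis by (simp add: P_def del: power_Suc picard.simps)
    qed
  qed
qed

text \<open>At points where the majorant is finite the iterates converge, and so does the Duhamel integral, by
  dominated convergence with the potential of \<open>majorant_limit a ^ Suc b\<close> as a bound. The other points form a
  null set in the application; there \<open>u\<close> is 0.\<close>

theorem picard_limit:
  assumes [measurable]: "a \<in> borel_measurable borel" and A: "case_prod A \<in> borel_measurable (borel \<Otimes>\<^sub>M borel)"
    and Aa: "\<And>t x. ennreal \<bar>A t x\<bar> \<le> a x"
  obtains u where "case_prod u \<in> borel_measurable (borel \<Otimes>\<^sub>M borel)"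
    "\<And>t x. ennreal \<bar>u t x\<bar> \<le> majorant_limit a x"
    "\<And>t x. majorant_limit a x < top \<Longrightarrow> u t x = A t x + duhamel_op (\<lambda>s y. signed_power b (u s y)) t x"
proof -
  define U where "U = majorant_limit a"
  have Um [measurable]: "U \<in> borel_measurable borel" unfolding U_def by measurable
  define v where "v = picard A"
  have vm: "case_prod (v k) \<in> borel_measurable (borel \<Otimes>\<^sub>M borel)" for k
    unfolding v_def by (rule borel_measurable_picard[OF A])
  have vU: "ennreal \<bar>v k t x\<bar> \<le> U x" for k t x
    unfolding v_def U_def using picard_bounds(1)[OF _ A Aa] majorant_le_limit by (rule order_trans) simp
  have conv: "convergent (\<lambda>k. v k t x)" if fin: "U x < top" for t x
  proof -
    have Mfin: "majorant a k x < top" for k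
      using majorant_le_limit[of a k x] fin unfolding U_def by (rule le_less_trans)
    define m where "m = (\<lambda>k. enn2real (majorant a k x))"
    have m: "majorant a k x = ennreal (m k)" "0 \<le> m k" for k using Mfin[of k] by (auto simp: m_def)
    have inc: "\<bar>v (Suc k) t x - v k t x\<bar> \<le> m (Suc k) - m k" for k
    proof -
      have "ennreal (\<bar>v (Suc k) t x - v k t x\<bar> + m k) \<le> ennreal (m (Suc k))"
        using picard_bounds(2)[OF _ A Aa, of k t x] unfolding v_def m by (simp add: m(2) del: picard.simps)
      then show ?thesis using m(2)[of "Suc k"] by (subst (asm) ennreal_le_iff) auto
    qed
    have "summable (\<lambda>k. \<bar>v (Suc k) t x - v k t x\<bar>)"
    proof (rule summableI_nonneg_bounded)
      fix n
      have "(\<Sum>k<n. \<bar>v (Suc k) t x - v k t x\<bar>) \<le> (\<Sum>k<n. m (Suc k) - m k)" by (rule sum_mono) (rule inc)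
      also have "\<dots> = m n - m 0" by (rule sum_lessThan_telescope)
      also have "\<dots> \<le> m n" using m(2)[of 0] by simp
      also have "\<dots> \<le> enn2real (U x)"
        unfolding m_def U_def using fin[unfolded U_def] majorant_le_limit by (intro enn2real_mono) auto
      finally show "(\<Sum>k<n. \<bar>v (Suc k) t x - v k t x\<bar>) \<le> enn2real (U x)" .
    qed simp
    then have "summable (\<lambda>k. v (Suc k) t x - v k t x)" by (rule summable_rabs_cancel)
    then have "convergent (\<lambda>n. \<Sum>k<n. v (Suc k) t x - v k t x)" by (simp add: summable_iff_convergent)
    moreover have "(\<Sum>k<n. v (Suc k) t x - v k t x) = v n t x" for n
      by (subst sum_lessThan_telescope) (simp add: v_def)
    ultimately show ?thesis by simp
  qed
  define u where "u = (\<lambda>t x. if U x < top then lim (\<lambda>k. v k t x) else 0)"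
  have ulim: "(\<lambda>k. v k t x) \<longlonglongrightarrow> u t x" if "U x < top" for t x
    using conv[OF that, of t] that by (simp add: u_def convergent_LIMSEQ_iff)
  have um: "case_prod u \<in> borel_measurable (borel \<Otimes>\<^sub>M borel)"
  proof -
    have [measurable]: "(\<lambda>p. v k (fst p) (snd p)) \<in> borel_measurable (borel \<Otimes>\<^sub>M borel)" for k
      using vm[of k] by (simp add: case_prod_beta' del: borel_prod)
    have "(\<lambda>p. if U (snd p) < top then lim (\<lambda>k. v k (fst p) (snd p)) else 0) \<in> borel_measurable (borel \<Otimes>\<^sub>M borel)"
      by measurable
    then show ?thesis by (simp add: u_def case_prod_beta' del: borel_prod)
  qed
  have uU: "ennreal \<bar>u t x\<bar> \<le> U x" for t x
  proof (cases "U x < top")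
    case True
    have "(\<lambda>k. ennreal \<bar>v k t x\<bar>) \<longlonglongrightarrow> ennreal \<bar>u t x\<bar>"
      by (intro tendsto_ennrealI tendsto_rabs ulim True)
    then show ?thesis by (rule LIMSEQ_le_const2) (use vU in auto)
  qed (simp add: u_def)
  have fixed: "u t x = A t x + duhamel_op (\<lambda>s y. signed_power b (u s y)) t x" if fin: "U x < top" for t x
  proof -
    have Pm [measurable]: "(\<lambda>y. U y ^ Suc b) \<in> borel_measurable borel" by measurable
    have "R (\<lambda>y. U y ^ Suc b) x \<le> U x"
      using majorant_limit_fixed[of a x] unfolding U_def[symmetric]
      by (rule order_trans[rotated]) (auto intro: add_increasing)
    then have Rfin: "R (\<lambda>y. U y ^ Suc b) x < top" using fin by (rule le_less_trans)
    define W where "W = (\<lambda>z. ennreal \<bar>duhamel_kernel t x (fst z) (snd z)\<bar> * U (snd z) ^ Suc b)"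
    have Wm [measurable]: "W \<in> borel_measurable (lborel \<Otimes>\<^sub>M lborel)" unfolding W_def by measurable
    have Wint: "(\<integral>\<^sup>+z. W z \<partial>(lborel \<Otimes>\<^sub>M lborel)) < top"
      using duhamel_kernel_R[OF Pm, of t x] Rfin unfolding W_def by (rule le_less_trans)
    then have Wae: "AE z in lborel \<Otimes>\<^sub>M lborel. W z < top"
      using nn_integral_PInf_AE[of W "lborel \<Otimes>\<^sub>M lborel"] by (auto simp: less_top)
    have kv: "ennreal \<bar>duhamel_kernel t x (fst z) (snd z) * signed_power b (f (fst z) (snd z))\<bar> \<le> W z"
      if "\<And>s y. ennreal \<bar>f s y\<bar> \<le> U y" for f z
    proof -
      have "ennreal \<bar>signed_power b (f (fst z) (snd z))\<bar> \<le> U (snd z) ^ Suc b"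
        using power_mono[OF that[of "fst z" "snd z"], of "Suc b"]
        by (simp add: abs_signed_power ennreal_power del: power_Suc)
      then show ?thesis by (simp add: W_def abs_mult ennreal_mult mult_left_mono del: power_Suc)
    qed
    have "(\<lambda>k. duhamel_op (\<lambda>s y. signed_power b (v k s y)) t x) \<longlonglongrightarrow> duhamel_op (\<lambda>s y. signed_power b (u s y)) t x"
      unfolding duhamel_op_def
    proof (rule integral_dominated_convergence[where w="\<lambda>z. enn2real (W z)"])
      have [measurable]: "(\<lambda>z. v k (fst z) (snd z)) \<in> borel_measurable (borel \<Otimes>\<^sub>M borel)"
        "(\<lambda>z. u (fst z) (snd z)) \<in> borel_measurable (borel \<Otimes>\<^sub>M borel)" for k
        using vm[of k] um by (simp_all add: case_prod_beta' del: borel_prod)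
      show "(\<lambda>z. duhamel_kernel t x (fst z) (snd z) * signed_power b (u (fst z) (snd z))) \<in> borel_measurable (lborel \<Otimes>\<^sub>M lborel)"
        by measurable
      show "(\<lambda>z. duhamel_kernel t x (fst z) (snd z) * signed_power b (v k (fst z) (snd z))) \<in> borel_measurable (lborel \<Otimes>\<^sub>M lborel)" for k
        by measurable
      show "integrable (lborel \<Otimes>\<^sub>M lborel) (\<lambda>z. enn2real (W z))"
      proof (rule integrableI_bounded)
        have "(\<integral>\<^sup>+z. ennreal (norm (enn2real (W z))) \<partial>(lborel \<Otimes>\<^sub>M lborel)) \<le> (\<integral>\<^sup>+z. W z \<partial>(lborel \<Otimes>\<^sub>M lborel))"
          by (intro nn_integral_mono) (simp add: ennreal_enn2real_if)
        then show "(\<integral>\<^sup>+z. ennreal (norm (enn2real (W z))) \<partial>(lborel \<Otimes>\<^sub>M lborel)) < \<infinity>"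
          using Wint by (auto intro: le_less_trans)
      qed measurable
      show "AE z in lborel \<Otimes>\<^sub>M lborel. norm (duhamel_kernel t x (fst z) (snd z) * signed_power b (v k (fst z) (snd z))) \<le> enn2real (W z)" for k
        using Wae
      proof eventually_elim
        case (elim z)
        have "ennreal \<bar>duhamel_kernel t x (fst z) (snd z) * signed_power b (v k (fst z) (snd z))\<bar> \<le> ennreal (enn2real (W z))"
          using kv[of "v k" z] vU elim by simp
        then show ?case by (subst (asm) ennreal_le_iff) auto
      qed
      show "AE z in lborel \<Otimes>\<^sub>M lborel. (\<lambda>k. duhamel_kernel t x (fst z) (snd z) * signed_power b (v k (fst z) (snd z)))
          \<longlonglongrightarrow> duhamel_kernel t x (fst z) (snd z) * signed_power b (u (fst z) (snd z))"
        using Wae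
      proof eventually_elim
        case (elim z)
        show ?case
        proof (cases "U (snd z) < top")
          case True
          then show ?thesis unfolding signed_power_def by (intro tendsto_intros ulim)
        next
          case False
          then have "duhamel_kernel t x (fst z) (snd z) = 0"
            using elim by (auto simp: W_def less_top[symmetric] ennreal_mult_top split: if_splits)
          then show ?thesis by simp
        qed
      qed
    qed
    then have "(\<lambda>k. A t x + duhamel_op (\<lambda>s y. signed_power b (v k s y)) t x) \<longlonglongrightarrow> A t x + duhamel_op (\<lambda>s y. signed_power b (u s y)) t x"
      by (intro tendsto_intros)
    then have "(\<lambda>k. v (Suc k) t x) \<longlonglongrightarrow> A t x + duhamel_op (\<lambda>s y. signed_power b (u s y)) t x"
      by (simp add: v_def)
    moreover have "(\<lambda>k. v (Suc k) t x) \<longlonglongrightarrow> u t x" using ulim[OF fin] by (rule LIMSEQ_Suc)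
    ultimately show ?thesis by (rule LIMSEQ_unique[symmetric])
  qed
  show ?thesis by (rule that[of u]) (use um uU fixed in \<open>auto simp: U_def\<close>)
qed

abbreviation Q where "Q \<equiv> (real b + 1) * q"

lemma Q_gt: "real b + 1 < Q"
  using q by simp

text \<open>Combines the smallness of the data majorant with the invariance of the ball, for the exponent \<open>e0\<close> and
  for the constant exponent \<open>Q\<close> simultaneously.\<close>

lemma small_data_majorant:
  assumes e0: "admissible e0" and C1: "0 \<le> C1"
  obtains l \<epsilon> where "0 < l" "0 < \<epsilon>" "\<And>f0 F \<delta> e. f0 \<in> borel_measurable borel \<Longrightarrow> F \<in> borel_measurable borel \<Longrightarrow>
     0 < \<delta> \<Longrightarrow> \<delta> \<le> \<epsilon> \<Longrightarrow>
     (\<And>e. e = e0 \<or> e = (\<lambda>_. Q) \<Longrightarrow> modular e (\<lambda>x. ennreal (1 / \<delta>) * f0 x) \<le> 1) \<Longrightarrow>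
     (\<And>e. e = e0 \<or> e = (\<lambda>_. Q) \<Longrightarrow> modular (\<lambda>x. e x / (real b + 1)) (\<lambda>x. ennreal (1 / \<delta>) * F x) \<le> 1) \<Longrightarrow>
     e = e0 \<or> e = (\<lambda>_. Q) \<Longrightarrow>
     modular e (\<lambda>x. ennreal (1 / l) * majorant_limit (\<lambda>x. f0 x + (ennreal C1 * maxfun f0 x + R F x)) x) \<le> 1"
proof -
  have Qa: "admissible (\<lambda>_. Q)" by (rule admissible_const[OF Q_gt])
  obtain Ca where Ca: "1 \<le> Ca" "\<And>h. h \<in> borel_measurable borel \<Longrightarrow> (\<integral>\<^sup>+y. epow (h y) q \<partial>lborel) \<le> 1 \<Longrightarrow>
      modular (\<lambda>x. e0 x / (real b + 1)) h \<le> 1 \<Longrightarrow> modular e0 (\<lambda>x. ennreal (1 / Ca) * R h x) \<le> 1"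
    using R_modular_bound[OF e0] by blast
  obtain Cb where Cb: "1 \<le> Cb" "\<And>h. h \<in> borel_measurable borel \<Longrightarrow> (\<integral>\<^sup>+y. epow (h y) q \<partial>lborel) \<le> 1 \<Longrightarrow>
      modular (\<lambda>x. Q / (real b + 1)) h \<le> 1 \<Longrightarrow> modular (\<lambda>_. Q) (\<lambda>x. ennreal (1 / Cb) * R h x) \<le> 1"
    using R_modular_bound[OF Qa] by blast
  define C where "C = max Ca Cb"
  have C: "1 \<le> C" using Ca(1) by (simp add: C_def)
  have RC: "modular e (\<lambda>x. ennreal (1 / C) * R h x) \<le> 1"
    if e: "e = e0 \<or> e = (\<lambda>_. Q)" and h: "h \<in> borel_measurable borel" "(\<integral>\<^sup>+y. epow (h y) q \<partial>lborel) \<le> 1"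
      "modular (\<lambda>x. e x / (real b + 1)) h \<le> 1" for e h
  proof -
    have le: "modular e (\<lambda>x. ennreal (1 / C) * R h x) \<le> modular e (\<lambda>x. ennreal (1 / c) * R h x)"
      if "c \<le> C" "1 \<le> c" for c
    proof (rule modular_mono)
      show "0 \<le> e x" for x using e admissible_ge_1[OF e0, of x] admissible_ge_1[OF Qa] by auto
      show "ennreal (1 / C) * R h x \<le> ennreal (1 / c) * R h x" for x
        using that by (intro mult_right_mono ennreal_leI) (auto simp: frac_le)
    qed
    show ?thesis
    proof (cases "e = e0")
      case True
      then show ?thesis using Ca(2)[of h] h le[of Ca] Ca(1) by (auto simp: C_def intro: order_trans)
    next
      case False
      then have "e = (\<lambda>_. Q)" using e by simp
      then show ?thesis using Cb(2)[of h] h le[of Cb] Cb(1) by (auto simp: C_def intro: order_trans)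
    qed
  qed
  define l where "l = (1 / (4 * C)) powr (1 / real b)"
  have l: "0 < l" using C by (simp add: l_def)
  have "l ^ b = 1 / (4 * C)" using C b by (simp add: l_def powr_powr flip: powr_realpow)
  then have small: "4 * C * l ^ b \<le> 1" using C by simp
  obtain \<epsilon>a where \<epsilon>a: "0 < \<epsilon>a" "\<And>f0 F \<delta>. f0 \<in> borel_measurable borel \<Longrightarrow> F \<in> borel_measurable borel \<Longrightarrow>
     0 < \<delta> \<Longrightarrow> \<delta> \<le> \<epsilon>a \<Longrightarrow> modular e0 (\<lambda>x. ennreal (1 / \<delta>) * f0 x) \<le> 1 \<Longrightarrow>
     (\<integral>\<^sup>+y. epow (ennreal (1 / \<delta>) * F y) q \<partial>lborel) \<le> 1 \<Longrightarrow>
     modular (\<lambda>x. e0 x / (real b + 1)) (\<lambda>x. ennreal (1 / \<delta>) * F x) \<le> 1 \<Longrightarrow>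
     modular e0 (\<lambda>x. ennreal (4 / l) * (f0 x + (ennreal C1 * maxfun f0 x + R F x))) \<le> 1"
    using data_majorant_small[OF e0 l C1] by blast
  obtain \<epsilon>b where \<epsilon>b: "0 < \<epsilon>b" "\<And>f0 F \<delta>. f0 \<in> borel_measurable borel \<Longrightarrow> F \<in> borel_measurable borel \<Longrightarrow>
     0 < \<delta> \<Longrightarrow> \<delta> \<le> \<epsilon>b \<Longrightarrow> modular (\<lambda>_. Q) (\<lambda>x. ennreal (1 / \<delta>) * f0 x) \<le> 1 \<Longrightarrow>
     (\<integral>\<^sup>+y. epow (ennreal (1 / \<delta>) * F y) q \<partial>lborel) \<le> 1 \<Longrightarrow>
     modular (\<lambda>x. Q / (real b + 1)) (\<lambda>x. ennreal (1 / \<delta>) * F x) \<le> 1 \<Longrightarrow>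
     modular (\<lambda>_. Q) (\<lambda>x. ennreal (4 / l) * (f0 x + (ennreal C1 * maxfun f0 x + R F x))) \<le> 1"
    using data_majorant_small[OF Qa l C1] by blast
  show ?thesis
  proof (rule that[of l "min \<epsilon>a \<epsilon>b"])
    show "0 < min \<epsilon>a \<epsilon>b" using \<epsilon>a(1) \<epsilon>b(1) by simp
    fix f0 F :: "'a \<Rightarrow> ennreal" and \<delta> e
    assume m [measurable]: "f0 \<in> borel_measurable borel" "F \<in> borel_measurable borel" and \<delta>: "0 < \<delta>" "\<delta> \<le> min \<epsilon>a \<epsilon>b"
      and mf: "\<And>e. e = e0 \<or> e = (\<lambda>_. Q) \<Longrightarrow> modular e (\<lambda>x. ennreal (1 / \<delta>) * f0 x) \<le> 1"
      and mF: "\<And>e. e = e0 \<or> e = (\<lambda>_. Q) \<Longrightarrow> modular (\<lambda>x. e x / (real b + 1)) (\<lambda>x. ennreal (1 / \<delta>) * F x) \<le> 1"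
      and e: "e = e0 \<or> e = (\<lambda>_. Q)"
    have Fq: "(\<integral>\<^sup>+y. epow (ennreal (1 / \<delta>) * F y) q \<partial>lborel) \<le> 1"
      using mF[of "\<lambda>_. Q"] by (simp add: modular_def)
    show "modular e (\<lambda>x. ennreal (1 / l) * majorant_limit (\<lambda>x. f0 x + (ennreal C1 * maxfun f0 x + R F x)) x) \<le> 1"
    proof (rule modular_majorant[OF l C RC small _ e0 _ e])
      fix e assume e: "e = e0 \<or> e = (\<lambda>_. Q)"
      show "modular e (\<lambda>x. ennreal (4 / l) * (f0 x + (ennreal C1 * maxfun f0 x + R F x))) \<le> 1"
      proof (cases "e = e0")
        case True
        then show ?thesis using \<epsilon>a(2)[OF m \<delta>(1) _ _ Fq] \<delta>(2) mf mF by auto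
      next
        case False
        then have e: "e = (\<lambda>_. Q)" using e by simp
        show ?thesis unfolding e using \<epsilon>b(2)[OF m \<delta>(1) _ _ Fq] \<delta>(2) mf[of "\<lambda>_. Q"] mF[of "\<lambda>_. Q"] by auto
      qed
    qed auto
  qed (rule l)
qed

section \<open>Unconditional uniqueness\<close>

lemma potential_le_R:
  assumes "\<And>\<sigma>. 0 < \<sigma> \<Longrightarrow> w \<sigma> \<le> 1"
  shows "potential w H x \<le> R H x"
  unfolding potential_def
proof (rule nn_integral_mono)
  fix \<sigma> :: real
  show "(if 0 < \<sigma> then w \<sigma> * (\<integral>\<^sup>+y. ennreal \<bar>K \<sigma> (x - y)\<bar> * H y \<partial>lborel) else 0)
    \<le> (if 0 < \<sigma> then 1 * (\<integral>\<^sup>+y. ennreal \<bar>K \<sigma> (x - y)\<bar> * H y \<partial>lborel) else 0)"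
    using assms[of \<sigma>] mult_right_mono[of "w \<sigma>" 1] by (cases "0 < \<sigma>") auto
qed

lemma tail_integral_small:
  fixes V :: "'a \<Rightarrow> ennreal"
  assumes [measurable]: "V \<in> borel_measurable borel" and fin: "(\<integral>\<^sup>+x. epow (V x) Q \<partial>lborel) < top" and t: "0 < t"
  obtains m where "0 < m" "(\<integral>\<^sup>+x. (if ennreal m < V x then epow (V x) Q else 0) \<partial>lborel) \<le> ennreal t"
proof -
  have ae: "AE x in (lborel :: 'a measure). V x < top"
    using nn_integral_PInf_AE[of "\<lambda>x. epow (V x) Q" lborel] fin by (auto simp: less_top)
  have "(\<lambda>i. \<integral>\<^sup>+x. (if ennreal (real (Suc i)) < V x then epow (V x) Q else 0) \<partial>lborel) \<longlonglongrightarrow> (\<integral>\<^sup>+x. 0 \<partial>(lborel::'a measure))"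
  proof (rule nn_integral_dominated_convergence[where w="\<lambda>x. epow (V x) Q"])
    show "AE x in lborel. (\<lambda>i. if ennreal (real (Suc i)) < V x then epow (V x) Q else 0) \<longlonglongrightarrow> 0"
      using ae
    proof eventually_elim
      case (elim x)
      then obtain r where r: "0 \<le> r" "V x = ennreal r" by (cases "V x") auto
      obtain n where n: "r \<le> real n" using real_arch_simple by blast
      have "\<forall>\<^sub>F i in sequentially. (if ennreal (real (Suc i)) < V x then epow (V x) Q else 0) = 0"
        using eventually_ge_at_top[of n]
      proof eventually_elim
        case (elim i)
        then have "r \<le> real (Suc i)" using n by simp
        then show ?case using r by (simp add: ennreal_less_iff del: of_nat_Suc)
      qed
      then show ?case by (rule tendsto_eventually)
    qed
  qed (use fin in auto)
  then have "\<forall>\<^sub>F i in sequentially. (\<integral>\<^sup>+x. (if ennreal (real (Suc i)) < V x then epow (V x) Q else 0) \<partial>lborel) < ennreal t"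
    using t by (intro order_tendstoD(2)) auto
  then obtain i where "(\<integral>\<^sup>+x. (if ennreal (real (Suc i)) < V x then epow (V x) Q else 0) \<partial>lborel) < ennreal t"
    by (auto simp: eventually_sequentially)
  then show ?thesis using that[of "real (Suc i)"] by auto
qed

text \<open>A form of Hoelder's inequality for the exponents \<open>Q / b\<close> and \<open>Q\<close>. The parameter \<open>t\<close> is the size of the
  integral of \<open>epow V Q\<close>; when it is small, so is the product.\<close>

lemma epow_product_le:
  assumes t: "0 < t"
  shows "epow (V ^ b * W) q \<le> ennreal (t powr (real b / (real b + 1))) * (ennreal (1 / t) * epow V Q + epow W Q)"
proof -
  define A where "A = ennreal (1 / t) * epow V Q"
  define B where "B = epow W Q"
  define M where "M = max A B"
  define r where "r = real b / (real b + 1)"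
  have r: "0 \<le> r" "real b * q = Q * r" "q = Q * (1 / (real b + 1))" "r + 1 / (real b + 1) = 1"
    by (auto simp: r_def field_simps)
  have b0: "0 < real b" using b by simp
  have "epow (V ^ b * W) q = epow (epow V Q) r * epow (epow W Q) (1 / (real b + 1))"
    using b by (simp add: epow_mult epow_epow r_def mult.commute[of q] flip: epow_of_nat)
  also have "epow V Q = ennreal t * A"
    using t by (simp add: A_def mult.assoc[symmetric] flip: ennreal_mult)
  also have "epow (ennreal t * A) r * epow (epow W Q) (1 / (real b + 1))
    = ennreal (t powr r) * (epow A r * epow B (1 / (real b + 1)))"
    using t by (simp add: epow_mult B_def mult.assoc)
  also have "\<dots> \<le> ennreal (t powr r) * (epow M r * epow M (1 / (real b + 1)))"
    using r(1) by (intro mult_left_mono mult_mono epow_mono) (auto simp: M_def)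
  also have "epow M r * epow M (1 / (real b + 1)) = M"
    using r(4) by (simp flip: epow_add_exponent)
  also have "M \<le> A + B" by (simp add: M_def add_increasing add_increasing2)
  finally show ?thesis by (simp add: r_def A_def B_def mult_left_mono)
qed

text \<open>The constant is the Lipschitz constant of the nonlinearity in \<open>signed_power_lipschitz\<close>.\<close>

definition difference_bound :: "real \<Rightarrow> ('a \<Rightarrow> ennreal) \<Rightarrow> ('a \<Rightarrow> ennreal) \<Rightarrow> 'a \<Rightarrow> ennreal" where
  "difference_bound k V W = potential (\<lambda>\<sigma>. ennreal (exp (- (k * \<sigma>))))
     (\<lambda>y. ennreal (real (Suc b) * 3 ^ b) * (V y ^ b * W y))"

lemma borel_measurable_difference_bound [measurable]:
  assumes [measurable]: "V \<in> borel_measurable borel" "W \<in> borel_measurable borel"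
  shows "difference_bound k V W \<in> borel_measurable borel"
  unfolding difference_bound_def by measurable

text \<open>The part of \<open>V\<close> above a high level \<open>m\<close> is small in \<open>L^Q\<close>, and Hedberg's bound handles its contribution. The
  rest is at most \<open>m\<close>, and its contribution is small for large \<open>k\<close> by \<open>weighted_potential_small\<close>. Thus \<open>V\<close>
  may be large.\<close>

lemma difference_bound_contraction:
  assumes V [measurable]: "V \<in> borel_measurable borel" and fin: "(\<integral>\<^sup>+x. epow (V x) Q \<partial>lborel) < top"
  obtains k where "0 < k" "\<And>W l. W \<in> borel_measurable borel \<Longrightarrow> 0 < l \<Longrightarrow>
    modular (\<lambda>_. Q) (\<lambda>x. ennreal (1 / l) * W x) \<le> 1 \<Longrightarrow>
    modular (\<lambda>_. Q) (\<lambda>x. ennreal (2 / l) * difference_bound k V W x) \<le> 1"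
proof -
  have Qa: "admissible (\<lambda>_. Q)" by (rule admissible_const[OF Q_gt])
  have Q0: "0 \<le> Q" "1 \<le> Q" using Q_gt by linarith+
  obtain C where C: "1 \<le> C" "\<And>h. h \<in> borel_measurable borel \<Longrightarrow> (\<integral>\<^sup>+y. epow (h y) q \<partial>lborel) \<le> 1 \<Longrightarrow>
      modular (\<lambda>x. Q / (real b + 1)) h \<le> 1 \<Longrightarrow> modular (\<lambda>_. Q) (\<lambda>x. ennreal (1 / C) * R h x) \<le> 1"
    using R_modular_bound[OF Qa] by blast
  obtain K0 where K0: "1 \<le> K0" "\<And>f :: 'a \<Rightarrow> ennreal. f \<in> borel_measurable borel \<Longrightarrow> modular (\<lambda>_. Q) f \<le> 1 \<Longrightarrow>
       modular (\<lambda>_. Q) (maxfun f) \<le> ennreal K0"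
    using maxfun_normalized[OF Qa, of 1] by auto
  define c where "c = real (Suc b) * 3 ^ b"
  have c: "1 \<le> c" unfolding c_def
    by (rule order_trans[OF _ mult_mono[of 1 "real (Suc b)" 1 "3 ^ b"]]) auto
  \<comment> \<open>\<open>N\<close>, \<open>t\<close> and \<open>e\<close> are chosen so that each of the two parts contributes one half at the end.\<close>
  define N where "N = 1 / (8 * c * C)"
  have N: "0 < N" using c C by (simp add: N_def)
  define t where "t = (N powr q / 2) powr ((real b + 1) / real b)"
  have t: "0 < t" using N by (simp add: t_def)
  have tN: "2 * t powr (real b / (real b + 1)) = N powr q"
  proof -
    have "(real b + 1) / real b * (real b / (real b + 1)) = 1" using b by simp
    then have "t powr (real b / (real b + 1)) = (N powr q / 2) powr 1"
      by (simp only: t_def powr_powr)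
    then show ?thesis using N by simp
  qed
  obtain m where m: "0 < m" "(\<integral>\<^sup>+x. (if ennreal m < V x then epow (V x) Q else 0) \<partial>lborel) \<le> ennreal t"
    using tail_integral_small[OF V fin t] by blast
  define V1 where "V1 = (\<lambda>x. if ennreal m < V x then V x else 0)"
  define V2 where "V2 = (\<lambda>x. if ennreal m < V x then 0 else V x)"
  have [measurable]: "V1 \<in> borel_measurable borel" "V2 \<in> borel_measurable borel"
    unfolding V1_def V2_def by measurable
  have V12: "V x ^ b = V1 x ^ b + V2 x ^ b" for x using b by (simp add: V1_def V2_def)
  have V2m: "V2 x ^ b \<le> ennreal (m ^ b)" for x
  proof -
    have "V2 x ^ b \<le> ennreal m ^ b" by (rule power_mono) (auto simp: V2_def not_less)
    then show ?thesis using m(1) by (simp add: ennreal_power)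
  qed
  define e where "e = 1 / (8 * c * m ^ b * K0)"
  have e: "0 < e" using c m(1) K0(1) by (simp add: e_def)
  obtain k where k: "0 < k" "\<And>(H :: 'a \<Rightarrow> ennreal) x. H \<in> borel_measurable borel \<Longrightarrow>
    potential (\<lambda>\<sigma>. ennreal (exp (- (k * \<sigma>)))) H x \<le> ennreal e * maxfun H x"
    using weighted_potential_small[OF e] by blast
  show ?thesis
  proof (rule that[OF k(1)])
    fix W :: "'a \<Rightarrow> ennreal" and l :: real
    assume [measurable]: "W \<in> borel_measurable borel" and l: "0 < l"
      and W: "modular (\<lambda>_. Q) (\<lambda>x. ennreal (1 / l) * W x) \<le> 1"
    define w where "w = (\<lambda>x. ennreal (1 / l) * W x)"
    have [measurable]: "w \<in> borel_measurable borel" unfolding w_def by measurable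
    have w: "(\<integral>\<^sup>+x. epow (w x) Q \<partial>lborel) \<le> 1" using W by (simp add: w_def modular_def)
    define h where "h = (\<lambda>x. ennreal (1 / N) * (V1 x ^ b * w x))"
    have [measurable]: "h \<in> borel_measurable borel" unfolding h_def by measurable
    have hq: "(\<integral>\<^sup>+x. epow (h x) q \<partial>lborel) \<le> 1"
    proof -
      have "(\<integral>\<^sup>+x. epow (V1 x ^ b * w x) q \<partial>lborel)
        \<le> (\<integral>\<^sup>+x. ennreal (t powr (real b / (real b + 1))) * (ennreal (1 / t) * epow (V1 x) Q + epow (w x) Q) \<partial>lborel)"
        by (intro nn_integral_mono epow_product_le t)
      also have "\<dots> = ennreal (t powr (real b / (real b + 1))) * (ennreal (1 / t) * (\<integral>\<^sup>+x. epow (V1 x) Q \<partial>lborel) + (\<integral>\<^sup>+x. epow (w x) Q \<partial>lborel))"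
        by (simp add: nn_integral_cmult nn_integral_add)
      also have "\<dots> \<le> ennreal (t powr (real b / (real b + 1))) * (ennreal (1 / t) * ennreal t + 1)"
      proof (intro mult_left_mono add_mono w)
        have "(\<integral>\<^sup>+x. epow (V1 x) Q \<partial>lborel) = (\<integral>\<^sup>+x. (if ennreal m < V x then epow (V x) Q else 0) \<partial>lborel)"
          by (intro nn_integral_cong) (simp add: V1_def)
        then show "(\<integral>\<^sup>+x. epow (V1 x) Q \<partial>lborel) \<le> ennreal t" using m(2) by simp
      qed auto
      also have "ennreal (1 / t) * ennreal t = 1" using t by (simp flip: ennreal_mult)
      also have "ennreal (t powr (real b / (real b + 1))) * (1 + 1) = ennreal (N powr q)"
        unfolding tN[symmetric] by (simp add: ennreal_mult mult.commute)
      finally have "ennreal ((1 / N) powr q) * (\<integral>\<^sup>+x. epow (V1 x ^ b * w x) q \<partial>lborel) \<le> ennreal ((1 / N) powr q) * ennreal (N powr q)"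
        by (rule mult_left_mono) simp
      also have "\<dots> = 1" using N by (simp add: powr_divide flip: ennreal_mult)
      also have "ennreal ((1 / N) powr q) * (\<integral>\<^sup>+x. epow (V1 x ^ b * w x) q \<partial>lborel) = (\<integral>\<^sup>+x. epow (h x) q \<partial>lborel)"
        using N by (simp add: h_def epow_mult[of "ennreal (1/N)"] nn_integral_cmult)
      finally show ?thesis .
    qed
    have Rh: "modular (\<lambda>_. Q) (\<lambda>x. ennreal (1 / C) * R h x) \<le> ennreal 1"
      using C(2)[of h] hq by (simp add: modular_def)
    have Mw: "modular (\<lambda>_. Q) (maxfun w) \<le> ennreal K0"
      using K0(2)[of w] W by (simp add: w_def)
    have bound: "ennreal (2 / l) * difference_bound k V W x
       \<le> ennreal (2 * c * N * C) * (ennreal (1 / C) * R h x) + ennreal (2 * c * m ^ b * e) * maxfun w x" for x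
    proof -
      have "ennreal (2 / l) * difference_bound k V W x
        = potential (\<lambda>\<sigma>. ennreal (exp (- (k * \<sigma>)))) (\<lambda>y. ennreal (2 / l) * (ennreal c * (V y ^ b * W y))) x"
        unfolding difference_bound_def c_def by (rule potential_cmult[symmetric]) measurable
      also have "(\<lambda>y. ennreal (2 / l) * (ennreal c * (V y ^ b * W y))) = (\<lambda>y. ennreal (2 * c) * (V y ^ b * w y))"
      proof
        fix y
        have "ennreal (2 / l) * ennreal c = ennreal (2 * c) * ennreal (1 / l)"
          using l c by (simp flip: ennreal_mult)
        then have "ennreal (2 / l) * ennreal c * (V y ^ b * W y) = ennreal (2 * c) * ennreal (1 / l) * (V y ^ b * W y)"
          by simp
        then show "ennreal (2 / l) * (ennreal c * (V y ^ b * W y)) = ennreal (2 * c) * (V y ^ b * w y)"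
          by (simp only: w_def mult.assoc mult.left_commute[of "ennreal (1 / l)"])
      qed
      also have "potential (\<lambda>\<sigma>. ennreal (exp (- (k * \<sigma>)))) (\<lambda>y. ennreal (2 * c) * (V y ^ b * w y)) x
        = ennreal (2 * c) * (potential (\<lambda>\<sigma>. ennreal (exp (- (k * \<sigma>)))) (\<lambda>y. V1 y ^ b * w y) x
            + potential (\<lambda>\<sigma>. ennreal (exp (- (k * \<sigma>)))) (\<lambda>y. V2 y ^ b * w y) x)"
        unfolding V12 distrib_right by (simp add: potential_cmult potential_add)
      also have "\<dots> \<le> ennreal (2 * c) * (ennreal (N * C) * (ennreal (1 / C) * R h x) + ennreal (m ^ b * e) * maxfun w x)"
      proof (intro mult_left_mono add_mono)
        have "potential (\<lambda>\<sigma>. ennreal (exp (- (k * \<sigma>)))) (\<lambda>y. V1 y ^ b * w y) x \<le> R (\<lambda>y. V1 y ^ b * w y) x"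
          using k(1) by (intro potential_le_R ennreal_le_1[THEN iffD2]) auto
        also have "\<dots> = ennreal N * R h x"
        proof -
          have "(\<lambda>y. V1 y ^ b * w y) = (\<lambda>y. ennreal N * h y)"
            using N by (simp add: h_def mult.assoc[symmetric] flip: ennreal_mult)
          then show ?thesis by (simp only:) (rule potential_cmult, auto)
        qed
        also have "\<dots> = ennreal (N * C) * (ennreal (1 / C) * R h x)"
          using N C(1) by (simp add: mult.assoc[symmetric] flip: ennreal_mult)
        finally show "potential (\<lambda>\<sigma>. ennreal (exp (- (k * \<sigma>)))) (\<lambda>y. V1 y ^ b * w y) x \<le> ennreal (N * C) * (ennreal (1 / C) * R h x)" .
        have "potential (\<lambda>\<sigma>. ennreal (exp (- (k * \<sigma>)))) (\<lambda>y. V2 y ^ b * w y) x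
          \<le> potential (\<lambda>\<sigma>. ennreal (exp (- (k * \<sigma>)))) (\<lambda>y. ennreal (m ^ b) * w y) x"
          by (intro potential_mono mult_right_mono V2m) simp
        also have "\<dots> = ennreal (m ^ b) * potential (\<lambda>\<sigma>. ennreal (exp (- (k * \<sigma>)))) w x"
          by (rule potential_cmult) auto
        also have "\<dots> \<le> ennreal (m ^ b) * (ennreal e * maxfun w x)"
          by (intro mult_left_mono k(2)) auto
        finally show "potential (\<lambda>\<sigma>. ennreal (exp (- (k * \<sigma>)))) (\<lambda>y. V2 y ^ b * w y) x \<le> ennreal (m ^ b * e) * maxfun w x"
          using m(1) e by (simp add: ennreal_mult mult.assoc)
      qed simp
      also have "\<dots> = ennreal (2 * c * N * C) * (ennreal (1 / C) * R h x) + ennreal (2 * c * m ^ b * e) * maxfun w x"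
        using c N C(1) m(1) e by (simp add: distrib_left mult.assoc[symmetric] flip: ennreal_mult)
      finally show ?thesis .
    qed
    have "modular (\<lambda>_. Q) (\<lambda>x. ennreal (2 / l) * difference_bound k V W x)
      \<le> modular (\<lambda>_. Q) (\<lambda>x. ennreal (2 * c * N * C) * (ennreal (1 / C) * R h x) + ennreal (2 * c * m ^ b * e) * maxfun w x)"
      using Q0(1) bound by (rule modular_mono)
    also have "\<dots> \<le> modular (\<lambda>_. Q) (\<lambda>x. 2 * (ennreal (2 * c * N * C) * (ennreal (1 / C) * R h x)))
        + modular (\<lambda>_. Q) (\<lambda>x. 2 * (ennreal (2 * c * m ^ b * e) * maxfun w x))"
      by (rule modular_add) (use Q0 in auto)
    also have "(\<lambda>x. 2 * (ennreal (2 * c * N * C) * (ennreal (1 / C) * R h x))) = (\<lambda>x. ennreal (1 / 2) * (ennreal (1 / C) * R h x))"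
    proof -
      have "ennreal 2 * ennreal (2 * c * N * C) = ennreal (2 * (2 * c * N * C))"
        by (rule ennreal_mult[symmetric]) (use c N C(1) in auto)
      also have "2 * (2 * c * N * C) = 1 / 2" using c C(1) by (simp add: N_def)
      finally show ?thesis by (simp only: mult.assoc[symmetric] ennreal_numeral)
    qed
    also have "(\<lambda>x. 2 * (ennreal (2 * c * m ^ b * e) * maxfun w x)) = (\<lambda>x. ennreal (1 / (2 * K0)) * maxfun w x)"
    proof -
      have "ennreal 2 * ennreal (2 * c * m ^ b * e) = ennreal (2 * (2 * c * m ^ b * e))"
        by (rule ennreal_mult[symmetric]) (use c m(1) e in auto)
      also have "2 * (2 * c * m ^ b * e) = 1 / (2 * K0)" using c m(1) by (simp add: e_def)
      finally show ?thesis by (simp only: mult.assoc[symmetric] ennreal_numeral)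
    qed
    also have "modular (\<lambda>_. Q) (\<lambda>x. ennreal (1 / 2) * (ennreal (1 / C) * R h x)) \<le> ennreal (1 / 2)"
      by (rule modular_scaled_le[OF Qa _ Rh]) auto
    also have "modular (\<lambda>_. Q) (\<lambda>x. ennreal (1 / (2 * K0)) * maxfun w x) \<le> ennreal (1 / 2)"
      by (rule modular_scaled_le[OF Qa _ Mw]) (use K0(1) in auto)
    also have "ennreal (1 / 2) + ennreal (1 / 2) = 1" by (subst ennreal_plus[symmetric]) auto
    finally show "modular (\<lambda>_. Q) (\<lambda>x. ennreal (2 / l) * difference_bound k V W x) \<le> 1"
      by (simp add: add_left_mono add_right_mono)
  qed
qed

lemma potential_power_finite_AE:
  assumes [measurable]: "V \<in> borel_measurable borel" and l: "0 < l"
    and V: "modular (\<lambda>_. Q) (\<lambda>x. ennreal (1 / l) * V x) \<le> 1"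
  shows "AE x in lborel. R (\<lambda>y. V y ^ Suc b) x < top"
proof -
  have Qa: "admissible (\<lambda>_. Q)" by (rule admissible_const[OF Q_gt])
  obtain C where C: "1 \<le> C" "\<And>h. h \<in> borel_measurable borel \<Longrightarrow> (\<integral>\<^sup>+y. epow (h y) q \<partial>lborel) \<le> 1 \<Longrightarrow>
      modular (\<lambda>x. Q / (real b + 1)) h \<le> 1 \<Longrightarrow> modular (\<lambda>_. Q) (\<lambda>x. ennreal (1 / C) * R h x) \<le> 1"
    using R_modular_bound[OF Qa] by blast
  define h where "h = (\<lambda>x. (ennreal (1 / l) * V x) ^ (b + 1))"
  have [measurable]: "h \<in> borel_measurable borel" unfolding h_def by measurable
  have hm: "modular (\<lambda>x. Q / (real b + 1)) h \<le> 1"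
    unfolding h_def modular_power_scaled[OF l] by (rule V)
  have "modular (\<lambda>_. Q) (\<lambda>x. ennreal (1 / C) * R h x) \<le> 1"
    using C(2)[of h] hm by (simp add: modular_def)
  then have "(\<integral>\<^sup>+x. epow (ennreal (1 / C) * R h x) Q \<partial>lborel) \<noteq> \<infinity>"
    by (auto simp: modular_def top_unique)
  then have "AE x in lborel. epow (ennreal (1 / C) * R h x) Q \<noteq> \<infinity>"
    by (intro nn_integral_PInf_AE) auto
  moreover have "R (\<lambda>y. V y ^ Suc b) x = ennreal (l ^ Suc b) * R h x" for x
  proof -
    have "V y ^ Suc b = ennreal (l ^ Suc b) * h y" for y
    proof -
      have "ennreal (l ^ Suc b) * h y = (ennreal l * (ennreal (1 / l) * V y)) ^ Suc b"
        using l by (simp only: h_def power_mult_distrib ennreal_power less_imp_le Suc_eq_plus1)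
      also have "ennreal l * (ennreal (1 / l) * V y) = V y"
        using l by (simp add: mult.assoc[symmetric] flip: ennreal_mult)
      finally show ?thesis by simp
    qed
    then show ?thesis by (simp only:) (rule potential_cmult, auto)
  qed
  ultimately show ?thesis
  proof (elim eventually_mono)
    fix x assume "epow (ennreal (1 / C) * R h x) Q \<noteq> \<infinity>"
      and eq: "\<And>x. R (\<lambda>y. V y ^ Suc b) x = ennreal (l ^ Suc b) * R h x"
    then have "R h x \<noteq> top" using C(1) by (auto simp: ennreal_mult_eq_top_iff)
    then show "R (\<lambda>y. V y ^ Suc b) x < top"
      unfolding eq by (simp add: less_top[symmetric] ennreal_mult_eq_top_iff del: power_Suc)
  qed
qed

text \<open>Starting from \<open>2 * V\<close>, the bound for the difference of two solutions improves by a factor of two in \<open>L^Q\<close>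
  with every iteration.\<close>

primrec difference_majorant :: "real \<Rightarrow> ('a \<Rightarrow> ennreal) \<Rightarrow> nat \<Rightarrow> 'a \<Rightarrow> ennreal" where
  "difference_majorant k V 0 = (\<lambda>x. 2 * V x)"
| "difference_majorant k V (Suc j) = difference_bound k V (difference_majorant k V j)"

lemma borel_measurable_difference_majorant [measurable]:
  assumes [measurable]: "V \<in> borel_measurable borel"
  shows "difference_majorant k V j \<in> borel_measurable borel"
  by (induction j) auto

lemma difference_majorant_vanishes:
  assumes [measurable]: "V \<in> borel_measurable borel" and l: "0 < l"
    and V: "modular (\<lambda>_. Q) (\<lambda>x. ennreal (1 / l) * V x) \<le> 1"
  obtains k where "0 < k" "AE x in lborel. (INF j. difference_majorant k V (Suc j) x) = 0"
proof -
  have Q1: "1 \<le> Q" "0 < Q" using Q_gt b by linarith+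
  have "epow (V x) Q = ennreal (l powr Q) * epow (ennreal (1 / l) * V x) Q" for x
    using l by (simp add: epow_mult powr_divide mult.assoc[symmetric] flip: ennreal_mult)
  then have "(\<integral>\<^sup>+x. epow (V x) Q \<partial>lborel) = ennreal (l powr Q) * modular (\<lambda>_. Q) (\<lambda>x. ennreal (1 / l) * V x)"
    by (simp add: modular_def nn_integral_cmult)
  also have "\<dots> < top" using V by (auto simp: ennreal_mult_less_top intro: le_less_trans)
  finally have fin: "(\<integral>\<^sup>+x. epow (V x) Q \<partial>lborel) < top" .
  obtain k where k: "0 < k" "\<And>W l. W \<in> borel_measurable borel \<Longrightarrow> 0 < l \<Longrightarrow>
    modular (\<lambda>_. Q) (\<lambda>x. ennreal (1 / l) * W x) \<le> 1 \<Longrightarrow>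
    modular (\<lambda>_. Q) (\<lambda>x. ennreal (2 / l) * difference_bound k V W x) \<le> 1"
    using difference_bound_contraction[OF _ fin] by auto
  define L where "L = (\<lambda>j. 2 * l / 2 ^ j)"
  have L: "0 < L j" for j using l by (simp add: L_def)
  have mod: "modular (\<lambda>_. Q) (\<lambda>x. ennreal (1 / L j) * difference_majorant k V j x) \<le> 1" for j
  proof (induction j)
    case 0
    have "ennreal (1 / (2 * l)) * (2 * V x) = ennreal (1 / l) * V x" for x
    proof -
      have "ennreal (1 / (2 * l)) * ennreal 2 = ennreal (1 / l)"
        using l by (subst ennreal_mult[symmetric]) auto
      then show ?thesis by (simp only: mult.assoc[symmetric] ennreal_numeral)
    qed
    then show ?case using V by (simp add: L_def)
  next
    case (Suc j)
    have "1 / L (Suc j) = 2 / L j" by (simp add: L_def)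
    then show ?case using k(2)[OF _ L Suc] by simp
  qed
  define I where "I = (\<lambda>x. INF j. difference_majorant k V (Suc j) x)"
  have [measurable]: "I \<in> borel_measurable borel" unfolding I_def by measurable
  have le: "(\<integral>\<^sup>+x. epow (I x) Q \<partial>lborel) \<le> ennreal (L j powr Q)" if j: "1 \<le> j" for j
  proof -
    obtain i where i: "j = Suc i" using j by (cases j) auto
    have "(\<integral>\<^sup>+x. epow (I x) Q \<partial>lborel) \<le> (\<integral>\<^sup>+x. epow (difference_majorant k V j x) Q \<partial>lborel)"
      using Q1 unfolding I_def i by (intro nn_integral_mono epow_mono INF_lower) auto
    also have "\<dots> = (\<integral>\<^sup>+x. ennreal (L j powr Q) * epow (ennreal (1 / L j) * difference_majorant k V j x) Q \<partial>lborel)"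
      using L[of j] by (simp add: epow_mult powr_divide mult.assoc[symmetric] flip: ennreal_mult)
    also have "\<dots> = ennreal (L j powr Q) * modular (\<lambda>_. Q) (\<lambda>x. ennreal (1 / L j) * difference_majorant k V j x)"
      by (simp add: modular_def nn_integral_cmult)
    also have "\<dots> \<le> ennreal (L j powr Q) * 1" by (intro mult_left_mono mod) simp
    finally show ?thesis by simp
  qed
  have "(\<lambda>j. ennreal (L j powr Q)) \<longlonglongrightarrow> ennreal (0 powr Q)"
  proof (intro tendsto_ennrealI tendsto_powr')
    have "(\<lambda>j. 2 * l * inverse (2 ^ j)) \<longlonglongrightarrow> 2 * l * 0"
      by (intro tendsto_mult tendsto_const LIMSEQ_inverse_realpow_zero) simp
    then show "L \<longlonglongrightarrow> 0" by (simp add: L_def divide_inverse)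
  qed (use Q1 in \<open>auto intro!: always_eventually less_imp_le L\<close>)
  then have "(\<integral>\<^sup>+x. epow (I x) Q \<partial>lborel) \<le> ennreal (0 powr Q)"
    by (rule LIMSEQ_le_const) (use le in auto)
  then have "(\<integral>\<^sup>+x. epow (I x) Q \<partial>lborel) = 0" by simp
  then have "AE x in lborel. I x = 0" by (subst (asm) nn_integral_0_iff_AE) auto
  then show ?thesis using that[OF k(1)] by (simp only: I_def)
qed

text \<open>The growth \<open>exp (k * s)\<close> of the bound at time \<open>s\<close> is \<open>exp (k * t) * exp (- (k * (t - s)))\<close>: the second
  factor becomes the weight in the potential.\<close>

lemma duhamel_op_difference_le:
  assumes um: "case_prod u \<in> borel_measurable (borel \<Otimes>\<^sub>M borel)" and vm: "case_prod v \<in> borel_measurable (borel \<Otimes>\<^sub>M borel)"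
    and [measurable]: "V \<in> borel_measurable borel" "W \<in> borel_measurable borel"
    and uV: "\<And>s y. ennreal \<bar>u s y\<bar> \<le> V y" and vV: "\<And>s y. ennreal \<bar>v s y\<bar> \<le> V y"
    and fin: "R (\<lambda>y. V y ^ Suc b) x < top"
    and W: "AE s in lborel. 0 < s \<and> s < t \<longrightarrow> (AE y in lborel. ennreal \<bar>u s y - v s y\<bar> \<le> ennreal (exp (k * s)) * W y)"
  shows "ennreal \<bar>duhamel_op (\<lambda>s y. signed_power b (u s y)) t x - duhamel_op (\<lambda>s y. signed_power b (v s y)) t x\<bar>
    \<le> ennreal (exp (k * t)) * difference_bound k V W x"
proof -
  define c where "c = ennreal (real (Suc b) * 3 ^ b)"
  have NV: "ennreal \<bar>signed_power b (f s y)\<bar> \<le> V y ^ Suc b" if "\<And>s y. ennreal \<bar>f s y\<bar> \<le> V y" for f s y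
    using power_mono[OF that[of s y], of "Suc b"] by (simp add: abs_signed_power ennreal_power del: power_Suc)
  have uN: "ennreal \<bar>signed_power b (u s y)\<bar> \<le> V y ^ Suc b"
    and vN: "ennreal \<bar>signed_power b (v s y)\<bar> \<le> V y ^ Suc b" for s y
    by (rule NV, rule uV, rule NV, rule vV)
  have mN: "case_prod (\<lambda>s y. signed_power b (u s y)) \<in> borel_measurable (borel \<Otimes>\<^sub>M borel)"
      "case_prod (\<lambda>s y. signed_power b (v s y)) \<in> borel_measurable (borel \<Otimes>\<^sub>M borel)"
    by (rule borel_measurable_signed_power_prod[OF um], rule borel_measurable_signed_power_prod[OF vm])
  have [measurable]: "(\<lambda>z. u (fst z) (snd z)) \<in> borel_measurable (borel \<Otimes>\<^sub>M borel)"
    "(\<lambda>z. v (fst z) (snd z)) \<in> borel_measurable (borel \<Otimes>\<^sub>M borel)"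
    using um vm by (simp_all add: case_prod_beta' del: borel_prod)
  have lip: "ennreal \<bar>signed_power b (u s y) - signed_power b (v s y)\<bar> \<le> c * (V y ^ b * ennreal \<bar>u s y - v s y\<bar>)" for s y
  proof (cases "V y")
    case (real r)
    have "\<bar>signed_power b (u s y) - signed_power b (v s y)\<bar> \<le> real (Suc b) * 3 ^ b * r ^ b * \<bar>u s y - v s y\<bar>"
      by (rule signed_power_lipschitz) (use uV[of s y] vV[of s y] real in auto)
    then have "ennreal \<bar>signed_power b (u s y) - signed_power b (v s y)\<bar> \<le> ennreal (real (Suc b) * 3 ^ b * (r ^ b * \<bar>u s y - v s y\<bar>))"
      by (intro ennreal_leI) (simp add: mult.assoc)
    also have "\<dots> = c * (V y ^ b * ennreal \<bar>u s y - v s y\<bar>)"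
      unfolding real c_def ennreal_power[OF \<open>0 \<le> r\<close>] using \<open>0 \<le> r\<close>
      by (simp only: ennreal_mult[symmetric] mult_nonneg_nonneg zero_le_power abs_ge_zero of_nat_0_le_iff zero_le_numeral)
    finally show ?thesis .
  next
    case top
    show ?thesis
    proof (cases "u s y = v s y")
      case False
      have "c \<noteq> 0" by (simp add: c_def add_pos_nonneg)
      then show ?thesis using top False b
        by (simp add: ennreal_top_mult ennreal_mult_top power_eq_top_ennreal ennreal_mult_eq_top_iff)
    qed simp
  qed
  have "duhamel_op (\<lambda>s y. signed_power b (u s y)) t x - duhamel_op (\<lambda>s y. signed_power b (v s y)) t x
    = (LINT z|(lborel \<Otimes>\<^sub>M lborel). duhamel_kernel t x (fst z) (snd z) * (signed_power b (u (fst z) (snd z)) - signed_power b (v (fst z) (snd z))))"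
    unfolding duhamel_op_def right_diff_distrib
    by (rule Bochner_Integration.integral_diff[symmetric])
       (auto intro: duhamel_op_integrable[OF _ mN(1) uN fin] duhamel_op_integrable[OF _ mN(2) vN fin] simp del: power_Suc)
  then have "ennreal \<bar>duhamel_op (\<lambda>s y. signed_power b (u s y)) t x - duhamel_op (\<lambda>s y. signed_power b (v s y)) t x\<bar>
    \<le> (\<integral>\<^sup>+z. ennreal \<bar>duhamel_kernel t x (fst z) (snd z) * (signed_power b (u (fst z) (snd z)) - signed_power b (v (fst z) (snd z)))\<bar> \<partial>(lborel \<Otimes>\<^sub>M lborel))"
    using ennreal_abs_integral_le by simp
  also have "\<dots> = (\<integral>\<^sup>+s. (\<integral>\<^sup>+y. ennreal \<bar>duhamel_kernel t x s y * (signed_power b (u s y) - signed_power b (v s y))\<bar> \<partial>lborel) \<partial>lborel)"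
    by (subst lborel.nn_integral_fst[symmetric]) auto
  also have "\<dots> \<le> (\<integral>\<^sup>+s. (\<integral>\<^sup>+y. ennreal (exp (k * t)) * (ennreal \<bar>duhamel_kernel t x s y\<bar> * (ennreal (exp (- (k * (t - s)))) * (c * (V y ^ b * W y)))) \<partial>lborel) \<partial>lborel)"
  proof (rule nn_integral_mono_AE)
    show "AE s in lborel. (\<integral>\<^sup>+y. ennreal \<bar>duhamel_kernel t x s y * (signed_power b (u s y) - signed_power b (v s y))\<bar> \<partial>lborel)
      \<le> (\<integral>\<^sup>+y. ennreal (exp (k * t)) * (ennreal \<bar>duhamel_kernel t x s y\<bar> * (ennreal (exp (- (k * (t - s)))) * (c * (V y ^ b * W y)))) \<partial>lborel)"
      using W
    proof eventually_elim
      case (elim s)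
      show ?case
      proof (cases "0 < s \<and> s < t")
        case True
        with elim have ae: "AE y in lborel. ennreal \<bar>u s y - v s y\<bar> \<le> ennreal (exp (k * s)) * W y" by simp
        have ex: "ennreal (exp (k * s)) = ennreal (exp (k * t)) * ennreal (exp (- (k * (t - s))))"
          by (simp add: algebra_simps flip: ennreal_mult exp_add)
        show ?thesis
        proof (rule nn_integral_mono_AE)
          show "AE y in lborel. ennreal \<bar>duhamel_kernel t x s y * (signed_power b (u s y) - signed_power b (v s y))\<bar>
            \<le> ennreal (exp (k * t)) * (ennreal \<bar>duhamel_kernel t x s y\<bar> * (ennreal (exp (- (k * (t - s)))) * (c * (V y ^ b * W y))))"
            using ae
          proof eventually_elim
            case (elim y)
            have "ennreal \<bar>duhamel_kernel t x s y * (signed_power b (u s y) - signed_power b (v s y))\<bar>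
              = ennreal \<bar>duhamel_kernel t x s y\<bar> * ennreal \<bar>signed_power b (u s y) - signed_power b (v s y)\<bar>"
              by (simp add: abs_mult ennreal_mult)
            also have "\<dots> \<le> ennreal \<bar>duhamel_kernel t x s y\<bar> * (c * (V y ^ b * (ennreal (exp (k * s)) * W y)))"
              using elim by (intro mult_left_mono order_trans[OF lip]) auto
            also have "\<dots> = ennreal (exp (k * t)) * (ennreal \<bar>duhamel_kernel t x s y\<bar> * (ennreal (exp (- (k * (t - s)))) * (c * (V y ^ b * W y))))"
              unfolding ex by (simp only: mult_ac)
            finally show ?case .
          qed
        qed
      next
        case False
        then have "duhamel_kernel t x s y = 0" for y by (auto simp: duhamel_kernel_def)
        then show ?thesis by simp
      qed
    qed
  qed
  also have "\<dots> = (\<integral>\<^sup>+z. ennreal (exp (k * t)) * (ennreal \<bar>duhamel_kernel t x (fst z) (snd z)\<bar> * (ennreal (exp (- (k * (t - fst z)))) * (c * (V (snd z) ^ b * W (snd z))))) \<partial>(lborel \<Otimes>\<^sub>M lborel))"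
    by (subst lborel.nn_integral_fst[symmetric]) auto
  also have "\<dots> = ennreal (exp (k * t)) * (\<integral>\<^sup>+z. ennreal \<bar>duhamel_kernel t x (fst z) (snd z)\<bar> * (ennreal (exp (- (k * (t - fst z)))) * (c * (V (snd z) ^ b * W (snd z)))) \<partial>(lborel \<Otimes>\<^sub>M lborel))"
    by (rule nn_integral_cmult) measurable
  also have "\<dots> \<le> ennreal (exp (k * t)) * difference_bound k V W x"
    unfolding difference_bound_def c_def
    by (intro mult_left_mono duhamel_kernel_potential[where w="\<lambda>\<sigma>. ennreal (exp (- (k * \<sigma>)))"]) auto
  finally show ?thesis .
qed

text \<open>The difference \<open>d\<close> is given at every time of \<open>J\<close>, but the Borel representatives \<open>u\<close> and \<open>v\<close> agree with the
  solutions at almost every time only. This suffices, since the Duhamel integral ignores null sets of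
  times, and the conclusion is recovered at every time from the integral equation.\<close>

theorem difference_vanishes:
  assumes um: "case_prod u \<in> borel_measurable (borel \<Otimes>\<^sub>M borel)" and vm: "case_prod v \<in> borel_measurable (borel \<Otimes>\<^sub>M borel)"
    and Vm [measurable]: "V \<in> borel_measurable borel"
    and uV: "\<And>s y. ennreal \<bar>u s y\<bar> \<le> V y" and vV: "\<And>s y. ennreal \<bar>v s y\<bar> \<le> V y"
    and l: "0 < l" and V: "modular (\<lambda>_. Q) (\<lambda>x. ennreal (1 / l) * V x) \<le> 1"
    and J: "\<And>s t. 0 < s \<Longrightarrow> s < t \<Longrightarrow> t \<in> J \<Longrightarrow> s \<in> J"
    and eq: "\<And>t. t \<in> J \<Longrightarrow> AE x in lborel. d t x = duhamel_op (\<lambda>s y. signed_power b (u s y)) t x - duhamel_op (\<lambda>s y. signed_power b (v s y)) t x"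
    and rep: "AE t in lborel. t \<in> J \<longrightarrow> (AE x in lborel. d t x = u t x - v t x)"
    and t: "t \<in> J"
  shows "AE x in lborel. d t x = 0"
proof -
  obtain k where k: "0 < k" "AE x in lborel. (INF j. difference_majorant k V (Suc j) x) = 0"
    using difference_majorant_vanishes[OF Vm l V] by blast
  have fin: "AE x in lborel. R (\<lambda>y. V y ^ Suc b) x < top"
    by (rule potential_power_finite_AE[OF Vm l V])
  have step: "AE x in lborel. ennreal \<bar>d t x\<bar> \<le> ennreal (exp (k * t)) * difference_majorant k V (Suc j) x"
    if t: "t \<in> J" and W: "AE s in lborel. s \<in> J \<longrightarrow> (AE y in lborel. 0 < s \<longrightarrow> ennreal \<bar>u s y - v s y\<bar> \<le> ennreal (exp (k * s)) * difference_majorant k V j y)"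
    for t j
  proof -
    have W': "AE s in lborel. 0 < s \<and> s < t \<longrightarrow> (AE y in lborel. ennreal \<bar>u s y - v s y\<bar> \<le> ennreal (exp (k * s)) * difference_majorant k V j y)"
      using W by eventually_elim (use J t in auto)
    show ?thesis
      using fin eq[OF t]
    proof eventually_elim
      case (elim x)
      show ?case
        using duhamel_op_difference_le[OF um vm Vm _ uV vV elim(1) W'] elim(2) by simp
    qed
  qed
  have claim: "AE s in lborel. s \<in> J \<longrightarrow> (AE y in lborel. 0 < s \<longrightarrow> ennreal \<bar>u s y - v s y\<bar> \<le> ennreal (exp (k * s)) * difference_majorant k V j y)" for j
  proof (induction j)
    case 0
    have "ennreal \<bar>u s y - v s y\<bar> \<le> ennreal (exp (k * s)) * (2 * V y)" if s: "0 < s" for s y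
    proof -
      have "ennreal \<bar>u s y - v s y\<bar> \<le> ennreal (\<bar>u s y\<bar> + \<bar>v s y\<bar>)" by (intro ennreal_leI) simp
      also have "\<dots> = ennreal \<bar>u s y\<bar> + ennreal \<bar>v s y\<bar>" by simp
      also have "\<dots> \<le> V y + V y" by (intro add_mono uV vV)
      also have "\<dots> = 1 * (2 * V y)" by (simp add: mult_2)
      also have "\<dots> \<le> ennreal (exp (k * s)) * (2 * V y)" using k(1) s by (intro mult_right_mono) auto
      finally show ?thesis .
    qed
    then show ?case by simp
  next
    case (Suc j)
    show ?case
      using rep
    proof eventually_elim
      case (elim s)
      show ?case
      proof
        assume s: "s \<in> J"
        have "AE x in lborel. d s x = u s x - v s x" using elim s by simp
        moreover have "AE x in lborel. ennreal \<bar>d s x\<bar> \<le> ennreal (exp (k * s)) * difference_majorant k V (Suc j) x"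
          by (rule step[OF s Suc])
        ultimately show "AE y in lborel. 0 < s \<longrightarrow> ennreal \<bar>u s y - v s y\<bar> \<le> ennreal (exp (k * s)) * difference_majorant k V (Suc j) y"
          by eventually_elim simp
      qed
    qed
  qed
  have "AE x in lborel. \<forall>j. ennreal \<bar>d t x\<bar> \<le> ennreal (exp (k * t)) * difference_majorant k V (Suc j) x"
    unfolding AE_all_countable using step[OF t claim] by blast
  then show ?thesis
    using k(2)
  proof eventually_elim
    case (elim x)
    have le0: "ennreal (exp (- (k * t))) * ennreal \<bar>d t x\<bar> \<le> difference_majorant k V (Suc j) x" for j
    proof -
      have "ennreal (exp (- (k * t))) * ennreal \<bar>d t x\<bar>
        \<le> ennreal (exp (- (k * t))) * (ennreal (exp (k * t)) * difference_majorant k V (Suc j) x)"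
        using elim(1) by (intro mult_left_mono) auto
      also have "ennreal (exp (- (k * t))) * (ennreal (exp (k * t)) * difference_majorant k V (Suc j) x) = difference_majorant k V (Suc j) x"
        by (simp add: mult.assoc[symmetric] flip: ennreal_mult exp_add)
      finally show ?thesis .
    qed
    have "ennreal (exp (- (k * t))) * ennreal \<bar>d t x\<bar> \<le> (INF j. difference_majorant k V (Suc j) x)"
      using le0 by (intro INF_greatest) simp
    then have "ennreal (exp (- (k * t)) * \<bar>d t x\<bar>) \<le> 0" using elim(2) by (simp add: ennreal_mult)
    then show ?case by (simp add: mult_le_0_iff)
  qed
qed

end

section \<open>Lebesgue measurable functions and Borel representatives\<close>

lemma lebesgue_measurable_cong_AE:
  fixes f g :: "'a::euclidean_space \<Rightarrow> 'b::topological_space"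
  assumes g: "g \<in> borel_measurable borel" and eq: "AE x in lborel. f x = g x"
  shows "f \<in> borel_measurable lebesgue"
proof (rule measurableI)
  fix A :: "'b set" assume A: "A \<in> sets borel"
  have "AE x in lebesgue. x \<in> g -` A \<longleftrightarrow> x \<in> f -` A"
    unfolding AE_completion_iff using eq by eventually_elim auto
  moreover have "g -` A \<in> sets lebesgue"
    using measurable_sets[OF g A] by (auto simp: sets_completionI_sets)
  ultimately show "f -` A \<inter> space lebesgue \<in> sets lebesgue"
    using completion.in_sets_AE[where M=lborel and A="g -` A" and B="f -` A"] by simp
qed simp

lemma borel_representative:
  fixes f :: "'a::euclidean_space \<Rightarrow> real"
  assumes "f \<in> borel_measurable lebesgue"
  obtains g where "g \<in> borel_measurable borel" "AE x in lborel. f x = g x"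
  using completion_ex_borel_measurable_real[OF assms] by auto

lemma lebesgue_integral_cong_lborel:
  fixes f g :: "'a::euclidean_space \<Rightarrow> real"
  assumes g: "g \<in> borel_measurable borel" and eq: "AE x in lborel. f x = g x"
  shows "integrable lebesgue f \<longleftrightarrow> integrable lborel g" "(LINT x|lebesgue. f x) = (LINT x|lborel. g x)"
proof -
  have f: "f \<in> borel_measurable lebesgue" by (rule lebesgue_measurable_cong_AE[OF g eq])
  have g': "g \<in> borel_measurable lebesgue" using g by (intro measurable_completion) simp
  have eq': "AE x in lebesgue. f x = g x" unfolding AE_completion_iff by (rule eq)
  have "integrable lebesgue f \<longleftrightarrow> integrable lebesgue g" by (rule integrable_cong_AE[OF f g' eq'])
  also have "\<dots> \<longleftrightarrow> integrable lborel g" using g by (intro integrable_completion) simp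
  finally show "integrable lebesgue f \<longleftrightarrow> integrable lborel g" .
  have "(LINT x|lebesgue. f x) = (LINT x|lebesgue. g x)" by (rule integral_cong_AE[OF f g' eq'])
  also have "\<dots> = (LINT x|lborel. g x)" using g by (intro integral_completion) simp
  finally show "(LINT x|lebesgue. f x) = (LINT x|lborel. g x)" .
qed

lemma lebesgue_on_AE_iff:
  fixes S :: "real set"
  assumes "S \<in> sets borel"
  shows "(AE t in lebesgue_on S. P t) \<longleftrightarrow> (AE t in lborel. t \<in> S \<longrightarrow> P t)"
  using assms by (subst AE_restrict_space_iff) (auto simp: AE_completion_iff)

lemma time_interval_borel [measurable, simp]: "time_interval T \<in> sets borel"
  unfolding time_interval_def by measurable

lemma AE_pair_lborel:
  fixes P :: "real \<Rightarrow> 'a::euclidean_space \<Rightarrow> bool"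
  assumes "AE z in lborel. P (fst z) (snd z)"
  shows "AE t in lborel. AE x in lborel. P t x" "AE x in lborel. AE t in lborel. P t x"
proof -
  from assms obtain N where N: "N \<in> null_sets (lborel \<Otimes>\<^sub>M (lborel :: 'a measure) :: (real \<times> 'a) measure)"
    "{z. \<not> P (fst z) (snd z)} \<subseteq> N"
    unfolding lborel_prod eventually_ae_filter by auto
  have "AE z in lborel \<Otimes>\<^sub>M lborel. z \<notin> N" using N(1) by (rule AE_not_in)
  then have "AE z in lborel \<Otimes>\<^sub>M lborel. (\<lambda>z. (fst z, snd z) \<notin> N) z" by simp
  then have 1: "AE t in lborel. AE x in lborel. (t, x) \<notin> N"
    by (drule_tac lborel_pair.AE_pair) simp
  have "{z \<in> space (lborel \<Otimes>\<^sub>M lborel). (fst z, snd z) \<notin> N} = space (lborel \<Otimes>\<^sub>M (lborel :: 'a measure)) - N"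
    by auto
  also have "\<dots> \<in> sets (lborel \<Otimes>\<^sub>M (lborel :: 'a measure) :: (real \<times> 'a) measure)"
    by (rule sets.compl_sets[OF null_setsD2[OF N(1)]])
  finally have "{z \<in> space (lborel \<Otimes>\<^sub>M lborel). (fst z, snd z) \<notin> N} \<in> sets (lborel \<Otimes>\<^sub>M (lborel :: 'a measure) :: (real \<times> 'a) measure)" .
  from lborel_pair.AE_commute[OF this] 1 have 2: "AE x in lborel. AE t in lborel. (t, x) \<notin> N" by simp
  show "AE t in lborel. AE x in lborel. P t x"
    using 1
  proof eventually_elim
    case (elim t)
    then show ?case by eventually_elim (use subsetD[OF N(2), of "(t, _)"] in auto)
  qed
  show "AE x in lborel. AE t in lborel. P t x"
    using 2
  proof eventually_elim
    case (elim x)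
    then show ?case by eventually_elim (use subsetD[OF N(2), of "(_, x)"] in auto)
  qed
qed

text \<open>Setting \<open>G\<close> to 0 where it exceeds \<open>\<bar>H\<bar>\<close> makes the bound hold everywhere. This changes \<open>G\<close> on a null set
  only: for almost every \<open>x\<close> the bound holds at almost every time, by definition of the essential
  supremum, and Fubini's theorem exchanges the two quantifiers.\<close>

lemma time_space_representative:
  fixes F :: "real \<Rightarrow> real^'n \<Rightarrow> real"
  assumes F: "F \<in> mixed_time_space p q T"
  obtains G H where "case_prod G \<in> borel_measurable (borel \<Otimes>\<^sub>M borel)" "H \<in> borel_measurable borel"
    "\<And>t x. \<bar>G t x\<bar> \<le> \<bar>H x\<bar>" "AE x in lborel. real_of_ereal (time_sup T F x) = H x"
    "AE t in lborel. t \<in> time_interval T \<longrightarrow> (AE x in lborel. F t x = G t x)"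
proof -
  define I where "I = time_interval T"
  have I [measurable]: "I \<in> sets borel" by (simp add: I_def)
  have Fm: "(\<lambda>(t, x). F t x) \<in> borel_measurable (lebesgue_on (I \<times> UNIV))"
    and fin: "AE x in lebesgue. time_sup T F x < \<infinity>"
    and S: "(\<lambda>x. real_of_ereal (time_sup T F x)) \<in> borel_measurable lebesgue"
    using F by (auto simp: mixed_time_space_def mixed_space_def I_def)
  have "I \<times> (UNIV :: (real^'n) set) \<in> sets (borel \<Otimes>\<^sub>M borel)" by (intro pair_measureI) auto
  then have IU: "I \<times> (UNIV :: (real^'n) set) \<in> sets lebesgue"
    unfolding borel_prod by (intro sets_completionI_sets) simp
  have "(\<lambda>z. if z \<in> I \<times> UNIV then (\<lambda>(t, x). F t x) z else 0) \<in> borel_measurable lebesgue"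
    by (rule borel_measurable_if_I[OF Fm IU])
  then obtain g where g: "g \<in> borel_measurable borel"
    "AE z in lborel. (if z \<in> I \<times> UNIV then (\<lambda>(t, x). F t x) z else 0) = g z"
    by (rule borel_representative)
  obtain H where H [measurable]: "H \<in> borel_measurable borel" and SH: "AE x in lborel. real_of_ereal (time_sup T F x) = H x"
    using S by (rule borel_representative)
  define g' where "g' = (\<lambda>t x. g (t, x))"
  have gm: "case_prod g' \<in> borel_measurable (borel \<Otimes>\<^sub>M borel)"
    using g(1) by (simp add: g'_def borel_prod)
  then have [measurable]: "(\<lambda>z. g' (fst z) (snd z)) \<in> borel_measurable (borel \<Otimes>\<^sub>M borel)"
    by (simp add: case_prod_beta' del: borel_prod)
  have "AE z in lborel. fst z \<in> I \<longrightarrow> F (fst z) (snd z) = g' (fst z) (snd z)"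
    using g(2) by eventually_elim (auto simp: g'_def split: prod.splits)
  note Fg = AE_pair_lborel[of "\<lambda>t x. t \<in> I \<longrightarrow> F t x = g' t x", OF this]
  have bound: "AE x in lborel. AE t in lborel. t \<in> I \<longrightarrow> \<bar>g' t x\<bar> \<le> \<bar>H x\<bar>"
    using SH Fg(2) fin[unfolded AE_completion_iff]
  proof eventually_elim
    case (elim x)
    have "AE t in lebesgue_on I. ereal \<bar>F t x\<bar> \<le> time_sup T F x"
      unfolding time_sup_def I_def by (rule esssup_AE)
    then have "AE t in lborel. t \<in> I \<longrightarrow> ereal \<bar>F t x\<bar> \<le> time_sup T F x"
      by (simp add: lebesgue_on_AE_iff)
    then show ?case
      using elim(2)
    proof eventually_elim
      case (elim t)
      show ?case
      proof
        assume t: "t \<in> I"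
        then have "ereal \<bar>g' t x\<bar> \<le> time_sup T F x" using elim by simp
        then have "\<bar>g' t x\<bar> \<le> real_of_ereal (time_sup T F x)"
          using \<open>time_sup T F x < \<infinity>\<close> by (cases "time_sup T F x") auto
        then show "\<bar>g' t x\<bar> \<le> \<bar>H x\<bar>" using \<open>real_of_ereal (time_sup T F x) = H x\<close> by simp
      qed
    qed
  qed
  have "{z \<in> space (lborel \<Otimes>\<^sub>M lborel). fst z \<in> I \<longrightarrow> \<bar>g' (fst z) (snd z)\<bar> \<le> \<bar>H (snd z)\<bar>} \<in> sets (lborel \<Otimes>\<^sub>M lborel)"
    by measurable
  from lborel_pair.AE_commute[OF this] bound
  have bound': "AE t in lborel. AE x in lborel. t \<in> I \<longrightarrow> \<bar>g' t x\<bar> \<le> \<bar>H x\<bar>" by simp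
  define G where "G = (\<lambda>t x. if \<bar>g' t x\<bar> \<le> \<bar>H x\<bar> then g' t x else 0)"
  have "(\<lambda>z. if \<bar>g' (fst z) (snd z)\<bar> \<le> \<bar>H (snd z)\<bar> then g' (fst z) (snd z) else 0) \<in> borel_measurable (borel \<Otimes>\<^sub>M borel)"
    by measurable
  then have "case_prod G \<in> borel_measurable (borel \<Otimes>\<^sub>M borel)"
    by (simp add: G_def case_prod_beta' del: borel_prod)
  moreover have "\<bar>G t x\<bar> \<le> \<bar>H x\<bar>" for t x by (simp add: G_def)
  moreover have "AE t in lborel. t \<in> I \<longrightarrow> (AE x in lborel. F t x = G t x)"
    using bound' Fg(1)
  proof eventually_elim
    case (elim t)
    show ?case
    proof
      assume t: "t \<in> I"
      show "AE x in lborel. F t x = G t x"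
        using elim by eventually_elim (use t in \<open>auto simp: G_def\<close>)
    qed
  qed
  ultimately show ?thesis using that[of G H] H SH by (simp add: I_def)
qed

section \<open>Norms and modulars\<close>

lemma luxemburg_norm_imp_modular:
  fixes f :: "real^'n \<Rightarrow> real"
  assumes f: "AE x in lborel. f x = g x" and e: "luxemburg_norm p f < ennreal e" and p: "\<And>x. 0 \<le> p x"
  shows "modular p (\<lambda>x. ennreal (1 / e) * ennreal \<bar>g x\<bar>) \<le> 1"
proof -
  obtain l where l: "0 < l" "ennreal l < ennreal e" "(\<integral>\<^sup>+x. ennreal (\<bar>f x / l\<bar> powr p x) \<partial>lebesgue) \<le> 1"
    using e unfolding luxemburg_norm_def Inf_less_iff by auto
  have le: "l < e" using l by (simp add: ennreal_less_iff)
  have "modular p (\<lambda>x. ennreal (1 / e) * ennreal \<bar>g x\<bar>) \<le> (\<integral>\<^sup>+x. ennreal (\<bar>f x / l\<bar> powr p x) \<partial>lborel)"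
    unfolding modular_def
  proof (rule nn_integral_mono_AE)
    show "AE x in lborel. epow (ennreal (1 / e) * ennreal \<bar>g x\<bar>) (p x) \<le> ennreal (\<bar>f x / l\<bar> powr p x)"
      using f
    proof eventually_elim
      case (elim x)
      have "ennreal (1 / e) * ennreal \<bar>g x\<bar> = ennreal (\<bar>g x\<bar> / e)" using l(1) le by (simp flip: ennreal_mult)
      moreover have "\<bar>g x\<bar> / e \<le> \<bar>f x / l\<bar>" using elim l(1) le by (simp add: abs_divide frac_le)
      ultimately show ?case using p[of x] l(1) le by (auto intro!: ennreal_leI powr_mono2)
    qed
  qed
  then show ?thesis using l(3) by (simp add: nn_integral_completion)
qed

lemma modular_imp_luxemburg_norm:
  fixes f :: "real^'n \<Rightarrow> real"
  assumes m: "modular p (\<lambda>x. ennreal (1 / l) * G x) \<le> 1" and l: "0 < l" and p: "\<And>x. 0 \<le> p x"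
    and f: "AE x in lborel. ennreal \<bar>f x\<bar> \<le> G x"
  shows "luxemburg_norm p f < \<infinity>"
proof -
  have "(\<integral>\<^sup>+x. ennreal (\<bar>f x / l\<bar> powr p x) \<partial>lebesgue) \<le> modular p (\<lambda>x. ennreal (1 / l) * G x)"
    unfolding modular_def nn_integral_completion
  proof (rule nn_integral_mono_AE)
    show "AE x in lborel. ennreal (\<bar>f x / l\<bar> powr p x) \<le> epow (ennreal (1 / l) * G x) (p x)"
      using f
    proof eventually_elim
      case (elim x)
      have "ennreal (\<bar>f x / l\<bar> powr p x) = epow (ennreal (1 / l) * ennreal \<bar>f x\<bar>) (p x)"
        using l by (simp add: abs_divide flip: ennreal_mult)
      also have "\<dots> \<le> epow (ennreal (1 / l) * G x) (p x)" by (intro epow_mono mult_left_mono elim p) simp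
      finally show ?case .
    qed
  qed
  then have "luxemburg_norm p f \<le> ennreal l"
    unfolding luxemburg_norm_def using l m by (intro Inf_lower) auto
  then show ?thesis by (auto intro: le_less_trans)
qed

lemma Lq_norm_imp_modular:
  fixes f :: "real^'n \<Rightarrow> real"
  assumes f: "AE x in lborel. f x = g x" and [measurable]: "g \<in> borel_measurable borel"
    and e: "Lq_norm q f < ennreal e" and q: "0 < q"
  shows "modular (\<lambda>_. q) (\<lambda>x. ennreal (1 / e) * ennreal \<bar>g x\<bar>) \<le> 1"
proof -
  define I where "I = (\<integral>\<^sup>+x. ennreal (\<bar>f x\<bar> powr q) \<partial>lebesgue)"
  have "I \<noteq> \<infinity>" using e by (auto simp: Lq_norm_def I_def[symmetric])
  then obtain i where i: "0 \<le> i" "I = ennreal i" by (cases I) auto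
  have less: "i powr (1 / q) < e" using e i by (simp add: Lq_norm_def I_def[symmetric] ennreal_less_iff)
  have e0: "0 < e" using less powr_ge_zero[of i "1 / q"] by linarith
  have "(i powr (1 / q)) powr q \<le> e powr q" using less q by (intro powr_mono2) auto
  then have ie: "i \<le> e powr q" using i q by (simp add: powr_powr)
  have "modular (\<lambda>_. q) (\<lambda>x. ennreal (1 / e) * ennreal \<bar>g x\<bar>) = (\<integral>\<^sup>+x. ennreal (e powr (- q)) * ennreal (\<bar>g x\<bar> powr q) \<partial>lborel)"
    unfolding modular_def using e0
    by (intro nn_integral_cong) (simp add: powr_divide powr_minus_divide flip: ennreal_mult)
  also have "\<dots> = ennreal (e powr (- q)) * (\<integral>\<^sup>+x. ennreal (\<bar>g x\<bar> powr q) \<partial>lborel)"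
    by (rule nn_integral_cmult) simp
  also have "(\<integral>\<^sup>+x. ennreal (\<bar>g x\<bar> powr q) \<partial>lborel) = I"
    unfolding I_def nn_integral_completion by (rule nn_integral_cong_AE) (use f in eventually_elim, simp)
  also have "ennreal (e powr (- q)) * I \<le> 1"
  proof -
    have "e powr (- q) * i \<le> e powr (- q) * e powr q" using ie by (intro mult_left_mono) auto
    also have "\<dots> = 1" using e0 by (simp flip: powr_add)
    finally show ?thesis using i by (simp add: ennreal_le_1 flip: ennreal_mult)
  qed
  finally show ?thesis .
qed

lemma modular_imp_Lq_norm:
  fixes f :: "real^'n \<Rightarrow> real"
  assumes m: "modular (\<lambda>_. q) (\<lambda>x. ennreal (1 / l) * G x) \<le> 1" and l: "0 < l" and q: "0 \<le> q"
    and f: "AE x in lborel. ennreal \<bar>f x\<bar> \<le> G x" and [measurable]: "G \<in> borel_measurable borel"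
  shows "Lq_norm q f < \<infinity>"
proof -
  have "(\<integral>\<^sup>+x. ennreal (\<bar>f x\<bar> powr q) \<partial>lebesgue) \<le> (\<integral>\<^sup>+x. ennreal (l powr q) * epow (ennreal (1 / l) * G x) q \<partial>lborel)"
    unfolding nn_integral_completion
  proof (rule nn_integral_mono_AE)
    show "AE x in lborel. ennreal (\<bar>f x\<bar> powr q) \<le> ennreal (l powr q) * epow (ennreal (1 / l) * G x) q"
      using f
    proof eventually_elim
      case (elim x)
      have "ennreal (\<bar>f x\<bar> powr q) = epow (ennreal \<bar>f x\<bar>) q" by simp
      also have "\<dots> \<le> epow (G x) q" using elim q by (rule epow_mono)
      also have "\<dots> = ennreal (l powr q) * epow (ennreal (1 / l) * G x) q"
        using l by (simp add: epow_mult powr_divide mult.assoc[symmetric] flip: ennreal_mult)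
      finally show ?case .
    qed
  qed
  also have "\<dots> = ennreal (l powr q) * modular (\<lambda>_. q) (\<lambda>x. ennreal (1 / l) * G x)"
    by (simp add: modular_def nn_integral_cmult)
  also have "\<dots> < top" using m by (auto simp: ennreal_mult_less_top intro: le_less_trans)
  finally show ?thesis by (simp add: Lq_norm_def Let_def less_top[symmetric])
qed

lemma AE_continuous_imp_all:
  fixes p :: "'a::euclidean_space \<Rightarrow> real"
  assumes c: "continuous_on UNIV p" and C: "closed C" and ae: "AE x in lborel. p x \<in> C"
  shows "p x \<in> C"
proof (rule ccontr)
  assume x: "p x \<notin> C"
  have "open (p -` (- C))" using c C by (intro open_vimage) auto
  moreover have "x \<in> p -` (- C)" using x by simp
  ultimately obtain e where e: "0 < e" "ball x e \<subseteq> p -` (- C)" by (rule openE)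
  have "AE y in lborel. y \<notin> ball x e" using ae by eventually_elim (use e(2) in auto)
  then have "emeasure lborel (ball x e) = 0" by (subst (asm) AE_iff_measurable[of "ball x e"]) auto
  then show False using emeasure_ball_pos[OF e(1), of x] by simp
qed

text \<open>Exponents in \<open>P_log\<close> are continuous, so that their essential bounds hold everywhere.\<close>

lemma P_log_properties:
  fixes p :: "real^'n \<Rightarrow> real"
  assumes p: "p \<in> P_log" and lo: "ereal m < exponent_minus p" and hi: "exponent_plus p < \<infinity>"
  obtains a B where "log_holder p" "p \<in> borel_measurable borel" "m < a" "\<And>x. a \<le> p x" "\<And>x. p x \<le> B"
proof -
  obtain L C where C: "0 < C" "\<And>x y. \<bar>1 / p x - 1 / p y\<bar> \<le> C / ln (exp 1 + 1 / norm (x - y))"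
    "\<And>x. \<bar>1 / p x - L\<bar> \<le> C / ln (exp 1 + norm x)"
    using p unfolding P_log_def by blast
  have lh: "log_holder p" unfolding log_holder_def using C by blast
  have p1: "1 \<le> p x" for x using p by (auto simp: P_log_def variable_exponent_def)
  have "isCont (\<lambda>x. 1 / p x) x" for x
  proof -
    have lim: "((\<lambda>r. C / ln (exp 1 + 1 / r)) \<longlongrightarrow> 0) (at_right 0)" by real_asymp
    have nrm: "filterlim (\<lambda>y. norm (y - x)) (at_right 0) (at x)"
      unfolding filterlim_at by (auto intro!: tendsto_eq_intros simp: eventually_at_filter)
    have "((\<lambda>y. C / ln (exp 1 + 1 / norm (y - x))) \<longlongrightarrow> 0) (at x)"
      by (rule filterlim_compose[OF lim nrm])
    then have "((\<lambda>y. 1 / p y - 1 / p x) \<longlongrightarrow> 0) (at x)"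
      by (rule Lim_null_comparison[rotated]) (use C(2) in auto)
    then show ?thesis by (simp add: isCont_def LIM_zero_iff)
  qed
  then have "continuous_on UNIV (\<lambda>x. 1 / p x)" by (intro continuous_at_imp_continuous_on) auto
  moreover have "1 / p x \<noteq> 0" for x using p1[of x] by simp
  ultimately have "continuous_on UNIV (\<lambda>x. inverse (1 / p x))"
    using continuous_on_inverse[of UNIV "\<lambda>x. 1 / p x"] by blast
  then have cont: "continuous_on UNIV p" by (simp add: inverse_eq_divide)
  obtain z where z: "ereal m < z" "z < exponent_minus p" using dense[OF lo] by blast
  then obtain a where a: "z = ereal a" by (cases z) auto
  have "AE x in lebesgue. z < ereal (p x)"
    using z(2) unfolding exponent_minus_def by (rule less_LiminfD)
  then have "AE x in lborel. p x \<in> {a..}" unfolding AE_completion_iff a by eventually_elim simp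
  from AE_continuous_imp_all[OF cont closed_atLeast this] have ap: "a \<le> p x" for x by simp
  have "AE x in lebesgue. ereal (p x) \<le> exponent_plus p" unfolding exponent_plus_def by (rule esssup_AE)
  then have "AE x in lborel. p x \<in> {..real_of_ereal (exponent_plus p)}"
    unfolding AE_completion_iff
  proof eventually_elim
    case (elim x)
    then show ?case using hi by (cases "exponent_plus p") auto
  qed
  from AE_continuous_imp_all[OF cont closed_atMost this] have pB: "p x \<le> real_of_ereal (exponent_plus p)" for x
    by simp
  show ?thesis
    by (rule that[OF lh borel_measurable_continuous_onI[OF cont] _ ap pB]) (use z a in simp)
qed

section \<open>Membership in the space-time space\<close>

lemma time_interval_positive: "0 < T \<Longrightarrow> 0 < emeasure lborel (time_interval T)"
proof -
  assume T: "0 < T"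
  then obtain z where z: "0 < z" "z < T" using dense by blast
  then obtain c where c: "z = ereal c" by (cases z) auto
  have sub: "{0..c} \<subseteq> time_interval T"
    using z c by (auto simp: time_interval_def intro: le_less_trans[of _ "ereal c"])
  have "0 < emeasure lborel {0..c}" using z c by (simp add: zero_ereal_def)
  also have "\<dots> \<le> emeasure lborel (time_interval T)" by (rule emeasure_mono[OF sub]) simp
  finally show ?thesis .
qed

lemma time_sup_le_iff:
  assumes [measurable]: "(\<lambda>t. u t x) \<in> borel_measurable borel"
  shows "time_sup T u x \<le> c \<longleftrightarrow> (AE t in lborel. t \<in> time_interval T \<longrightarrow> ereal \<bar>u t x\<bar> \<le> c)"
proof -
  have m: "(\<lambda>t. ereal \<bar>u t x\<bar>) \<in> borel_measurable (lebesgue_on (time_interval T))"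
    by (intro measurable_restrict_space1 measurable_completion) simp
  have "time_sup T u x \<le> c \<longleftrightarrow> (AE t in lebesgue_on (time_interval T). ereal \<bar>u t x\<bar> \<le> c)"
  proof
    assume "time_sup T u x \<le> c"
    moreover have "AE t in lebesgue_on (time_interval T). ereal \<bar>u t x\<bar> \<le> time_sup T u x"
      unfolding time_sup_def by (rule esssup_AE)
    ultimately show "AE t in lebesgue_on (time_interval T). ereal \<bar>u t x\<bar> \<le> c"
      by (auto elim: eventually_mono)
  next
    assume "AE t in lebesgue_on (time_interval T). ereal \<bar>u t x\<bar> \<le> c"
    then show "time_sup T u x \<le> c" unfolding time_sup_def using m by (intro esssup_I) auto
  qed
  then show ?thesis by (simp add: lebesgue_on_AE_iff)
qed

lemma time_sup_nonneg:
  assumes T: "0 < T" and m: "(\<lambda>t. u t x) \<in> borel_measurable borel"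
  shows "0 \<le> time_sup T u x"
proof (rule ccontr)
  assume neg: "\<not> 0 \<le> time_sup T u x"
  have "AE t in lborel. t \<in> time_interval T \<longrightarrow> ereal \<bar>u t x\<bar> \<le> time_sup T u x"
    using time_sup_le_iff[where c="time_sup T u x" and u=u and x=x and T=T] m by simp
  then have "AE t in lborel. t \<notin> time_interval T"
  proof eventually_elim
    case (elim t)
    have "\<not> ereal \<bar>u t x\<bar> \<le> time_sup T u x"
      using neg by (meson abs_ge_zero ereal_less_eq(5) order_trans)
    then show ?case using elim by blast
  qed
  then have "emeasure lborel (time_interval T) = 0"
    by (subst (asm) AE_iff_measurable[of "time_interval T"]) auto
  then show False using time_interval_positive[OF T] by simp
qed

text \<open>The point is the measurability in \<open>x\<close> of the essential supremum in time.\<close>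

lemma mixed_time_space_I:
  fixes u :: "real \<Rightarrow> real^'n \<Rightarrow> real"
  assumes T: "0 < T" and um: "case_prod u \<in> borel_measurable (borel \<Otimes>\<^sub>M borel)"
    and [measurable]: "U \<in> borel_measurable borel" and uU: "\<And>t x. ennreal \<bar>u t x\<bar> \<le> U x"
    and l: "0 < l" and p: "\<And>x. 0 < p x" and q: "0 < q"
    and mp: "modular p (\<lambda>x. ennreal (1 / l) * U x) \<le> 1" and mq: "modular (\<lambda>_. q) (\<lambda>x. ennreal (1 / l) * U x) \<le> 1"
  shows "u \<in> mixed_time_space p q T"
proof -
  have [measurable]: "(\<lambda>z. u (fst z) (snd z)) \<in> borel_measurable (borel \<Otimes>\<^sub>M borel)"
    using um by (simp add: case_prod_beta' del: borel_prod)
  have sec [measurable]: "(\<lambda>t. u t x) \<in> borel_measurable borel" for x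
  proof -
    have "(\<lambda>t. (t, x)) \<in> measurable borel (borel \<Otimes>\<^sub>M borel)" by (intro measurable_Pair) auto
    from measurable_compose[OF this um] show ?thesis by simp
  qed
  have m1: "(\<lambda>(t, x). u t x) \<in> borel_measurable (lebesgue_on (time_interval T \<times> UNIV))"
    using um by (intro measurable_restrict_space1 measurable_completion) (simp add: borel_prod)
  have Sm: "time_sup T u \<in> borel_measurable borel"
  proof (rule borel_measurableI_le)
    fix c
    \<comment> \<open>The condition becomes the vanishing of an integral that depends measurably on \<open>x\<close>.\<close>
    have "time_sup T u x \<le> c \<longleftrightarrow> (\<integral>\<^sup>+t. (if t \<in> time_interval T \<and> c < ereal \<bar>u t x\<bar> then 1 else 0) \<partial>lborel) = 0" for x
      unfolding time_sup_le_iff[OF sec] by (subst nn_integral_0_iff_AE) (auto simp: not_less)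
    then have "{x \<in> space borel. time_sup T u x \<le> c} = {x \<in> space borel. (\<integral>\<^sup>+t. (if t \<in> time_interval T \<and> c < ereal \<bar>u t x\<bar> then 1 else 0) \<partial>lborel) = (0::ennreal)}"
      by simp
    also have "\<dots> \<in> sets borel"
    proof -
      have "(\<lambda>z. (snd z, fst z)) \<in> measurable (borel \<Otimes>\<^sub>M lborel) (borel \<Otimes>\<^sub>M borel)" by measurable
      from measurable_compose[OF this um]
      have [measurable]: "(\<lambda>z. u (snd z) (fst z)) \<in> borel_measurable (borel \<Otimes>\<^sub>M lborel)" by simp
      show ?thesis by measurable
    qed
    finally show "{x \<in> space borel. time_sup T u x \<le> c} \<in> sets borel" .
  qed
  have Sle: "ennreal \<bar>real_of_ereal (time_sup T u x)\<bar> \<le> U x \<and> (U x < top \<longrightarrow> time_sup T u x < \<infinity>)" for x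
  proof (cases "U x")
    case (real r)
    have "time_sup T u x \<le> ereal r"
      unfolding time_sup_le_iff[OF sec] using uU[of _ x] real by auto
    moreover have "0 \<le> time_sup T u x" by (rule time_sup_nonneg[OF T sec])
    ultimately show ?thesis using real by (cases "time_sup T u x") (auto intro: ennreal_leI)
  qed simp
  have "(\<integral>\<^sup>+x. epow (ennreal (1 / l) * U x) q \<partial>lborel) \<noteq> \<infinity>" using mq by (auto simp: modular_def top_unique)
  then have "AE x in lborel. epow (ennreal (1 / l) * U x) q \<noteq> \<infinity>" by (intro nn_integral_PInf_AE) auto
  then have "AE x in lborel. U x < top"
    by eventually_elim (use l in \<open>auto simp: ennreal_mult_eq_top_iff less_top[symmetric]\<close>)
  then have fin: "AE x in lebesgue. time_sup T u x < \<infinity>"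
    unfolding AE_completion_iff by eventually_elim (use Sle in auto)
  have m2: "(\<lambda>x. real_of_ereal (time_sup T u x)) \<in> borel_measurable lebesgue"
    using Sm by (intro measurable_completion borel_measurable_real_of_ereal) simp
  have "luxemburg_norm p (\<lambda>x. real_of_ereal (time_sup T u x)) < \<infinity>"
    by (rule modular_imp_luxemburg_norm[OF mp l]) (use Sle p in \<open>auto intro: less_imp_le\<close>)
  moreover have "Lq_norm q (\<lambda>x. real_of_ereal (time_sup T u x)) < \<infinity>"
    by (rule modular_imp_Lq_norm[OF mq l]) (use Sle q in auto)
  ultimately show ?thesis
    using m1 m2 fin by (auto simp: mixed_time_space_def mixed_space_def)
qed

section \<open>The mild formulation in terms of Borel functions\<close>

context stable_subordinator_law
begin

lemma convolution_frac_kernel: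
  fixes u0 w :: "real^'n \<Rightarrow> real"
  assumes t: "0 < t" and \<gamma>: "\<gamma> \<in> {0, 1}" and [measurable]: "w \<in> borel_measurable borel" and eq: "AE x in lborel. u0 x = w x"
  shows "convolvable_at (nabla_pow \<gamma> (frac_heat_kernel \<alpha> t)) u0 x
      \<longleftrightarrow> integrable lborel (\<lambda>y. frac_kernel \<gamma> t (x - y) * w y)"
    "convolution_at (nabla_pow \<gamma> (frac_heat_kernel \<alpha> t)) u0 x = (LINT y|lborel. frac_kernel \<gamma> t (x - y) * w y)"
proof -
  have m: "(\<lambda>y. frac_kernel \<gamma> t (x - y) * w y) \<in> borel_measurable borel" by measurable
  have ae: "AE y in lborel. nabla_pow \<gamma> (frac_heat_kernel \<alpha> t) (x - y) * u0 y = frac_kernel \<gamma> t (x - y) * w y"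
    using eq by eventually_elim (simp add: nabla_pow_frac_heat_kernel[OF t \<gamma>])
  show "convolvable_at (nabla_pow \<gamma> (frac_heat_kernel \<alpha> t)) u0 x
      \<longleftrightarrow> integrable lborel (\<lambda>y. frac_kernel \<gamma> t (x - y) * w y)"
    "convolution_at (nabla_pow \<gamma> (frac_heat_kernel \<alpha> t)) u0 x = (LINT y|lborel. frac_kernel \<gamma> t (x - y) * w y)"
    unfolding convolvable_at_def convolution_at_def by (rule lebesgue_integral_cong_lborel[OF m ae])+
qed

lemma nabla_pow_0: "nabla_pow 0 g = g"
  by (simp add: nabla_pow_def fun_eq_iff)

end

locale fractional_heat = stable_subordinator_law M \<alpha> +
  critical_kernel "stable_subordinator_law.frac_kernel M \<alpha> \<gamma> :: real \<Rightarrow> real^'n \<Rightarrow> real" b "real \<gamma> / (2 * \<alpha>)" q D1 D2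
  for M :: "real measure" and \<alpha> :: real and \<gamma> b :: nat and q D1 D2 :: real +
  assumes \<gamma>: "\<gamma> \<in> {0, 1}"
begin

text \<open>Fubini's theorem turns the space-time integral into the iterated one. Equality of \<open>h\<close> and \<open>h'\<close> almost
  everywhere at almost every time is enough, since both integrals ignore null sets.\<close>

lemma duhamel_transfer:
  fixes h h' :: "real \<Rightarrow> real^'n \<Rightarrow> real"
  assumes h': "case_prod h' \<in> borel_measurable (borel \<Otimes>\<^sub>M borel)" and H: "H \<in> borel_measurable borel"
    and bound: "\<And>s y. ennreal \<bar>h' s y\<bar> \<le> H y" and fin: "R H x < top"
    and eq: "AE s in lborel. 0 < s \<and> s < t \<longrightarrow> (AE y in lborel. h s y = h' s y)"
  shows "duhamel_exists \<gamma> \<alpha> h t x" "duhamel \<gamma> \<alpha> h t x = duhamel_op h' t x"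
proof -
  let ?k = "\<lambda>s y. duhamel_kernel t x s y * h' s y"
  let ?c = "\<lambda>s. convolution_at (nabla_pow \<gamma> (frac_heat_kernel \<alpha> (t - s))) (h s) x"
  define g where "g = (\<lambda>s. LINT y|lborel. ?k s y)"
  have int: "integrable (lborel \<Otimes>\<^sub>M lborel) (\<lambda>z. ?k (fst z) (snd z))"
    by (rule duhamel_op_integrable[OF H h' bound fin])
  have sec: "AE s in lborel. integrable lborel (?k s)"
    using lborel_pair.AE_integrable_fst'[OF int] by simp
  have g: "integrable lborel g" using lborel_pair.integrable_fst'[OF int] by (simp add: g_def)
  have gm: "g \<in> borel_measurable borel" using borel_measurable_integrable[OF g] by simp
  have gD: "(LINT s|lborel. g s) = duhamel_op h' t x"
    using lborel_pair.integral_fst'[OF int] by (simp add: g_def duhamel_op_def)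
  have h's: "h' s \<in> borel_measurable borel" for s
  proof -
    have "Pair s \<in> measurable borel (borel \<Otimes>\<^sub>M borel)" by (intro measurable_Pair1') simp
    from measurable_compose[OF this h'] show ?thesis by simp
  qed
  have key: "AE s in lborel. 0 < s \<and> s < t \<longrightarrow>
      convolvable_at (nabla_pow \<gamma> (frac_heat_kernel \<alpha> (t - s))) (h s) x \<and> ?c s = g s"
    using sec eq
  proof eventually_elim
    case (elim s)
    show ?case
    proof
      assume s: "0 < s \<and> s < t"
      have "?k s = (\<lambda>y. frac_kernel \<gamma> (t - s) (x - y) * h' s y)"
        using s by (simp add: duhamel_kernel_def fun_eq_iff)
      with elim s show "convolvable_at (nabla_pow \<gamma> (frac_heat_kernel \<alpha> (t - s))) (h s) x \<and> ?c s = g s"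
        using convolution_frac_kernel[OF _ \<gamma> h's, of "t - s" "h s" s x] by (simp add: g_def)
    qed
  qed
  have g0: "g s = 0" if "\<not> (0 < s \<and> s < t)" for s
  proof -
    have "?k s = (\<lambda>y. 0)" using that by (auto simp: duhamel_kernel_def fun_eq_iff)
    then show ?thesis by (simp add: g_def)
  qed
  have ae: "AE s in lborel. indicator {0<..<t} s *\<^sub>R ?c s = g s"
    using key by eventually_elim (use g0 in \<open>auto simp: indicator_def\<close>)
  show "duhamel_exists \<gamma> \<alpha> h t x"
    unfolding duhamel_exists_def set_integrable_def lebesgue_integral_cong_lborel(1)[OF gm ae]
  proof
    show "AE s in lebesgue_on {0<..<t}. convolvable_at (nabla_pow \<gamma> (frac_heat_kernel \<alpha> (t - s))) (h s) x"
      using key by (subst lebesgue_on_AE_iff) (auto elim: eventually_mono)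
  qed (rule g)
  show "duhamel \<gamma> \<alpha> h t x = duhamel_op h' t x"
    unfolding duhamel_def set_lebesgue_integral_def lebesgue_integral_cong_lborel(2)[OF gm ae] by (rule gD)
qed

lemma duhamel_power_transfer:
  fixes u u' :: "real \<Rightarrow> real^'n \<Rightarrow> real"
  assumes u': "case_prod u' \<in> borel_measurable (borel \<Otimes>\<^sub>M borel)" and [measurable]: "U \<in> borel_measurable borel"
    and bound: "\<And>s y. ennreal \<bar>u' s y\<bar> \<le> U y" and fin: "R (\<lambda>y. U y ^ Suc b) x < top"
    and eq: "AE s in lborel. 0 < s \<and> s < t \<longrightarrow> (AE y in lborel. u s y = u' s y)"
  shows "duhamel_exists \<gamma> \<alpha> (\<lambda>s y. \<bar>u s y\<bar> ^ b * u s y) t x"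
    "duhamel \<gamma> \<alpha> (\<lambda>s y. \<bar>u s y\<bar> ^ b * u s y) t x = duhamel_op (\<lambda>s y. signed_power b (u' s y)) t x"
proof -
  have "AE s in lborel. 0 < s \<and> s < t \<longrightarrow> (AE y in lborel. \<bar>u s y\<bar> ^ b * u s y = signed_power b (u' s y))"
    using eq by eventually_elim (auto simp: signed_power_def elim: eventually_mono)
  note * = duhamel_transfer[OF borel_measurable_signed_power_prod[OF u'] _ signed_power_bound[OF bound] fin this]
  show "duhamel_exists \<gamma> \<alpha> (\<lambda>s y. \<bar>u s y\<bar> ^ b * u s y) t x" by (rule *(1)) measurable
  show "duhamel \<gamma> \<alpha> (\<lambda>s y. \<bar>u s y\<bar> ^ b * u s y) t x = duhamel_op (\<lambda>s y. signed_power b (u' s y)) t x" by (rule *(2)) measurable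
qed

lemma time_interval_downward: "0 < s \<Longrightarrow> s < t \<Longrightarrow> t \<in> time_interval T \<Longrightarrow> s \<in> time_interval T"
  by (auto simp: time_interval_def intro: le_less_trans[of _ "ereal t"])

lemma Lq_norm_finite_modular:
  fixes g :: "real^'n \<Rightarrow> real"
  assumes f: "AE x in lborel. f x = g x" and [measurable]: "g \<in> borel_measurable borel" and fin: "Lq_norm Q f < \<infinity>"
  obtains e0 where "0 < e0" "\<And>e. e0 \<le> e \<Longrightarrow> modular (\<lambda>_. Q) (\<lambda>x. ennreal (1 / e) * ennreal \<bar>g x\<bar>) \<le> 1"
proof -
  obtain r where r: "0 \<le> r" "Lq_norm Q f = ennreal r" using fin by (cases "Lq_norm Q f") auto
  show ?thesis
  proof (rule that)
    fix e assume "r + 1 \<le> e"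
    then have "Lq_norm Q f < ennreal e" using r by (simp add: ennreal_less_iff)
    then show "modular (\<lambda>_. Q) (\<lambda>x. ennreal (1 / e) * ennreal \<bar>g x\<bar>) \<le> 1"
      using Q_gt by (intro Lq_norm_imp_modular[OF f]) auto
  qed (use r in simp)
qed

lemma modular_sum_le_1:
  fixes F G :: "real^'n \<Rightarrow> ennreal"
  assumes [measurable]: "F \<in> borel_measurable borel" "G \<in> borel_measurable borel" and e: "0 < e"
    and F: "modular (\<lambda>_. Q) (\<lambda>x. ennreal (1 / e) * F x) \<le> 1" and G: "modular (\<lambda>_. Q) (\<lambda>x. ennreal (1 / e) * G x) \<le> 1"
  shows "modular (\<lambda>_. Q) (\<lambda>x. ennreal (1 / (4 * e)) * (F x + G x)) \<le> 1"
proof -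
  have half: "modular (\<lambda>_. Q) (\<lambda>x. 2 * (ennreal (1 / (4 * e)) * H x)) \<le> ennreal (1 / 2)"
    if [measurable]: "H \<in> borel_measurable borel" and H: "modular (\<lambda>_. Q) (\<lambda>x. ennreal (1 / e) * H x) \<le> 1" for H :: "real^'n \<Rightarrow> ennreal"
  proof -
    have "2 * (ennreal (1 / (4 * e)) * r) = ennreal (1 / 2) * (ennreal (1 / e) * r)" for r
    proof -
      have "2 * ennreal (1 / (4 * e)) = ennreal (2 * (1 / (4 * e)))" using e by (subst ennreal_mult) auto
      also have "2 * (1 / (4 * e)) = 1 / 2 * (1 / e)" by simp
      also have "ennreal (1 / 2 * (1 / e)) = ennreal (1 / 2) * ennreal (1 / e)" using e by (intro ennreal_mult) auto
      finally have "2 * ennreal (1 / (4 * e)) = ennreal (1 / 2) * ennreal (1 / e)" .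
      then show ?thesis by (simp add: mult.assoc[symmetric])
    qed
    then have "modular (\<lambda>_. Q) (\<lambda>x. 2 * (ennreal (1 / (4 * e)) * H x)) = modular (\<lambda>_. Q) (\<lambda>x. ennreal (1 / 2) * (ennreal (1 / e) * H x))"
      by simp
    also have "\<dots> \<le> ennreal (1 / 2) * modular (\<lambda>_. Q) (\<lambda>x. ennreal (1 / e) * H x)"
    proof (rule modular_scale)
      show "1 \<le> Q" using Q_gt of_nat_0_le_iff[of b] by linarith
      show "ennreal (1 / 2) \<le> 1" using ennreal_le_1[of "1 / 2"] by linarith
    qed measurable
    also have "\<dots> \<le> ennreal (1 / 2) * 1" by (rule mult_left_mono[OF H]) simp
    finally show ?thesis by simp
  qed
  have "modular (\<lambda>_. Q) (\<lambda>x. ennreal (1 / (4 * e)) * F x + ennreal (1 / (4 * e)) * G x)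
    \<le> modular (\<lambda>_. Q) (\<lambda>x. 2 * (ennreal (1 / (4 * e)) * F x)) + modular (\<lambda>_. Q) (\<lambda>x. 2 * (ennreal (1 / (4 * e)) * G x))"
    using Q_gt by (intro modular_add) auto
  also have "\<dots> \<le> ennreal (1 / 2) + ennreal (1 / 2)" by (intro add_mono half assms)
  also have "\<dots> = 1" by (subst ennreal_plus[symmetric]) auto
  finally show ?thesis by (simp only: distrib_left)
qed

text \<open>A common majorant of Borel representatives of both solutions belongs to \<open>L^Q\<close>. In the difference of the
  two integral equations the data cancel.\<close>

theorem mild_solution_unique:
  fixes u v F :: "real \<Rightarrow> real^'n \<Rightarrow> real"
  assumes u: "u \<in> mixed_time_space p Q T" and v: "v \<in> mixed_time_space p Q T"
    and mu: "mild_solution \<gamma> \<alpha> b T u0 F u" and mv: "mild_solution \<gamma> \<alpha> b T u0 F v" and t: "t \<in> time_interval T"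
  shows "AE x in lebesgue. v t x = u t x"
proof -
  obtain u' Hu where u': "case_prod u' \<in> borel_measurable (borel \<Otimes>\<^sub>M borel)" and Hu [measurable]: "Hu \<in> borel_measurable borel"
    and u'b: "\<And>t x. \<bar>u' t x\<bar> \<le> \<bar>Hu x\<bar>" and Hu_eq: "AE x in lborel. real_of_ereal (time_sup T u x) = Hu x"
    and uu': "AE t in lborel. t \<in> time_interval T \<longrightarrow> (AE x in lborel. u t x = u' t x)"
    by (rule time_space_representative[OF u]) blast
  obtain v' Hv where v': "case_prod v' \<in> borel_measurable (borel \<Otimes>\<^sub>M borel)" and Hv [measurable]: "Hv \<in> borel_measurable borel"
    and v'b: "\<And>t x. \<bar>v' t x\<bar> \<le> \<bar>Hv x\<bar>" and Hv_eq: "AE x in lborel. real_of_ereal (time_sup T v x) = Hv x"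
    and vv': "AE t in lborel. t \<in> time_interval T \<longrightarrow> (AE x in lborel. v t x = v' t x)"
    by (rule time_space_representative[OF v]) blast
  have "Lq_norm Q (\<lambda>x. real_of_ereal (time_sup T u x)) < \<infinity>" "Lq_norm Q (\<lambda>x. real_of_ereal (time_sup T v x)) < \<infinity>"
    using u v by (auto simp: mixed_time_space_def mixed_space_def)
  then obtain e1 e2 where e: "0 < e1" "\<And>e. e1 \<le> e \<Longrightarrow> modular (\<lambda>_. Q) (\<lambda>x. ennreal (1 / e) * ennreal \<bar>Hu x\<bar>) \<le> 1"
      "0 < e2" "\<And>e. e2 \<le> e \<Longrightarrow> modular (\<lambda>_. Q) (\<lambda>x. ennreal (1 / e) * ennreal \<bar>Hv x\<bar>) \<le> 1"
    using Lq_norm_finite_modular[OF Hu_eq Hu] Lq_norm_finite_modular[OF Hv_eq Hv] by metis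
  define V where "V = (\<lambda>x. ennreal \<bar>Hu x\<bar> + ennreal \<bar>Hv x\<bar>)"
  have Vm [measurable]: "V \<in> borel_measurable borel" unfolding V_def by measurable
  have V: "modular (\<lambda>_. Q) (\<lambda>x. ennreal (1 / (4 * max e1 e2)) * V x) \<le> 1"
    unfolding V_def using e by (intro modular_sum_le_1) auto
  have l: "0 < 4 * max e1 e2" using e by simp
  have u'V: "ennreal \<bar>u' s y\<bar> \<le> V y" for s y
    unfolding V_def using ennreal_leI[OF u'b, of s y] by (rule order_trans) simp
  have v'V: "ennreal \<bar>v' s y\<bar> \<le> V y" for s y
    unfolding V_def using ennreal_leI[OF v'b, of s y] by (rule order_trans) simp
  have fin: "AE x in lborel. R (\<lambda>y. V y ^ Suc b) x < top"
    by (rule potential_power_finite_AE[OF Vm l V])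
  have below: "AE s in lborel. 0 < s \<and> s < t \<longrightarrow> (AE y in lborel. w s y = w' s y)"
    if "AE t in lborel. t \<in> time_interval T \<longrightarrow> (AE x in lborel. w t x = w' t x)" "t \<in> time_interval T"
    for t and w w' :: "real \<Rightarrow> real^'n \<Rightarrow> real"
    using that(1) by eventually_elim (use time_interval_downward that(2) in blast)
  have "AE x in lborel. v t x - u t x = 0"
  proof (rule difference_vanishes[OF v' u' Vm v'V u'V l V time_interval_downward _ _ t, where d="\<lambda>t x. v t x - u t x"])
    fix t assume t: "t \<in> time_interval T"
    have "AE x in lborel. u t x = heat_flow \<alpha> t u0 x + duhamel \<gamma> \<alpha> F t x + duhamel \<gamma> \<alpha> (\<lambda>s y. \<bar>u s y\<bar> ^ b * u s y) t x"
      "AE x in lborel. v t x = heat_flow \<alpha> t u0 x + duhamel \<gamma> \<alpha> F t x + duhamel \<gamma> \<alpha> (\<lambda>s y. \<bar>v s y\<bar> ^ b * v s y) t x"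
      using bspec[OF mu[unfolded mild_solution_def] t] bspec[OF mv[unfolded mild_solution_def] t]
      unfolding AE_completion_iff by (auto elim: eventually_mono)
    then show "AE x in lborel. v t x - u t x = duhamel_op (\<lambda>s y. signed_power b (v' s y)) t x - duhamel_op (\<lambda>s y. signed_power b (u' s y)) t x"
      using fin
    proof eventually_elim
      case (elim x)
      show ?case
        using elim(1,2) duhamel_power_transfer(2)[OF u' Vm u'V elim(3) below[OF uu' t]]
          duhamel_power_transfer(2)[OF v' Vm v'V elim(3) below[OF vv' t]] by simp
    qed
  next
    show "AE t in lborel. t \<in> time_interval T \<longrightarrow> (AE x in lborel. v t x - u t x = v' t x - u' t x)"
      using uu' vv'
    proof eventually_elim
      case (elim t)
      show ?case
      proof
        assume t: "t \<in> time_interval T"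
        have "AE x in lborel. u t x = u' t x" "AE x in lborel. v t x = v' t x" using elim t by auto
        then show "AE x in lborel. v t x - u t x = v' t x - u' t x" by eventually_elim simp
      qed
    qed
  qed
  then show ?thesis unfolding AE_completion_iff by eventually_elim simp
qed

text \<open>The fixed point for the data \<open>A\<close>, majorised by \<open>a\<close>, is a mild solution at every \<open>x\<close> where the limit \<open>U\<close> of the
  majorants is finite, thus almost everywhere. There all convolutions and Duhamel integrals converge
  absolutely, being bounded by summands of \<open>U x\<close>.\<close>

lemma mild_solution_exists:
  fixes p :: "real^'n \<Rightarrow> real"
  assumes p: "admissible p"
  obtains \<epsilon> where "0 < \<epsilon>" "\<And>T u0 F. 0 < T \<Longrightarrow> u0 \<in> mixed_space p Q \<Longrightarrow>
    F \<in> mixed_time_space (\<lambda>x. p x / (real b + 1)) q T \<Longrightarrow>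
    mixed_norm p Q u0 + mixed_time_norm (\<lambda>x. p x / (real b + 1)) q T F \<le> ennreal \<epsilon> \<Longrightarrow>
    \<exists>u\<in>mixed_time_space p Q T. mild_solution \<gamma> \<alpha> b T u0 F u"
proof -
  obtain C1 where C1: "0 < C1" "\<And>(H :: real^'n \<Rightarrow> ennreal) \<sigma> x. H \<in> borel_measurable borel \<Longrightarrow> 0 < \<sigma> \<Longrightarrow>
      (\<integral>\<^sup>+y. ennreal \<bar>frac_kernel 0 \<sigma> (x - y)\<bar> * H y \<partial>lborel) \<le> ennreal C1 * maxfun H x"
    using frac_kernel_maxfun_bound[of 0, where 'n='n] by auto
  obtain l \<delta> where l: "0 < l" and \<delta>: "0 < \<delta>" and small: "\<And>f0 F e. f0 \<in> borel_measurable borel \<Longrightarrow> F \<in> borel_measurable borel \<Longrightarrow>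
     (\<And>e. e = p \<or> e = (\<lambda>_. Q) \<Longrightarrow> modular e (\<lambda>x. ennreal (1 / \<delta>) * f0 x) \<le> 1) \<Longrightarrow>
     (\<And>e. e = p \<or> e = (\<lambda>_. Q) \<Longrightarrow> modular (\<lambda>x. e x / (real b + 1)) (\<lambda>x. ennreal (1 / \<delta>) * F x) \<le> 1) \<Longrightarrow>
     e = p \<or> e = (\<lambda>_. Q) \<Longrightarrow>
     modular e (\<lambda>x. ennreal (1 / l) * majorant_limit (\<lambda>x. f0 x + (ennreal C1 * maxfun f0 x + R F x)) x) \<le> 1"
  proof (rule small_data_majorant[OF p, of C1])
    fix l \<epsilon> :: real
    assume *: "0 < l" "0 < \<epsilon>" and **: "\<And>f0 F \<delta> e. f0 \<in> borel_measurable borel \<Longrightarrow> F \<in> borel_measurable borel \<Longrightarrow>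
     0 < \<delta> \<Longrightarrow> \<delta> \<le> \<epsilon> \<Longrightarrow>
     (\<And>e. e = p \<or> e = (\<lambda>_. Q) \<Longrightarrow> modular e (\<lambda>x. ennreal (1 / \<delta>) * f0 x) \<le> 1) \<Longrightarrow>
     (\<And>e. e = p \<or> e = (\<lambda>_. Q) \<Longrightarrow> modular (\<lambda>x. e x / (real b + 1)) (\<lambda>x. ennreal (1 / \<delta>) * F x) \<le> 1) \<Longrightarrow>
     e = p \<or> e = (\<lambda>_. Q) \<Longrightarrow>
     modular e (\<lambda>x. ennreal (1 / l) * majorant_limit (\<lambda>x. f0 x + (ennreal C1 * maxfun f0 x + R F x)) x) \<le> 1"
    show thesis by (rule that[OF *]) (rule **[OF _ _ *(2) order_refl])
  qed (use C1 in simp)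
  obtain a B where aB: "real b + 1 < a" "\<And>x. a \<le> p x" using p unfolding admissible_def by blast
  have p_pos: "0 < p x" for x using aB(1) aB(2)[of x] by linarith
  \<comment> \<open>Half of \<open>\<delta>\<close> leaves room for strict inequalities: a norm strictly below \<open>\<delta>\<close> bounds the modular of the
    function divided by \<open>\<delta>\<close>, although the infimum in the Luxemburg norm need not be attained.\<close>
  show thesis
  proof (rule that[of "\<delta> / 2"])
    show "0 < \<delta> / 2" using \<delta> by simp
    fix T :: ereal and u0 :: "real^'n \<Rightarrow> real" and F :: "real \<Rightarrow> real^'n \<Rightarrow> real"
    assume T: "0 < T" and u0: "u0 \<in> mixed_space p Q" and F: "F \<in> mixed_time_space (\<lambda>x. p x / (real b + 1)) q T"
      and norm: "mixed_norm p Q u0 + mixed_time_norm (\<lambda>x. p x / (real b + 1)) q T F \<le> ennreal (\<delta> / 2)"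
    have "ennreal (\<delta> / 2) < ennreal \<delta>" using \<delta> by (simp add: ennreal_less_iff)
    then have sum: "mixed_norm p Q u0 + mixed_time_norm (\<lambda>x. p x / (real b + 1)) q T F < ennreal \<delta>"
      using norm by (rule le_less_trans[rotated])
    have "mixed_norm p Q u0 < ennreal \<delta>" by (rule le_less_trans[OF _ sum]) simp
    then have n0: "luxemburg_norm p u0 < ennreal \<delta>" "Lq_norm Q u0 < ennreal \<delta>" by (auto simp: mixed_norm_def)
    have "mixed_time_norm (\<lambda>x. p x / (real b + 1)) q T F < ennreal \<delta>" by (rule le_less_trans[OF _ sum]) simp
    then have nF: "luxemburg_norm (\<lambda>x. p x / (real b + 1)) (\<lambda>x. real_of_ereal (time_sup T F x)) < ennreal \<delta>"
      "Lq_norm q (\<lambda>x. real_of_ereal (time_sup T F x)) < ennreal \<delta>"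
      by (auto simp: mixed_norm_def mixed_time_norm_def)
    obtain w where w [measurable]: "w \<in> borel_measurable borel" and u0w: "AE x in lborel. u0 x = w x"
      using u0 by (auto simp: mixed_space_def elim: borel_representative)
    obtain G H where G: "case_prod G \<in> borel_measurable (borel \<Otimes>\<^sub>M borel)" and H [measurable]: "H \<in> borel_measurable borel"
      and GH: "\<And>t x. \<bar>G t x\<bar> \<le> \<bar>H x\<bar>" and H_eq: "AE x in lborel. real_of_ereal (time_sup T F x) = H x"
      and FG: "AE t in lborel. t \<in> time_interval T \<longrightarrow> (AE x in lborel. F t x = G t x)"
      by (rule time_space_representative[OF F]) blast
    define f0 :: "real^'n \<Rightarrow> ennreal" where "f0 = (\<lambda>x. ennreal \<bar>w x\<bar>)"
    define h :: "real^'n \<Rightarrow> ennreal" where "h = (\<lambda>x. ennreal \<bar>H x\<bar>)"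
    have [measurable]: "f0 \<in> borel_measurable borel" "h \<in> borel_measurable borel" by (auto simp: f0_def h_def)
    define a where "a = (\<lambda>x. f0 x + (ennreal C1 * maxfun f0 x + R h x))"
    define U where "U = majorant_limit a"
    have am [measurable]: "a \<in> borel_measurable borel" unfolding a_def by measurable
    have Um [measurable]: "U \<in> borel_measurable borel" unfolding U_def by measurable
    have Gh: "ennreal \<bar>G t x\<bar> \<le> h x" for t x unfolding h_def by (rule ennreal_leI[OF GH])
    have mod0: "modular e (\<lambda>x. ennreal (1 / \<delta>) * f0 x) \<le> 1" if "e = p \<or> e = (\<lambda>_. Q)" for e
      using that luxemburg_norm_imp_modular[OF u0w n0(1)] Lq_norm_imp_modular[OF u0w w n0(2)] p_pos Q_gt
      by (auto simp: f0_def less_imp_le)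
    have modh: "modular (\<lambda>x. e x / (real b + 1)) (\<lambda>x. ennreal (1 / \<delta>) * h x) \<le> 1" if "e = p \<or> e = (\<lambda>_. Q)" for e
      using that luxemburg_norm_imp_modular[OF H_eq nF(1)] Lq_norm_imp_modular[OF H_eq H nF(2)] p_pos q
      by (auto simp: h_def less_imp_le)
    have modU: "modular e (\<lambda>x. ennreal (1 / l) * U x) \<le> 1" if "e = p \<or> e = (\<lambda>_. Q)" for e
      unfolding U_def a_def by (rule small[OF _ _ mod0 modh that]) auto
    define A where "A = (\<lambda>t x. (if 0 < t then LINT y|lborel. frac_kernel 0 t (x - y) * w y else w x) + duhamel_op G t x)"
    have Am: "case_prod A \<in> borel_measurable (borel \<Otimes>\<^sub>M borel)"
    proof -
      have "(\<lambda>z. duhamel_op G (fst z) (snd z)) \<in> borel_measurable (borel \<Otimes>\<^sub>M borel)"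
        using borel_measurable_duhamel_op[OF G] by (simp add: case_prod_beta' del: borel_prod)
      moreover have "(\<lambda>z. LINT y|lborel. frac_kernel 0 (fst z) (snd z - y) * w y) \<in> borel_measurable (borel \<Otimes>\<^sub>M borel)"
        by measurable
      ultimately have "(\<lambda>z. (if 0 < fst z then LINT y|lborel. frac_kernel 0 (fst z) (snd z - y) * w y else w (snd z)) + duhamel_op G (fst z) (snd z))
          \<in> borel_measurable (borel \<Otimes>\<^sub>M borel)" by measurable
      then show ?thesis by (simp add: A_def case_prod_beta' del: borel_prod)
    qed
    have heat_abs: "(\<integral>\<^sup>+y. ennreal \<bar>frac_kernel 0 t (x - y) * w y\<bar> \<partial>lborel) \<le> ennreal C1 * maxfun f0 x" if "0 < t" for t x
      using C1(2)[OF _ that, of f0 x] by (simp add: f0_def abs_mult ennreal_mult)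
    have Aa: "ennreal \<bar>A t x\<bar> \<le> a x" for t x
    proof -
      define r where "r = (if 0 < t then LINT y|lborel. frac_kernel 0 t (x - y) * w y else w x)"
      have "ennreal \<bar>r\<bar> \<le> f0 x + ennreal C1 * maxfun f0 x"
      proof (cases "0 < t")
        case True
        have "ennreal \<bar>r\<bar> \<le> ennreal C1 * maxfun f0 x"
          unfolding r_def using True order_trans[OF ennreal_abs_integral_le heat_abs[OF True]] by simp
        then show ?thesis by (rule order_trans) simp
      qed (simp add: r_def f0_def)
      moreover have "ennreal \<bar>duhamel_op G t x\<bar> \<le> R h x" by (rule duhamel_op_abs_le[OF _ Gh]) simp
      ultimately have "ennreal \<bar>r\<bar> + ennreal \<bar>duhamel_op G t x\<bar> \<le> a x" unfolding a_def add.assoc[symmetric] by (rule add_mono)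
      moreover have "ennreal \<bar>A t x\<bar> \<le> ennreal \<bar>r\<bar> + ennreal \<bar>duhamel_op G t x\<bar>"
        using ennreal_leI[OF abs_triangle_ineq[of r "duhamel_op G t x"]] by (simp add: A_def r_def[symmetric])
      ultimately show ?thesis by (rule order_trans[rotated])
    qed
    obtain u where um: "case_prod u \<in> borel_measurable (borel \<Otimes>\<^sub>M borel)" and uU: "\<And>t x. ennreal \<bar>u t x\<bar> \<le> U x"
      and fixed: "\<And>t x. U x < top \<Longrightarrow> u t x = A t x + duhamel_op (\<lambda>s y. signed_power b (u s y)) t x"
      using picard_limit[OF am Am Aa] unfolding U_def by blast
    have "u \<in> mixed_time_space p Q T"
      using Q_gt by (intro mixed_time_space_I[OF T um Um uU l p_pos _ modU modU]) auto
    moreover have "mild_solution \<gamma> \<alpha> b T u0 F u"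
      unfolding mild_solution_def AE_completion_iff
    proof
      fix t assume t: "t \<in> time_interval T"
      have t0: "0 \<le> t" using t by (simp add: time_interval_def)
      have FGt: "AE s in lborel. 0 < s \<and> s < t \<longrightarrow> (AE y in lborel. F s y = G s y)"
        using FG by eventually_elim (use time_interval_downward t in blast)
      have "(\<integral>\<^sup>+x. epow (ennreal (1 / l) * U x) Q \<partial>lborel) \<noteq> \<infinity>"
        using modU[of "\<lambda>_. Q"] by (auto simp: modular_def top_unique)
      then have "AE x in lborel. epow (ennreal (1 / l) * U x) Q \<noteq> \<infinity>" by (intro nn_integral_PInf_AE) auto
      then have "AE x in lborel. U x < top"
        by eventually_elim (use l in \<open>auto simp: ennreal_mult_eq_top_iff less_top[symmetric]\<close>)
      then show "AE x in lborel. (0 < t \<longrightarrow> convolvable_at (frac_heat_kernel \<alpha> t) u0 x) \<and>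
        duhamel_exists \<gamma> \<alpha> F t x \<and> duhamel_exists \<gamma> \<alpha> (\<lambda>s y. \<bar>u s y\<bar> ^ b * u s y) t x \<and>
        u t x = heat_flow \<alpha> t u0 x + duhamel \<gamma> \<alpha> F t x + duhamel \<gamma> \<alpha> (\<lambda>s y. \<bar>u s y\<bar> ^ b * u s y) t x"
        using u0w
      proof eventually_elim
        case (elim x)
        have "a x + R (\<lambda>y. U y ^ Suc b) x < top"
          using le_less_trans[OF majorant_limit_fixed[OF am, of x] elim(1)[unfolded U_def]] by (simp only: U_def)
        then have fin: "R (\<lambda>y. U y ^ Suc b) x < top" "ennreal C1 * maxfun f0 x < top" "R h x < top"
          by (auto simp: a_def)
        note d1 = duhamel_transfer[OF G _ Gh fin(3) FGt]
        have d2: "duhamel_exists \<gamma> \<alpha> (\<lambda>s y. \<bar>u s y\<bar> ^ b * u s y) t x"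
          "duhamel \<gamma> \<alpha> (\<lambda>s y. \<bar>u s y\<bar> ^ b * u s y) t x = duhamel_op (\<lambda>s y. signed_power b (u s y)) t x"
          by (rule duhamel_power_transfer[OF um Um uU fin(1)]; simp)+
        have conv: "convolvable_at (frac_heat_kernel \<alpha> t) u0 x"
          "convolution_at (frac_heat_kernel \<alpha> t) u0 x = (LINT y|lborel. frac_kernel 0 t (x - y) * w y)" if "0 < t"
        proof -
          have "integrable lborel (\<lambda>y. frac_kernel 0 t (x - y) * w y)"
          proof (rule integrableI_bounded)
            show "(\<integral>\<^sup>+y. ennreal (norm (frac_kernel 0 t (x - y) * w y)) \<partial>lborel) < \<infinity>"
              using le_less_trans[OF heat_abs[OF that] fin(2)] by simp
          qed measurable
          then show "convolvable_at (frac_heat_kernel \<alpha> t) u0 x"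
            "convolution_at (frac_heat_kernel \<alpha> t) u0 x = (LINT y|lborel. frac_kernel 0 t (x - y) * w y)"
            using convolution_frac_kernel[OF that _ w u0w, of 0 x] by (auto simp: nabla_pow_0)
        qed
        have "heat_flow \<alpha> t u0 x = (if 0 < t then LINT y|lborel. frac_kernel 0 t (x - y) * w y else w x)"
          using conv t0 elim(2) by (auto simp: heat_flow_def)
        with fixed[OF elim(1), of t] conv d1 d2 show ?case by (auto simp: A_def)
      qed
    qed
    ultimately show "\<exists>u\<in>mixed_time_space p Q T. mild_solution \<gamma> \<alpha> b T u0 F u" by blast
  qed
qed

end

theorem theorem1:
  fixes p :: "real^'n \<Rightarrow> real" and b \<gamma> :: nat and \<alpha> :: real and T :: ereal
  assumes "1 \<le> b" and "\<gamma> \<in> {0, 1}" and "1 / 2 < \<alpha>" and "\<alpha> \<le> 1" and "0 < T"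
    and "p \<in> P_log"
    and "ereal (real b + 1) < exponent_minus p"
    and "exponent_minus p \<le> exponent_plus p"
    and "exponent_plus p < \<infinity>"
    and "real CARD('n) * real b / ((real b + 1) * (2 * \<alpha> - real \<gamma>)) > 1"
  defines "q \<equiv> real CARD('n) * real b / (2 * \<alpha> - real \<gamma>)"
    and "q' \<equiv> real CARD('n) * real b / ((real b + 1) * (2 * \<alpha> - real \<gamma>))"
    and "p' \<equiv> (\<lambda>x. p x / (real b + 1))"
  shows "\<exists>\<epsilon>>0. \<forall>u0 F.
    u0 \<in> mixed_space p q \<longrightarrow>
    F \<in> mixed_time_space p' q' T \<longrightarrow>
    mixed_norm p q u0 + mixed_time_norm p' q' T F \<le> ennreal \<epsilon> \<longrightarrow>
    (\<exists>u \<in> mixed_time_space p q T.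
       mild_solution \<gamma> \<alpha> b T u0 F u \<and>
       (\<forall>v \<in> mixed_time_space p q T.
          mild_solution \<gamma> \<alpha> b T u0 F v \<longrightarrow>
          (\<forall>t\<in>time_interval T. AE x in lebesgue. v t x = u t x)))"
proof -
  have \<alpha>: "0 < \<alpha>" "1 / 2 < \<alpha>" using assms(3) by auto
  have \<gamma>1: "real \<gamma> \<le> 1" using assms(2) by auto
  have d: "0 < 2 * \<alpha> - real \<gamma>" using \<alpha> \<gamma>1 by linarith
  have b0: "0 < real b" using assms(1) by simp
  have q'1: "1 < q'" using assms(10) by (simp add: q'_def)
  have qq': "(real b + 1) * q' = q" unfolding q_def q'_def by (simp add: divide_simps)
  obtain M where M: "real_distribution M" "AE s in M. 0 < s"
    "\<And>l. 0 \<le> l \<Longrightarrow> (\<integral>\<^sup>+s. ennreal (exp (- (l * s))) \<partial>M) = ennreal (exp (- (l powr \<alpha>)))"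
    "\<And>k. 0 \<le> k \<Longrightarrow> (\<integral>\<^sup>+s. ennreal (s powr (- k)) \<partial>M) < top"
    by (rule stable_subordinator[OF \<alpha>(1) assms(4)]) blast
  interpret law: stable_subordinator_law M \<alpha>
    by (intro stable_subordinator_law.intro stable_subordinator_law_axioms.intro M \<alpha>(1) assms(4))
  obtain D1 where D1: "0 < D1" "\<And>(H :: real^'n \<Rightarrow> ennreal) \<sigma> x. H \<in> borel_measurable borel \<Longrightarrow> 0 < \<sigma> \<Longrightarrow>
      (\<integral>\<^sup>+y. ennreal \<bar>law.frac_kernel \<gamma> \<sigma> (x - y)\<bar> * H y \<partial>lborel) \<le> ennreal (D1 * \<sigma> powr (- (\<gamma> / (2 * \<alpha>)))) * maxfun H x"
    using law.frac_kernel_maxfun_bound[OF assms(2), where 'n='n] by auto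
  obtain D2 where D2: "0 < D2" "\<And>(H :: real^'n \<Rightarrow> ennreal) \<sigma> x. H \<in> borel_measurable borel \<Longrightarrow> (\<integral>\<^sup>+y. epow (H y) q' \<partial>lborel) \<le> 1 \<Longrightarrow> 0 < \<sigma> \<Longrightarrow>
      (\<integral>\<^sup>+y. ennreal \<bar>law.frac_kernel \<gamma> \<sigma> (x - y)\<bar> * H y \<partial>lborel) \<le> ennreal (D2 * \<sigma> powr (- ((\<gamma> + CARD('n) / q') / (2 * \<alpha>))))"
    using law.frac_kernel_decay_bound[OF assms(2), where 'n='n and r=q'] q'1 by auto
  \<comment> \<open>The time decay provided by \<open>L^q'\<close> is the critical one.\<close>
  have scaling: "(\<gamma> + CARD('n) / q') / (2 * \<alpha>) = \<gamma> / (2 * \<alpha>) + (1 - \<gamma> / (2 * \<alpha>)) * (real b + 1) / real b"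
    unfolding q'_def using \<alpha> d b0 by (simp add: field_simps)
  interpret fractional_heat M \<alpha> \<gamma> b q' D1 D2
  proof unfold_locales
    show "case_prod (law.frac_kernel \<gamma> :: real \<Rightarrow> real^'n \<Rightarrow> real) \<in> borel_measurable (borel \<Otimes>\<^sub>M borel)"
      by (rule law.borel_measurable_frac_kernel)
    show "real \<gamma> / (2 * \<alpha>) < 1" using \<alpha> \<gamma>1 by (simp add: field_simps)
  qed (use assms(1,2) q'1 D1 D2[unfolded scaling] in auto)
  obtain c B where c: "log_holder p" "p \<in> borel_measurable borel" "real b + 1 < c" "\<And>x. c \<le> p x" "\<And>x. p x \<le> B"
    by (rule P_log_properties[OF assms(6,7,9)]) blast
  have p: "admissible p" unfolding admissible_def using c by blast
  obtain \<epsilon> where \<epsilon>: "0 < \<epsilon>" "\<And>T u0 F. 0 < T \<Longrightarrow> u0 \<in> mixed_space p q \<Longrightarrow> F \<in> mixed_time_space p' q' T \<Longrightarrow>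
    mixed_norm p q u0 + mixed_time_norm p' q' T F \<le> ennreal \<epsilon> \<Longrightarrow>
    \<exists>u\<in>mixed_time_space p q T. mild_solution \<gamma> \<alpha> b T u0 F u"
    using mild_solution_exists[OF p] unfolding qq' p'_def by blast
  show ?thesis
  proof (intro exI[of _ \<epsilon>] conjI allI impI)
    fix u0 F
    assume *: "u0 \<in> mixed_space p q" "F \<in> mixed_time_space p' q' T" "mixed_norm p q u0 + mixed_time_norm p' q' T F \<le> ennreal \<epsilon>"
    obtain u where u: "u \<in> mixed_time_space p q T" "mild_solution \<gamma> \<alpha> b T u0 F u"
      using \<epsilon>(2)[OF assms(5) *] by blast
    have "AE x in lebesgue. v t x = u t x"
      if "v \<in> mixed_time_space p q T" "mild_solution \<gamma> \<alpha> b T u0 F v" "t \<in> time_interval T" for v t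
      using mild_solution_unique[unfolded qq', OF u(1) that(1) u(2) that(2,3)] .
    with u show "\<exists>u\<in>mixed_time_space p q T. mild_solution \<gamma> \<alpha> b T u0 F u \<and>
       (\<forall>v\<in>mixed_time_space p q T. mild_solution \<gamma> \<alpha> b T u0 F v \<longrightarrow>
          (\<forall>t\<in>time_interval T. AE x in lebesgue. v t x = u t x))" by blast
  qed (rule \<epsilon>(1))
qed

end
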